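(* Let $\mathcal{Q}_2$ be the universal $C^*$-algebra generated by a unitary $U$ and an isometry $S_2$ satisfying $U^2S_2=S_2U$ and $S_2S_2^*+US_2S_2^*U^*=1$. Put $S_1:=US_2$ and let $\mathcal{O}_2\subset\mathcal{Q}_2$ be the canonical copy of the Cuntz algebra, that is, the $C^*$-subalgebra of $\mathcal{Q}_2$ generated by $S_1$ and $S_2$. Then: (1) the inclusion $\mathcal{O}_2\subset\mathcal{Q}_2$ is $C^*$-irreducible; (2) the inclusion $\mathcal{O}_2\subset\mathcal{Q}_2$ is rigid. Moreover, the injective envelopes $I(\mathcal{O}_2)$ and $I(\mathcal{Q}_2)$ are $*$-isomorphic.
   Context: The Cuntz algebra $\mathcal{O}_2$ is the universal $C^*$-algebra generated by two isometries $S_1,S_2$ with $S_1S_1^*+S_2S_2^*=1$. In $\mathcal{Q}_2$ (the diadic $C^*$-algebra) the elements $S_1:=US_2$ and $S_2$ satisfy these relations, which gives a canonical unital embedding $\mathcal{O}_2\subset\mathcal{Q}_2$. A unital inclusion $A\subset B$ of $C^*$-algebras is $C^*$-irreducible if every intermediate $C^*$-algebra $A\subset C\subset B$ is simple (in particular $A$ and $B$ are simple). A unital inclusion $A\subset B$ of $C^*$-algebras is rigid if the identity map $\mathrm{id}_B$ is the only unital completely positive (ucp) map $\phi:B\to B$ with $\phi|_A=\mathrm{id}_A$. The injective envelope $I(A)$ of a unital $C^*$-algebra $A$ is Hamana's injective envelope: a unital $C^*$-algebra containing $A$ unitally that is injective (as an operator system, with respect to ucp maps) and such that the only ucp map $I(A)\to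 I(A)$ restricting to the identity on $A$ is the identity. It exists and is unique up to $*$-isomorphism fixing $A$. *)

theory Defs
  imports "HOL-Analysis.Analysis" "HOL-Algebra.QuotRing" "HOL-Algebra.Module"
begin

text \<open>
  Every C*-algebra here is unital and is given by a carrier set, so that subalgebras and
  universal properties can be expressed. A subalgebra with carrier \<open>C\<close> is
  \<open>B\<lparr>carrier := C\<rparr>\<close>, as in HOL-Algebra.
\<close>

record 'a cstar_alg = "(complex, 'a) module" +
  star :: "'a \<Rightarrow> 'a"
  cnorm :: "'a \<Rightarrow> real"

text \<open>The value outside the carrier only serves the unrestricted axioms (nonnegativity and
  symmetry) of the locale \<^locale>\<open>Metric_space\<close>.\<close>

definition cdist :: "'a cstar_alg \<Rightarrow> 'a \<Rightarrow> 'a \<Rightarrow> real" where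
  "cdist A x y =
     (if x \<in> carrier A \<and> y \<in> carrier A then cnorm A (x \<ominus>\<^bsub>A\<^esub> y) else 0)"

locale cstar_algebra = ring A for A :: "'a cstar_alg" (structure) +
  assumes smult_closed: "x \<in> carrier A \<Longrightarrow> c \<odot> x \<in> carrier A"
    and smult_l_distr: "x \<in> carrier A \<Longrightarrow> (c + d) \<odot> x = c \<odot> x \<oplus> d \<odot> x"
    and smult_r_distr:
      "\<lbrakk>x \<in> carrier A; y \<in> carrier A\<rbrakk> \<Longrightarrow> c \<odot> (x \<oplus> y) = c \<odot> x \<oplus> c \<odot> y"
    and smult_assoc: "x \<in> carrier A \<Longrightarrow> (c * d) \<odot> x = c \<odot> (d \<odot> x)"
    and smult_one: "x \<in> carrier A \<Longrightarrow> 1 \<odot> x = x"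
    and smult_mult_l:
      "\<lbrakk>x \<in> carrier A; y \<in> carrier A\<rbrakk> \<Longrightarrow> (c \<odot> x) \<otimes> y = c \<odot> (x \<otimes> y)"
    and smult_mult_r:
      "\<lbrakk>x \<in> carrier A; y \<in> carrier A\<rbrakk> \<Longrightarrow> x \<otimes> (c \<odot> y) = c \<odot> (x \<otimes> y)"
    and star_closed: "x \<in> carrier A \<Longrightarrow> star A x \<in> carrier A"
    and star_star: "x \<in> carrier A \<Longrightarrow> star A (star A x) = x"
    and star_add:
      "\<lbrakk>x \<in> carrier A; y \<in> carrier A\<rbrakk> \<Longrightarrow> star A (x \<oplus> y) = star A x \<oplus> star A y"
    and star_smult: "x \<in> carrier A \<Longrightarrow> star A (c \<odot> x) = cnj c \<odot> star A x"
    and star_mult: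
      "\<lbrakk>x \<in> carrier A; y \<in> carrier A\<rbrakk> \<Longrightarrow> star A (x \<otimes> y) = star A y \<otimes> star A x"
    and cnorm_nonneg: "x \<in> carrier A \<Longrightarrow> 0 \<le> cnorm A x"
    and cnorm_eq_0: "x \<in> carrier A \<Longrightarrow> cnorm A x = 0 \<longleftrightarrow> x = \<zero>"
    and cnorm_triangle:
      "\<lbrakk>x \<in> carrier A; y \<in> carrier A\<rbrakk> \<Longrightarrow> cnorm A (x \<oplus> y) \<le> cnorm A x + cnorm A y"
    and cnorm_smult: "x \<in> carrier A \<Longrightarrow> cnorm A (c \<odot> x) = cmod c * cnorm A x"
    and cnorm_mult:
      "\<lbrakk>x \<in> carrier A; y \<in> carrier A\<rbrakk> \<Longrightarrow> cnorm A (x \<otimes> y) \<le> cnorm A x * cnorm A y"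
    and cstar_identity: "x \<in> carrier A \<Longrightarrow> cnorm A (star A x \<otimes> x) = (cnorm A x)\<^sup>2"
    and complete: "Metric_space.mcomplete (carrier A) (cdist A)"

definition norm_closed :: "'a cstar_alg \<Rightarrow> 'a set \<Rightarrow> bool" where
  "norm_closed A C \<longleftrightarrow> closedin (Metric_space.mtopology (carrier A) (cdist A)) C"

definition cstar_subalgebra :: "'a set \<Rightarrow> 'a cstar_alg \<Rightarrow> bool" where
  "cstar_subalgebra C A \<longleftrightarrow>
     C \<subseteq> carrier A \<and> \<zero>\<^bsub>A\<^esub> \<in> C \<and>
     (\<forall>x\<in>C. \<forall>y\<in>C. x \<oplus>\<^bsub>A\<^esub> y \<in> C \<and> x \<otimes>\<^bsub>A\<^esub> y \<in> C) \<and>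
     (\<forall>c. \<forall>x\<in>C. c \<odot>\<^bsub>A\<^esub> x \<in> C) \<and>
     (\<forall>x\<in>C. star A x \<in> C) \<and>
     norm_closed A C"

definition cstar_generated :: "'a cstar_alg \<Rightarrow> 'a set \<Rightarrow> 'a set" where
  "cstar_generated A X = \<Inter>{C. cstar_subalgebra C A \<and> X \<subseteq> C}"

definition star_hom :: "'a cstar_alg \<Rightarrow> 'b cstar_alg \<Rightarrow> ('a \<Rightarrow> 'b) set" where
  "star_hom A B = {h \<in> ring_hom A B. \<forall>x\<in>carrier A.
     (\<forall>c. h (c \<odot>\<^bsub>A\<^esub> x) = c \<odot>\<^bsub>B\<^esub> h x) \<and> h (star A x) = star B (h x)}"

definition star_isomorphic :: "'a cstar_alg \<Rightarrow> 'b cstar_alg \<Rightarrow> bool" where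
  "star_isomorphic A B \<longleftrightarrow> (\<exists>h \<in> star_hom A B. bij_betw h (carrier A) (carrier B))"

definition simple_cstar :: "'a cstar_alg \<Rightarrow> bool" where
  "simple_cstar A \<longleftrightarrow> cstar_algebra A \<and> carrier A \<noteq> {\<zero>\<^bsub>A\<^esub>} \<and>
     (\<forall>J. ideal J A \<and> norm_closed A J \<longrightarrow> J = {\<zero>\<^bsub>A\<^esub>} \<or> J = carrier A)"

definition unital_inclusion :: "'a set \<Rightarrow> 'a cstar_alg \<Rightarrow> bool" where
  "unital_inclusion A B \<longleftrightarrow> cstar_algebra B \<and> cstar_subalgebra A B \<and> \<one>\<^bsub>B\<^esub> \<in> A"

definition cstar_irreducible :: "'a set \<Rightarrow> 'a cstar_alg \<Rightarrow> bool" where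
  "cstar_irreducible A B \<longleftrightarrow> unital_inclusion A B \<and>
     (\<forall>C. cstar_subalgebra C B \<and> A \<subseteq> C \<longrightarrow> simple_cstar (B\<lparr>carrier := C\<rparr>))"

text \<open>Positivity of \<open>x\<close> in \<open>M\<^sub>n(A)\<close>, i.e. \<open>x = y\<^sup>*y\<close> for some \<open>y\<close> in \<open>M\<^sub>n(A)\<close>; only the
  entries with indices below \<open>n\<close> matter.\<close>

definition pos_matrix :: "'a cstar_alg \<Rightarrow> nat \<Rightarrow> (nat \<Rightarrow> nat \<Rightarrow> 'a) \<Rightarrow> bool" where
  "pos_matrix A n x \<longleftrightarrow>
     (\<exists>y. (\<forall>i<n. \<forall>j<n. y i j \<in> carrier A) \<and>
          (\<forall>i<n. \<forall>j<n. x i j = (\<Oplus>\<^bsub>A\<^esub>k\<in>{..<n}. star A (y k i) \<otimes>\<^bsub>A\<^esub> y k j)))"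

definition operator_system :: "'a set \<Rightarrow> 'a cstar_alg \<Rightarrow> bool" where
  "operator_system E A \<longleftrightarrow>
     E \<subseteq> carrier A \<and> \<one>\<^bsub>A\<^esub> \<in> E \<and>
     (\<forall>x\<in>E. \<forall>y\<in>E. x \<oplus>\<^bsub>A\<^esub> y \<in> E) \<and>
     (\<forall>c. \<forall>x\<in>E. c \<odot>\<^bsub>A\<^esub> x \<in> E) \<and>
     (\<forall>x\<in>E. star A x \<in> E)"

text \<open>Unital completely positive maps from an operator system \<open>E\<close> in \<open>A\<close> to \<open>B\<close>; the
  positive cone of \<open>M\<^sub>n(E)\<close> is the one induced by \<open>M\<^sub>n(A)\<close>.\<close>

definition ucp :: "'a set \<Rightarrow> 'a cstar_alg \<Rightarrow> 'b cstar_alg \<Rightarrow> ('a \<Rightarrow> 'b) \<Rightarrow> bool" where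
  "ucp E A B \<phi> \<longleftrightarrow>
     (\<forall>x\<in>E. \<phi> x \<in> carrier B) \<and>
     \<phi> \<one>\<^bsub>A\<^esub> = \<one>\<^bsub>B\<^esub> \<and>
     (\<forall>x\<in>E. \<forall>y\<in>E. \<phi> (x \<oplus>\<^bsub>A\<^esub> y) = \<phi> x \<oplus>\<^bsub>B\<^esub> \<phi> y) \<and>
     (\<forall>c. \<forall>x\<in>E. \<phi> (c \<odot>\<^bsub>A\<^esub> x) = c \<odot>\<^bsub>B\<^esub> \<phi> x) \<and>
     (\<forall>n x. (\<forall>i<n. \<forall>j<n. x i j \<in> E) \<and> pos_matrix A n x
        \<longrightarrow> pos_matrix B n (\<lambda>i j. \<phi> (x i j)))"

definition rigid :: "'a set \<Rightarrow> 'a cstar_alg \<Rightarrow> bool" where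
  "rigid A B \<longleftrightarrow> unital_inclusion A B \<and>
     (\<forall>\<phi>. ucp (carrier B) B B \<phi> \<and> (\<forall>a\<in>A. \<phi> a = a) \<longrightarrow> (\<forall>b\<in>carrier B. \<phi> b = b))"

text \<open>
  HOL cannot quantify over all types inside a definition, so the ambient algebras of the
  operator systems \<open>E \<subseteq> F\<close> live on a fixed type, chosen large enough to lose nothing.
  If \<open>I \<noteq> 0\<close> lives on \<open>'b\<close>, a direct sum of GNS representations embeds \<open>I\<close> into the bounded
  operators on \<open>\<ell>\<^sup>2(X)\<close> for some \<open>X \<subseteq> 'b\<close>; these are matrices of type
  \<open>'b \<Rightarrow> 'b \<Rightarrow> complex\<close>. Extending \<open>id\<^sub>I\<close> along this embedding gives a ucp projection onto \<open>I\<close>,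
  and then, by Arveson's theorem, \<open>I\<close> is injective for operator systems of any size.
\<close>

definition injective_cstar :: "'b cstar_alg \<Rightarrow> bool" where
  "injective_cstar I \<longleftrightarrow> cstar_algebra I \<and>
     (\<forall>(A :: ('b \<Rightarrow> 'b \<Rightarrow> complex) cstar_alg) E F \<phi>.
        cstar_algebra A \<and> operator_system E A \<and> operator_system F A \<and> E \<subseteq> F \<and> ucp E A I \<phi>
        \<longrightarrow> (\<exists>\<psi>. ucp F A I \<psi> \<and> (\<forall>x\<in>E. \<psi> x = \<phi> x)))"

text \<open>\<open>(I, j)\<close> is an injective envelope of \<open>A\<close>, where \<open>j\<close> is the unital embedding
  \<open>A \<subseteq> I\<close>.\<close>

definition injective_envelope ::
  "'a cstar_alg \<Rightarrow> 'b cstar_alg \<Rightarrow> ('a \<Rightarrow> 'b) \<Rightarrow> bool" where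
  "injective_envelope A I j \<longleftrightarrow>
     cstar_algebra A \<and> injective_cstar I \<and>
     j \<in> star_hom A I \<and> inj_on j (carrier A) \<and>
     (\<forall>\<phi>. ucp (carrier I) I I \<phi> \<and> (\<forall>a\<in>carrier A. \<phi> (j a) = j a)
        \<longrightarrow> (\<forall>x\<in>carrier I. \<phi> x = x))"

definition diadic_relations :: "'a cstar_alg \<Rightarrow> 'a \<Rightarrow> 'a \<Rightarrow> bool" where
  "diadic_relations A u s \<longleftrightarrow>
     u \<in> carrier A \<and> s \<in> carrier A \<and>
     star A u \<otimes>\<^bsub>A\<^esub> u = \<one>\<^bsub>A\<^esub> \<and> u \<otimes>\<^bsub>A\<^esub> star A u = \<one>\<^bsub>A\<^esub> \<and>
     star A s \<otimes>\<^bsub>A\<^esub> s = \<one>\<^bsub>A\<^esub> \<and>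
     u \<otimes>\<^bsub>A\<^esub> u \<otimes>\<^bsub>A\<^esub> s = s \<otimes>\<^bsub>A\<^esub> u \<and>
     s \<otimes>\<^bsub>A\<^esub> star A s \<oplus>\<^bsub>A\<^esub> u \<otimes>\<^bsub>A\<^esub> s \<otimes>\<^bsub>A\<^esub> star A s \<otimes>\<^bsub>A\<^esub> star A u = \<one>\<^bsub>A\<^esub>"

text \<open>
  The universal C*-algebra of these relations. It suffices to test against algebras on the
  type \<open>nat \<Rightarrow> nat \<Rightarrow> complex\<close>: a C*-algebra generated by two elements is separable, hence is
  isomorphic to an algebra of bounded operators, i.e. of infinite matrices, on \<open>\<ell>\<^sup>2(nat)\<close>.
  Uniqueness of \<open>h\<close> on the carrier follows from the generation clause.
\<close>

definition universal_diadic :: "'a cstar_alg \<Rightarrow> 'a \<Rightarrow> 'a \<Rightarrow> bool" where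
  "universal_diadic Q u s \<longleftrightarrow>
     cstar_algebra Q \<and> diadic_relations Q u s \<and> cstar_generated Q {u, s} = carrier Q \<and>
     (\<forall>(B :: (nat \<Rightarrow> nat \<Rightarrow> complex) cstar_alg) v t.
        cstar_algebra B \<and> diadic_relations B v t
        \<longrightarrow> (\<exists>h \<in> star_hom Q B. h u = v \<and> h s = t))"

end

theory Submission
  imports Defs
begin

text \<open>
  Put \<open>\<Phi>(x) = (S\<^sub>1\<^sup>* x S\<^sub>1 + S\<^sub>2\<^sup>* x S\<^sub>2) / 2\<close>. On the monomials \<open>U\<^sup>a S\<^sub>2\<^sup>m (S\<^sub>2\<^sup>*)\<^sup>k U\<^sup>-\<^sup>b\<close>, hence on all of \<open>Q\<^sub>2\<close>,
  the iterates \<open>\<Phi>\<^sup>n(x)\<close> converge in norm to \<open>\<psi>(x) 1\<close> for a state \<open>\<psi>\<close>, and \<open>\<psi>\<close> is faithful. If \<open>J\<close> is a nonzero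
  closed ideal of an algebra between \<open>O\<^sub>2\<close> and \<open>Q\<^sub>2\<close> and \<open>0 \<noteq> x \<in> J\<close>, then \<open>\<psi>(x\<^sup>* x) 1 = lim \<Phi>\<^sup>n(x\<^sup>* x)\<close> lies in \<open>J\<close>:
  this is irreducibility.

  Let \<open>\<phi>\<close> be a ucp map fixing \<open>O\<^sub>2\<close>. Then \<open>O\<^sub>2\<close> lies in its multiplicative domain, and \<open>U S\<^sub>2 = S\<^sub>1\<close>, \<open>U S\<^sub>1 = S\<^sub>2 U\<close>
  give \<open>D = S\<^sub>2 D S\<^sub>1\<^sup>*\<close> for \<open>D = U - \<phi>(U)\<close>. Hence \<open>\<psi>(D\<^sup>* D) = \<psi>(D\<^sup>* D) / 2\<close>, so \<open>D = 0\<close>: this is rigidity.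

  The identity of \<open>O\<^sub>2\<close> extends to ucp maps between the injective envelopes in both directions. Their composite on
  \<open>I(O\<^sub>2)\<close> is the identity; on \<open>I(Q\<^sub>2)\<close> it fixes \<open>O\<^sub>2\<close>, and \<open>D = U - \<rho>(U) \<in> I(Q\<^sub>2)\<close> satisfies the same equation.
  Here \<open>\<psi>\<close> is not available, but \<open>D\<close> vanishes when compressed by the projections
  \<open>1 - S\<^sub>1\<^sup>n (S\<^sub>1\<^sup>*)\<^sup>n - S\<^sub>2\<^sup>n (S\<^sub>2\<^sup>*)\<^sup>n\<close>, and these compressions detect positivity in \<open>Q\<^sub>2\<close>. So the map that kills \<open>D\<close> and
  fixes \<open>Q\<^sub>2\<close> is ucp; it extends to \<open>I(Q\<^sub>2)\<close>, where it must be the identity.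

  Finally \<open>Q\<^sub>2 \<noteq> 0\<close>, because the relations hold for the shift and the doubling map on \<open>\<ell>\<^sup>2(\<int>)\<close>.
\<close>

section \<open>Norm convergence\<close>

text \<open>The delicate point is the faithfulness of \<open>psi\<close>: simplicity of
  \<open>Q_2\<close> cannot be assumed. It follows once the GNS norm of \<open>psi\<close> bounds
  the C*-norm on polynomials in the generators, because a polynomial near a null vector is then
  small. On the pieces considered, the quotient of the two norms grows only linearly under passage
  to \<open>N\<close>-th powers, so it disappears in the \<open>N\<close>-th root;
  \<open>N = 2^i\<close>, since the C*-identity gives the norm of repeated squares exactly. For null
  vectors to be stable under right multiplication, \<open>psi\<close> has to be invariant under
  conjugation by \<open>u\<close> and to scale by 1/2 under \<open>s\<close>.

  Positivity is a norm condition, and a selfadjoint \<open>x\<close> that is not positive is exposed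
  by some \<open>b x b = - c^2\<close> with \<open>c \<noteq> 0\<close>. Such witnesses survive
  injective homomorphisms and limits of compressions, which is how positivity is pulled back to the
  smaller algebra. Since \<open>O_2\<close> contains Cuntz families of every size,
  \<open>M_n(A)\<close> is isomorphic to \<open>A\<close>, and complete positivity reduces to
  positivity of single elements.\<close>

declare (in ring) r_one [algebra ring "zero R" "add R" "a_inv R" "a_minus R" "one R" "mult R"]

context cstar_algebra
begin

abbreviation adj :: "'a \<Rightarrow> 'a" ("_\<^sup>\<star>" [1000] 999) where "x\<^sup>\<star> \<equiv> star A x"

abbreviation nrm :: "'a \<Rightarrow> real" ("\<parallel>_\<parallel>") where "\<parallel>x\<parallel> \<equiv> cnorm A x"

declare smult_closed [simp, intro] star_closed [simp, intro] cnorm_nonneg [simp]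
declare star_star [simp] smult_one [simp]

lemma norm_zero [simp]: "\<parallel>\<zero>\<parallel> = 0"
  by (simp add: cnorm_eq_0)

lemma smult_0_left [simp]: "x \<in> carrier A \<Longrightarrow> 0 \<odot> x = \<zero>"
  using cnorm_eq_0[of "0 \<odot> x"] cnorm_smult[of x 0] by simp

lemma smult_0_right [simp]: "c \<odot> \<zero> = \<zero>"
  using cnorm_eq_0[of "c \<odot> \<zero>"] cnorm_smult[of \<zero> c] by simp

lemma uminus_eq_smult: "x \<in> carrier A \<Longrightarrow> \<ominus> x = (-1) \<odot> x"
proof (rule minus_equality)
  assume x: "x \<in> carrier A"
  have "(-1) \<odot> x \<oplus> 1 \<odot> x = (-1 + 1) \<odot> x" using x by (metis smult_l_distr)
  then show "(-1) \<odot> x \<oplus> x = \<zero>" using x by simp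
qed auto

lemma smult_uminus [simp]: "x \<in> carrier A \<Longrightarrow> c \<odot> (\<ominus> x) = \<ominus> (c \<odot> x)"
  by (simp add: uminus_eq_smult flip: smult_assoc)

lemma smult_uminus_left: "x \<in> carrier A \<Longrightarrow> (- c) \<odot> x = \<ominus> (c \<odot> x)"
  by (simp add: uminus_eq_smult flip: smult_assoc)

lemma smult_smult: "x \<in> carrier A \<Longrightarrow> c \<odot> (d \<odot> x) = (c * d) \<odot> x"
  by (simp add: smult_assoc)

lemma smult_diff_distr:
  "\<lbrakk>x \<in> carrier A; y \<in> carrier A\<rbrakk> \<Longrightarrow> c \<odot> (x \<ominus> y) = c \<odot> x \<ominus> c \<odot> y"
  by (simp add: minus_eq smult_r_distr)

lemma smult_eq_0_iff: "x \<in> carrier A \<Longrightarrow> c \<odot> x = \<zero> \<longleftrightarrow> c = 0 \<or> x = \<zero>"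
  using cnorm_eq_0[of "c \<odot> x"] cnorm_smult[of x c] cnorm_eq_0[of x] by auto

lemma norm_uminus [simp]: "x \<in> carrier A \<Longrightarrow> \<parallel>\<ominus> x\<parallel> = \<parallel>x\<parallel>"
  by (simp add: uminus_eq_smult cnorm_smult)

lemma diff_eq_0_iff: "\<lbrakk>x \<in> carrier A; y \<in> carrier A\<rbrakk> \<Longrightarrow> x \<ominus> y = \<zero> \<longleftrightarrow> x = y"
  by (metis minus_eq r_neg minus_equality minus_minus a_inv_closed)

lemma norm_minus_commute:
  "\<lbrakk>x \<in> carrier A; y \<in> carrier A\<rbrakk> \<Longrightarrow> \<parallel>x \<ominus> y\<parallel> = \<parallel>y \<ominus> x\<parallel>"
proof -
  assume "x \<in> carrier A" "y \<in> carrier A"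
  moreover from this have "x \<ominus> y = \<ominus> (y \<ominus> x)" by algebra
  ultimately show ?thesis by simp
qed

lemma norm_diff_le: "\<lbrakk>x \<in> carrier A; y \<in> carrier A\<rbrakk> \<Longrightarrow> \<parallel>x \<ominus> y\<parallel> \<le> \<parallel>x\<parallel> + \<parallel>y\<parallel>"
  using cnorm_triangle[of x "\<ominus> y"] by (simp add: minus_eq)

lemma norm_diff_triangle:
  "\<lbrakk>x \<in> carrier A; y \<in> carrier A; z \<in> carrier A\<rbrakk> \<Longrightarrow> \<parallel>x \<ominus> z\<parallel> \<le> \<parallel>x \<ominus> y\<parallel> + \<parallel>y \<ominus> z\<parallel>"
proof -
  assume *: "x \<in> carrier A" "y \<in> carrier A" "z \<in> carrier A"
  then have "x \<ominus> z = (x \<ominus> y) \<oplus> (y \<ominus> z)" by algebra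
  with * show ?thesis by (metis cnorm_triangle minus_closed)
qed

lemma norm_le_diff: "\<lbrakk>x \<in> carrier A; y \<in> carrier A\<rbrakk> \<Longrightarrow> \<parallel>x\<parallel> \<le> \<parallel>x \<ominus> y\<parallel> + \<parallel>y\<parallel>"
  using norm_diff_triangle[of x y \<zero>] by (simp add: minus_eq)

lemma star_zero [simp]: "\<zero>\<^sup>\<star> = \<zero>"
  using star_smult[of \<zero> 0] by (metis smult_0_left smult_0_right star_closed zero_closed complex_cnj_zero)

lemma star_one [simp]: "\<one>\<^sup>\<star> = \<one>"
  by (metis one_closed r_one star_closed star_mult star_star)

lemma star_uminus: "x \<in> carrier A \<Longrightarrow> (\<ominus> x)\<^sup>\<star> = \<ominus> (x\<^sup>\<star>)"
  by (simp add: uminus_eq_smult star_smult)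

lemma star_diff: "\<lbrakk>x \<in> carrier A; y \<in> carrier A\<rbrakk> \<Longrightarrow> (x \<ominus> y)\<^sup>\<star> = x\<^sup>\<star> \<ominus> y\<^sup>\<star>"
  by (simp add: minus_eq star_add star_uminus)

lemmas star_simps = star_add star_smult star_mult star_uminus star_diff

text \<open>Registered with the \<open>algebra\<close> method, which then normalises adjoints and
  scalars along with the ring operations.\<close>

lemmas cstar_simprules
  [algebra ring "zero A" "add A" "a_inv A" "a_minus A" "one A" "mult A"] =
  star_closed smult_closed star_star star_add star_smult star_mult star_uminus star_one
  star_zero smult_r_distr smult_mult_l smult_mult_r smult_smult smult_uminus smult_one

text \<open>The C*-identity and submultiplicativity bound \<open>\<parallel>x\<parallel>^2\<close>
  by \<open>\<parallel>x\<^sup>\<star>\<parallel> \<parallel>x\<parallel>\<close>; cancelling gives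
  one inequality, and the same for \<open>x\<^sup>\<star>\<close> gives the other.\<close>

lemma norm_star [simp]: "x \<in> carrier A \<Longrightarrow> \<parallel>x\<^sup>\<star>\<parallel> = \<parallel>x\<parallel>"
proof -
  have le: "\<parallel>x\<parallel> \<le> \<parallel>x\<^sup>\<star>\<parallel>" if x: "x \<in> carrier A" for x
  proof (cases "\<parallel>x\<parallel> = 0")
    case False
    then have "\<parallel>x\<parallel> > 0" using x cnorm_nonneg[of x] by linarith
    moreover have "\<parallel>x\<parallel> * \<parallel>x\<parallel> \<le> \<parallel>x\<^sup>\<star>\<parallel> * \<parallel>x\<parallel>"
      using cstar_identity[OF x] cnorm_mult[of "x\<^sup>\<star>" x] x by (simp add: power2_eq_square)
    ultimately show ?thesis by simp
  qed (use x in simp)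
  assume x: "x \<in> carrier A"
  show ?thesis using le[of x] le[of "x\<^sup>\<star>"] x by simp
qed

text \<open>The C*-identity makes \<open>\<parallel>\<one>\<parallel>\<close> idempotent. The zero
  algebra satisfies the axioms, so the value 0 cannot be excluded here.\<close>

lemma norm_one_le: "\<parallel>\<one>\<parallel> \<le> 1"
proof -
  have "\<parallel>\<one>\<parallel> = \<parallel>\<one>\<parallel>\<^sup>2" using cstar_identity[of \<one>] by simp
  then have "\<parallel>\<one>\<parallel> = 0 \<or> \<parallel>\<one>\<parallel> = 1" by (simp add: power2_eq_square)
  then show ?thesis by auto
qed

lemma norm_scalar_le: "\<parallel>c \<odot> \<one>\<parallel> \<le> cmod c"
  using norm_one_le by (simp add: cnorm_smult mult_left_le)

lemma norm_mult_le:
  "\<lbrakk>x \<in> carrier A; y \<in> carrier A; \<parallel>x\<parallel> \<le> a; \<parallel>y\<parallel> \<le> b\<rbrakk> \<Longrightarrow> \<parallel>x \<otimes> y\<parallel> \<le> a * b"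
  by (meson cnorm_mult cnorm_nonneg mult_mono order_trans)

lemma norm_isometry_le: "\<lbrakk>v \<in> carrier A; v\<^sup>\<star> \<otimes> v = \<one>\<rbrakk> \<Longrightarrow> \<parallel>v\<parallel> \<le> 1"
  using cstar_identity[of v] norm_one_le by (simp add: power_le_one_iff)

lemma star_mult_eq_0: "\<lbrakk>x \<in> carrier A; x\<^sup>\<star> \<otimes> x = \<zero>\<rbrakk> \<Longrightarrow> x = \<zero>"
  using cstar_identity[of x] by (simp add: cnorm_eq_0)

lemma selfadjoint_norm_square: "\<lbrakk>x \<in> carrier A; x\<^sup>\<star> = x\<rbrakk> \<Longrightarrow> \<parallel>x \<otimes> x\<parallel> = \<parallel>x\<parallel>\<^sup>2"
  using cstar_identity[of x] by simp

lemma half_double: "x \<in> carrier A \<Longrightarrow> (1/2) \<odot> (x \<oplus> x) = x"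
  using smult_l_distr[of x "1/2" "1/2"] by (simp add: smult_r_distr)

lemma double_half: "x \<in> carrier A \<Longrightarrow> (1/2) \<odot> x \<oplus> (1/2) \<odot> x = x"
  using smult_l_distr[of x "1/2" "1/2"] by simp

text \<open>Membership in the carrier is part of the notion, so that the limit rules for sums,
  products and adjoints carry no side conditions.\<close>

definition tends :: "(nat \<Rightarrow> 'a) \<Rightarrow> 'a \<Rightarrow> bool" (infix "\<leadsto>" 50) where
  "X \<leadsto> x \<longleftrightarrow> (\<forall>n. X n \<in> carrier A) \<and> x \<in> carrier A \<and> (\<lambda>n. \<parallel>X n \<ominus> x\<parallel>) \<longlonglongrightarrow> 0"

lemma tendsD: assumes "X \<leadsto> x" shows "X n \<in> carrier A" "x \<in> carrier A"
  using assms by (auto simp: tends_def)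

lemma tendsI:
  assumes "\<And>n. X n \<in> carrier A" "x \<in> carrier A" "\<And>n. \<parallel>X n \<ominus> x\<parallel> \<le> e n" "e \<longlonglongrightarrow> 0"
  shows "X \<leadsto> x"
  unfolding tends_def using assms
  by (auto intro!: Lim_null_comparison[of "\<lambda>n. \<parallel>X n \<ominus> x\<parallel>" e])

lemma tends_const: "x \<in> carrier A \<Longrightarrow> (\<lambda>n. x) \<leadsto> x"
  by (simp add: tends_def minus_eq r_neg)

lemma tends_unique: assumes "X \<leadsto> x" "X \<leadsto> y" shows "x = y"
proof -
  note c = tendsD[OF assms(1)] tendsD[OF assms(2)]
  have "(\<lambda>n. \<parallel>X n \<ominus> x\<parallel> + \<parallel>X n \<ominus> y\<parallel>) \<longlonglongrightarrow> 0 + 0"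
    using assms unfolding tends_def by (intro tendsto_add) auto
  moreover have "\<parallel>x \<ominus> y\<parallel> \<le> \<parallel>X n \<ominus> x\<parallel> + \<parallel>X n \<ominus> y\<parallel>" for n
    using norm_diff_triangle[of x "X n" y] norm_minus_commute[of x "X n"] c by simp
  ultimately have "\<parallel>x \<ominus> y\<parallel> \<le> 0" by (intro LIMSEQ_le_const) auto
  then have "\<parallel>x \<ominus> y\<parallel> = 0" using c cnorm_nonneg[of "x \<ominus> y"] by (intro antisym) auto
  then show ?thesis using c cnorm_eq_0[of "x \<ominus> y"] by (simp add: diff_eq_0_iff)
qed

lemma tends_norm: assumes "X \<leadsto> x" shows "(\<lambda>n. \<parallel>X n\<parallel>) \<longlonglongrightarrow> \<parallel>x\<parallel>"
proof (rule LIM_zero_cancel, rule Lim_null_comparison)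
  note c = tendsD[OF assms]
  show "(\<lambda>n. \<parallel>X n \<ominus> x\<parallel>) \<longlonglongrightarrow> 0" using assms by (simp add: tends_def)
  have "norm (\<parallel>X n\<parallel> - \<parallel>x\<parallel>) \<le> \<parallel>X n \<ominus> x\<parallel>" for n
    using norm_le_diff[of "X n" x] norm_le_diff[of x "X n"] norm_minus_commute[of x "X n"] c
    by (simp add: abs_le_iff)
  then show "\<forall>\<^sub>F n in sequentially. norm (\<parallel>X n\<parallel> - \<parallel>x\<parallel>) \<le> \<parallel>X n \<ominus> x\<parallel>" by simp
qed

lemma tends_norm_le: assumes "X \<leadsto> x" "\<And>n. \<parallel>X n\<parallel> \<le> t" shows "\<parallel>x\<parallel> \<le> t"
  using tends_norm[OF assms(1)] assms(2) by (intro LIMSEQ_le_const2) auto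

lemma tends_add: assumes "X \<leadsto> x" "Y \<leadsto> y" shows "(\<lambda>n. X n \<oplus> Y n) \<leadsto> x \<oplus> y"
proof (rule tendsI)
  note c = tendsD[OF assms(1)] tendsD[OF assms(2)]
  have "(X n \<oplus> Y n) \<ominus> (x \<oplus> y) = (X n \<ominus> x) \<oplus> (Y n \<ominus> y)" for n
    using c(1)[of n] c(2) c(3)[of n] c(4) by algebra
  then show "\<parallel>(X n \<oplus> Y n) \<ominus> (x \<oplus> y)\<parallel> \<le> \<parallel>X n \<ominus> x\<parallel> + \<parallel>Y n \<ominus> y\<parallel>" for n
    using c by (simp add: cnorm_triangle)
  show "(\<lambda>n. \<parallel>X n \<ominus> x\<parallel> + \<parallel>Y n \<ominus> y\<parallel>) \<longlonglongrightarrow> 0"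
    using assms tendsto_add[of _ 0 _ _ 0] by (auto simp: tends_def)
qed (use tendsD[OF assms(1)] tendsD[OF assms(2)] in auto)

lemma tends_mult: assumes "X \<leadsto> x" "Y \<leadsto> y" shows "(\<lambda>n. X n \<otimes> Y n) \<leadsto> x \<otimes> y"
proof (rule tendsI)
  note c = tendsD[OF assms(1)] tendsD[OF assms(2)]
  have eq: "X n \<otimes> Y n \<ominus> x \<otimes> y = (X n \<ominus> x) \<otimes> Y n \<oplus> x \<otimes> (Y n \<ominus> y)" for n
    using c(1)[of n] c(2) c(3)[of n] c(4) by algebra
  show "\<parallel>X n \<otimes> Y n \<ominus> x \<otimes> y\<parallel> \<le> \<parallel>X n \<ominus> x\<parallel> * \<parallel>Y n\<parallel> + \<parallel>x\<parallel> * \<parallel>Y n \<ominus> y\<parallel>" for n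
    unfolding eq using c by (intro order_trans[OF cnorm_triangle] add_mono cnorm_mult) auto
  have "(\<lambda>n. \<parallel>X n \<ominus> x\<parallel> * \<parallel>Y n\<parallel> + \<parallel>x\<parallel> * \<parallel>Y n \<ominus> y\<parallel>) \<longlonglongrightarrow> 0 * \<parallel>y\<parallel> + \<parallel>x\<parallel> * 0"
    using assms tends_norm[OF assms(2)] unfolding tends_def by (intro tendsto_intros) auto
  then show "(\<lambda>n. \<parallel>X n \<ominus> x\<parallel> * \<parallel>Y n\<parallel> + \<parallel>x\<parallel> * \<parallel>Y n \<ominus> y\<parallel>) \<longlonglongrightarrow> 0" by simp
qed (use tendsD[OF assms(1)] tendsD[OF assms(2)] in auto)

lemma tends_smult: assumes "X \<leadsto> x" shows "(\<lambda>n. c \<odot> X n) \<leadsto> c \<odot> x"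
proof (rule tendsI)
  show "\<parallel>c \<odot> X n \<ominus> c \<odot> x\<parallel> \<le> cmod c * \<parallel>X n \<ominus> x\<parallel>" for n
    using tendsD[OF assms] by (simp flip: smult_diff_distr cnorm_smult)
  show "(\<lambda>n. cmod c * \<parallel>X n \<ominus> x\<parallel>) \<longlonglongrightarrow> 0"
    using assms tendsto_mult_left[of _ 0 _ "cmod c"] by (auto simp: tends_def)
qed (use tendsD[OF assms] in auto)

lemma tends_uminus: "X \<leadsto> x \<Longrightarrow> (\<lambda>n. \<ominus> X n) \<leadsto> \<ominus> x"
  using tends_smult[of X x "-1"] tendsD[of X x] by (simp add: uminus_eq_smult)

lemma tends_diff: "\<lbrakk>X \<leadsto> x; Y \<leadsto> y\<rbrakk> \<Longrightarrow> (\<lambda>n. X n \<ominus> Y n) \<leadsto> x \<ominus> y"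
  unfolding minus_eq by (intro tends_add tends_uminus)

lemma tends_star: assumes "X \<leadsto> x" shows "(\<lambda>n. (X n)\<^sup>\<star>) \<leadsto> x\<^sup>\<star>"
  using assms by (simp add: tends_def flip: star_diff)

lemma tends_Suc: "X \<leadsto> x \<Longrightarrow> (\<lambda>n. X (Suc n)) \<leadsto> x"
  by (auto simp: tends_def dest: LIMSEQ_Suc)

text \<open>Links \<open>tends\<close> to the topology that \<open>norm_closed\<close> and the
  completeness axiom refer to.\<close>

sublocale metr: Metric_space "carrier A" "cdist A"
proof
  show "0 \<le> cdist A x y" for x y by (simp add: cdist_def)
  show "cdist A x y = cdist A y x" for x y by (simp add: cdist_def norm_minus_commute)
  show "cdist A x y = 0 \<longleftrightarrow> x = y" if "x \<in> carrier A" "y \<in> carrier A" for x y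
    using that by (simp add: cdist_def cnorm_eq_0 diff_eq_0_iff)
  show "cdist A x z \<le> cdist A x y + cdist A y z"
    if "x \<in> carrier A" "y \<in> carrier A" "z \<in> carrier A" for x y z
    using that by (simp add: cdist_def norm_diff_triangle)
qed

lemma limitin_iff_tends:
  assumes "\<And>n. X n \<in> carrier A"
  shows "limitin metr.mtopology X x sequentially \<longleftrightarrow> X \<leadsto> x"
  unfolding metr.limitin_metric_dist_null tends_def using assms by (auto simp: cdist_def)

lemma norm_closed_iff:
  "norm_closed A C \<longleftrightarrow> C \<subseteq> carrier A \<and> (\<forall>X x. (\<forall>n. X n \<in> C) \<and> X \<leadsto> x \<longrightarrow> x \<in> C)"
proof -
  have "(range X \<subseteq> C \<and> limitin metr.mtopology X x sequentially) = ((\<forall>n. X n \<in> C) \<and> X \<leadsto> x)"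
    if "C \<subseteq> carrier A" for X x
    using that limitin_iff_tends[of X x] by (auto simp: image_subset_iff)
  then show ?thesis
    unfolding norm_closed_def metr.metric_closedin_iff_sequentially_closed by blast
qed

text \<open>The one-sided form of the Cauchy condition suits iterations whose tails are majorised by
  a scalar sequence.\<close>

lemma Cauchy_tends:
  assumes X: "\<And>n. X n \<in> carrier A"
    and e: "\<And>m n. m \<le> n \<Longrightarrow> \<parallel>X n \<ominus> X m\<parallel> \<le> f m" "f \<longlonglongrightarrow> 0"
  obtains x where "X \<leadsto> x"
proof -
  have "metr.MCauchy X"
    unfolding metr.MCauchy_def
  proof (intro conjI allI impI)
    fix \<epsilon> :: real assume "\<epsilon> > 0"
    then obtain N where N: "\<And>n. n \<ge> N \<Longrightarrow> norm (f n - 0) < \<epsilon>"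
      using e(2) by (meson LIMSEQ_iff)
    have "\<parallel>X n \<ominus> X m\<parallel> < \<epsilon>" if "n \<ge> N" "m \<ge> N" for n m
      using e(1)[of m n] e(1)[of n m] N[OF that(1)] N[OF that(2)] norm_minus_commute[OF X X, of n m]
      by (cases "m \<le> n") auto
    then show "\<exists>N. \<forall>n n'. N \<le> n \<longrightarrow> N \<le> n' \<longrightarrow> cdist A (X n) (X n') < \<epsilon>"
      using X by (auto simp: cdist_def)
  qed (use X in auto)
  then obtain x where "limitin metr.mtopology X x sequentially"
    using complete unfolding metr.mcomplete_def by blast
  then show ?thesis using that limitin_iff_tends[of X x] X by simp
qed

end

section \<open>Square roots\<close>


context cstar_algebra
begin

text \<open>For a limit \<open>r\<close> of the iteration, \<open>(\<one> - r)\<^sup>2 = \<one> - k\<close>. The scalar iteration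
  \<open>sqrt_bound\<close> (the case \<open>k = 1\<close>) majorises it.\<close>

primrec sqrt_iter :: "'a \<Rightarrow> nat \<Rightarrow> 'a" where
  "sqrt_iter k 0 = \<zero>"
| "sqrt_iter k (Suc n) = (1/2) \<odot> (k \<oplus> sqrt_iter k n \<otimes> sqrt_iter k n)"

end

primrec sqrt_bound :: "nat \<Rightarrow> real" where
  "sqrt_bound 0 = 0"
| "sqrt_bound (Suc n) = (1 + (sqrt_bound n)\<^sup>2) / 2"

lemma sqrt_bound_range: "0 \<le> sqrt_bound n \<and> sqrt_bound n \<le> 1"
  by (induction n) (auto simp: power_le_one)

lemma sqrt_bound_convergent: obtains l where "sqrt_bound \<longlonglongrightarrow> l" "\<And>n. sqrt_bound n \<le> l"
proof -
  have "sqrt_bound n \<le> sqrt_bound (Suc n)" for n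
    using sum_squares_bound[of "sqrt_bound n" 1] by (simp add: field_simps)
  then have "incseq sqrt_bound" by (rule incseq_SucI)
  then show ?thesis using that incseq_convergent[of sqrt_bound 1] sqrt_bound_range by blast
qed

context cstar_algebra
begin

lemma sqrt_iter_props:
  assumes k: "k \<in> carrier A" "k\<^sup>\<star> = k" "\<parallel>k\<parallel> \<le> 1"
  shows "sqrt_iter k n \<in> carrier A \<and> (sqrt_iter k n)\<^sup>\<star> = sqrt_iter k n \<and> \<parallel>sqrt_iter k n\<parallel> \<le> sqrt_bound n"
proof (induction n)
  case (Suc n)
  let ?r = "sqrt_iter k n"
  have "\<parallel>k \<oplus> ?r \<otimes> ?r\<parallel> \<le> 1 + sqrt_bound n * sqrt_bound n"
    using Suc k by (intro order_trans[OF cnorm_triangle] add_mono norm_mult_le) auto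
  then show ?case using Suc k by (simp add: star_simps cnorm_smult power2_eq_square)
qed auto

text \<open>Noncommutative difference of squares: \<open>s^2 - r^2 = s (s - r) + (s - r) r\<close>.
  The scalar iteration satisfies the same identity with equality, so its increments bound those in
  the algebra.\<close>

lemma sqrt_iter_Suc_diff:
  assumes k: "k \<in> carrier A" "k\<^sup>\<star> = k" "\<parallel>k\<parallel> \<le> 1"
  shows "\<parallel>sqrt_iter k (Suc n) \<ominus> sqrt_iter k n\<parallel> \<le> sqrt_bound (Suc n) - sqrt_bound n"
proof (induction n)
  case 0
  then show ?case using k by (simp add: cnorm_smult minus_eq)
next
  case (Suc n)
  let ?r = "sqrt_iter k n" and ?s = "sqrt_iter k (Suc n)"
  let ?a = "sqrt_bound n" and ?b = "sqrt_bound (Suc n)"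
  note r = sqrt_iter_props[OF k, of n] and s = sqrt_iter_props[OF k, of "Suc n"]
  have rc: "?r \<in> carrier A" and sc: "?s \<in> carrier A" using r s by auto
  have "sqrt_iter k (Suc (Suc n)) \<ominus> ?s
      = (1/2) \<odot> (k \<oplus> ?s \<otimes> ?s) \<ominus> (1/2) \<odot> (k \<oplus> ?r \<otimes> ?r)" by simp
  also have "\<dots> = (1/2) \<odot> ((k \<oplus> ?s \<otimes> ?s) \<ominus> (k \<oplus> ?r \<otimes> ?r))"
    using rc sc k by (subst smult_diff_distr) auto
  also have "(k \<oplus> ?s \<otimes> ?s) \<ominus> (k \<oplus> ?r \<otimes> ?r) = ?s \<otimes> (?s \<ominus> ?r) \<oplus> (?s \<ominus> ?r) \<otimes> ?r"
    using rc sc k(1) by algebra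
  finally have "\<parallel>sqrt_iter k (Suc (Suc n)) \<ominus> ?s\<parallel>
      = \<parallel>?s \<otimes> (?s \<ominus> ?r) \<oplus> (?s \<ominus> ?r) \<otimes> ?r\<parallel> / 2"
    using rc sc by (simp add: cnorm_smult del: sqrt_iter.simps)
  also have "\<dots> \<le> (?b * (?b - ?a) + (?b - ?a) * ?a) / 2"
    using r s Suc
    by (intro divide_right_mono order_trans[OF cnorm_triangle] add_mono norm_mult_le)
      (auto simp del: sqrt_iter.simps sqrt_bound.simps)
  also have "\<dots> = sqrt_bound (Suc (Suc n)) - ?b"
  proof -
    have "?b = (1 + ?a\<^sup>2) / 2" by simp
    moreover have "(b * (b - a) + (b - a) * a) / 2 = (1 + b\<^sup>2) / 2 - b"
      if "b = (1 + a\<^sup>2) / 2" for a b :: real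
      using that by (simp add: power2_eq_square field_simps)
    ultimately show ?thesis unfolding sqrt_bound.simps(2)[of "Suc n"] by blast
  qed
  finally show ?case .
qed

lemma sqrt_iter_diff:
  assumes k: "k \<in> carrier A" "k\<^sup>\<star> = k" "\<parallel>k\<parallel> \<le> 1" and "m \<le> n"
  shows "\<parallel>sqrt_iter k n \<ominus> sqrt_iter k m\<parallel> \<le> sqrt_bound n - sqrt_bound m"
  using \<open>m \<le> n\<close>
proof (induction n rule: dec_induct)
  case base
  then show ?case using sqrt_iter_props[OF k, of m] by (simp add: minus_eq r_neg)
next
  case (step n)
  then show ?case
    using norm_diff_triangle[of "sqrt_iter k (Suc n)" "sqrt_iter k n" "sqrt_iter k m"]
      sqrt_iter_Suc_diff[OF k, of n] sqrt_iter_props[OF k, of n] sqrt_iter_props[OF k, of m]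
      sqrt_iter_props[OF k, of "Suc n"]
    by linarith
qed

text \<open>The fixed point equation \<open>r = (k + r^2) / 2\<close> is
  \<open>(1 - r)^2 = 1 - k\<close> rearranged. The iterates are polynomials in \<open>k\<close>
  without constant term, hence \<open>r\<close> lies in every C*-subalgebra that contains
  \<open>k\<close>, unital or not, and commutes with whatever commutes with
  \<open>k\<close>.\<close>

lemma sqrt_one_minus:
  assumes k: "k \<in> carrier A" "k\<^sup>\<star> = k" "\<parallel>k\<parallel> \<le> 1"
  obtains r where "r \<in> carrier A" "r\<^sup>\<star> = r" "\<parallel>r\<parallel> \<le> 1" "(\<one> \<ominus> r) \<otimes> (\<one> \<ominus> r) = \<one> \<ominus> k"
    "\<And>C. \<lbrakk>cstar_subalgebra C A; k \<in> C\<rbrakk> \<Longrightarrow> r \<in> C"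
    "\<And>y. \<lbrakk>y \<in> carrier A; k \<otimes> y = y \<otimes> k\<rbrakk> \<Longrightarrow> r \<otimes> y = y \<otimes> r"
proof -
  note P = sqrt_iter_props[OF k]
  obtain l where l: "sqrt_bound \<longlonglongrightarrow> l" "\<And>n. sqrt_bound n \<le> l"
    using sqrt_bound_convergent by blast
  obtain r where r: "sqrt_iter k \<leadsto> r"
  proof (rule Cauchy_tends[of "sqrt_iter k" "\<lambda>m. l - sqrt_bound m"])
    show "\<parallel>sqrt_iter k n \<ominus> sqrt_iter k m\<parallel> \<le> l - sqrt_bound m" if "m \<le> n" for m n
      using sqrt_iter_diff[OF k that] l(2)[of n] by linarith
    show "(\<lambda>m. l - sqrt_bound m) \<longlonglongrightarrow> 0" using tendsto_diff[OF tendsto_const l(1), of l] by simp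
  qed (use P in auto)
  have rc: "r \<in> carrier A" using tendsD[OF r] by simp
  have "(\<lambda>n. sqrt_iter k (Suc n)) \<leadsto> (1/2) \<odot> (k \<oplus> r \<otimes> r)"
    unfolding sqrt_iter.simps using k by (intro tends_smult tends_add tends_mult tends_const r)
  then have fix_eq: "r = (1/2) \<odot> (k \<oplus> r \<otimes> r)" using tends_unique[OF tends_Suc[OF r]] by blast
  have dbl: "r \<oplus> r = k \<oplus> r \<otimes> r"
    using double_half[of "k \<oplus> r \<otimes> r"] rc k by (simp flip: fix_eq)
  have "(\<one> \<ominus> r) \<otimes> (\<one> \<ominus> r) = \<one> \<ominus> (r \<oplus> r) \<oplus> r \<otimes> r" using rc by algebra
  also have "\<dots> = \<one> \<ominus> k" unfolding dbl using rc k(1) by algebra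
  finally have sq: "(\<one> \<ominus> r) \<otimes> (\<one> \<ominus> r) = \<one> \<ominus> k" .
  have "(\<lambda>n. (sqrt_iter k n)\<^sup>\<star>) \<leadsto> r\<^sup>\<star>" by (rule tends_star[OF r])
  then have "sqrt_iter k \<leadsto> r\<^sup>\<star>" using P by simp
  then have sa: "r\<^sup>\<star> = r" using tends_unique r by blast
  have nr: "\<parallel>r\<parallel> \<le> 1" using P sqrt_bound_range by (intro tends_norm_le[OF r]) (meson order_trans)
  have inC: "r \<in> C" if C: "cstar_subalgebra C A" "k \<in> C" for C
  proof -
    have "sqrt_iter k n \<in> C" for n
      by (induction n) (use C in \<open>auto simp: cstar_subalgebra_def\<close>)
    then show ?thesis using C r unfolding cstar_subalgebra_def norm_closed_iff by blast
  qed
  have comm: "r \<otimes> y = y \<otimes> r" if y: "y \<in> carrier A" "k \<otimes> y = y \<otimes> k" for y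
  proof -
    have eq: "sqrt_iter k n \<otimes> y = y \<otimes> sqrt_iter k n" for n
    proof (induction n)
      case (Suc n)
      let ?r = "sqrt_iter k n"
      have c: "?r \<in> carrier A" using P by simp
      have "(?r \<otimes> ?r) \<otimes> y = y \<otimes> (?r \<otimes> ?r)" using Suc c y(1) by (metis m_assoc)
      then show ?case using c y k(1) by (simp add: smult_mult_l smult_mult_r l_distr r_distr)
    qed (use y in simp)
    have "(\<lambda>n. sqrt_iter k n \<otimes> y) \<leadsto> r \<otimes> y" "(\<lambda>n. y \<otimes> sqrt_iter k n) \<leadsto> y \<otimes> r"
      using y by (auto intro!: tends_mult r tends_const)
    then show ?thesis unfolding eq by (rule tends_unique)
  qed
  show ?thesis using that rc sa nr sq inC comm by blast
qed

text \<open>Avoids spectra: for selfadjoint \<open>x\<close>, \<open>\<parallel>t - x\<parallel> \<le> t\<close> means that the spectrum lies in \<open>[0, 2 t]\<close>.\<close>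

definition pos :: "'a \<Rightarrow> bool" where
  "pos x \<longleftrightarrow> x \<in> carrier A \<and> x\<^sup>\<star> = x \<and> (\<exists>t\<ge>0. \<parallel>complex_of_real t \<odot> \<one> \<ominus> x\<parallel> \<le> t)"

lemma posD: assumes "pos x" shows "x \<in> carrier A" "x\<^sup>\<star> = x"
  using assms by (auto simp: pos_def)

lemma pos_zero: "pos \<zero>" by (auto simp: pos_def minus_eq intro!: exI[of _ 0])

lemma pos_add: assumes "pos x" "pos y" shows "pos (x \<oplus> y)"
proof -
  obtain t s where t: "t \<ge> 0" "\<parallel>complex_of_real t \<odot> \<one> \<ominus> x\<parallel> \<le> t"
    and s: "s \<ge> 0" "\<parallel>complex_of_real s \<odot> \<one> \<ominus> y\<parallel> \<le> s" using assms by (auto simp: pos_def)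
  have c: "x \<in> carrier A" "y \<in> carrier A" "x\<^sup>\<star> = x" "y\<^sup>\<star> = y" using assms by (auto simp: pos_def)
  have "complex_of_real (t + s) \<odot> \<one> \<ominus> (x \<oplus> y)
      = (complex_of_real t \<odot> \<one> \<oplus> complex_of_real s \<odot> \<one>) \<ominus> (x \<oplus> y)"
    by (simp add: smult_l_distr)
  also have "\<dots> = (complex_of_real t \<odot> \<one> \<ominus> x) \<oplus> (complex_of_real s \<odot> \<one> \<ominus> y)"
    using c(1,2) by algebra
  finally have "\<parallel>complex_of_real (t + s) \<odot> \<one> \<ominus> (x \<oplus> y)\<parallel> \<le> t + s"
    using t s c cnorm_triangle[of "complex_of_real t \<odot> \<one> \<ominus> x" "complex_of_real s \<odot> \<one> \<ominus> y"] by simp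
  then show ?thesis unfolding pos_def using c t s
    by (intro conjI exI[of _ "t + s"]) (auto simp: star_simps)
qed

lemma pos_smult: assumes "pos x" "c \<ge> 0" shows "pos (complex_of_real c \<odot> x)"
proof -
  obtain t where t: "t \<ge> 0" "\<parallel>complex_of_real t \<odot> \<one> \<ominus> x\<parallel> \<le> t" using assms by (auto simp: pos_def)
  have c: "x \<in> carrier A" "x\<^sup>\<star> = x" using assms by (auto simp: pos_def)
  have "complex_of_real (c * t) \<odot> \<one> \<ominus> complex_of_real c \<odot> x
     = complex_of_real c \<odot> (complex_of_real t \<odot> \<one> \<ominus> x)"
    using c by (simp add: smult_diff_distr smult_smult)
  then have "\<parallel>complex_of_real (c * t) \<odot> \<one> \<ominus> complex_of_real c \<odot> x\<parallel> \<le> c * t"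
    using t assms c by (simp add: cnorm_smult mult_left_mono)
  then show ?thesis unfolding pos_def using c t assms
    by (intro conjI exI[of _ "c * t"]) (auto simp: star_simps)
qed

lemma pos_scalar_minus:
  assumes "x \<in> carrier A" "x\<^sup>\<star> = x" "\<parallel>x\<parallel> \<le> t"
  shows "pos (complex_of_real t \<odot> \<one> \<ominus> x)"
proof -
  have "complex_of_real t \<odot> \<one> \<ominus> (complex_of_real t \<odot> \<one> \<ominus> x) = x" using assms(1) by algebra
  moreover have "t \<ge> 0" using assms cnorm_nonneg by (meson order_trans)
  ultimately show ?thesis unfolding pos_def using assms
    by (intro conjI exI[of _ t]) (auto simp: star_simps)
qed

text \<open>Since \<open>k = 1 - x / t\<close> has norm at most 1, \<open>x / t\<close> has a root
  \<open>1 - r\<close> with \<open>\<parallel>r\<parallel> \<le> 1\<close>. Scaled by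
  \<open>sqrt t\<close>, this root \<open>s\<close> satisfies
  \<open>sqrt t - s = sqrt t * r\<close>, so \<open>sqrt t\<close> witnesses that \<open>s\<close>
  is positive.\<close>

lemma pos_sqrt:
  assumes "pos x"
  obtains s where "pos s" "s \<otimes> s = x"
    "\<And>C. \<lbrakk>cstar_subalgebra C A; \<one> \<in> C; x \<in> C\<rbrakk> \<Longrightarrow> s \<in> C"
    "\<And>y. \<lbrakk>y \<in> carrier A; x \<otimes> y = y \<otimes> x\<rbrakk> \<Longrightarrow> s \<otimes> y = y \<otimes> s"
proof -
  obtain t where t: "t \<ge> 0" "\<parallel>complex_of_real t \<odot> \<one> \<ominus> x\<parallel> \<le> t" using assms by (auto simp: pos_def)
  have c: "x \<in> carrier A" "x\<^sup>\<star> = x" using assms by (auto simp: pos_def)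
  show ?thesis
  proof (cases "t = 0")
    case True
    then have "\<parallel>x\<parallel> \<le> 0" using t c by (simp add: minus_eq)
    then have "x = \<zero>" using c cnorm_nonneg[of x] cnorm_eq_0[of x] by linarith
    then show ?thesis using that[of \<zero>] pos_zero by (auto simp: cstar_subalgebra_def)
  next
    case False
    then have tp: "t > 0" using t by simp
    define k where "k = \<one> \<ominus> complex_of_real (1/t) \<odot> x"
    have "k = complex_of_real (1/t) \<odot> (complex_of_real t \<odot> \<one> \<ominus> x)"
      unfolding k_def using c tp by (simp add: smult_diff_distr smult_smult)
    then have nk: "\<parallel>k\<parallel> \<le> 1" using t tp c by (simp add: cnorm_smult norm_divide)
    have kc: "k \<in> carrier A" "k\<^sup>\<star> = k" unfolding k_def using c by (auto simp: star_simps)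
    obtain r where r: "r \<in> carrier A" "r\<^sup>\<star> = r" "\<parallel>r\<parallel> \<le> 1" "(\<one> \<ominus> r) \<otimes> (\<one> \<ominus> r) = \<one> \<ominus> k"
    "\<And>C. \<lbrakk>cstar_subalgebra C A; k \<in> C\<rbrakk> \<Longrightarrow> r \<in> C"
    "\<And>y. \<lbrakk>y \<in> carrier A; k \<otimes> y = y \<otimes> k\<rbrakk> \<Longrightarrow> r \<otimes> y = y \<otimes> r"
      using sqrt_one_minus[OF kc nk] by blast
    have k1: "\<one> \<ominus> k = complex_of_real (1/t) \<odot> x" unfolding k_def using c(1) by algebra
    define s where "s = complex_of_real (sqrt t) \<odot> (\<one> \<ominus> r)"
    have sc: "s \<in> carrier A" "s\<^sup>\<star> = s" unfolding s_def using r by (auto simp: star_simps)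
    have ss: "s \<otimes> s = x" unfolding s_def using r(1) c tp
      by (simp add: smult_mult_l smult_mult_r smult_smult r(4) k1 flip: of_real_mult)
    have "complex_of_real (sqrt t) \<odot> \<one> \<ominus> s = complex_of_real (sqrt t) \<odot> (\<one> \<ominus> (\<one> \<ominus> r))"
      unfolding s_def using r(1) by (simp add: smult_diff_distr)
    also have "\<one> \<ominus> (\<one> \<ominus> r) = r" using r(1) by algebra
    finally have "\<parallel>complex_of_real (sqrt t) \<odot> \<one> \<ominus> s\<parallel> \<le> sqrt t"
      using r tp by (simp add: cnorm_smult mult_left_le)
    then have ps: "pos s" unfolding pos_def using sc tp by (intro conjI exI[of _ "sqrt t"]) auto
    have um: "\<ominus> y \<in> C" if "cstar_subalgebra C A" "y \<in> C" for C y
    proof -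
      have "(-1) \<odot> y \<in> C" "y \<in> carrier A" using that by (auto simp: cstar_subalgebra_def)
      then show ?thesis by (simp add: uminus_eq_smult)
    qed
    have inC: "s \<in> C" if C: "cstar_subalgebra C A" "\<one> \<in> C" "x \<in> C" for C
    proof -
      have sm: "\<And>c y. y \<in> C \<Longrightarrow> c \<odot> y \<in> C" and ad: "\<And>z y. z \<in> C \<Longrightarrow> y \<in> C \<Longrightarrow> z \<oplus> y \<in> C"
        using C by (auto simp: cstar_subalgebra_def)
      have "k \<in> C" unfolding k_def minus_eq using C by (intro ad um sm) auto
      then have "r \<in> C" using r(5) C by blast
      then show ?thesis unfolding s_def minus_eq using C by (intro ad um sm) auto
    qed
    have comm: "s \<otimes> y = y \<otimes> s" if y: "y \<in> carrier A" "x \<otimes> y = y \<otimes> x" for y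
    proof -
      have "k \<otimes> y = y \<otimes> k" unfolding k_def minus_eq using y c
        by (simp add: l_distr r_distr l_minus r_minus smult_mult_l smult_mult_r)
      then have "r \<otimes> y = y \<otimes> r" using r y by blast
      then show ?thesis unfolding s_def minus_eq using y r(1)
        by (simp add: l_distr r_distr l_minus r_minus smult_mult_l smult_mult_r)
    qed
    show ?thesis using that ps ss inC comm by blast
  qed
qed

text \<open>The stand-in for functional calculus. With \<open>h = s / sqrt t\<close> and a root
  \<open>c\<close> of \<open>1 - h^2\<close> that commutes with \<open>h\<close>, the element
  \<open>u = h + \<i> c\<close> is an isometry. Its imaginary part \<open>c\<close> therefore has
  norm at most 1, and \<open>t - s^2 = t c^2\<close>.\<close>

lemma norm_scalar_minus_square:
  assumes s: "s \<in> carrier A" "s\<^sup>\<star> = s" "\<parallel>s\<parallel>\<^sup>2 \<le> t"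
  shows "\<parallel>complex_of_real t \<odot> \<one> \<ominus> s \<otimes> s\<parallel> \<le> t"
proof (cases "t = 0")
  case True
  then have "s = \<zero>" using s by (simp add: cnorm_eq_0)
  then show ?thesis using True by (simp add: minus_eq)
next
  case False
  then have t: "t > 0" using s zero_le_power2[of "\<parallel>s\<parallel>"] by linarith
  define h where "h = complex_of_real (1 / sqrt t) \<odot> s"
  have hc: "h \<in> carrier A" "h\<^sup>\<star> = h" unfolding h_def using s by (auto simp: star_simps)
  have hh: "h \<otimes> h = complex_of_real (1/t) \<odot> (s \<otimes> s)" unfolding h_def using s t
    by (simp add: smult_mult_l smult_mult_r smult_smult flip: of_real_mult)
  have "\<parallel>h \<otimes> h\<parallel> \<le> 1" unfolding hh using s t by (simp add: cnorm_smult selfadjoint_norm_square norm_divide)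
  then obtain r where r: "r \<in> carrier A" "r\<^sup>\<star> = r" "(\<one> \<ominus> r) \<otimes> (\<one> \<ominus> r) = \<one> \<ominus> h \<otimes> h"
    "\<And>y. \<lbrakk>y \<in> carrier A; h \<otimes> h \<otimes> y = y \<otimes> (h \<otimes> h)\<rbrakk> \<Longrightarrow> r \<otimes> y = y \<otimes> r"
    using sqrt_one_minus[of "h \<otimes> h"] hc by (metis m_closed star_mult)
  define c where "c = \<one> \<ominus> r"
  have c: "c \<in> carrier A" "c\<^sup>\<star> = c" "c \<otimes> c = \<one> \<ominus> h \<otimes> h" unfolding c_def using r by (auto simp: star_simps)
  have "r \<otimes> h = h \<otimes> r" using r(4)[of h] hc by (simp add: m_assoc)
  then have ch: "c \<otimes> h = h \<otimes> c" unfolding c_def minus_eq using hc r(1)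
    by (simp add: l_distr r_distr l_minus r_minus)
  define u where "u = h \<oplus> \<i> \<odot> c"
  have uc: "u \<in> carrier A" unfolding u_def using hc c by simp
  have us: "u\<^sup>\<star> = h \<ominus> \<i> \<odot> c" unfolding u_def using hc c by (simp add: star_simps smult_uminus_left minus_eq)
  have "u\<^sup>\<star> \<otimes> u = h \<otimes> h \<oplus> \<i> \<odot> (h \<otimes> c) \<ominus> \<i> \<odot> (c \<otimes> h) \<ominus> (\<i> * \<i>) \<odot> (c \<otimes> c)"
    unfolding us unfolding u_def using hc(1) c(1) by algebra
  also have "(\<i> * \<i>) \<odot> (c \<otimes> c) = \<ominus> (c \<otimes> c)" using c(1) by (simp add: uminus_eq_smult)
  also have "h \<otimes> h \<oplus> \<i> \<odot> (h \<otimes> c) \<ominus> \<i> \<odot> (c \<otimes> h) \<ominus> \<ominus> (c \<otimes> c) = h \<otimes> h \<oplus> c \<otimes> c"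
    unfolding ch using hc(1) c(1) by algebra
  also have "\<dots> = \<one>" unfolding c(3) using hc(1) by algebra
  finally have nu: "\<parallel>u\<parallel> \<le> 1" using norm_isometry_le uc by blast
  have "u \<ominus> u\<^sup>\<star> = \<i> \<odot> c \<oplus> \<i> \<odot> c" unfolding us unfolding u_def using hc(1) c(1) by algebra
  then have "\<i> \<odot> c = (1/2) \<odot> (u \<ominus> u\<^sup>\<star>)" using half_double[of "\<i> \<odot> c"] c by simp
  then have "\<parallel>c\<parallel> \<le> (1/2) * \<parallel>u \<ominus> u\<^sup>\<star>\<parallel>"
    using cnorm_smult[of c \<i>] cnorm_smult[of "u \<ominus> u\<^sup>\<star>" "1/2"] c uc by simp
  also have "\<dots> \<le> 1" using norm_diff_le[of u "u\<^sup>\<star>"] nu uc by simp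
  finally have "\<parallel>c \<otimes> c\<parallel> \<le> 1" using selfadjoint_norm_square[OF c(1,2)] c by (simp add: power_le_one)
  moreover have "complex_of_real t \<odot> (c \<otimes> c) = complex_of_real t \<odot> \<one> \<ominus> s \<otimes> s"
    unfolding c(3) hh using s t by (simp add: smult_diff_distr smult_smult flip: of_real_mult)
  moreover have "\<parallel>complex_of_real t \<odot> (c \<otimes> c)\<parallel> = t * \<parallel>c \<otimes> c\<parallel>"
    using cnorm_smult[of "c \<otimes> c" "complex_of_real t"] c(1) t by simp
  ultimately show ?thesis using t by (metis mult_left_le less_imp_le mult.right_neutral mult_left_mono)
qed

lemma pos_square: "\<lbrakk>s \<in> carrier A; s\<^sup>\<star> = s\<rbrakk> \<Longrightarrow> pos (s \<otimes> s)"
  unfolding pos_def using norm_scalar_minus_square[of s "\<parallel>s\<parallel>\<^sup>2"]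
  by (intro conjI exI[of _ "\<parallel>s\<parallel>\<^sup>2"]) (auto simp: star_simps)

text \<open>The definition of \<open>pos\<close> provides some \<open>t\<close>; writing
  \<open>x\<close> as a square shows that every bound of the norm can play its role.\<close>

lemma pos_norm: assumes "pos x" "\<parallel>x\<parallel> \<le> t" shows "\<parallel>complex_of_real t \<odot> \<one> \<ominus> x\<parallel> \<le> t"
proof -
  obtain s where "pos s" "s \<otimes> s = x" using pos_sqrt[OF assms(1)] by metis
  then show ?thesis using norm_scalar_minus_square[of s t] assms posD[of s] selfadjoint_norm_square[of s]
    by auto
qed

text \<open>The roots \<open>s\<close> of \<open>x\<close> and \<open>q\<close> of
  \<open>t - x\<close> commute, so \<open>u = s + \<i> q\<close> satisfies
  \<open>u\<^sup>\<star> u = t\<close>; its real part \<open>s\<close> has norm at most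
  \<open>sqrt t\<close>.\<close>

lemma pos_le_scalar_norm:
  assumes x: "pos x" and y: "pos (complex_of_real t \<odot> \<one> \<ominus> x)" and t: "t \<ge> 0"
  shows "\<parallel>x\<parallel> \<le> t"
proof -
  obtain s where s: "pos s" "s \<otimes> s = x"
    "\<And>y. \<lbrakk>y \<in> carrier A; x \<otimes> y = y \<otimes> x\<rbrakk> \<Longrightarrow> s \<otimes> y = y \<otimes> s" using pos_sqrt[OF x] by metis
  obtain q where q: "pos q" "q \<otimes> q = complex_of_real t \<odot> \<one> \<ominus> x"
    "\<And>y. \<lbrakk>y \<in> carrier A; (complex_of_real t \<odot> \<one> \<ominus> x) \<otimes> y = y \<otimes> (complex_of_real t \<odot> \<one> \<ominus> x)\<rbrakk>
       \<Longrightarrow> q \<otimes> y = y \<otimes> q" using pos_sqrt[OF y] by metis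
  note c = posD[OF x] posD[OF s(1)] posD[OF q(1)]
  have "x \<otimes> s = s \<otimes> x" using s c by (metis m_assoc)
  then have qs: "q \<otimes> s = s \<otimes> q" using c
    by (intro q(3)) (auto simp: minus_eq l_distr r_distr l_minus r_minus smult_mult_l smult_mult_r)
  define u where "u = s \<oplus> \<i> \<odot> q"
  have uc: "u \<in> carrier A" unfolding u_def using c by simp
  have us: "u\<^sup>\<star> = s \<ominus> \<i> \<odot> q" unfolding u_def using c by (simp add: star_simps smult_uminus_left minus_eq)
  have "u\<^sup>\<star> \<otimes> u = s \<otimes> s \<oplus> \<i> \<odot> (s \<otimes> q) \<ominus> \<i> \<odot> (q \<otimes> s) \<ominus> (\<i> * \<i>) \<odot> (q \<otimes> q)"
    unfolding us unfolding u_def using c(3,5) by algebra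
  also have "(\<i> * \<i>) \<odot> (q \<otimes> q) = \<ominus> (q \<otimes> q)" using c by (simp add: uminus_eq_smult)
  also have "s \<otimes> s \<oplus> \<i> \<odot> (s \<otimes> q) \<ominus> \<i> \<odot> (q \<otimes> s) \<ominus> \<ominus> (q \<otimes> q) = s \<otimes> s \<oplus> q \<otimes> q"
    unfolding qs using c(3,5) by algebra
  also have "\<dots> = complex_of_real t \<odot> \<one>" unfolding s(2) q(2) using c(1) by algebra
  finally have "\<parallel>u\<parallel>\<^sup>2 \<le> t" using cstar_identity[OF uc] norm_scalar_le[of "complex_of_real t"] t by simp
  then have nu: "\<parallel>u\<parallel> \<le> sqrt t" using real_le_rsqrt by blast
  have "u \<oplus> u\<^sup>\<star> = s \<oplus> s" unfolding us unfolding u_def using c(3,5) by algebra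
  then have "s = (1/2) \<odot> (u \<oplus> u\<^sup>\<star>)" using half_double[of s] c by simp
  then have "\<parallel>s\<parallel> = (1/2) * \<parallel>u \<oplus> u\<^sup>\<star>\<parallel>"
    using cnorm_smult[of "u \<oplus> u\<^sup>\<star>" "1/2"] uc by simp
  also have "\<dots> \<le> sqrt t" using cnorm_triangle[of u "u\<^sup>\<star>"] nu uc by simp
  finally have "\<parallel>s\<parallel>\<^sup>2 \<le> t" using c t by (metis cnorm_nonneg power_mono real_sqrt_pow2)
  then show ?thesis using selfadjoint_norm_square[OF c(3,4)] s by simp
qed

lemma pos_antisym: assumes "pos x" "pos (\<ominus> x)" shows "x = \<zero>"
proof -
  have "\<parallel>x\<parallel> \<le> 0" using pos_le_scalar_norm[of x 0] assms posD[OF assms(1)] by (simp add: minus_eq)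
  then show ?thesis using posD[OF assms(1)] cnorm_eq_0 cnorm_nonneg by (metis antisym)
qed

text \<open>The element \<open>y\<close> lies below the scalar
  \<open>\<parallel>y\<parallel>\<close>, hence so does \<open>x\<close>, and
  \<open>pos_le_scalar_norm\<close> applies.\<close>

lemma pos_norm_mono: assumes "pos x" "pos (y \<ominus> x)" "y \<in> carrier A" shows "\<parallel>x\<parallel> \<le> \<parallel>y\<parallel>"
proof -
  note c = posD[OF assms(1)]
  have "y = x \<oplus> (y \<ominus> x)" using c(1) assms(3) by algebra
  then have "pos y" using pos_add[OF assms(1,2)] by simp
  then have "pos (complex_of_real \<parallel>y\<parallel> \<odot> \<one> \<ominus> y)" using posD[of y] pos_scalar_minus by blast
  then have "pos ((complex_of_real \<parallel>y\<parallel> \<odot> \<one> \<ominus> y) \<oplus> (y \<ominus> x))" using pos_add assms(2) by blast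
  moreover have "(complex_of_real \<parallel>y\<parallel> \<odot> \<one> \<ominus> y) \<oplus> (y \<ominus> x) = complex_of_real \<parallel>y\<parallel> \<odot> \<one> \<ominus> x"
    using c(1) assms(3) by algebra
  ultimately show ?thesis using pos_le_scalar_norm assms by simp
qed

text \<open>A convergent sequence is bounded in norm, so by \<open>pos_norm\<close> a single
  \<open>t\<close> serves for all its terms, and the norm condition passes to the limit.\<close>

lemma pos_tends: assumes "X \<leadsto> x" "\<And>n. pos (X n)" shows "pos x"
proof -
  note c = tendsD[OF assms(1)]
  have "(\<lambda>n. (X n)\<^sup>\<star>) \<leadsto> x\<^sup>\<star>" using tends_star[OF assms(1)] .
  then have "X \<leadsto> x\<^sup>\<star>" by (simp only: posD(2)[OF assms(2)])
  then have sa: "x\<^sup>\<star> = x" by (rule tends_unique[OF _ assms(1)])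
  have "Bseq (\<lambda>n. \<parallel>X n\<parallel>)"
    using tends_norm[OF assms(1)] by (intro convergent_imp_Bseq convergentI)
  then obtain t where "\<And>n. norm (\<parallel>X n\<parallel>) \<le> t" unfolding Bseq_def by blast
  then have t: "\<And>n. \<parallel>X n\<parallel> \<le> t" by (simp add: abs_le_iff)
  have "(\<lambda>n. complex_of_real t \<odot> \<one> \<ominus> X n) \<leadsto> complex_of_real t \<odot> \<one> \<ominus> x"
    by (intro tends_diff tends_const assms) auto
  then have "\<parallel>complex_of_real t \<odot> \<one> \<ominus> x\<parallel> \<le> t"
    by (rule tends_norm_le) (rule pos_norm[OF assms(2) t])
  moreover have "t \<ge> 0" using t[of 0] cnorm_nonneg[OF c(1)[of 0]] by linarith
  ultimately show ?thesis unfolding pos_def using c sa by blast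
qed

end

section \<open>Positive elements\<close>

context cstar_algebra
begin

text \<open>Take \<open>b = |x| - x\<close> with \<open>|x| = (x\<^sup>2)\<^sup>1\<^sup>/\<^sup>2\<close>, and \<open>c = |x|\<^sup>1\<^sup>/\<^sup>2 b\<close>.\<close>

lemma pos_or_witness:
  assumes x: "x \<in> carrier A" "x\<^sup>\<star> = x"
  obtains b c where "b \<in> carrier A" "c \<in> carrier A" "b\<^sup>\<star> = b" "c\<^sup>\<star> = c"
    "b \<otimes> x \<otimes> b = \<ominus> (c \<otimes> c)" "c = \<zero> \<Longrightarrow> pos x"
proof -
  obtain g where g: "pos g" "g \<otimes> g = x \<otimes> x"
    "\<And>y. \<lbrakk>y \<in> carrier A; x \<otimes> x \<otimes> y = y \<otimes> (x \<otimes> x)\<rbrakk> \<Longrightarrow> g \<otimes> y = y \<otimes> g"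
    using pos_sqrt[OF pos_square[OF x]] by metis
  note gc = posD[OF g(1)]
  have gx: "g \<otimes> x = x \<otimes> g" using g(3)[of x] x by (simp add: m_assoc)
  obtain h where h: "pos h" "h \<otimes> h = g" "\<And>y. \<lbrakk>y \<in> carrier A; g \<otimes> y = y \<otimes> g\<rbrakk> \<Longrightarrow> h \<otimes> y = y \<otimes> h"
    using pos_sqrt[OF g(1)] by metis
  note hc = posD[OF h(1)]
  define b where "b = g \<ominus> x"
  have b: "b \<in> carrier A" "b\<^sup>\<star> = b" unfolding b_def using gc x by (auto simp: star_diff)
  have "g \<otimes> b = b \<otimes> g" unfolding b_def minus_eq using gc x gx
    by (simp add: l_distr r_distr l_minus r_minus)
  then have hb: "h \<otimes> b = b \<otimes> h" using h(3) b by blast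
  \<comment> \<open>\<open>b\<close> is twice the negative part of \<open>x\<close>, on which
    \<open>x\<close> acts as \<open>- g\<close>; this follows from \<open>g^2 = x^2\<close> and the
    commutation of \<open>g\<close> with \<open>x\<close>.\<close>
  have "x \<otimes> b = x \<otimes> g \<ominus> x \<otimes> x" unfolding b_def using gc(1) x(1) by algebra
  also have "\<dots> = g \<otimes> x \<ominus> g \<otimes> g" unfolding gx g(2) ..
  also have "\<dots> = \<ominus> (g \<otimes> b)" unfolding b_def using gc(1) x(1) by algebra
  finally have xb: "x \<otimes> b = \<ominus> (g \<otimes> b)" .
  define c where "c = h \<otimes> b"
  have c: "c \<in> carrier A" "c\<^sup>\<star> = c" unfolding c_def using hc b hb by (auto simp: star_mult)
  have "b \<otimes> x \<otimes> b = \<ominus> (b \<otimes> (h \<otimes> h \<otimes> b))" using b x gc xb h(2) by (simp add: m_assoc r_minus)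
  also have "b \<otimes> (h \<otimes> h \<otimes> b) = (b \<otimes> h) \<otimes> (h \<otimes> b)" using b(1) hc(1) by algebra
  also have "\<dots> = c \<otimes> c" unfolding c_def using hb by simp
  finally have eq: "b \<otimes> x \<otimes> b = \<ominus> (c \<otimes> c)" .
  have "pos x" if "c = \<zero>"
  proof -
    have "h \<otimes> (h \<otimes> b) = \<zero>" using that hc unfolding c_def by simp
    then have gb: "g \<otimes> b = \<zero>" using h(2) hc b by (metis m_assoc)
    have "b\<^sup>\<star> \<otimes> b = (g \<ominus> x) \<otimes> b" using b b_def by simp
    also have "\<dots> = g \<otimes> b \<ominus> x \<otimes> b" using b(1) gc(1) x(1) by algebra
    also have "\<dots> = \<zero>" unfolding xb gb by (simp add: minus_eq)
    finally have "b = \<zero>" using star_mult_eq_0 b by blast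
    then show ?thesis unfolding b_def using diff_eq_0_iff gc x g by metis
  qed
  then show ?thesis using that b c eq by blast
qed

text \<open>The Kelley--Vaught theorem. The spectral argument is replaced by comparing the norms of
  the two sides of \<open>w\<^sup>\<star> (t - w w\<^sup>\<star>)\<^sup>2 w = - m (t + m)\<^sup>2\<close>, where \<open>w\<^sup>\<star> w = - m\<close> and \<open>t = \<parallel>m\<parallel>\<close>:
  the left side is at most \<open>t\<^sup>3\<close>, the right side at least \<open>2 t\<^sup>3\<close>.\<close>

lemma star_mult_neg_square:
  assumes w: "w \<in> carrier A" and v: "v \<in> carrier A" "v\<^sup>\<star> = v" and eq: "w\<^sup>\<star> \<otimes> w = \<ominus> (v \<otimes> v)"
  shows "w = \<zero>"
proof -
  define m where "m = v \<otimes> v"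
  define z where "z = w \<otimes> w\<^sup>\<star>"
  have m: "m \<in> carrier A" "m\<^sup>\<star> = m" "pos m" "w\<^sup>\<star> \<otimes> w = \<ominus> m"
    unfolding m_def using v eq pos_square[OF v] by (auto simp: star_mult)
  have zc: "z \<in> carrier A" unfolding z_def using w by simp
  \<comment> \<open>Up to sign, \<open>p\<close> and \<open>q\<close> are twice the real and
    imaginary parts of \<open>w\<close>. From
    \<open>p^2 + q^2 = 2 (w\<^sup>\<star> w + w w\<^sup>\<star>)\<close> one reads off that
    \<open>z = (p^2 + q^2) / 2 + m\<close> is positive, at a point where products
    \<open>y\<^sup>\<star> y\<close> are not yet known to be so.\<close>
  define p where "p = w \<oplus> w\<^sup>\<star>"
  define q where "q = \<i> \<odot> (w \<ominus> w\<^sup>\<star>)"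
  have pq: "p \<in> carrier A" "p\<^sup>\<star> = p" "q \<in> carrier A" "q\<^sup>\<star> = q"
    unfolding p_def q_def using w
    by (auto simp: star_simps a_comm smult_uminus_left smult_diff_distr minus_eq smult_r_distr)
  have "q \<otimes> q = (\<i> * \<i>) \<odot> ((w \<ominus> w\<^sup>\<star>) \<otimes> (w \<ominus> w\<^sup>\<star>))" unfolding q_def using w
    by (simp add: smult_mult_l smult_mult_r smult_smult)
  then have qq: "q \<otimes> q = \<ominus> ((w \<ominus> w\<^sup>\<star>) \<otimes> (w \<ominus> w\<^sup>\<star>))" using w by (simp add: uminus_eq_smult)
  have "p \<otimes> p \<oplus> q \<otimes> q = (w\<^sup>\<star> \<otimes> w \<oplus> z) \<oplus> (w\<^sup>\<star> \<otimes> w \<oplus> z)"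
    unfolding qq p_def z_def using w by algebra
  then have "w\<^sup>\<star> \<otimes> w \<oplus> z = (1/2) \<odot> (p \<otimes> p \<oplus> q \<otimes> q)" using half_double w zc by simp
  moreover have "(w\<^sup>\<star> \<otimes> w \<oplus> z) \<oplus> m = z" unfolding m(4) using zc m(1) by algebra
  ultimately have "z = complex_of_real (1/2) \<odot> (p \<otimes> p \<oplus> q \<otimes> q) \<oplus> m" by simp
  moreover have "pos (complex_of_real (1/2) \<odot> (p \<otimes> p \<oplus> q \<otimes> q) \<oplus> m)"
    using pq m(3) by (intro pos_add pos_smult pos_square) auto
  ultimately have pz: "pos z" by metis
  define t where "t = \<parallel>m\<parallel>"
  have t0: "t \<ge> 0" unfolding t_def using m by simp
  have wn: "\<parallel>w\<parallel>\<^sup>2 = t" using cstar_identity[OF w] m unfolding t_def by simp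
  then have zn: "\<parallel>z\<parallel> = t" using cstar_identity[of "w\<^sup>\<star>"] w unfolding z_def by simp
  define T where "T = complex_of_real t \<odot> \<one>"
  have Tc: "T \<in> carrier A" and T: "\<And>x. x \<in> carrier A \<Longrightarrow> T \<otimes> x = x \<otimes> T"
    unfolding T_def by (auto simp: smult_mult_l smult_mult_r)
  define Y where "Y = T \<ominus> z"
  have Yc: "Y \<in> carrier A" unfolding Y_def using Tc zc by simp
  have Yn: "\<parallel>Y\<parallel> \<le> t" unfolding Y_def T_def using pos_norm[OF pz] zn by simp
  have Yw: "Y \<otimes> w = w \<otimes> (T \<oplus> m)"
  proof -
    have "Y \<otimes> w = T \<otimes> w \<ominus> w \<otimes> (w\<^sup>\<star> \<otimes> w)" unfolding Y_def z_def using Tc w by algebra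
    also have "\<dots> = w \<otimes> (T \<oplus> m)" unfolding m(4) T[OF w] using Tc w m(1) by algebra
    finally show ?thesis .
  qed
  define E where "E = m \<otimes> ((T \<oplus> m) \<otimes> (T \<oplus> m))"
  have Ec: "E \<in> carrier A" unfolding E_def using m Tc by simp
  have "w\<^sup>\<star> \<otimes> (Y \<otimes> (Y \<otimes> w)) = w\<^sup>\<star> \<otimes> ((Y \<otimes> w) \<otimes> (T \<oplus> m))"
    unfolding Yw using w Yc Tc m(1) by (metis m_assoc a_closed Yw)
  also have "\<dots> = (w\<^sup>\<star> \<otimes> w) \<otimes> ((T \<oplus> m) \<otimes> (T \<oplus> m))" unfolding Yw using w Tc m(1) by algebra
  also have "\<dots> = \<ominus> E" unfolding m(4) E_def using Tc m(1) by algebra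
  finally have "\<parallel>E\<parallel> = \<parallel>w\<^sup>\<star> \<otimes> (Y \<otimes> (Y \<otimes> w))\<parallel>" using Ec by simp
  also have "\<dots> \<le> \<parallel>w\<parallel> * (t * (t * \<parallel>w\<parallel>))" using w Yc Yn by (intro norm_mult_le) auto
  also have "\<dots> = t ^ 3" using wn by (simp add: power2_eq_square power3_eq_cube algebra_simps)
  finally have En: "\<parallel>E\<parallel> \<le> t ^ 3" .
  \<comment> \<open>\<open>F\<close> is the middle term of \<open>E = t^2 m + 2 t m^2 + m^3\<close>;
    the other two terms are positive, so an element of norm \<open>2 t^3\<close> lies below
    \<open>E\<close>.\<close>
  define F where "F = complex_of_real (2 * t) \<odot> (m \<otimes> m)"
  have Fc: "F \<in> carrier A" unfolding F_def using m by simp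
  have F1: "F = m \<otimes> (T \<otimes> m) \<oplus> m \<otimes> (T \<otimes> m)" unfolding F_def T_def using m(1)
    by (simp add: smult_mult_l smult_mult_r flip: smult_l_distr)
  have "E = m \<otimes> (T \<otimes> T) \<oplus> (m \<otimes> (T \<otimes> m) \<oplus> m \<otimes> (m \<otimes> T)) \<oplus> m \<otimes> (m \<otimes> m)"
    unfolding E_def using Tc m(1) by algebra
  then have "E \<ominus> F = m \<otimes> (T \<otimes> T) \<oplus> m \<otimes> (m \<otimes> m)"
    unfolding F1 T[OF m(1), symmetric] using Tc m(1) by algebra
  moreover have "m \<otimes> (T \<otimes> T) = complex_of_real (t * t) \<odot> m"
    unfolding T_def using m(1) by (simp add: smult_mult_l smult_mult_r smult_smult)
  moreover have "m \<otimes> (m \<otimes> m) = (v \<otimes> m) \<otimes> (v \<otimes> m)" unfolding m_def using v(1) by algebra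
  moreover have "(v \<otimes> m)\<^sup>\<star> = v \<otimes> m" unfolding m_def using v by (simp add: star_mult m_assoc)
  moreover have "pos (complex_of_real (t * t) \<odot> m \<oplus> (v \<otimes> m) \<otimes> (v \<otimes> m))"
    if "(v \<otimes> m)\<^sup>\<star> = v \<otimes> m"
    using that v m t0 by (intro pos_add pos_smult pos_square) auto
  ultimately have "pos (E \<ominus> F)" by simp
  moreover have "pos F" unfolding F_def using m t0 by (intro pos_smult pos_square) auto
  ultimately have "\<parallel>F\<parallel> \<le> t ^ 3" using pos_norm_mono Ec En by fastforce
  moreover have "\<parallel>F\<parallel> = 2 * t * t\<^sup>2" unfolding F_def t_def using m selfadjoint_norm_square[OF m(1,2)]
    by (simp add: cnorm_smult)
  ultimately have "t ^ 3 \<le> 0" by (simp add: power2_eq_square power3_eq_cube)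
  then have "t = 0" using t0 by (metis antisym power_eq_0_iff zero_le_power)
  then show ?thesis using wn w cnorm_eq_0 by simp
qed

text \<open>For a witness \<open>b x b = - c^2\<close> at \<open>x = y\<^sup>\<star> y\<close>, the
  element \<open>y b\<close> satisfies \<open>(y b)\<^sup>\<star> (y b) = - c^2\<close> and hence
  vanishes, which forces \<open>c = 0\<close>.\<close>

lemma pos_star_mult: assumes y: "y \<in> carrier A" shows "pos (y\<^sup>\<star> \<otimes> y)"
proof -
  let ?x = "y\<^sup>\<star> \<otimes> y"
  obtain b c where bc: "b \<in> carrier A" "c \<in> carrier A" "b\<^sup>\<star> = b" "c\<^sup>\<star> = c"
    "b \<otimes> ?x \<otimes> b = \<ominus> (c \<otimes> c)" "c = \<zero> \<Longrightarrow> pos ?x"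
    using pos_or_witness[of ?x] y by (auto simp: star_mult)
  have "(y \<otimes> b)\<^sup>\<star> \<otimes> (y \<otimes> b) = b \<otimes> ?x \<otimes> b" using y bc by (simp add: star_mult m_assoc)
  then have e: "(y \<otimes> b)\<^sup>\<star> \<otimes> (y \<otimes> b) = \<ominus> (c \<otimes> c)" using bc by simp
  then have "y \<otimes> b = \<zero>" using star_mult_neg_square[of "y \<otimes> b" c] y bc by simp
  then have "\<ominus> (c \<otimes> c) = \<zero>" using e by simp
  then have "c\<^sup>\<star> \<otimes> c = \<zero>" using bc by (metis m_closed minus_minus minus_zero)
  then show ?thesis using bc star_mult_eq_0 by blast
qed

lemma pos_iff: "pos x \<longleftrightarrow> (\<exists>y\<in>carrier A. x = y\<^sup>\<star> \<otimes> y)"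
  using pos_star_mult posD by (metis pos_sqrt)

lemma pos_conj: assumes "pos x" "y \<in> carrier A" shows "pos (y\<^sup>\<star> \<otimes> x \<otimes> y)"
proof -
  obtain s where s: "s \<in> carrier A" "x = s\<^sup>\<star> \<otimes> s" using assms pos_iff by blast
  have "y\<^sup>\<star> \<otimes> x \<otimes> y = (s \<otimes> y)\<^sup>\<star> \<otimes> (s \<otimes> y)" unfolding s(2) using s(1) assms(2) by (simp add: star_mult m_assoc)
  then show ?thesis using pos_star_mult s assms by simp
qed

lemma pos_add_eq_0: assumes "pos x" "pos y" "x \<oplus> y = \<zero>" shows "x = \<zero>"
  using assms posD pos_antisym by (metis a_comm minus_equality)

lemma norm_le_of_pos:
  assumes "x \<in> carrier A" "pos (complex_of_real (t\<^sup>2) \<odot> \<one> \<ominus> x\<^sup>\<star> \<otimes> x)" "t \<ge> 0"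
  shows "\<parallel>x\<parallel> \<le> t"
proof -
  have "\<parallel>x\<parallel>\<^sup>2 \<le> t\<^sup>2" using pos_le_scalar_norm[OF pos_star_mult assms(2)] assms cstar_identity by simp
  then show ?thesis using assms(3) power2_le_imp_le by blast
qed

lemma pos_norm_minus_star_mult:
  assumes "x \<in> carrier A" shows "pos (complex_of_real (\<parallel>x\<parallel>\<^sup>2) \<odot> \<one> \<ominus> x\<^sup>\<star> \<otimes> x)"
  by (rule pos_scalar_minus) (use assms cstar_identity in \<open>auto simp: star_mult\<close>)

lemma pos_finsum: "finite I \<Longrightarrow> (\<And>i. i \<in> I \<Longrightarrow> pos (f i)) \<Longrightarrow> pos (\<Oplus>i\<in>I. f i)"
proof (induction I rule: finite_induct)
  case (insert i I)
  then have "f \<in> I \<rightarrow> carrier A" "f i \<in> carrier A" using posD by auto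
  then show ?case using insert by (simp add: pos_add)
qed (simp add: pos_zero)

lemma finsum_star_mult_eq_0:
  "\<lbrakk>finite I; \<And>i. i \<in> I \<Longrightarrow> w i \<in> carrier A; (\<Oplus>i\<in>I. (w i)\<^sup>\<star> \<otimes> w i) = \<zero>; i \<in> I\<rbrakk> \<Longrightarrow> w i = \<zero>"
proof -
  assume I: "finite I" and w: "\<And>i. i \<in> I \<Longrightarrow> w i \<in> carrier A"
    and z: "(\<Oplus>i\<in>I. (w i)\<^sup>\<star> \<otimes> w i) = \<zero>" and i: "i \<in> I"
  let ?f = "\<lambda>i. (w i)\<^sup>\<star> \<otimes> w i"
  have "?f \<in> I - {i} \<rightarrow> carrier A" "?f i \<in> carrier A" using w i by auto
  then have "(\<Oplus>i\<in>insert i (I - {i}). ?f i) = ?f i \<oplus> (\<Oplus>i\<in>I - {i}. ?f i)"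
    using I by (intro finsum_insert) auto
  then have "?f i \<oplus> (\<Oplus>i\<in>I - {i}. ?f i) = \<zero>" using z i by (simp add: insert_absorb)
  moreover have "pos (?f i)" "pos (\<Oplus>i\<in>I - {i}. ?f i)" using w i I by (auto intro!: pos_finsum pos_star_mult)
  ultimately show ?thesis using pos_add_eq_0 star_mult_eq_0 w i by blast
qed

lemma pos_scalar_iff:
  assumes "\<one> \<noteq> \<zero>" and "pos (c \<odot> \<one>)"
  shows "c = complex_of_real (Re c) \<and> 0 \<le> Re c"
proof -
  have n1: "\<parallel>\<one>\<parallel> = 1"
  proof -
    have "\<parallel>\<one>\<parallel> = \<parallel>\<one>\<parallel>\<^sup>2" "\<parallel>\<one>\<parallel> \<noteq> 0" using cstar_identity[of \<one>] assms by (auto simp: cnorm_eq_0)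
    then show ?thesis by (simp add: power2_eq_square)
  qed
  have inj: "c = d" if "c \<odot> \<one> = d \<odot> \<one>" for c d
  proof -
    have "(c - d) \<odot> \<one> = \<zero>"
      using that smult_l_distr[of \<one> c "- d"] by (simp add: smult_uminus_left r_neg)
    then show ?thesis using assms by (simp add: smult_eq_0_iff)
  qed
  have "cnj c \<odot> \<one> = c \<odot> \<one>" using posD(2)[OF assms(2)] by (simp add: star_smult)
  then have "cnj c = c" by (rule inj)
  then have re: "c = complex_of_real (Re c)" by (simp add: complex_eq_iff)
  obtain t where t: "t \<ge> 0" "\<parallel>complex_of_real t \<odot> \<one> \<ominus> c \<odot> \<one>\<parallel> \<le> t" using assms by (auto simp: pos_def)
  have "complex_of_real t \<odot> \<one> \<ominus> c \<odot> \<one> = (complex_of_real t - c) \<odot> \<one>"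
    using smult_l_distr[of \<one> "complex_of_real t" "- c"] by (simp add: smult_uminus_left minus_eq)
  then have "cmod (complex_of_real t - c) \<le> t" using t n1 by (simp add: cnorm_smult)
  then have "\<bar>t - Re c\<bar> \<le> t" using re by (metis norm_of_real of_real_diff)
  then show ?thesis using re by auto
qed

end

text \<open>The part of the axioms that makes \<open>cdist\<close> a metric. It lets completeness of
  a new algebra be proved through norms before the algebra is known to be a C*-algebra; it serves
  subalgebras, transported algebras and the matrix model.\<close>

locale pre_cstar_algebra = ring A for A :: "'a cstar_alg" (structure) +
  assumes smult_closed: "x \<in> carrier A \<Longrightarrow> c \<odot> x \<in> carrier A"
    and smult_l_distr: "x \<in> carrier A \<Longrightarrow> (c + d) \<odot> x = c \<odot> x \<oplus> d \<odot> x"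
    and smult_one: "x \<in> carrier A \<Longrightarrow> 1 \<odot> x = x"
    and cnorm_nonneg: "x \<in> carrier A \<Longrightarrow> 0 \<le> cnorm A x"
    and cnorm_eq_0: "x \<in> carrier A \<Longrightarrow> cnorm A x = 0 \<longleftrightarrow> x = \<zero>"
    and cnorm_triangle:
      "\<lbrakk>x \<in> carrier A; y \<in> carrier A\<rbrakk> \<Longrightarrow> cnorm A (x \<oplus> y) \<le> cnorm A x + cnorm A y"
    and cnorm_smult: "x \<in> carrier A \<Longrightarrow> cnorm A (c \<odot> x) = cmod c * cnorm A x"
begin

lemma uminus_smult: "x \<in> carrier A \<Longrightarrow> \<ominus> x = (-1) \<odot> x"
proof (rule minus_equality)
  assume x: "x \<in> carrier A"
  have z: "0 \<odot> x = \<zero>" using cnorm_eq_0[of "0 \<odot> x"] cnorm_smult[of x 0] smult_closed x by simp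
  have "(-1) \<odot> x \<oplus> 1 \<odot> x = (-1 + 1) \<odot> x" using x by (metis smult_l_distr)
  then show "(-1) \<odot> x \<oplus> x = \<zero>" using x z smult_one by simp
qed (auto simp: smult_closed)

lemma metric: "Metric_space (carrier A) (cdist A)"
proof
  show "0 \<le> cdist A x y" for x y by (simp add: cdist_def cnorm_nonneg)
  show "cdist A x y = cdist A y x" for x y
  proof (cases "x \<in> carrier A \<and> y \<in> carrier A")
    case True
    then have "x \<in> carrier A" "y \<in> carrier A" by auto
    then have "x \<ominus> y = \<ominus> (y \<ominus> x)" by algebra
    also have "\<dots> = (-1) \<odot> (y \<ominus> x)" using True uminus_smult by simp
    finally show ?thesis using True by (simp add: cdist_def cnorm_smult)
  qed (auto simp: cdist_def)
  show "cdist A x y = 0 \<longleftrightarrow> x = y" if "x \<in> carrier A" "y \<in> carrier A" for x y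
    using that by (simp add: cdist_def cnorm_eq_0) (metis minus_eq r_neg minus_equality minus_minus a_inv_closed)
  show "cdist A x z \<le> cdist A x y + cdist A y z"
    if "x \<in> carrier A" "y \<in> carrier A" "z \<in> carrier A" for x y z
  proof -
    have "x \<ominus> z = (x \<ominus> y) \<oplus> (y \<ominus> z)" using that by algebra
    then show ?thesis using that cnorm_triangle[of "x \<ominus> y" "y \<ominus> z"] by (simp add: cdist_def)
  qed
qed

lemma mcompleteI:
  assumes "\<And>X. \<lbrakk>\<And>n. X n \<in> carrier A;
      \<And>e. e > 0 \<Longrightarrow> \<exists>N. \<forall>m\<ge>N. \<forall>n\<ge>N. cnorm A (X m \<ominus> X n) < e\<rbrakk>
    \<Longrightarrow> \<exists>x\<in>carrier A. (\<lambda>n. cnorm A (X n \<ominus> x)) \<longlonglongrightarrow> 0"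
  shows "Metric_space.mcomplete (carrier A) (cdist A)"
proof -
  interpret M: Metric_space "carrier A" "cdist A" by (rule metric)
  show ?thesis unfolding M.mcomplete_def
  proof (intro allI impI)
    fix X assume X: "M.MCauchy X"
    then have c: "X n \<in> carrier A" for n by (auto simp: M.MCauchy_def)
    have "\<exists>x\<in>carrier A. (\<lambda>n. cnorm A (X n \<ominus> x)) \<longlonglongrightarrow> 0"
    proof (rule assms[OF c])
      fix e :: real assume "e > 0"
      then obtain N where "\<forall>n n'. N \<le> n \<longrightarrow> N \<le> n' \<longrightarrow> cdist A (X n) (X n') < e"
        using X unfolding M.MCauchy_def by blast
      then show "\<exists>N. \<forall>m\<ge>N. \<forall>n\<ge>N. cnorm A (X m \<ominus> X n) < e" using c by (auto simp: cdist_def)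
    qed
    then show "\<exists>x. limitin M.mtopology X x sequentially"
      unfolding M.limitin_metric_dist_null using c by (auto simp: cdist_def)
  qed
qed

end

context cstar_algebra
begin

lemma Cauchy_tends':
  assumes X: "\<And>n. X n \<in> carrier A"
    and e: "\<And>e. e > 0 \<Longrightarrow> \<exists>N. \<forall>m\<ge>N. \<forall>n\<ge>N. \<parallel>X m \<ominus> X n\<parallel> < e"
  obtains x where "X \<leadsto> x"
proof -
  have "metr.MCauchy X"
    unfolding metr.MCauchy_def using X e by (auto simp: cdist_def)
  then obtain x where "limitin metr.mtopology X x sequentially"
    using complete unfolding metr.mcomplete_def by blast
  then show ?thesis using that limitin_iff_tends[of X x] X by simp
qed

lemma subalgebra_uminus: "\<lbrakk>cstar_subalgebra C A; x \<in> C\<rbrakk> \<Longrightarrow> \<ominus> x \<in> C"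
proof -
  assume C: "cstar_subalgebra C A" "x \<in> C"
  then have "(-1) \<odot> x \<in> C" "x \<in> carrier A" by (auto simp: cstar_subalgebra_def)
  then show ?thesis by (simp add: uminus_eq_smult)
qed

section \<open>Closed unital subalgebras as C*-algebras\<close>

context
  fixes C assumes C: "cstar_subalgebra C A" "\<one> \<in> C"
begin

lemma subalgebraD:
  shows "x \<in> C \<Longrightarrow> x \<in> carrier A" "\<zero> \<in> C" "\<lbrakk>x \<in> C; y \<in> C\<rbrakk> \<Longrightarrow> x \<oplus> y \<in> C"
    "\<lbrakk>x \<in> C; y \<in> C\<rbrakk> \<Longrightarrow> x \<otimes> y \<in> C" "x \<in> C \<Longrightarrow> c \<odot> x \<in> C" "x \<in> C \<Longrightarrow> x\<^sup>\<star> \<in> C"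
    "x \<in> C \<Longrightarrow> \<ominus> x \<in> C"
  using C subalgebra_uminus by (auto simp: cstar_subalgebra_def)

lemma subalgebra_ring: "ring (A\<lparr>carrier := C\<rparr>)"
proof (intro ringI abelian_groupI monoidI)
  fix x assume "x \<in> carrier (A\<lparr>carrier := C\<rparr>)"
  then show "\<exists>y\<in>carrier (A\<lparr>carrier := C\<rparr>). y \<oplus>\<^bsub>A\<lparr>carrier := C\<rparr>\<^esub> x = \<zero>\<^bsub>A\<lparr>carrier := C\<rparr>\<^esub>"
    using subalgebraD by (auto intro!: bexI[of _ "\<ominus> x"] simp: l_neg)
qed (use subalgebraD C in \<open>auto simp: a_ac l_distr r_distr m_assoc\<close>)

lemma subalgebra_a_inv: "x \<in> C \<Longrightarrow> \<ominus>\<^bsub>A\<lparr>carrier := C\<rparr>\<^esub> x = \<ominus> x"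
proof -
  assume x: "x \<in> C"
  interpret S: ring "A\<lparr>carrier := C\<rparr>" by (rule subalgebra_ring)
  show ?thesis using S.minus_equality[of "\<ominus> x" x] x subalgebraD by (simp add: l_neg)
qed

lemma subalgebra_minus: "\<lbrakk>x \<in> C; y \<in> C\<rbrakk> \<Longrightarrow> x \<ominus>\<^bsub>A\<lparr>carrier := C\<rparr>\<^esub> y = x \<ominus> y"
  by (simp add: a_minus_def subalgebra_a_inv)

lemma subalgebra_cstar: "cstar_algebra (A\<lparr>carrier := C\<rparr>)"
proof -
  let ?S = "A\<lparr>carrier := C\<rparr>"
  interpret S: ring ?S by (rule subalgebra_ring)
  interpret S: pre_cstar_algebra ?S
    by unfold_locales (use subalgebraD C in \<open>auto simp: smult_l_distr cnorm_eq_0 cnorm_triangle cnorm_smult\<close>)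
  have "Metric_space.mcomplete (carrier ?S) (cdist ?S)"
  proof (rule S.mcompleteI)
    fix X :: "nat \<Rightarrow> 'a" assume X: "\<And>n. X n \<in> carrier ?S"
      and cau: "\<And>e. e > 0 \<Longrightarrow> \<exists>N. \<forall>m\<ge>N. \<forall>n\<ge>N. cnorm ?S (X m \<ominus>\<^bsub>?S\<^esub> X n) < e"
    have cau': "\<exists>N. \<forall>m\<ge>N. \<forall>n\<ge>N. \<parallel>X m \<ominus> X n\<parallel> < e" if "e > 0" for e
      using cau[OF that] X by (simp add: subalgebra_minus)
    moreover have "X n \<in> carrier A" for n using X subalgebraD(1) by simp
    ultimately obtain x where x: "X \<leadsto> x" using Cauchy_tends'[of X] by metis
    have "norm_closed A C" using C by (simp add: cstar_subalgebra_def)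
    then have xC: "x \<in> C" using x X by (auto simp: norm_closed_iff)
    then have "(\<lambda>n. cnorm ?S (X n \<ominus>\<^bsub>?S\<^esub> x)) \<longlonglongrightarrow> 0"
      using x X by (simp add: subalgebra_minus tends_def)
    then show "\<exists>x\<in>carrier ?S. (\<lambda>n. cnorm ?S (X n \<ominus>\<^bsub>?S\<^esub> x)) \<longlonglongrightarrow> 0" using xC by auto
  qed
  then show ?thesis
    by unfold_locales
      (use subalgebraD C in \<open>auto simp: smult_l_distr smult_r_distr smult_smult smult_mult_l
        smult_mult_r star_add star_smult star_mult cnorm_eq_0 cnorm_triangle cnorm_smult cnorm_mult
        cstar_identity\<close>)
qed

text \<open>Closedness of an ideal of the subalgebra refers to the metric of the subalgebra, while
  the limits of interest are computed in \<open>A\<close>.\<close>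

lemma subalgebra_tends_iff:
  assumes "\<And>n. X n \<in> C" "x \<in> C"
  shows "cstar_algebra.tends (A\<lparr>carrier := C\<rparr>) X x \<longleftrightarrow> X \<leadsto> x"
proof -
  interpret S: cstar_algebra "A\<lparr>carrier := C\<rparr>" by (rule subalgebra_cstar)
  show ?thesis using assms subalgebraD(1) unfolding S.tends_def tends_def
    by (simp add: subalgebra_minus)
qed

end

end

section \<open>Homomorphisms and matrices over the algebra\<close>

locale cstar_hom = A: cstar_algebra A + B: cstar_algebra B
  for A :: "'a cstar_alg" and B :: "'b cstar_alg" +
  fixes h assumes hom: "h \<in> star_hom A B"
begin

lemma hom_simps [simp]:
  shows "x \<in> carrier A \<Longrightarrow> h x \<in> carrier B"
    and "\<lbrakk>x \<in> carrier A; y \<in> carrier A\<rbrakk> \<Longrightarrow> h (x \<otimes>\<^bsub>A\<^esub> y) = h x \<otimes>\<^bsub>B\<^esub> h y"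
    and "\<lbrakk>x \<in> carrier A; y \<in> carrier A\<rbrakk> \<Longrightarrow> h (x \<oplus>\<^bsub>A\<^esub> y) = h x \<oplus>\<^bsub>B\<^esub> h y"
    and "h \<one>\<^bsub>A\<^esub> = \<one>\<^bsub>B\<^esub>"
    and "x \<in> carrier A \<Longrightarrow> h (c \<odot>\<^bsub>A\<^esub> x) = c \<odot>\<^bsub>B\<^esub> h x"
    and "x \<in> carrier A \<Longrightarrow> h (star A x) = star B (h x)"
  using hom by (auto simp: star_hom_def ring_hom_def)

lemma hom_zero [simp]: "h \<zero>\<^bsub>A\<^esub> = \<zero>\<^bsub>B\<^esub>"
  by (metis A.smult_0_left A.zero_closed B.smult_0_left hom_simps(1) hom_simps(5))

lemma hom_uminus [simp]: "x \<in> carrier A \<Longrightarrow> h (\<ominus>\<^bsub>A\<^esub> x) = \<ominus>\<^bsub>B\<^esub> h x"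
  by (simp add: A.uminus_eq_smult B.uminus_eq_smult)

lemma hom_minus [simp]:
  "\<lbrakk>x \<in> carrier A; y \<in> carrier A\<rbrakk> \<Longrightarrow> h (x \<ominus>\<^bsub>A\<^esub> y) = h x \<ominus>\<^bsub>B\<^esub> h y"
  by (simp add: A.minus_eq B.minus_eq)

lemma hom_finsum:
  "finite I \<Longrightarrow> (\<And>i. i \<in> I \<Longrightarrow> f i \<in> carrier A) \<Longrightarrow> h (\<Oplus>\<^bsub>A\<^esub>i\<in>I. f i) = (\<Oplus>\<^bsub>B\<^esub>i\<in>I. h (f i))"
proof (induction I rule: finite_induct)
  case (insert i I)
  then have "f \<in> I \<rightarrow> carrier A" "(\<lambda>i. h (f i)) \<in> I \<rightarrow> carrier B" by auto
  then show ?case using insert by simp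
qed simp

lemma hom_pos: "A.pos x \<Longrightarrow> B.pos (h x)"
  unfolding A.pos_iff B.pos_iff by auto

text \<open>Positivity of \<open>\<parallel>x\<parallel>^2 - x\<^sup>\<star> x\<close> is preserved,
  so continuity of a homomorphism is automatic.\<close>

lemma hom_norm_le: assumes x: "x \<in> carrier A" shows "cnorm B (h x) \<le> cnorm A x"
  using hom_pos[OF A.pos_norm_minus_star_mult[OF x]] x by (intro B.norm_le_of_pos) auto

lemma hom_tends: assumes X: "A.tends X x" shows "B.tends (\<lambda>n. h (X n)) (h x)"
proof (rule B.tendsI)
  note c = A.tendsD[OF X]
  show "cnorm B (h (X n) \<ominus>\<^bsub>B\<^esub> h x) \<le> cnorm A (X n \<ominus>\<^bsub>A\<^esub> x)" for n
    using hom_norm_le[of "X n \<ominus>\<^bsub>A\<^esub> x"] c by simp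
  show "(\<lambda>n. cnorm A (X n \<ominus>\<^bsub>A\<^esub> x)) \<longlonglongrightarrow> 0" using X by (simp add: A.tends_def)
qed (use A.tendsD[OF X] in auto)

text \<open>Apply \<open>h\<close> to a witness \<open>b x b = - c^2\<close>: the image is both
  positive and negative, so \<open>h c = 0\<close>, and \<open>c = 0\<close> by injectivity.\<close>

lemma pos_hom_imp_pos:
  assumes inj: "inj_on h (carrier A)" and x: "x \<in> carrier A" and p: "B.pos (h x)"
  shows "A.pos x"
proof -
  have "h (star A x) = h x" using B.posD[OF p] x by simp
  then have sa: "star A x = x" using inj x by (meson A.star_closed inj_onD)
  obtain b c where bc: "b \<in> carrier A" "c \<in> carrier A" "star A b = b" "star A c = c"
    "b \<otimes>\<^bsub>A\<^esub> x \<otimes>\<^bsub>A\<^esub> b = \<ominus>\<^bsub>A\<^esub> (c \<otimes>\<^bsub>A\<^esub> c)" "c = \<zero>\<^bsub>A\<^esub> \<Longrightarrow> A.pos x"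
    using A.pos_or_witness[OF x sa] by blast
  have hb: "star B (h b) = h b" "star B (h c) = h c" using bc by (metis hom_simps(6))+
  have "B.pos (h b \<otimes>\<^bsub>B\<^esub> h x \<otimes>\<^bsub>B\<^esub> h b)" using B.pos_conj[OF p, of "h b"] bc hb by simp
  also have "h b \<otimes>\<^bsub>B\<^esub> h x \<otimes>\<^bsub>B\<^esub> h b = \<ominus>\<^bsub>B\<^esub> (h c \<otimes>\<^bsub>B\<^esub> h c)"
    using arg_cong[OF bc(5), of h] bc(1,2) x by simp
  finally have "h c \<otimes>\<^bsub>B\<^esub> h c = \<zero>\<^bsub>B\<^esub>"
    using B.pos_antisym[of "h c \<otimes>\<^bsub>B\<^esub> h c"] B.pos_square[of "h c"] bc hb by simp
  then have "h c = \<zero>\<^bsub>B\<^esub>" using B.star_mult_eq_0[of "h c"] hb bc by simp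
  then have "c = \<zero>\<^bsub>A\<^esub>" using inj bc by (metis A.zero_closed hom_zero inj_onD)
  then show ?thesis using bc by simp
qed

lemma hom_pos_matrix:
  assumes "pos_matrix A n x" shows "pos_matrix B n (\<lambda>i j. h (x i j))"
proof -
  obtain y where y: "\<And>i j. i < n \<Longrightarrow> j < n \<Longrightarrow> y i j \<in> carrier A"
    "\<And>i j. i < n \<Longrightarrow> j < n \<Longrightarrow> x i j = (\<Oplus>\<^bsub>A\<^esub>k\<in>{..<n}. star A (y k i) \<otimes>\<^bsub>A\<^esub> y k j)"
    using assms unfolding pos_matrix_def by blast
  have "h (x i j) = (\<Oplus>\<^bsub>B\<^esub>k\<in>{..<n}. star B (h (y k i)) \<otimes>\<^bsub>B\<^esub> h (y k j))" if "i < n" "j < n" for i j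
  proof -
    have "h (x i j) = (\<Oplus>\<^bsub>B\<^esub>k\<in>{..<n}. h (star A (y k i) \<otimes>\<^bsub>A\<^esub> y k j))"
      unfolding y(2)[OF that] using y that by (intro hom_finsum) auto
    also have "\<dots> = (\<Oplus>\<^bsub>B\<^esub>k\<in>{..<n}. star B (h (y k i)) \<otimes>\<^bsub>B\<^esub> h (y k j))"
      using y that by (intro B.finsum_cong') auto
    finally show ?thesis .
  qed
  then show ?thesis unfolding pos_matrix_def using y by (intro exI[of _ "\<lambda>i j. h (y i j)"]) auto
qed

end

text \<open>\<open>injective_cstar\<close> tests only algebras on one type; other algebras are moved there along
  an injection of their carrier.\<close>

definition transport :: "('a \<Rightarrow> 'c) \<Rightarrow> 'a cstar_alg \<Rightarrow> 'c cstar_alg" where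
  "transport f A =
    (let g = inv_into (carrier A) f in
     \<lparr>carrier = f ` carrier A, mult = \<lambda>x y. f (g x \<otimes>\<^bsub>A\<^esub> g y), one = f \<one>\<^bsub>A\<^esub>,
      zero = f \<zero>\<^bsub>A\<^esub>, add = \<lambda>x y. f (g x \<oplus>\<^bsub>A\<^esub> g y), smult = \<lambda>c x. f (c \<odot>\<^bsub>A\<^esub> g x),
      star = \<lambda>x. f (star A (g x)), cnorm = \<lambda>x. cnorm A (g x)\<rparr>)"

context cstar_algebra
begin

context
  fixes f :: "'a \<Rightarrow> 'c" and T :: "'c cstar_alg"
  assumes inj: "inj_on f (carrier A)" and T: "T = transport f A"
begin

lemma transport_simps:
  shows "carrier T = f ` carrier A" "\<one>\<^bsub>T\<^esub> = f \<one>" "\<zero>\<^bsub>T\<^esub> = f \<zero>"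
    and "\<lbrakk>x \<in> carrier A; y \<in> carrier A\<rbrakk> \<Longrightarrow> f x \<otimes>\<^bsub>T\<^esub> f y = f (x \<otimes> y)"
    and "\<lbrakk>x \<in> carrier A; y \<in> carrier A\<rbrakk> \<Longrightarrow> f x \<oplus>\<^bsub>T\<^esub> f y = f (x \<oplus> y)"
    and "x \<in> carrier A \<Longrightarrow> c \<odot>\<^bsub>T\<^esub> f x = f (c \<odot> x)"
    and "x \<in> carrier A \<Longrightarrow> star T (f x) = f (x\<^sup>\<star>)"
    and "x \<in> carrier A \<Longrightarrow> cnorm T (f x) = \<parallel>x\<parallel>"
  using inj by (auto simp: T transport_def Let_def)

lemma transport_ring: "ring T"
proof (intro ringI abelian_groupI monoidI)
  fix x assume "x \<in> carrier T"
  then obtain z where "z \<in> carrier A" "x = f z" by (auto simp: transport_simps)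
  then show "\<exists>y\<in>carrier T. y \<oplus>\<^bsub>T\<^esub> x = \<zero>\<^bsub>T\<^esub>"
    by (intro bexI[of _ "f (\<ominus> z)"]) (auto simp: transport_simps l_neg)
qed (auto simp: transport_simps a_ac l_distr r_distr m_assoc)

lemma transport_minus: "\<lbrakk>x \<in> carrier A; y \<in> carrier A\<rbrakk> \<Longrightarrow> f x \<ominus>\<^bsub>T\<^esub> f y = f (x \<ominus> y)"
proof -
  assume xy: "x \<in> carrier A" "y \<in> carrier A"
  interpret T: ring T by (rule transport_ring)
  have "\<ominus>\<^bsub>T\<^esub> f y = f (\<ominus> y)"
    using T.minus_equality[of "f (\<ominus> y)" "f y"] xy by (simp add: transport_simps l_neg)
  then show ?thesis using xy by (simp add: T.minus_eq minus_eq transport_simps)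
qed

lemma transport_cstar: "cstar_algebra T"
proof -
  interpret T: ring T by (rule transport_ring)
  have f0: "f x = f \<zero> \<longleftrightarrow> x = \<zero>" if "x \<in> carrier A" for x using inj that by (auto dest: inj_onD)
  interpret T: pre_cstar_algebra T
    by unfold_locales
      (auto simp: transport_simps smult_l_distr cnorm_eq_0 cnorm_triangle cnorm_smult f0)
  have "Metric_space.mcomplete (carrier T) (cdist T)"
  proof (rule T.mcompleteI)
    fix X :: "nat \<Rightarrow> 'c" assume X: "\<And>n. X n \<in> carrier T"
      and cau: "\<And>e. e > 0 \<Longrightarrow> \<exists>N. \<forall>m\<ge>N. \<forall>n\<ge>N. cnorm T (X m \<ominus>\<^bsub>T\<^esub> X n) < e"
    have "\<forall>n. \<exists>y\<in>carrier A. X n = f y" using X by (auto simp: transport_simps)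
    then obtain Y where Y: "\<And>n. Y n \<in> carrier A" "\<And>n. X n = f (Y n)" by metis
    have "\<exists>N. \<forall>m\<ge>N. \<forall>n\<ge>N. \<parallel>Y m \<ominus> Y n\<parallel> < e" if "e > 0" for e
      using cau[OF that] Y by (simp add: transport_minus transport_simps)
    then obtain x where x: "Y \<leadsto> x" using Cauchy_tends'[of Y] Y(1) by metis
    then have "(\<lambda>n. cnorm T (X n \<ominus>\<^bsub>T\<^esub> f x)) \<longlonglongrightarrow> 0"
      using Y by (simp add: transport_minus transport_simps tends_def)
    then show "\<exists>x\<in>carrier T. (\<lambda>n. cnorm T (X n \<ominus>\<^bsub>T\<^esub> x)) \<longlonglongrightarrow> 0"
      using tendsD[OF x] by (auto simp: transport_simps)
  qed
  then show ?thesis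
    by unfold_locales
      (auto simp: transport_simps smult_l_distr smult_r_distr smult_smult smult_mult_l
        smult_mult_r star_add star_smult star_mult cnorm_eq_0 cnorm_triangle cnorm_smult cnorm_mult
        cstar_identity f0)
qed

lemma transport_hom: "f \<in> star_hom A T"
  by (auto simp: star_hom_def ring_hom_def transport_simps)

lemma transport_inv_hom: "inv_into (carrier A) f \<in> star_hom T A"
  using inj by (auto simp: star_hom_def ring_hom_def transport_simps)

end

text \<open>The relations of the Cuntz algebra \<open>O_n\<close>: such a family identifies
  \<open>M_n(A)\<close> with \<open>A\<close>.\<close>

definition iso_family :: "(nat \<Rightarrow> 'a) \<Rightarrow> nat \<Rightarrow> bool" where
  "iso_family T n \<longleftrightarrow> (\<forall>i<n. T i \<in> carrier A) \<and>
     (\<forall>i<n. \<forall>j<n. (T i)\<^sup>\<star> \<otimes> T j = (if i = j then \<one> else \<zero>)) \<and>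
     (\<Oplus>i\<in>{..<n}. T i \<otimes> (T i)\<^sup>\<star>) = \<one>"

text \<open>From \<open>n\<close> isometries \<open>T i\<close> one gets \<open>n + 1\<close>,
  namely \<open>s1\<close> and the \<open>s2 \<otimes> T i\<close>. The set \<open>D\<close> records
  that the family consists of products of the two generators.\<close>

lemma iso_family_exists:
  assumes D: "D \<subseteq> carrier A" "\<one> \<in> D" "s1 \<in> D" "s2 \<in> D" "\<And>x y. \<lbrakk>x \<in> D; y \<in> D\<rbrakk> \<Longrightarrow> x \<otimes> y \<in> D"
    and s: "s1\<^sup>\<star> \<otimes> s1 = \<one>" "s2\<^sup>\<star> \<otimes> s2 = \<one>" "s1\<^sup>\<star> \<otimes> s2 = \<zero>"
      "s1 \<otimes> s1\<^sup>\<star> \<oplus> s2 \<otimes> s2\<^sup>\<star> = \<one>"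
    and n: "n \<ge> 1"
  shows "\<exists>T. iso_family T n \<and> (\<forall>i<n. T i \<in> D)"
  using n
proof (induction n rule: dec_induct)
  case base
  have "{..<Suc 0} = insert 0 {}" by auto
  moreover have "(\<Oplus>i\<in>insert (0::nat) {}. \<one>) = \<one>" by (subst finsum_insert) auto
  ultimately have "iso_family (\<lambda>_. \<one>) 1" unfolding iso_family_def by simp
  then show ?case using D by auto
next
  case (step n)
  then obtain T where T: "iso_family T n" "\<forall>i<n. T i \<in> D" by blast
  define T' where "T' i = (case i of 0 \<Rightarrow> s1 | Suc i \<Rightarrow> s2 \<otimes> T i)" for i
  have s_c: "s1 \<in> carrier A" "s2 \<in> carrier A" using D by auto
  have T_c: "\<And>i. i < n \<Longrightarrow> T i \<in> carrier A" using T by (auto simp: iso_family_def)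
  have T'_c: "T' i \<in> carrier A \<and> T' i \<in> D" if "i < Suc n" for i
    using that T D unfolding T'_def by (auto split: nat.splits)
  have s21: "s2\<^sup>\<star> \<otimes> s1 = \<zero>" using arg_cong[OF s(3), of "star A"] s_c by (simp add: star_mult)
  have ss: "s2\<^sup>\<star> \<otimes> (s2 \<otimes> x) = x" "s1\<^sup>\<star> \<otimes> (s2 \<otimes> x) = \<zero>" if "x \<in> carrier A" for x
    using that s s_c by (simp_all flip: m_assoc)
  have orth: "(T' i)\<^sup>\<star> \<otimes> T' j = (if i = j then \<one> else \<zero>)" if "i < Suc n" "j < Suc n" for i j
    using that T s s_c T_c unfolding T'_def
    by (auto simp: iso_family_def star_mult m_assoc ss s21 split: nat.splits)
  have "(\<Oplus>i\<in>{..<Suc n}. T' i \<otimes> (T' i)\<^sup>\<star>) = (\<Oplus>i\<in>insert 0 (Suc ` {..<n}). T' i \<otimes> (T' i)\<^sup>\<star>)"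
    by (simp only: lessThan_Suc_eq_insert_0)
  also have "\<dots> = T' 0 \<otimes> (T' 0)\<^sup>\<star> \<oplus> (\<Oplus>i\<in>Suc ` {..<n}. T' i \<otimes> (T' i)\<^sup>\<star>)"
    using T'_c by (intro finsum_insert) auto
  also have "(\<Oplus>i\<in>Suc ` {..<n}. T' i \<otimes> (T' i)\<^sup>\<star>) = (\<Oplus>i\<in>{..<n}. T' (Suc i) \<otimes> (T' (Suc i))\<^sup>\<star>)"
    using T'_c by (intro finsum_reindex) auto
  also have "\<dots> = (\<Oplus>i\<in>{..<n}. s2 \<otimes> ((T i \<otimes> (T i)\<^sup>\<star>) \<otimes> s2\<^sup>\<star>))"
    using T_c s_c by (intro finsum_cong') (auto simp: T'_def star_mult m_assoc)
  also have "\<dots> = s2 \<otimes> ((\<Oplus>i\<in>{..<n}. T i \<otimes> (T i)\<^sup>\<star>) \<otimes> s2\<^sup>\<star>)"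
    using T_c s_c by (subst finsum_ldistr, simp, simp, force, subst finsum_rdistr) auto
  also have "(\<Oplus>i\<in>{..<n}. T i \<otimes> (T i)\<^sup>\<star>) = \<one>" using T by (simp add: iso_family_def)
  also have "T' 0 \<otimes> (T' 0)\<^sup>\<star> \<oplus> s2 \<otimes> (\<one> \<otimes> s2\<^sup>\<star>) = \<one>" using s s_c by (simp add: T'_def)
  finally show ?case unfolding iso_family_def using orth T'_c by blast
qed

lemma finsum_delta:
  fixes n :: nat
  assumes "i < n" "\<And>k. k < n \<Longrightarrow> f k \<in> carrier A" "\<And>k. k < n \<Longrightarrow> k \<noteq> i \<Longrightarrow> f k = \<zero>"
  shows "(\<Oplus>k\<in>{..<n}. f k) = f i"
proof -
  have "(\<Oplus>k\<in>{..<n}. f k) = (\<Oplus>k\<in>{..<n}. if i = k then f k else \<zero>)"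
    using assms by (intro finsum_cong') auto
  also have "\<dots> = f i" using assms by (intro finsum_singleton) auto
  finally show ?thesis .
qed

context
  fixes T n assumes T: "iso_family T n"
begin

lemma iso_familyD:
  shows "i < n \<Longrightarrow> T i \<in> carrier A"
    and "\<lbrakk>i < n; j < n\<rbrakk> \<Longrightarrow> (T i)\<^sup>\<star> \<otimes> T j = (if i = j then \<one> else \<zero>)"
    and "(\<Oplus>i\<in>{..<n}. T i \<otimes> (T i)\<^sup>\<star>) = \<one>"
  using T by (auto simp: iso_family_def)

text \<open>Matrix multiplication in disguise: the partition of unity by range projections is
  inserted between the two factors.\<close>

lemma iso_family_insert:
  assumes "a \<in> carrier A" "b \<in> carrier A"
  shows "a \<otimes> b = (\<Oplus>k\<in>{..<n}. (a \<otimes> T k) \<otimes> ((T k)\<^sup>\<star> \<otimes> b))"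
proof -
  have "a \<otimes> b = a \<otimes> ((\<Oplus>k\<in>{..<n}. T k \<otimes> (T k)\<^sup>\<star>) \<otimes> b)" using assms iso_familyD(3) by simp
  also have "\<dots> = (\<Oplus>k\<in>{..<n}. a \<otimes> (T k \<otimes> (T k)\<^sup>\<star> \<otimes> b))"
    using assms iso_familyD(1) by (subst finsum_ldistr, simp, simp, force, subst finsum_rdistr) auto
  also have "\<dots> = (\<Oplus>k\<in>{..<n}. (a \<otimes> T k) \<otimes> ((T k)\<^sup>\<star> \<otimes> b))"
    using assms iso_familyD(1) by (intro finsum_cong') (auto simp: m_assoc)
  finally show ?thesis .
qed

text \<open>The compressions are the matrix entries of \<open>M\<close>; they determine first its
  rows and then \<open>M\<close> itself.\<close>

lemma iso_family_eqI:
  assumes "M \<in> carrier A" "M' \<in> carrier A"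
    and e: "\<And>i j. \<lbrakk>i < n; j < n\<rbrakk> \<Longrightarrow> (T i)\<^sup>\<star> \<otimes> M \<otimes> T j = (T i)\<^sup>\<star> \<otimes> M' \<otimes> T j"
  shows "M = M'"
proof -
  have row: "(T i)\<^sup>\<star> \<otimes> M = (T i)\<^sup>\<star> \<otimes> M'" if i: "i < n" for i
  proof -
    have "(T i)\<^sup>\<star> \<otimes> N = (\<Oplus>k\<in>{..<n}. ((T i)\<^sup>\<star> \<otimes> N \<otimes> T k) \<otimes> (T k)\<^sup>\<star>)" if "N \<in> carrier A" for N
    proof -
      have "(T i)\<^sup>\<star> \<otimes> N = (T i)\<^sup>\<star> \<otimes> N \<otimes> \<one>" using that i iso_familyD(1) by simp
      also have "\<dots> = (\<Oplus>k\<in>{..<n}. ((T i)\<^sup>\<star> \<otimes> N \<otimes> T k) \<otimes> ((T k)\<^sup>\<star> \<otimes> \<one>))"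
        using that i iso_familyD(1) by (intro iso_family_insert) auto
      also have "\<dots> = (\<Oplus>k\<in>{..<n}. ((T i)\<^sup>\<star> \<otimes> N \<otimes> T k) \<otimes> (T k)\<^sup>\<star>)"
        using that i iso_familyD(1) by (intro finsum_cong') auto
      finally show ?thesis .
    qed
    note r = this
    have "(\<Oplus>k\<in>{..<n}. ((T i)\<^sup>\<star> \<otimes> M \<otimes> T k) \<otimes> (T k)\<^sup>\<star>)
        = (\<Oplus>k\<in>{..<n}. ((T i)\<^sup>\<star> \<otimes> M' \<otimes> T k) \<otimes> (T k)\<^sup>\<star>)"
      using assms i iso_familyD(1) by (intro finsum_cong') auto
    from trans[OF r[OF assms(1)] trans[OF this r[OF assms(2), symmetric]]] show ?thesis .
  qed
  have col: "N = (\<Oplus>k\<in>{..<n}. T k \<otimes> ((T k)\<^sup>\<star> \<otimes> N))" if "N \<in> carrier A" for N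
  proof -
    have "N = \<one> \<otimes> N" using that by simp
    also have "\<dots> = (\<Oplus>k\<in>{..<n}. (\<one> \<otimes> T k) \<otimes> ((T k)\<^sup>\<star> \<otimes> N))"
      using that by (intro iso_family_insert) auto
    also have "\<dots> = (\<Oplus>k\<in>{..<n}. T k \<otimes> ((T k)\<^sup>\<star> \<otimes> N))"
      using that iso_familyD(1) by (intro finsum_cong') auto
    finally show ?thesis .
  qed
  have "(\<Oplus>k\<in>{..<n}. T k \<otimes> ((T k)\<^sup>\<star> \<otimes> M)) = (\<Oplus>k\<in>{..<n}. T k \<otimes> ((T k)\<^sup>\<star> \<otimes> M'))"
    using assms iso_familyD(1) row by (intro finsum_cong') auto
  from trans[OF col[OF assms(1)] trans[OF this col[OF assms(2), symmetric]]] show ?thesis .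
qed

text \<open>An isomorphism of \<open>M\<^sub>n(A)\<close> onto \<open>A\<close>, which reduces positivity of matrices to
  positivity of elements.\<close>

definition of_matrix :: "(nat \<Rightarrow> nat \<Rightarrow> 'a) \<Rightarrow> 'a" where
  "of_matrix x = (\<Oplus>i\<in>{..<n}. T i \<otimes> (\<Oplus>j\<in>{..<n}. x i j \<otimes> (T j)\<^sup>\<star>))"

lemma of_matrix_closed [simp]:
  "(\<And>i j. \<lbrakk>i < n; j < n\<rbrakk> \<Longrightarrow> x i j \<in> carrier A) \<Longrightarrow> of_matrix x \<in> carrier A"
  unfolding of_matrix_def using iso_familyD(1) by (intro finsum_closed Pi_I m_closed) auto

lemma of_matrix_entry:
  assumes x: "\<And>i j. \<lbrakk>i < n; j < n\<rbrakk> \<Longrightarrow> x i j \<in> carrier A" and i: "i < n" and j: "j < n"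
  shows "(T i)\<^sup>\<star> \<otimes> of_matrix x \<otimes> T j = x i j"
proof -
  let ?r = "\<lambda>i. (\<Oplus>j\<in>{..<n}. x i j \<otimes> (T j)\<^sup>\<star>)"
  have r: "?r i \<in> carrier A" if "i < n" for i
    using x that iso_familyD(1) by (intro finsum_closed Pi_I m_closed) auto
  have "(T i)\<^sup>\<star> \<otimes> of_matrix x = (\<Oplus>k\<in>{..<n}. (T i)\<^sup>\<star> \<otimes> (T k \<otimes> ?r k))"
    unfolding of_matrix_def using r i iso_familyD(1) by (intro finsum_rdistr) auto
  also have "\<dots> = (\<Oplus>k\<in>{..<n}. ((T i)\<^sup>\<star> \<otimes> T k) \<otimes> ?r k)"
    using r i iso_familyD(1) by (intro finsum_cong') (auto simp: m_assoc)
  also have "\<dots> = ((T i)\<^sup>\<star> \<otimes> T i) \<otimes> ?r i"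
    using r i iso_familyD by (intro finsum_delta) auto
  also have "\<dots> = ?r i" using r i iso_familyD by simp
  also have "?r i \<otimes> T j = (\<Oplus>k\<in>{..<n}. x i k \<otimes> (T k)\<^sup>\<star> \<otimes> T j)"
    using x i j iso_familyD(1) by (intro finsum_ldistr) auto
  also have "\<dots> = (\<Oplus>k\<in>{..<n}. x i k \<otimes> ((T k)\<^sup>\<star> \<otimes> T j))"
    using x i j iso_familyD(1) by (intro finsum_cong') (auto simp: m_assoc)
  also have "\<dots> = x i j \<otimes> ((T j)\<^sup>\<star> \<otimes> T j)" using x i j iso_familyD by (intro finsum_delta) auto
  also have "\<dots> = x i j" using x i j iso_familyD by simp
  finally show ?thesis .
qed

text \<open>\<open>of_matrix\<close> carries the Gram form in \<open>pos_matrix\<close> to a product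
  \<open>Y\<^sup>\<star> Y\<close>; conversely the entries of a factor \<open>s\<close> with
  \<open>of_matrix x = s\<^sup>\<star> s\<close> serve as \<open>y\<close>.\<close>

lemma pos_matrix_iff_pos:
  assumes x: "\<And>i j. \<lbrakk>i < n; j < n\<rbrakk> \<Longrightarrow> x i j \<in> carrier A"
  shows "pos_matrix A n x \<longleftrightarrow> pos (of_matrix x)"
proof
  assume "pos_matrix A n x"
  then obtain y where y: "\<And>i j. i < n \<Longrightarrow> j < n \<Longrightarrow> y i j \<in> carrier A"
    "\<And>i j. i < n \<Longrightarrow> j < n \<Longrightarrow> x i j = (\<Oplus>k\<in>{..<n}. (y k i)\<^sup>\<star> \<otimes> y k j)"
    unfolding pos_matrix_def by blast
  let ?Y = "of_matrix y"
  have Yc: "?Y \<in> carrier A" using y by simp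
  have "of_matrix x = ?Y\<^sup>\<star> \<otimes> ?Y"
  proof (rule iso_family_eqI)
    fix i j assume ij: "i < n" "j < n"
    have "(T i)\<^sup>\<star> \<otimes> (?Y\<^sup>\<star> \<otimes> ?Y) \<otimes> T j = (?Y \<otimes> T i)\<^sup>\<star> \<otimes> (?Y \<otimes> T j)"
      using ij iso_familyD(1) Yc by (simp add: star_mult m_assoc)
    also have "\<dots> = (\<Oplus>k\<in>{..<n}. ((?Y \<otimes> T i)\<^sup>\<star> \<otimes> T k) \<otimes> ((T k)\<^sup>\<star> \<otimes> (?Y \<otimes> T j)))"
      using ij iso_familyD(1) Yc by (intro iso_family_insert) auto
    also have "\<dots> = (\<Oplus>k\<in>{..<n}. (y k i)\<^sup>\<star> \<otimes> y k j)"
    proof (rule finsum_cong')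
      fix k assume "k \<in> {..<n}"
      then have k: "k < n" by simp
      have "(?Y \<otimes> T i)\<^sup>\<star> \<otimes> T k = ((T k)\<^sup>\<star> \<otimes> ?Y \<otimes> T i)\<^sup>\<star>"
        using ij k iso_familyD(1) Yc by (simp add: star_mult m_assoc)
      also have "\<dots> = (y k i)\<^sup>\<star>" using of_matrix_entry[of y k i] y ij k by simp
      moreover have "(T k)\<^sup>\<star> \<otimes> (?Y \<otimes> T j) = y k j"
        using of_matrix_entry[of y k j] y ij k iso_familyD(1) Yc by (simp add: m_assoc)
      ultimately show "((?Y \<otimes> T i)\<^sup>\<star> \<otimes> T k) \<otimes> ((T k)\<^sup>\<star> \<otimes> (?Y \<otimes> T j)) = (y k i)\<^sup>\<star> \<otimes> y k j" by simp
    qed (use y ij in auto)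
    finally show "(T i)\<^sup>\<star> \<otimes> of_matrix x \<otimes> T j = (T i)\<^sup>\<star> \<otimes> (?Y\<^sup>\<star> \<otimes> ?Y) \<otimes> T j"
      using of_matrix_entry[of x i j] x y(2) ij by simp
  qed (use x Yc in auto)
  then show "pos (of_matrix x)" using pos_star_mult Yc by simp
next
  assume "pos (of_matrix x)"
  then obtain s where s: "s \<in> carrier A" "of_matrix x = s\<^sup>\<star> \<otimes> s" using pos_iff by blast
  define y where "y i j = (T i)\<^sup>\<star> \<otimes> s \<otimes> T j" for i j
  have "x i j = (\<Oplus>k\<in>{..<n}. (y k i)\<^sup>\<star> \<otimes> y k j)" if ij: "i < n" "j < n" for i j
  proof -
    have "x i j = (T i)\<^sup>\<star> \<otimes> (s\<^sup>\<star> \<otimes> s) \<otimes> T j" using of_matrix_entry[of x i j] x ij s by simp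
    also have "\<dots> = (s \<otimes> T i)\<^sup>\<star> \<otimes> (s \<otimes> T j)"
      using ij iso_familyD(1) s by (simp add: star_mult m_assoc)
    also have "\<dots> = (\<Oplus>k\<in>{..<n}. ((s \<otimes> T i)\<^sup>\<star> \<otimes> T k) \<otimes> ((T k)\<^sup>\<star> \<otimes> (s \<otimes> T j)))"
      using ij iso_familyD(1) s by (intro iso_family_insert) auto
    also have "\<dots> = (\<Oplus>k\<in>{..<n}. (y k i)\<^sup>\<star> \<otimes> y k j)"
      unfolding y_def using ij iso_familyD(1) s by (intro finsum_cong') (auto simp: star_mult m_assoc)
    finally show ?thesis .
  qed
  moreover have "\<And>i j. i < n \<Longrightarrow> j < n \<Longrightarrow> y i j \<in> carrier A"
    unfolding y_def using iso_familyD(1) s by auto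
  ultimately show "pos_matrix A n x" unfolding pos_matrix_def by blast
qed

end

end

context cstar_hom
begin

lemma hom_iso_family: assumes T: "A.iso_family T n" shows "B.iso_family (\<lambda>i. h (T i)) n"
proof -
  note D = A.iso_familyD[OF T]
  have "(\<Oplus>\<^bsub>B\<^esub>i\<in>{..<n}. h (T i) \<otimes>\<^bsub>B\<^esub> star B (h (T i))) = (\<Oplus>\<^bsub>B\<^esub>i\<in>{..<n}. h (T i \<otimes>\<^bsub>A\<^esub> star A (T i)))"
    using D(1) by (intro B.finsum_cong') auto
  also have "\<dots> = h (\<Oplus>\<^bsub>A\<^esub>i\<in>{..<n}. T i \<otimes>\<^bsub>A\<^esub> star A (T i))" using D(1) by (intro hom_finsum[symmetric]) auto
  also have "\<dots> = \<one>\<^bsub>B\<^esub>" using D(3) by simp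
  finally have s: "(\<Oplus>\<^bsub>B\<^esub>i\<in>{..<n}. h (T i) \<otimes>\<^bsub>B\<^esub> star B (h (T i))) = \<one>\<^bsub>B\<^esub>" .
  have orth: "star B (h (T i)) \<otimes>\<^bsub>B\<^esub> h (T j) = (if i = j then \<one>\<^bsub>B\<^esub> else \<zero>\<^bsub>B\<^esub>)" if "i < n" "j < n" for i j
    using arg_cong[OF D(2)[OF that], of h] D(1)[OF that(1)] D(1)[OF that(2)] by (simp split: if_splits)
  show ?thesis unfolding B.iso_family_def by (intro conjI allI impI orth s) (auto simp: D(1))
qed

lemma hom_of_matrix:
  assumes T: "A.iso_family T n" and x: "\<And>i j. \<lbrakk>i < n; j < n\<rbrakk> \<Longrightarrow> x i j \<in> carrier A"
  shows "h (A.of_matrix T n x) = B.of_matrix (\<lambda>i. h (T i)) n (\<lambda>i j. h (x i j))"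
proof (rule B.iso_family_eqI[OF hom_iso_family[OF T]])
  note T' = hom_iso_family[OF T]
  note Ac = A.of_matrix_closed[OF T x, simplified] and D = A.iso_familyD[OF T]
  show "h (A.of_matrix T n x) \<in> carrier B" "B.of_matrix (\<lambda>i. h (T i)) n (\<lambda>i j. h (x i j)) \<in> carrier B"
    using Ac x by (auto intro!: B.of_matrix_closed[OF T'])
  fix i j assume ij: "i < n" "j < n"
  have "star B (h (T i)) \<otimes>\<^bsub>B\<^esub> h (A.of_matrix T n x) \<otimes>\<^bsub>B\<^esub> h (T j)
     = h (star A (T i) \<otimes>\<^bsub>A\<^esub> A.of_matrix T n x \<otimes>\<^bsub>A\<^esub> T j)" using Ac D(1) ij by simp
  also have "\<dots> = h (x i j)" using A.of_matrix_entry[OF T x ij] by simp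
  also have "\<dots> = star B (h (T i)) \<otimes>\<^bsub>B\<^esub> B.of_matrix (\<lambda>i. h (T i)) n (\<lambda>i j. h (x i j)) \<otimes>\<^bsub>B\<^esub> h (T j)"
    using B.of_matrix_entry[OF T', of "\<lambda>i j. h (x i j)" i j] x ij by simp
  finally show "star B (h (T i)) \<otimes>\<^bsub>B\<^esub> h (A.of_matrix T n x) \<otimes>\<^bsub>B\<^esub> h (T j)
     = star B (h (T i)) \<otimes>\<^bsub>B\<^esub> B.of_matrix (\<lambda>i. h (T i)) n (\<lambda>i j. h (x i j)) \<otimes>\<^bsub>B\<^esub> h (T j)" .
qed

text \<open>Once the source contains a Cuntz family of the given size, both matrices become single
  elements, and \<open>pos_hom_imp_pos\<close> applies to them.\<close>

lemma pos_matrix_hom_imp: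
  assumes inj: "inj_on h (carrier A)" and T: "A.iso_family T n"
    and x: "\<And>i j. \<lbrakk>i < n; j < n\<rbrakk> \<Longrightarrow> x i j \<in> carrier A"
    and p: "pos_matrix B n (\<lambda>i j. h (x i j))"
  shows "pos_matrix A n x"
proof -
  have "B.pos (h (A.of_matrix T n x))"
    using p B.pos_matrix_iff_pos[OF hom_iso_family[OF T], of "\<lambda>i j. h (x i j)"] x
    by (simp add: hom_of_matrix[OF T x])
  then have "A.pos (A.of_matrix T n x)"
    using pos_hom_imp_pos[OF inj] A.of_matrix_closed[OF T x] by simp
  then show ?thesis using A.pos_matrix_iff_pos[OF T x] by simp
qed

end

section \<open>Unital completely positive maps\<close>

context cstar_algebra
begin

lemma star_finsum:
  "finite I \<Longrightarrow> (\<And>i. i \<in> I \<Longrightarrow> f i \<in> carrier A) \<Longrightarrow> (\<Oplus>i\<in>I. f i)\<^sup>\<star> = (\<Oplus>i\<in>I. (f i)\<^sup>\<star>)"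
proof (induction I rule: finite_induct)
  case (insert i I)
  then have "f \<in> I \<rightarrow> carrier A" "(\<lambda>i. (f i)\<^sup>\<star>) \<in> I \<rightarrow> carrier A" by auto
  then show ?case using insert by (simp add: star_add)
qed simp

text \<open>Together with \<open>finsum_gram_right\<close>, the sesquilinear expansion behind the
  change of vectors in \<open>schwarz_data\<close>.\<close>

lemma finsum_gram_left:
  assumes "finite I" "\<And>i. i \<in> I \<Longrightarrow> p i \<in> carrier A" "\<And>i. i \<in> I \<Longrightarrow> q i \<in> carrier A"
    "\<And>i. i \<in> I \<Longrightarrow> r i \<in> carrier A" "c \<in> carrier A"
  shows "(\<Oplus>i\<in>I. (p i \<oplus> q i \<otimes> c)\<^sup>\<star> \<otimes> r i)
    = (\<Oplus>i\<in>I. (p i)\<^sup>\<star> \<otimes> r i) \<oplus> c\<^sup>\<star> \<otimes> (\<Oplus>i\<in>I. (q i)\<^sup>\<star> \<otimes> r i)"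
proof -
  have "(\<Oplus>i\<in>I. (p i \<oplus> q i \<otimes> c)\<^sup>\<star> \<otimes> r i)
      = (\<Oplus>i\<in>I. ((p i)\<^sup>\<star> \<otimes> r i) \<oplus> c\<^sup>\<star> \<otimes> ((q i)\<^sup>\<star> \<otimes> r i))"
    using assms by (intro finsum_cong') (auto simp: star_simps l_distr m_assoc)
  also have "\<dots> = (\<Oplus>i\<in>I. (p i)\<^sup>\<star> \<otimes> r i) \<oplus> (\<Oplus>i\<in>I. c\<^sup>\<star> \<otimes> ((q i)\<^sup>\<star> \<otimes> r i))"
    using assms by (intro finsum_addf) auto
  also have "(\<Oplus>i\<in>I. c\<^sup>\<star> \<otimes> ((q i)\<^sup>\<star> \<otimes> r i)) = c\<^sup>\<star> \<otimes> (\<Oplus>i\<in>I. (q i)\<^sup>\<star> \<otimes> r i)"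
    using assms by (intro finsum_rdistr[symmetric]) auto
  finally show ?thesis .
qed

lemma finsum_gram_right:
  assumes "finite I" "\<And>i. i \<in> I \<Longrightarrow> p i \<in> carrier A" "\<And>i. i \<in> I \<Longrightarrow> q i \<in> carrier A"
    "\<And>i. i \<in> I \<Longrightarrow> r i \<in> carrier A" "c \<in> carrier A"
  shows "(\<Oplus>i\<in>I. (p i)\<^sup>\<star> \<otimes> (q i \<oplus> r i \<otimes> c))
    = (\<Oplus>i\<in>I. (p i)\<^sup>\<star> \<otimes> q i) \<oplus> (\<Oplus>i\<in>I. (p i)\<^sup>\<star> \<otimes> r i) \<otimes> c"
proof -
  have "(\<Oplus>i\<in>I. (p i)\<^sup>\<star> \<otimes> (q i \<oplus> r i \<otimes> c))
      = (\<Oplus>i\<in>I. (p i)\<^sup>\<star> \<otimes> q i \<oplus> (p i)\<^sup>\<star> \<otimes> r i \<otimes> c)"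
    using assms by (intro finsum_cong') (auto simp: r_distr m_assoc)
  also have "\<dots> = (\<Oplus>i\<in>I. (p i)\<^sup>\<star> \<otimes> q i) \<oplus> (\<Oplus>i\<in>I. (p i)\<^sup>\<star> \<otimes> r i \<otimes> c)"
    using assms by (intro finsum_addf) auto
  also have "(\<Oplus>i\<in>I. (p i)\<^sup>\<star> \<otimes> r i \<otimes> c) = (\<Oplus>i\<in>I. (p i)\<^sup>\<star> \<otimes> r i) \<otimes> c"
    using assms by (intro finsum_ldistr[symmetric]) auto
  finally show ?thesis .
qed

end

locale ucp_map = A: cstar_algebra A + B: cstar_algebra B
  for A :: "'a cstar_alg" and B :: "'b cstar_alg" +
  fixes \<phi> assumes ucp: "ucp (carrier A) A B \<phi>"
begin

lemma ucp_simps [simp]: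
  shows "x \<in> carrier A \<Longrightarrow> \<phi> x \<in> carrier B"
    and "\<lbrakk>x \<in> carrier A; y \<in> carrier A\<rbrakk> \<Longrightarrow> \<phi> (x \<oplus>\<^bsub>A\<^esub> y) = \<phi> x \<oplus>\<^bsub>B\<^esub> \<phi> y"
    and "\<phi> \<one>\<^bsub>A\<^esub> = \<one>\<^bsub>B\<^esub>"
    and "x \<in> carrier A \<Longrightarrow> \<phi> (c \<odot>\<^bsub>A\<^esub> x) = c \<odot>\<^bsub>B\<^esub> \<phi> x"
  using ucp by (auto simp: ucp_def)

lemma ucp_pos_matrix:
  "\<lbrakk>\<And>i j. \<lbrakk>i < n; j < n\<rbrakk> \<Longrightarrow> x i j \<in> carrier A; pos_matrix A n x\<rbrakk> \<Longrightarrow> pos_matrix B n (\<lambda>i j. \<phi> (x i j))"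
  using ucp by (auto simp: ucp_def)

lemma ucp_zero [simp]: "\<phi> \<zero>\<^bsub>A\<^esub> = \<zero>\<^bsub>B\<^esub>"
  by (metis A.smult_0_left A.zero_closed B.smult_0_left ucp_simps(1) ucp_simps(4))

lemma ucp_uminus [simp]: "x \<in> carrier A \<Longrightarrow> \<phi> (\<ominus>\<^bsub>A\<^esub> x) = \<ominus>\<^bsub>B\<^esub> \<phi> x"
  by (simp add: A.uminus_eq_smult B.uminus_eq_smult)

lemma ucp_minus [simp]:
  "\<lbrakk>x \<in> carrier A; y \<in> carrier A\<rbrakk> \<Longrightarrow> \<phi> (x \<ominus>\<^bsub>A\<^esub> y) = \<phi> x \<ominus>\<^bsub>B\<^esub> \<phi> y"
  by (simp add: A.minus_eq B.minus_eq)

lemma ucp_gram: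
  fixes n :: nat
  assumes n: "n \<ge> 1" and x: "\<And>i. i < n \<Longrightarrow> x i \<in> carrier A"
  obtains z where "\<And>i j. \<lbrakk>i < n; j < n\<rbrakk> \<Longrightarrow> z i j \<in> carrier B"
    "\<And>i j. \<lbrakk>i < n; j < n\<rbrakk> \<Longrightarrow> \<phi> (star A (x i) \<otimes>\<^bsub>A\<^esub> x j)
      = (\<Oplus>\<^bsub>B\<^esub>k\<in>{..<n}. star B (z k i) \<otimes>\<^bsub>B\<^esub> z k j)"
proof -
  \<comment> \<open>The Gram matrix is \<open>y\<^sup>\<star> y\<close> for the square matrix with
    first row \<open>x\<close> and zeros below.\<close>
  define y where "y k i = (if k = 0 then x i else \<zero>\<^bsub>A\<^esub>)" for k i :: nat
  have y: "y k i \<in> carrier A" if "i < n" for k i using x that by (auto simp: y_def)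
  have "star A (x i) \<otimes>\<^bsub>A\<^esub> x j = (\<Oplus>\<^bsub>A\<^esub>k\<in>{..<n}. star A (y k i) \<otimes>\<^bsub>A\<^esub> y k j)"
    if "i < n" "j < n" for i j
  proof -
    have "(\<Oplus>\<^bsub>A\<^esub>k\<in>{..<n}. star A (y k i) \<otimes>\<^bsub>A\<^esub> y k j) = star A (y 0 i) \<otimes>\<^bsub>A\<^esub> y 0 j"
    proof (rule A.finsum_delta)
      show "star A (y k i) \<otimes>\<^bsub>A\<^esub> y k j = \<zero>\<^bsub>A\<^esub>" if "k < n" "k \<noteq> 0" for k
        using that by (simp add: y_def)
    qed (use n y that in auto)
    then show ?thesis by (simp add: y_def)
  qed
  then have "pos_matrix A n (\<lambda>i j. star A (x i) \<otimes>\<^bsub>A\<^esub> x j)"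
    unfolding pos_matrix_def using y by (intro exI[of _ y]) auto
  then have "pos_matrix B n (\<lambda>i j. \<phi> (star A (x i) \<otimes>\<^bsub>A\<^esub> x j))"
    using x by (intro ucp_pos_matrix) auto
  then show ?thesis using that unfolding pos_matrix_def by blast
qed

lemma ucp_pos: assumes "A.pos x" shows "B.pos (\<phi> x)"
proof -
  obtain y where y: "y \<in> carrier A" "x = star A y \<otimes>\<^bsub>A\<^esub> y" using assms A.pos_iff by blast
  obtain z :: "nat \<Rightarrow> nat \<Rightarrow> 'b" where z: "\<And>i j. \<lbrakk>i < 1; j < 1\<rbrakk> \<Longrightarrow> z i j \<in> carrier B"
    "\<And>i j. \<lbrakk>i < 1; j < 1\<rbrakk> \<Longrightarrow> \<phi> (star A y \<otimes>\<^bsub>A\<^esub> y)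
      = (\<Oplus>\<^bsub>B\<^esub>k\<in>{..<1::nat}. star B (z k i) \<otimes>\<^bsub>B\<^esub> z k j)"
    by (rule ucp_gram[of 1 "\<lambda>_. y"]) (use y in auto)
  have "B.pos (\<Oplus>\<^bsub>B\<^esub>k\<in>{..<1::nat}. star B (z k 0) \<otimes>\<^bsub>B\<^esub> z k 0)"
    using z(1) by (intro B.pos_finsum B.pos_star_mult) auto
  then show ?thesis using z(2)[of 0 0] y by simp
qed

text \<open>The Gram matrix of \<open>1\<close>, \<open>a\<close>, \<open>b\<close> is mapped to a
  Gram matrix \<open>G\<close> of three columns of \<open>z\<close>, with \<open>G 0 0 = 1\<close>.
  Subtracting from column 1 its component along column 0 produces the two defects, a Schur
  complement. Hermitian symmetry of \<open>G\<close> gives preservation of adjoints, which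
  \<open>ucp\<close> does not postulate.\<close>

lemma schwarz_data:
  assumes a: "a \<in> carrier A" and b: "b \<in> carrier A"
  obtains w v where "\<And>k. k < 3 \<Longrightarrow> w k \<in> carrier B" "\<And>k. k < 3 \<Longrightarrow> v k \<in> carrier B"
    "\<phi> (star A a \<otimes>\<^bsub>A\<^esub> a) \<ominus>\<^bsub>B\<^esub> star B (\<phi> a) \<otimes>\<^bsub>B\<^esub> \<phi> a
      = (\<Oplus>\<^bsub>B\<^esub>k\<in>{..<3::nat}. star B (w k) \<otimes>\<^bsub>B\<^esub> w k)"
    "\<phi> (star A a \<otimes>\<^bsub>A\<^esub> b) \<ominus>\<^bsub>B\<^esub> star B (\<phi> a) \<otimes>\<^bsub>B\<^esub> \<phi> b
      = (\<Oplus>\<^bsub>B\<^esub>k\<in>{..<3::nat}. star B (w k) \<otimes>\<^bsub>B\<^esub> v k)"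
    "\<phi> (star A a) = star B (\<phi> a)"
proof -
  define x where "x i = (if i = 0 then \<one>\<^bsub>A\<^esub> else if i = 1 then a else b)" for i :: nat
  have xc: "x i \<in> carrier A" for i using a b by (simp add: x_def)
  obtain z where z: "\<And>i j. \<lbrakk>i < 3; j < 3\<rbrakk> \<Longrightarrow> z i j \<in> carrier B"
    "\<And>i j. \<lbrakk>i < 3; j < 3\<rbrakk> \<Longrightarrow> \<phi> (star A (x i) \<otimes>\<^bsub>A\<^esub> x j)
      = (\<Oplus>\<^bsub>B\<^esub>k\<in>{..<3::nat}. star B (z k i) \<otimes>\<^bsub>B\<^esub> z k j)"
    by (rule ucp_gram[of 3 x, OF _ xc], simp, blast)
  define G where "G i j = (\<Oplus>\<^bsub>B\<^esub>k\<in>{..<3::nat}. star B (z k i) \<otimes>\<^bsub>B\<^esub> z k j)" for i j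
  have G: "G 0 0 = \<one>\<^bsub>B\<^esub>" "G 0 1 = \<phi> a" "G 0 2 = \<phi> b" "G 1 0 = \<phi> (star A a)"
    "G 1 1 = \<phi> (star A a \<otimes>\<^bsub>A\<^esub> a)" "G 1 2 = \<phi> (star A a \<otimes>\<^bsub>A\<^esub> b)"
    using z(2)[of 0 0] z(2)[of 0 1] z(2)[of 0 2] z(2)[of 1 0] z(2)[of 1 1] z(2)[of 1 2] a b
    by (simp_all add: x_def G_def)
  have "star B (G 0 1) = (\<Oplus>\<^bsub>B\<^esub>k\<in>{..<3::nat}. star B (star B (z k 0) \<otimes>\<^bsub>B\<^esub> z k 1))"
    unfolding G_def using z(1) by (intro B.star_finsum) auto
  also have "\<dots> = G 1 0" unfolding G_def using z(1)
    by (intro B.finsum_cong') (auto simp: B.star_mult)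
  finally have st: "\<phi> (star A a) = star B (\<phi> a)" by (simp only: G)
  define c where "c = \<ominus>\<^bsub>B\<^esub> \<phi> a"
  define w where "w k = z k 1 \<oplus>\<^bsub>B\<^esub> z k 0 \<otimes>\<^bsub>B\<^esub> c" for k
  have c: "c \<in> carrier B" unfolding c_def using a by simp
  have left: "(\<Oplus>\<^bsub>B\<^esub>k\<in>{..<3::nat}. star B (w k) \<otimes>\<^bsub>B\<^esub> r k)
     = (\<Oplus>\<^bsub>B\<^esub>k\<in>{..<3::nat}. star B (z k 1) \<otimes>\<^bsub>B\<^esub> r k)
       \<oplus>\<^bsub>B\<^esub> star B c \<otimes>\<^bsub>B\<^esub> (\<Oplus>\<^bsub>B\<^esub>k\<in>{..<3::nat}. star B (z k 0) \<otimes>\<^bsub>B\<^esub> r k)"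
    if "\<And>k. k < 3 \<Longrightarrow> r k \<in> carrier B" for r
    unfolding w_def using z(1) c that by (intro B.finsum_gram_left) auto
  have right: "(\<Oplus>\<^bsub>B\<^esub>k\<in>{..<3::nat}. star B (z k i) \<otimes>\<^bsub>B\<^esub> w k) = G i 1 \<oplus>\<^bsub>B\<^esub> G i 0 \<otimes>\<^bsub>B\<^esub> c"
    if "i < 3" for i
    unfolding w_def G_def using z(1) c that by (intro B.finsum_gram_right) auto
  have wc: "w k \<in> carrier B" if "k < 3" for k unfolding w_def using z(1) c that by simp
  have pa: "\<phi> a \<in> carrier B" "\<phi> b \<in> carrier B" "\<phi> (star A a \<otimes>\<^bsub>A\<^esub> a) \<in> carrier B"
    "\<phi> (star A a \<otimes>\<^bsub>A\<^esub> b) \<in> carrier B" using a b by auto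
  have "(\<Oplus>\<^bsub>B\<^esub>k\<in>{..<3::nat}. star B (w k) \<otimes>\<^bsub>B\<^esub> w k)
     = (G 1 1 \<oplus>\<^bsub>B\<^esub> G 1 0 \<otimes>\<^bsub>B\<^esub> c) \<oplus>\<^bsub>B\<^esub> star B c \<otimes>\<^bsub>B\<^esub> (G 0 1 \<oplus>\<^bsub>B\<^esub> G 0 0 \<otimes>\<^bsub>B\<^esub> c)"
    by (subst left) (use wc right in auto)
  also have "\<dots> = \<phi> (star A a \<otimes>\<^bsub>A\<^esub> a) \<ominus>\<^bsub>B\<^esub> star B (\<phi> a) \<otimes>\<^bsub>B\<^esub> \<phi> a"
    unfolding G st c_def using pa by algebra
  finally have e1: "\<phi> (star A a \<otimes>\<^bsub>A\<^esub> a) \<ominus>\<^bsub>B\<^esub> star B (\<phi> a) \<otimes>\<^bsub>B\<^esub> \<phi> a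
      = (\<Oplus>\<^bsub>B\<^esub>k\<in>{..<3::nat}. star B (w k) \<otimes>\<^bsub>B\<^esub> w k)" ..
  have "(\<Oplus>\<^bsub>B\<^esub>k\<in>{..<3::nat}. star B (w k) \<otimes>\<^bsub>B\<^esub> z k 2) = G 1 2 \<oplus>\<^bsub>B\<^esub> star B c \<otimes>\<^bsub>B\<^esub> G 0 2"
    unfolding G_def by (rule left) (use z(1) in auto)
  also have "\<dots> = \<phi> (star A a \<otimes>\<^bsub>A\<^esub> b) \<ominus>\<^bsub>B\<^esub> star B (\<phi> a) \<otimes>\<^bsub>B\<^esub> \<phi> b"
    unfolding G c_def using pa by algebra
  finally have e2: "\<phi> (star A a \<otimes>\<^bsub>A\<^esub> b) \<ominus>\<^bsub>B\<^esub> star B (\<phi> a) \<otimes>\<^bsub>B\<^esub> \<phi> b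
      = (\<Oplus>\<^bsub>B\<^esub>k\<in>{..<3::nat}. star B (w k) \<otimes>\<^bsub>B\<^esub> z k 2)" ..
  show ?thesis by (rule that[of w "\<lambda>k. z k 2"]) (use wc z(1) e1 e2 st in auto)
qed

lemma ucp_star [simp]: "x \<in> carrier A \<Longrightarrow> \<phi> (star A x) = star B (\<phi> x)"
  by (rule schwarz_data[of x x])

lemma kadison_schwarz:
  assumes "a \<in> carrier A"
  shows "B.pos (\<phi> (star A a \<otimes>\<^bsub>A\<^esub> a) \<ominus>\<^bsub>B\<^esub> star B (\<phi> a) \<otimes>\<^bsub>B\<^esub> \<phi> a)"
proof -
  obtain w v :: "nat \<Rightarrow> 'b" where w: "\<And>k. k < 3 \<Longrightarrow> w k \<in> carrier B" and
    e: "\<phi> (star A a \<otimes>\<^bsub>A\<^esub> a) \<ominus>\<^bsub>B\<^esub> star B (\<phi> a) \<otimes>\<^bsub>B\<^esub> \<phi> a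
      = (\<Oplus>\<^bsub>B\<^esub>k\<in>{..<3::nat}. star B (w k) \<otimes>\<^bsub>B\<^esub> w k)"
    by (rule schwarz_data[OF assms assms], rule that)
  show ?thesis unfolding e using w by (intro B.pos_finsum B.pos_star_mult) auto
qed

text \<open>The equality makes the sum of the products \<open>star (w k)\<close> times
  \<open>w k\<close> zero, hence every \<open>w k\<close> zero, and with them the mixed defect, each
  of whose summands has a factor \<open>star (w k)\<close>.\<close>

lemma multiplicative_domain:
  assumes a: "a \<in> carrier A" and b: "b \<in> carrier A"
    and e: "\<phi> (star A a \<otimes>\<^bsub>A\<^esub> a) = star B (\<phi> a) \<otimes>\<^bsub>B\<^esub> \<phi> a"
  shows "\<phi> (star A a \<otimes>\<^bsub>A\<^esub> b) = star B (\<phi> a) \<otimes>\<^bsub>B\<^esub> \<phi> b"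
    and "\<phi> (b \<otimes>\<^bsub>A\<^esub> a) = \<phi> b \<otimes>\<^bsub>B\<^esub> \<phi> a"
proof -
  have m: "\<phi> (star A a \<otimes>\<^bsub>A\<^esub> b) = star B (\<phi> a) \<otimes>\<^bsub>B\<^esub> \<phi> b" if b: "b \<in> carrier A" for b
  proof -
    obtain w v :: "nat \<Rightarrow> 'b" where w: "\<And>k. k < 3 \<Longrightarrow> w k \<in> carrier B" and v: "\<And>k. k < 3 \<Longrightarrow> v k \<in> carrier B" and
      e1: "\<phi> (star A a \<otimes>\<^bsub>A\<^esub> a) \<ominus>\<^bsub>B\<^esub> star B (\<phi> a) \<otimes>\<^bsub>B\<^esub> \<phi> a
        = (\<Oplus>\<^bsub>B\<^esub>k\<in>{..<3::nat}. star B (w k) \<otimes>\<^bsub>B\<^esub> w k)" and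
      e2: "\<phi> (star A a \<otimes>\<^bsub>A\<^esub> b) \<ominus>\<^bsub>B\<^esub> star B (\<phi> a) \<otimes>\<^bsub>B\<^esub> \<phi> b
        = (\<Oplus>\<^bsub>B\<^esub>k\<in>{..<3::nat}. star B (w k) \<otimes>\<^bsub>B\<^esub> v k)"
      by (rule schwarz_data[OF a b], rule that)
    have "(\<Oplus>\<^bsub>B\<^esub>k\<in>{..<3::nat}. star B (w k) \<otimes>\<^bsub>B\<^esub> w k) = \<zero>\<^bsub>B\<^esub>"
      using e1 e a by (simp add: B.minus_eq B.r_neg)
    then have "w k = \<zero>\<^bsub>B\<^esub>" if "k < 3" for k
      using B.finsum_star_mult_eq_0[of "{..<3::nat}" w k] w that by simp
    then have "(\<Oplus>\<^bsub>B\<^esub>k\<in>{..<3::nat}. star B (w k) \<otimes>\<^bsub>B\<^esub> v k) = (\<Oplus>\<^bsub>B\<^esub>k\<in>{..<3::nat}. \<zero>\<^bsub>B\<^esub>)"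
      using v by (intro B.finsum_cong') auto
    then show ?thesis using e2 B.diff_eq_0_iff a b by simp
  qed
  from m[OF b] show "\<phi> (star A a \<otimes>\<^bsub>A\<^esub> b) = star B (\<phi> a) \<otimes>\<^bsub>B\<^esub> \<phi> b" .
  have "\<phi> (b \<otimes>\<^bsub>A\<^esub> a) = \<phi> (star A (star A a \<otimes>\<^bsub>A\<^esub> star A b))" using a b by (simp add: A.star_mult)
  also have "\<dots> = star B (star B (\<phi> a) \<otimes>\<^bsub>B\<^esub> \<phi> (star A b))"
    using m[of "star A b"] a b by (simp del: A.star_mult)
  also have "\<dots> = \<phi> b \<otimes>\<^bsub>B\<^esub> \<phi> a" using a b by (simp add: B.star_mult)
  finally show "\<phi> (b \<otimes>\<^bsub>A\<^esub> a) = \<phi> b \<otimes>\<^bsub>B\<^esub> \<phi> a" .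
qed

text \<open>\<open>\<phi>(a)\<^sup>\<star> \<phi>(a) \<le> \<phi>(a\<^sup>\<star> a) \<le>
  \<parallel>a\<parallel>^2\<close>, by Kadison--Schwarz and positivity.\<close>

lemma ucp_norm_le: assumes a: "a \<in> carrier A" shows "cnorm B (\<phi> a) \<le> cnorm A a"
proof (rule B.norm_le_of_pos)
  let ?t = "complex_of_real ((cnorm A a)\<^sup>2)"
  have "B.pos (\<phi> (?t \<odot>\<^bsub>A\<^esub> \<one>\<^bsub>A\<^esub> \<ominus>\<^bsub>A\<^esub> star A a \<otimes>\<^bsub>A\<^esub> a))"
    by (rule ucp_pos[OF A.pos_norm_minus_star_mult[OF a]])
  then have "B.pos ((?t \<odot>\<^bsub>B\<^esub> \<one>\<^bsub>B\<^esub> \<ominus>\<^bsub>B\<^esub> \<phi> (star A a \<otimes>\<^bsub>A\<^esub> a))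
      \<oplus>\<^bsub>B\<^esub> (\<phi> (star A a \<otimes>\<^bsub>A\<^esub> a) \<ominus>\<^bsub>B\<^esub> star B (\<phi> a) \<otimes>\<^bsub>B\<^esub> \<phi> a))"
    using a by (intro B.pos_add kadison_schwarz) auto
  moreover have "(T \<ominus>\<^bsub>B\<^esub> p) \<oplus>\<^bsub>B\<^esub> (p \<ominus>\<^bsub>B\<^esub> q) = T \<ominus>\<^bsub>B\<^esub> q"
    if "T \<in> carrier B" "p \<in> carrier B" "q \<in> carrier B" for T p q using that by algebra
  ultimately show "B.pos (?t \<odot>\<^bsub>B\<^esub> \<one>\<^bsub>B\<^esub> \<ominus>\<^bsub>B\<^esub> star B (\<phi> a) \<otimes>\<^bsub>B\<^esub> \<phi> a)" using a by simp
qed (use a in auto)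

lemma ucp_tends: assumes X: "A.tends X x" shows "B.tends (\<lambda>n. \<phi> (X n)) (\<phi> x)"
proof (rule B.tendsI)
  note c = A.tendsD[OF X]
  show "cnorm B (\<phi> (X n) \<ominus>\<^bsub>B\<^esub> \<phi> x) \<le> cnorm A (X n \<ominus>\<^bsub>A\<^esub> x)" for n
    using ucp_norm_le[of "X n \<ominus>\<^bsub>A\<^esub> x"] c by simp
  show "(\<lambda>n. cnorm A (X n \<ominus>\<^bsub>A\<^esub> x)) \<longlonglongrightarrow> 0" using X by (simp add: A.tends_def)
qed (use A.tendsD[OF X] in auto)

end

lemma ucp_comp: "\<lbrakk>ucp E A B \<phi>; ucp (carrier B) B C \<psi>\<rbrakk> \<Longrightarrow> ucp E A C (\<lambda>x. \<psi> (\<phi> x))"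
  unfolding ucp_def by auto

text \<open>By the Kadison--Schwarz inequality, applied to both maps, the defect
  \<open>\<phi>(a\<^sup>\<star>a) - \<phi>(a)\<^sup>\<star>\<phi>(a)\<close> is mapped by \<open>\<psi>\<close> to an element that is both positive and negative.\<close>

lemma ucp_inverse_star_isomorphic:
  assumes "cstar_algebra A" "cstar_algebra B" "ucp (carrier A) A B \<phi>" "ucp (carrier B) B A \<psi>"
    and inv: "\<And>x. x \<in> carrier A \<Longrightarrow> \<psi> (\<phi> x) = x" "\<And>y. y \<in> carrier B \<Longrightarrow> \<phi> (\<psi> y) = y"
  shows "star_isomorphic A B"
proof -
  interpret F: ucp_map A B \<phi> using assms by (simp add: ucp_map_def ucp_map_axioms_def)
  interpret G: ucp_map B A \<psi> using assms by (simp add: ucp_map_def ucp_map_axioms_def)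
  have sq: "\<phi> (star A a \<otimes>\<^bsub>A\<^esub> a) = star B (\<phi> a) \<otimes>\<^bsub>B\<^esub> \<phi> a" if a: "a \<in> carrier A" for a
  proof -
    let ?p = "\<phi> (star A a \<otimes>\<^bsub>A\<^esub> a) \<ominus>\<^bsub>B\<^esub> star B (\<phi> a) \<otimes>\<^bsub>B\<^esub> \<phi> a"
    let ?q = "\<psi> (star B (\<phi> a) \<otimes>\<^bsub>B\<^esub> \<phi> a)"
    have p: "F.A.pos (star A a \<otimes>\<^bsub>A\<^esub> a \<ominus>\<^bsub>A\<^esub> ?q)"
      using G.ucp_pos[OF F.kadison_schwarz[OF a]] a inv(1) by simp
    have "F.A.pos (?q \<ominus>\<^bsub>A\<^esub> star A a \<otimes>\<^bsub>A\<^esub> a)" using G.kadison_schwarz[of "\<phi> a"] a inv(1) by simp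
    moreover have "\<ominus>\<^bsub>A\<^esub> (r \<ominus>\<^bsub>A\<^esub> q) = q \<ominus>\<^bsub>A\<^esub> r" if "r \<in> carrier A" "q \<in> carrier A" for r q
      using that by algebra
    then have "\<ominus>\<^bsub>A\<^esub> (star A a \<otimes>\<^bsub>A\<^esub> a \<ominus>\<^bsub>A\<^esub> ?q) = ?q \<ominus>\<^bsub>A\<^esub> star A a \<otimes>\<^bsub>A\<^esub> a" using a by simp
    ultimately have "star A a \<otimes>\<^bsub>A\<^esub> a \<ominus>\<^bsub>A\<^esub> ?q = \<zero>\<^bsub>A\<^esub>"
      using p by (intro F.A.pos_antisym) auto
    then have "star A a \<otimes>\<^bsub>A\<^esub> a = ?q" using F.A.diff_eq_0_iff a by simp
    then show ?thesis using inv(2) a by simp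
  qed
  have "\<phi> (x \<otimes>\<^bsub>A\<^esub> y) = \<phi> x \<otimes>\<^bsub>B\<^esub> \<phi> y" if "x \<in> carrier A" "y \<in> carrier A" for x y
    using F.multiplicative_domain(2)[OF that(2) that(1) sq[OF that(2)]] .
  then have "\<phi> \<in> star_hom A B" by (auto simp: star_hom_def ring_hom_def)
  moreover have "bij_betw \<phi> (carrier A) (carrier B)"
    by (rule bij_betw_byWitness[of _ \<psi>]) (use inv in auto)
  ultimately show ?thesis unfolding star_isomorphic_def by blast
qed

lemma injective_cstar_extend:
  fixes I A :: "'b cstar_alg"
  assumes I: "injective_cstar I" and A: "cstar_algebra A"
    and E: "operator_system E A" and F: "operator_system F A" and EF: "E \<subseteq> F" and phi: "ucp E A I \<phi>"
  shows "\<exists>\<psi>. ucp F A I \<psi> \<and> (\<forall>x\<in>E. \<psi> x = \<phi> x)"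
proof -
  \<comment> \<open>Any injection of the type into the test type of \<open>injective_cstar\<close>
    would do; \<open>x\<close> goes to the matrix with ones exactly in row \<open>x\<close>.\<close>
  define f :: "'b \<Rightarrow> 'b \<Rightarrow> 'b \<Rightarrow> complex" where "f x = (\<lambda>y z. of_bool (y = x))" for x
  have "f x x x \<noteq> f y x x" if "x \<noteq> y" for x y using that by (simp add: f_def)
  then have "inj f" by (metis injI)
  then have inj: "inj_on f (carrier A)" by (rule inj_on_subset) simp
  define T where "T = transport f A"
  define g where "g = inv_into (carrier A) f"
  interpret A: cstar_algebra A by (rule A)
  interpret T: cstar_algebra T by (rule A.transport_cstar[OF inj T_def])
  interpret f: cstar_hom A T f by unfold_locales (rule A.transport_hom[OF inj T_def])
  interpret g: cstar_hom T A g unfolding g_def by unfold_locales (rule A.transport_inv_hom[OF inj T_def])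
  have gf: "g (f x) = x" if "x \<in> carrier A" for x unfolding g_def using inj that by simp
  have Fc: "F \<subseteq> carrier A" and Ec: "E \<subseteq> carrier A" using E F by (auto simp: operator_system_def)
  have sys: "operator_system (f ` D) T" if "operator_system D A" for D
  proof -
    have D: "D \<subseteq> carrier A" using that by (simp add: operator_system_def)
    have "f x \<oplus>\<^bsub>T\<^esub> f y = f (x \<oplus>\<^bsub>A\<^esub> y)" if "x \<in> D" "y \<in> D" for x y using that D by (simp add: subsetD)
    moreover have "c \<odot>\<^bsub>T\<^esub> f x = f (c \<odot>\<^bsub>A\<^esub> x)" if "x \<in> D" for x c using that D by (simp add: subsetD)
    moreover have "star T (f x) = f (star A x)" if "x \<in> D" for x using that D by (simp add: subsetD)
    moreover have "\<one>\<^bsub>T\<^esub> = f \<one>\<^bsub>A\<^esub>" by simp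
    ultimately show ?thesis using that D unfolding operator_system_def
      by (auto simp del: f.hom_simps simp: f.hom_simps(1))
  qed
  have phi_pos: "\<lbrakk>\<forall>i<n. \<forall>j<n. x i j \<in> E; pos_matrix A n x\<rbrakk> \<Longrightarrow> pos_matrix I n (\<lambda>i j. \<phi> (x i j))" for n x
    using phi by (simp add: ucp_def)
  have "ucp (f ` E) T I (\<lambda>x. \<phi> (g x))"
    unfolding ucp_def
  proof (intro conjI ballI allI impI)
    fix n x assume x: "(\<forall>i<n. \<forall>j<n. x i j \<in> f ` E) \<and> pos_matrix T n x"
    then have "pos_matrix A n (\<lambda>i j. g (x i j))" using g.hom_pos_matrix by blast
    moreover have "g (f u) \<in> E" if "u \<in> E" for u using that gf Ec by (simp add: subset_iff)
    then have "\<forall>i<n. \<forall>j<n. g (x i j) \<in> E" using x by (metis imageE)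
    ultimately show "pos_matrix I n (\<lambda>i j. \<phi> (g (x i j)))"
      using phi_pos[of n "\<lambda>i j. g (x i j)"] by blast
  next
    fix x y assume "x \<in> f ` E" "y \<in> f ` E"
    then obtain u v where "u \<in> E" "v \<in> E" "x = f u" "y = f v" by auto
    then show "\<phi> (g (x \<oplus>\<^bsub>T\<^esub> y)) = \<phi> (g x) \<oplus>\<^bsub>I\<^esub> \<phi> (g y)"
      using phi Ec by (simp add: gf ucp_def subset_iff)
  next
    fix c x assume "x \<in> f ` E"
    then obtain u where "u \<in> E" "x = f u" by auto
    then show "\<phi> (g (c \<odot>\<^bsub>T\<^esub> x)) = c \<odot>\<^bsub>I\<^esub> \<phi> (g x)" using phi Ec by (simp add: gf ucp_def subset_iff)
  next
    fix x assume "x \<in> f ` E"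
    then obtain u where "u \<in> E" "x = f u" by auto
    then show "\<phi> (g x) \<in> carrier I" using phi Ec by (simp add: gf ucp_def subset_iff)
  qed (use phi in \<open>simp add: ucp_def\<close>)
  moreover have "f ` E \<subseteq> f ` F" using EF by auto
  ultimately obtain \<psi> where \<psi>: "ucp (f ` F) T I \<psi>" "\<forall>x\<in>f ` E. \<psi> x = \<phi> (g x)"
    using I sys[OF E] sys[OF F] T.cstar_algebra_axioms unfolding injective_cstar_def by blast
  have "ucp F A I (\<lambda>x. \<psi> (f x))"
    unfolding ucp_def
  proof (intro conjI ballI allI impI)
    fix n x assume x: "(\<forall>i<n. \<forall>j<n. x i j \<in> F) \<and> pos_matrix A n x"
    then have fx: "pos_matrix T n (\<lambda>i j. f (x i j))" using f.hom_pos_matrix by blast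
    have "\<lbrakk>\<forall>i<n. \<forall>j<n. y i j \<in> f ` F; pos_matrix T n y\<rbrakk> \<Longrightarrow> pos_matrix I n (\<lambda>i j. \<psi> (y i j))" for n y
      using \<psi>(1) by (simp add: ucp_def)
    from this[OF _ fx] show "pos_matrix I n (\<lambda>i j. \<psi> (f (x i j)))" using x by simp
  next
    show "\<psi> (f \<one>\<^bsub>A\<^esub>) = \<one>\<^bsub>I\<^esub>" using \<psi>(1) by (simp add: ucp_def)
  next
    fix x y assume xy: "x \<in> F" "y \<in> F"
    then have "f (x \<oplus>\<^bsub>A\<^esub> y) = f x \<oplus>\<^bsub>T\<^esub> f y" using Fc by (simp add: subsetD)
    then show "\<psi> (f (x \<oplus>\<^bsub>A\<^esub> y)) = \<psi> (f x) \<oplus>\<^bsub>I\<^esub> \<psi> (f y)" using \<psi>(1) xy by (simp add: ucp_def)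
  next
    fix c x assume x: "x \<in> F"
    then have "f (c \<odot>\<^bsub>A\<^esub> x) = c \<odot>\<^bsub>T\<^esub> f x" using Fc by (simp add: subsetD)
    then show "\<psi> (f (c \<odot>\<^bsub>A\<^esub> x)) = c \<odot>\<^bsub>I\<^esub> \<psi> (f x)" using \<psi>(1) x by (simp add: ucp_def)
  next
    fix x assume "x \<in> F"
    then show "\<psi> (f x) \<in> carrier I" using \<psi>(1) by (simp add: ucp_def)
  qed
  moreover have "\<forall>x\<in>E. \<psi> (f x) = \<phi> x" using \<psi>(2) gf Ec by auto
  ultimately show ?thesis by blast
qed

section \<open>Monomials in the diadic algebra\<close>

context cstar_algebra
begin

lemma tends_shift: assumes "(\<lambda>n. X (Suc n)) \<leadsto> x" "X 0 \<in> carrier A" shows "X \<leadsto> x"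
proof -
  have "X n \<in> carrier A" for n using assms tendsD(1)[OF assms(1)] by (cases n) auto
  moreover have "(\<lambda>n. \<parallel>X n \<ominus> x\<parallel>) \<longlonglongrightarrow> 0"
  proof (rule LIMSEQ_imp_Suc)
    show "(\<lambda>n. \<parallel>X (Suc n) \<ominus> x\<parallel>) \<longlonglongrightarrow> 0" using assms(1) by (simp add: tends_def)
  qed
  ultimately show ?thesis using tendsD(2)[OF assms(1)] by (simp add: tends_def)
qed

section \<open>Dense subalgebras and linear spans\<close>

definition seq_closure :: "'a set \<Rightarrow> 'a set" where
  "seq_closure D = {x. \<exists>X. (\<forall>n. X n \<in> D) \<and> X \<leadsto> x}"

lemma seq_closureI: "\<lbrakk>X \<leadsto> x; \<And>n. X n \<in> D\<rbrakk> \<Longrightarrow> x \<in> seq_closure D"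
  by (auto simp: seq_closure_def)

lemma seq_closure_approx:
  assumes "x \<in> seq_closure D" "e > 0" obtains y where "y \<in> D" "\<parallel>y \<ominus> x\<parallel> < e"
proof -
  obtain X where X: "\<And>n. X n \<in> D" "X \<leadsto> x" using assms by (auto simp: seq_closure_def)
  then have "\<forall>\<^sub>F n in sequentially. \<parallel>X n \<ominus> x\<parallel> < e"
    using assms(2) unfolding tends_def by (intro order_tendstoD(2)) auto
  then obtain n where "\<parallel>X n \<ominus> x\<parallel> < e" unfolding eventually_sequentially by blast
  then show ?thesis using that X(1) by blast
qed

lemma seq_closure_subalgebra:
  assumes D: "D \<subseteq> carrier A" "\<zero> \<in> D" "\<And>x y. \<lbrakk>x \<in> D; y \<in> D\<rbrakk> \<Longrightarrow> x \<oplus> y \<in> D"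
    "\<And>x y. \<lbrakk>x \<in> D; y \<in> D\<rbrakk> \<Longrightarrow> x \<otimes> y \<in> D" "\<And>c x. x \<in> D \<Longrightarrow> c \<odot> x \<in> D" "\<And>x. x \<in> D \<Longrightarrow> x\<^sup>\<star> \<in> D"
  shows "cstar_subalgebra (seq_closure D) A"
proof -
  have sub: "seq_closure D \<subseteq> carrier A" unfolding seq_closure_def by (auto dest: tendsD)
  have cl: "norm_closed A (seq_closure D)"
    unfolding norm_closed_iff
  proof (intro conjI allI impI sub)
    fix Y y assume Y: "(\<forall>n. Y n \<in> seq_closure D) \<and> Y \<leadsto> y"
    have "\<exists>x. x \<in> D \<and> \<parallel>x \<ominus> Y n\<parallel> < 1 / Suc n" for n
      using seq_closure_approx[of "Y n" D "1 / Suc n"] Y by auto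
    then obtain X where X: "\<And>n. X n \<in> D" "\<And>n. \<parallel>X n \<ominus> Y n\<parallel> < 1 / Suc n" by metis
    note c = tendsD[of Y y]
    have Xy: "X \<leadsto> y"
    proof (rule tendsI)
      show "\<parallel>X n \<ominus> y\<parallel> \<le> 1 / Suc n + \<parallel>Y n \<ominus> y\<parallel>" for n
        using norm_diff_triangle[of "X n" "Y n" y] X(2)[of n] X(1)[of n] D(1) c Y by force
      show "(\<lambda>n. 1 / Suc n + \<parallel>Y n \<ominus> y\<parallel>) \<longlonglongrightarrow> 0"
        using tendsto_add[OF LIMSEQ_Suc[OF lim_1_over_n] , of "\<lambda>n. \<parallel>Y n \<ominus> y\<parallel>" 0] Y by (simp add: tends_def)
    qed (use X D(1) c Y in auto)
    show "y \<in> seq_closure D" using Xy X(1) by (rule seq_closureI)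
  qed
  show ?thesis
    unfolding cstar_subalgebra_def
  proof (intro conjI sub cl ballI allI)
    show "\<zero> \<in> seq_closure D" using tends_const[OF zero_closed] D(2) by (rule seq_closureI)
    fix x assume x: "x \<in> seq_closure D"
    then obtain X where X: "\<And>n. X n \<in> D" "X \<leadsto> x" unfolding seq_closure_def by auto
    show "c \<odot> x \<in> seq_closure D" for c using tends_smult[OF X(2), of c] by (rule seq_closureI) (use X(1) D(5) in simp)
    show "x\<^sup>\<star> \<in> seq_closure D" using tends_star[OF X(2)] by (rule seq_closureI) (use X(1) D(6) in simp)
    fix y assume y: "y \<in> seq_closure D"
    then obtain Y where Y: "\<And>n. Y n \<in> D" "Y \<leadsto> y" unfolding seq_closure_def by auto
    show "x \<oplus> y \<in> seq_closure D" using tends_add[OF X(2) Y(2)] by (rule seq_closureI) (use X(1) Y(1) D(3) in simp)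
    show "x \<otimes> y \<in> seq_closure D" using tends_mult[OF X(2) Y(2)] by (rule seq_closureI) (use X(1) Y(1) D(4) in simp)
  qed
qed

text \<open>Built by adding one multiple of a generator at a time, so that facts about spans follow
  by rule induction.\<close>

inductive_set lspan :: "'a set \<Rightarrow> 'a set" for X where
  lspan_zero: "\<zero> \<in> lspan X"
| lspan_step: "\<lbrakk>x \<in> lspan X; m \<in> X\<rbrakk> \<Longrightarrow> c \<odot> m \<oplus> x \<in> lspan X"

lemma lspan_closed: "\<lbrakk>x \<in> lspan X; X \<subseteq> carrier A\<rbrakk> \<Longrightarrow> x \<in> carrier A"
  by (induction rule: lspan.induct) auto

lemma lspan_base: "\<lbrakk>m \<in> X; X \<subseteq> carrier A\<rbrakk> \<Longrightarrow> m \<in> lspan X"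
  using lspan_step[OF lspan_zero, of m X 1] by auto

lemma lspan_add: "\<lbrakk>x \<in> lspan X; y \<in> lspan X; X \<subseteq> carrier A\<rbrakk> \<Longrightarrow> x \<oplus> y \<in> lspan X"
proof (induction rule: lspan.induct)
  case lspan_zero
  then show ?case by (simp add: lspan_closed)
next
  case (lspan_step x m c)
  then have "c \<odot> m \<oplus> (x \<oplus> y) \<in> lspan X" by (intro lspan.lspan_step) auto
  then show ?case using lspan_step lspan_closed by (subst a_assoc) auto
qed

lemma lspan_smult: "\<lbrakk>x \<in> lspan X; X \<subseteq> carrier A\<rbrakk> \<Longrightarrow> c \<odot> x \<in> lspan X"
proof (induction rule: lspan.induct)
  case (lspan_step x m d)
  then have "m \<in> carrier A" "x \<in> carrier A" using lspan_closed by auto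
  then have "c \<odot> (d \<odot> m \<oplus> x) = (c * d) \<odot> m \<oplus> c \<odot> x" by (simp add: smult_r_distr smult_smult)
  then show ?case using lspan_step lspan.lspan_step by simp
qed (simp add: lspan_zero)

text \<open>The twist \<open>g\<close> on the scalars covers linear maps, with \<open>g\<close> the
  identity, and the conjugate-linear adjoint, with \<open>g = cnj\<close>.\<close>

lemma lspan_linear:
  assumes x: "x \<in> lspan X" and X: "X \<subseteq> carrier A" and Y: "Y \<subseteq> carrier A"
    and f: "f \<zero> = \<zero>" "\<And>m x c. \<lbrakk>m \<in> X; x \<in> carrier A\<rbrakk> \<Longrightarrow> f (c \<odot> m \<oplus> x) = g c \<odot> f m \<oplus> f x"
      "\<And>m. m \<in> X \<Longrightarrow> f m \<in> lspan Y"
  shows "f x \<in> lspan Y"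
  using x
proof (induction rule: lspan.induct)
  case (lspan_step x m c)
  then show ?case using f X Y by (simp add: lspan_closed lspan_add lspan_smult)
qed (simp add: f lspan_zero)

lemma lspan_mono: "\<lbrakk>x \<in> lspan X; X \<subseteq> Y\<rbrakk> \<Longrightarrow> x \<in> lspan Y"
  by (induction rule: lspan.induct) (auto intro: lspan.intros)

lemma lspan_mult:
  assumes x: "x \<in> lspan X" and y: "y \<in> lspan Y" and c: "X \<subseteq> carrier A" "Y \<subseteq> carrier A" "Z \<subseteq> carrier A"
    and m: "\<And>m n. \<lbrakk>m \<in> X; n \<in> Y\<rbrakk> \<Longrightarrow> m \<otimes> n \<in> lspan Z"
  shows "x \<otimes> y \<in> lspan Z"
proof -
  have yc: "y \<in> carrier A" using lspan_closed y c by blast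
  have my: "m \<otimes> y \<in> lspan Z" if "m \<in> X" for m
    by (rule lspan_linear[OF y c(2,3), where g = "\<lambda>c. c"])
      (use that c m in \<open>auto simp: r_distr smult_mult_r subset_iff\<close>)
  show ?thesis
    by (rule lspan_linear[OF x c(1,3), where g = "\<lambda>c. c"])
      (use c yc my in \<open>auto simp: l_distr smult_mult_l subset_iff\<close>)
qed

end

section \<open>Consequences of the diadic relations\<close>

locale diadic_algebra = cstar_algebra A for A :: "'a cstar_alg" (structure) +
  fixes u s :: 'a
  assumes rel: "diadic_relations A u s" and nontrivial: "\<one> \<noteq> \<zero>"
begin

abbreviation s1 :: 'a where "s1 \<equiv> u \<otimes> s"

lemma gen_closed [simp, intro]: "u \<in> carrier A" "s \<in> carrier A"
  using rel by (auto simp: diadic_relations_def)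

lemma gen_rel:
  shows "u\<^sup>\<star> \<otimes> u = \<one>" "u \<otimes> u\<^sup>\<star> = \<one>" "s\<^sup>\<star> \<otimes> s = \<one>" "u \<otimes> (u \<otimes> s) = s \<otimes> u"
  using rel by (auto simp: diadic_relations_def m_assoc)

lemma range_sum: "s \<otimes> s\<^sup>\<star> \<oplus> s1 \<otimes> s1\<^sup>\<star> = \<one>"
  using rel by (auto simp: diadic_relations_def m_assoc star_mult)

lemma gen_rel_assoc:
  assumes "x \<in> carrier A"
  shows "u\<^sup>\<star> \<otimes> (u \<otimes> x) = x" "u \<otimes> (u\<^sup>\<star> \<otimes> x) = x" "s\<^sup>\<star> \<otimes> (s \<otimes> x) = x"
    "u \<otimes> (u \<otimes> (s \<otimes> x)) = s \<otimes> (u \<otimes> x)"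
proof -
  show "u\<^sup>\<star> \<otimes> (u \<otimes> x) = x" "u \<otimes> (u\<^sup>\<star> \<otimes> x) = x" "s\<^sup>\<star> \<otimes> (s \<otimes> x) = x"
    using assms gen_rel by (simp_all flip: m_assoc)
  have "u \<otimes> (u \<otimes> (s \<otimes> x)) = (u \<otimes> (u \<otimes> s)) \<otimes> x" using assms by (simp add: m_assoc)
  then show "u \<otimes> (u \<otimes> (s \<otimes> x)) = s \<otimes> (u \<otimes> x)" unfolding gen_rel(4) using assms by (simp add: m_assoc)
qed

text \<open>Compressing the range relation by \<open>s\<close> gives
  \<open>1 = 1 + e e\<^sup>\<star>\<close> for \<open>e = s\<^sup>\<star> u s\<close>.\<close>

lemma ranges_orthogonal: "s\<^sup>\<star> \<otimes> (u \<otimes> s) = \<zero>"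
proof -
  define e where "e = s\<^sup>\<star> \<otimes> (u \<otimes> s)"
  have e: "e \<in> carrier A" unfolding e_def by simp
  have "\<one> = s\<^sup>\<star> \<otimes> (\<one> \<otimes> s)" using gen_rel by simp
  also have "\<dots> = s\<^sup>\<star> \<otimes> ((s \<otimes> s\<^sup>\<star> \<oplus> s1 \<otimes> s1\<^sup>\<star>) \<otimes> s)" unfolding range_sum ..
  also have "\<dots> = \<one> \<oplus> e \<otimes> e\<^sup>\<star>" unfolding e_def using gen_rel gen_rel_assoc
    by (simp add: l_distr r_distr m_assoc star_mult)
  finally have "\<one> \<oplus> e \<otimes> e\<^sup>\<star> = \<one> \<oplus> \<zero>" by simp
  then have "\<ominus> \<one> \<oplus> (\<one> \<oplus> e \<otimes> e\<^sup>\<star>) = \<ominus> \<one> \<oplus> (\<one> \<oplus> \<zero>)" by simp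
  then have "e \<otimes> e\<^sup>\<star> = \<zero>" using e by (simp only: r_neg1 one_closed zero_closed m_closed star_closed)
  then have "e\<^sup>\<star> = \<zero>" using star_mult_eq_0[of "e\<^sup>\<star>"] e by simp
  then show ?thesis using e e_def by (metis star_star star_zero)
qed

lemma ranges_orthogonal_assoc: "x \<in> carrier A \<Longrightarrow> s\<^sup>\<star> \<otimes> (u \<otimes> (s \<otimes> x)) = \<zero>"
  using ranges_orthogonal by (metis gen_closed l_null m_assoc m_closed star_closed)

lemma s1_rel: "s1\<^sup>\<star> \<otimes> s1 = \<one>" "s1\<^sup>\<star> \<otimes> s = \<zero>" "s\<^sup>\<star> \<otimes> s1 = \<zero>"
proof -
  have "s\<^sup>\<star> \<otimes> (u\<^sup>\<star> \<otimes> s) = (s\<^sup>\<star> \<otimes> (u \<otimes> s))\<^sup>\<star>" by (simp add: star_mult m_assoc)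
  also have "\<dots> = \<zero>" by (simp only: ranges_orthogonal star_zero)
  finally show "s1\<^sup>\<star> \<otimes> s1 = \<one>" "s1\<^sup>\<star> \<otimes> s = \<zero>" "s\<^sup>\<star> \<otimes> s1 = \<zero>"
    using gen_rel gen_rel_assoc ranges_orthogonal by (simp_all add: star_mult m_assoc)
qed

text \<open>As \<open>nat\<close> truncates at 0, only one of the two iterations acts for a given
  sign of the exponent.\<close>

definition upow :: "int \<Rightarrow> 'a" where
  "upow a = ((\<lambda>x. u \<otimes> x) ^^ nat a) (((\<lambda>x. u\<^sup>\<star> \<otimes> x) ^^ nat (- a)) \<one>)"

lemma upow_closed [simp, intro]: "upow a \<in> carrier A"
proof -
  have "((\<lambda>x. u\<^sup>\<star> \<otimes> x) ^^ n) \<one> \<in> carrier A" for n by (induction n) auto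
  moreover have "((\<lambda>x. u \<otimes> x) ^^ n) y \<in> carrier A" if "y \<in> carrier A" for n y by (induction n) (use that in auto)
  ultimately show ?thesis unfolding upow_def by blast
qed

lemma upow_0 [simp]: "upow 0 = \<one>" by (simp add: upow_def)

lemma u_upow: "u \<otimes> upow a = upow (a + 1)"
proof (cases "a \<ge> 0")
  case True
  then have "nat (a + 1) = Suc (nat a)" by simp
  then show ?thesis using True by (simp add: upow_def)
next
  case False
  then have e: "nat (- a) = Suc (nat (- (a + 1)))" "nat a = 0" "nat (a + 1) = 0" by auto
  have "((\<lambda>x. u\<^sup>\<star> \<otimes> x) ^^ n) \<one> \<in> carrier A" for n by (induction n) auto
  then show ?thesis unfolding upow_def e by (simp add: gen_rel_assoc)
qed

lemma ustar_upow: "u\<^sup>\<star> \<otimes> upow a = upow (a - 1)"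
  using u_upow[of "a - 1"] gen_rel_assoc(1)[of "upow (a - 1)"] by simp

lemma upow_1: "upow 1 = u" "upow (-1) = u\<^sup>\<star>"
  using u_upow[of 0] ustar_upow[of 0] by simp_all

lemma upow_add: "upow a \<otimes> upow b = upow (a + b)"
proof (induction a rule: int_induct[where k = 0])
  case (step1 i)
  have "upow (i + 1) \<otimes> upow b = u \<otimes> (upow i \<otimes> upow b)" by (simp add: m_assoc flip: u_upow)
  then show ?case using step1 by (simp add: u_upow algebra_simps)
next
  case (step2 i)
  have "upow (i - 1) \<otimes> upow b = u\<^sup>\<star> \<otimes> (upow i \<otimes> upow b)" by (simp add: m_assoc flip: ustar_upow)
  then show ?case using step2 by (simp add: ustar_upow algebra_simps)
qed simp

lemma upow_add_assoc: "x \<in> carrier A \<Longrightarrow> upow a \<otimes> (upow b \<otimes> x) = upow (a + b) \<otimes> x"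
  by (simp flip: upow_add add: m_assoc)

lemma upow_star: "(upow a)\<^sup>\<star> = upow (- a)"
proof -
  have "(upow a)\<^sup>\<star> \<otimes> upow a = \<one>"
  proof (induction a rule: int_induct[where k = 0])
    case (step1 i)
    then show ?case using gen_rel_assoc by (simp add: star_mult m_assoc flip: u_upow)
  next
    case (step2 i)
    then show ?case using gen_rel_assoc by (simp add: star_mult m_assoc flip: ustar_upow)
  qed simp
  then have "((upow a)\<^sup>\<star> \<otimes> upow a) \<otimes> upow (- a) = upow (- a)" by simp
  then show ?thesis by (simp add: m_assoc upow_add)
qed

lemma upow_norm_le: "\<parallel>upow a\<parallel> \<le> 1"
  by (rule norm_isometry_le) (auto simp: upow_star upow_add)

lemma s_upow: "s \<otimes> upow a = upow (2 * a) \<otimes> s"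
proof (induction a rule: int_induct[where k = 0])
  case (step1 i)
  have "s \<otimes> upow (i + 1) = u \<otimes> (u \<otimes> (s \<otimes> upow i))" by (simp add: gen_rel_assoc flip: u_upow)
  also have "\<dots> = upow (2 * (i + 1)) \<otimes> s" unfolding step1
    using upow_add_assoc[of s 1 "2 * i + 1"] upow_add_assoc[of s 1 "2 * i"] by (simp add: upow_1 algebra_simps)
  finally show ?case .
next
  case (step2 i)
  have "s \<otimes> (u\<^sup>\<star> \<otimes> x) = u\<^sup>\<star> \<otimes> (u\<^sup>\<star> \<otimes> (s \<otimes> x))" if "x \<in> carrier A" for x
  proof -
    have "s \<otimes> x = s \<otimes> (u \<otimes> (u\<^sup>\<star> \<otimes> x))" using that by (simp add: gen_rel_assoc)
    also have "\<dots> = u \<otimes> (u \<otimes> (s \<otimes> (u\<^sup>\<star> \<otimes> x)))" using that by (simp add: gen_rel_assoc(4))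
    finally show ?thesis using that by (simp add: gen_rel_assoc(1))
  qed
  then have "s \<otimes> upow (i - 1) = u\<^sup>\<star> \<otimes> (u\<^sup>\<star> \<otimes> (s \<otimes> upow i))" by (simp flip: ustar_upow)
  also have "\<dots> = upow (2 * (i - 1)) \<otimes> s" unfolding step2
    using upow_add_assoc[of s "-1" "2 * i - 1"] upow_add_assoc[of s "-1" "2 * i"]
    by (simp add: upow_1 algebra_simps)
  finally show ?case .
qed simp

lemma s_upow_assoc: "x \<in> carrier A \<Longrightarrow> s \<otimes> (upow a \<otimes> x) = upow (2 * a) \<otimes> (s \<otimes> x)"
  by (metis gen_closed(2) m_assoc s_upow upow_closed)

lemma sstar_upow_even: "s\<^sup>\<star> \<otimes> upow (2 * a) = upow a \<otimes> s\<^sup>\<star>"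
  using arg_cong[OF s_upow[of "- a"], of "star A"] by (simp add: star_mult upow_star)

lemma sstar_upow_even_assoc: "x \<in> carrier A \<Longrightarrow> s\<^sup>\<star> \<otimes> (upow (2 * a) \<otimes> x) = upow a \<otimes> (s\<^sup>\<star> \<otimes> x)"
  by (metis gen_closed(2) m_assoc sstar_upow_even upow_closed star_closed)

lemma sstar_upow_odd_assoc:
  "x \<in> carrier A \<Longrightarrow> s\<^sup>\<star> \<otimes> (upow (2 * a + 1) \<otimes> x) = upow a \<otimes> (s\<^sup>\<star> \<otimes> (u \<otimes> x))"
proof -
  assume x: "x \<in> carrier A"
  have "upow (2 * a + 1) \<otimes> x = upow (2 * a) \<otimes> (u \<otimes> x)"
    using x upow_add_assoc[of x "2 * a" 1] upow_1 by simp
  then show ?thesis using x by (simp add: sstar_upow_even_assoc)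
qed

text \<open>An odd exponent leaves a factor \<open>s\<^sup>\<star> u s = 0\<close>: in the
  representation by doubling, the range of \<open>s\<close> consists of the even positions.\<close>

lemma compress_upow:
  assumes x: "x \<in> carrier A"
  shows "s\<^sup>\<star> \<otimes> (upow a \<otimes> (s \<otimes> x)) = (if even a then upow (a div 2) \<otimes> x else \<zero>)"
proof (cases "even a")
  case True
  then obtain b where "a = 2 * b" by auto
  then show ?thesis using x by (simp add: sstar_upow_even_assoc gen_rel_assoc)
next
  case False
  then obtain b where "a = 2 * b + 1" using oddE by blast
  then show ?thesis using x by (simp add: sstar_upow_odd_assoc ranges_orthogonal_assoc)
qed

lemma compress_upow': "s\<^sup>\<star> \<otimes> (upow a \<otimes> s) = (if even a then upow (a div 2) else \<zero>)"
  using compress_upow[of \<one> a] by simp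

text \<open>Insert the range relation after \<open>u\<close>. Since \<open>u\<close> maps the range
  of \<open>s\<close> to that of \<open>s1\<close>, which \<open>s\<^sup>\<star>\<close>
  annihilates, only the second summand remains, and there \<open>u s1 = s u\<close>. This handles an
  odd power of \<open>u\<close> behind \<open>s\<^sup>\<star>\<close> when no \<open>s\<close>
  follows.\<close>

lemma sstar_u: "s\<^sup>\<star> \<otimes> u = u \<otimes> (s\<^sup>\<star> \<otimes> u\<^sup>\<star>)"
proof -
  have "s\<^sup>\<star> \<otimes> u = s\<^sup>\<star> \<otimes> (u \<otimes> (s \<otimes> s\<^sup>\<star> \<oplus> s1 \<otimes> s1\<^sup>\<star>))" unfolding range_sum by simp
  then show ?thesis
    by (simp add: r_distr m_assoc star_mult ranges_orthogonal_assoc gen_rel_assoc)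
qed

lemma sstar_u_assoc: "x \<in> carrier A \<Longrightarrow> s\<^sup>\<star> \<otimes> (u \<otimes> x) = u \<otimes> (s\<^sup>\<star> \<otimes> (u\<^sup>\<star> \<otimes> x))"
proof -
  assume x: "x \<in> carrier A"
  have "s\<^sup>\<star> \<otimes> (u \<otimes> x) = (s\<^sup>\<star> \<otimes> u) \<otimes> x" using x by (simp add: m_assoc)
  then show ?thesis unfolding sstar_u using x by (simp add: m_assoc)
qed

primrec spow :: "nat \<Rightarrow> 'a" where
  "spow 0 = \<one>"
| spow_Suc: "spow (Suc n) = s \<otimes> spow n"

lemma spow_closed [simp, intro]: "spow n \<in> carrier A"
  by (induction n) auto

lemma spow_commute: "spow n \<otimes> s = s \<otimes> spow n"
  by (induction n) (auto simp: m_assoc)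

lemma spow_upow: "spow n \<otimes> upow a = upow (2 ^ n * a) \<otimes> spow n"
proof (induction n arbitrary: a)
  case (Suc n)
  have "spow (Suc n) \<otimes> upow a = s \<otimes> (upow (2 ^ n * a) \<otimes> spow n)"
    unfolding spow_Suc using Suc by (simp add: m_assoc)
  then show ?case by (simp add: s_upow_assoc spow_Suc mult.assoc)
qed simp

lemma spow_star_commute: "(spow n)\<^sup>\<star> \<otimes> s\<^sup>\<star> = s\<^sup>\<star> \<otimes> (spow n)\<^sup>\<star>"
  using arg_cong[OF spow_commute[of n], of "star A"] by (simp add: star_mult)

lemma spow_star_commute_assoc:
  "x \<in> carrier A \<Longrightarrow> (spow n)\<^sup>\<star> \<otimes> (s\<^sup>\<star> \<otimes> x) = s\<^sup>\<star> \<otimes> ((spow n)\<^sup>\<star> \<otimes> x)"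
  using spow_star_commute[of n] by (simp flip: m_assoc)

lemma spow_star_Suc: "(spow (Suc n))\<^sup>\<star> = s\<^sup>\<star> \<otimes> (spow n)\<^sup>\<star>"
  by (simp add: star_mult spow_star_commute)

lemma ustar_spow_star: "u\<^sup>\<star> \<otimes> (spow n)\<^sup>\<star> = (spow n)\<^sup>\<star> \<otimes> upow (- (2 ^ n))"
  using arg_cong[OF spow_upow[of n 1], of "star A"] by (simp add: star_mult upow_star upow_1)

text \<open>The sign of \<open>b\<close> lets the adjoint simply exchange \<open>a, m\<close> with
  \<open>b, k\<close>.\<close>

definition monomial :: "int \<Rightarrow> nat \<Rightarrow> nat \<Rightarrow> int \<Rightarrow> 'a" where
  "monomial a m k b = upow a \<otimes> (spow m \<otimes> ((spow k)\<^sup>\<star> \<otimes> upow (- b)))"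

lemma monomial_closed [simp, intro]: "monomial a m k b \<in> carrier A"
  by (simp add: monomial_def)

lemma star_monomial: "(monomial a m k b)\<^sup>\<star> = monomial b k m a"
  by (simp add: monomial_def star_mult upow_star m_assoc)

lemma upow_monomial: "upow c \<otimes> monomial a m k b = monomial (c + a) m k b"
  by (simp add: monomial_def upow_add_assoc)

lemma s_monomial: "s \<otimes> monomial a m k b = monomial (2 * a) (Suc m) k b"
  by (simp add: monomial_def s_upow_assoc spow_Suc m_assoc)

text \<open>Elements of degree \<open>d\<close> for the gauge action \<open>u \<mapsto> u\<close>, \<open>s \<mapsto> z s\<close>.\<close>

definition homog :: "int \<Rightarrow> 'a set" where
  "homog d = lspan {monomial a m k b | a m k b. int m - int k = d}"

lemma monomial_homog: "monomial a m k b \<in> homog (int m - int k)"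
  unfolding homog_def by (rule lspan_base) auto

lemma monomial_homog': "int m - int k = d \<Longrightarrow> monomial a m k b \<in> homog d"
  using monomial_homog by blast

lemma homog_closed [simp]: "x \<in> homog d \<Longrightarrow> x \<in> carrier A"
  unfolding homog_def by (rule lspan_closed) auto

lemma homog_add: "\<lbrakk>x \<in> homog d; y \<in> homog d\<rbrakk> \<Longrightarrow> x \<oplus> y \<in> homog d"
  unfolding homog_def by (rule lspan_add) auto

lemma homog_smult: "x \<in> homog d \<Longrightarrow> c \<odot> x \<in> homog d"
  unfolding homog_def by (rule lspan_smult) auto

lemma homog_zero [simp]: "\<zero> \<in> homog d"
  unfolding homog_def by (rule lspan_zero)

lemma homog_left_mult:
  assumes x: "x \<in> homog d" and y: "y \<in> carrier A"
    and m: "\<And>a m k b. int m - int k = d \<Longrightarrow> y \<otimes> monomial a m k b \<in> homog e"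
  shows "y \<otimes> x \<in> homog e"
  unfolding homog_def
  by (rule lspan_linear[OF x[unfolded homog_def], where g = "\<lambda>c. c"])
    (use y m in \<open>auto simp: r_distr smult_mult_r homog_def\<close>)

lemma upow_homog: "x \<in> homog d \<Longrightarrow> upow a \<otimes> x \<in> homog d"
  by (rule homog_left_mult) (auto simp: upow_monomial monomial_homog')

lemma s_homog: "x \<in> homog d \<Longrightarrow> s \<otimes> x \<in> homog (d + 1)"
  by (rule homog_left_mult) (auto simp: s_monomial intro!: monomial_homog')

text \<open>Four cases. For even \<open>a\<close> the power of \<open>u\<close> is halved and
  \<open>s\<^sup>\<star>\<close> either cancels an \<open>s\<close> or joins the starred block; for
  odd \<open>a\<close> orthogonality of the ranges gives zero unless \<open>m = 0\<close>, where
  \<open>sstar_u\<close> applies.\<close>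

lemma sstar_homog: "x \<in> homog d \<Longrightarrow> s\<^sup>\<star> \<otimes> x \<in> homog (d - 1)"
proof (rule homog_left_mult)
  fix a m k b assume d: "int m - int k = d"
  show "s\<^sup>\<star> \<otimes> monomial a m k b \<in> homog (d - 1)"
  proof (cases "even a")
    case True
    then obtain c where a: "a = 2 * c" by auto
    show ?thesis
    proof (cases m)
      case 0
      have "s\<^sup>\<star> \<otimes> monomial a m k b = monomial c 0 (Suc k) b"
        unfolding monomial_def a 0 by (simp add: sstar_upow_even_assoc star_mult m_assoc spow_star_commute_assoc)
      then show ?thesis using d 0 by (auto intro: monomial_homog')
    next
      case (Suc m')
      have "s\<^sup>\<star> \<otimes> monomial a m k b = monomial c m' k b"
        unfolding monomial_def a Suc spow_Suc by (simp add: sstar_upow_even_assoc m_assoc gen_rel_assoc)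
      then show ?thesis using d Suc by (auto intro: monomial_homog')
    qed
  next
    case False
    then obtain c where a: "a = 2 * c + 1" using oddE by blast
    show ?thesis
    proof (cases m)
      case 0
      \<comment> \<open>Moving \<open>u\<^sup>\<star>\<close> to the right through \<open>k\<close>
        factors \<open>s\<^sup>\<star>\<close> doubles its exponent \<open>k\<close> times, whence
        \<open>2 ^ k\<close>.\<close>
      have "u\<^sup>\<star> \<otimes> ((spow k)\<^sup>\<star> \<otimes> upow (- b)) = (spow k)\<^sup>\<star> \<otimes> upow (- (b + 2 ^ k))"
        using ustar_spow_star[of k] by (simp add: upow_add m_assoc algebra_simps flip: m_assoc[of "u\<^sup>\<star>"])
      then have "s\<^sup>\<star> \<otimes> monomial a m k b = upow c \<otimes> (u \<otimes> (s\<^sup>\<star> \<otimes> ((spow k)\<^sup>\<star> \<otimes> upow (- (b + 2 ^ k)))))"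
        unfolding monomial_def a 0 by (simp add: sstar_upow_odd_assoc sstar_u_assoc)
      also have "\<dots> = monomial (c + 1) 0 (Suc k) (b + 2 ^ k)"
        using upow_add_assoc[of _ c 1] by (simp add: monomial_def upow_1 star_mult m_assoc spow_star_commute_assoc)
      finally show ?thesis using d 0 by (auto intro: monomial_homog')
    next
      case (Suc m')
      have "s\<^sup>\<star> \<otimes> monomial a m k b = \<zero>"
        unfolding monomial_def a Suc spow_Suc
        by (simp add: sstar_upow_odd_assoc m_assoc ranges_orthogonal_assoc)
      then show ?thesis by simp
    qed
  qed
qed auto

text \<open>A monomial is applied to \<open>y\<close> one generator at a time, and each generator
  shifts the degree by a known amount.\<close>

lemma homog_mult:
  assumes x: "x \<in> homog d" and y: "y \<in> homog e" shows "x \<otimes> y \<in> homog (d + e)"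
proof -
  have sp: "spow m \<otimes> y \<in> homog (int m + e)" if "y \<in> homog e" for m y e
  proof (induction m)
    case (Suc m)
    then have "s \<otimes> (spow m \<otimes> y) \<in> homog (int m + e + 1)" by (rule s_homog)
    then show ?case unfolding spow_Suc using that by (simp add: m_assoc algebra_simps)
  qed (use that in simp)
  have ss: "(spow k)\<^sup>\<star> \<otimes> y \<in> homog (e - int k)" if "y \<in> homog e" for k y e
  proof (induction k)
    case (Suc k)
    then have "s\<^sup>\<star> \<otimes> ((spow k)\<^sup>\<star> \<otimes> y) \<in> homog (e - int k - 1)" by (rule sstar_homog)
    then show ?case unfolding spow_star_Suc using that by (simp add: m_assoc algebra_simps)
  qed (use that in simp)
  have mm: "monomial a m k b \<otimes> y \<in> homog (d + e)" if "int m - int k = d" for a m k b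
  proof -
    have "upow a \<otimes> (spow m \<otimes> ((spow k)\<^sup>\<star> \<otimes> (upow (- b) \<otimes> y))) \<in> homog (int m + (e - int k))"
      using y by (intro upow_homog sp ss)
    then show ?thesis using y that by (simp add: monomial_def m_assoc algebra_simps)
  qed
  show ?thesis unfolding homog_def
    by (rule lspan_linear[OF x[unfolded homog_def], where g = "\<lambda>c. c"])
      (use homog_closed[OF y] mm in \<open>auto simp: l_distr smult_mult_l homog_def\<close>)
qed

lemma homog_star: assumes "x \<in> homog d" shows "x\<^sup>\<star> \<in> homog (- d)"
proof -
  have mm: "monomial b k m a \<in> homog (- d)" if "int m - int k = d" for a m k b
    using that by (intro monomial_homog') simp
  show ?thesis unfolding homog_def
    by (rule lspan_linear[OF assms[unfolded homog_def], where g = cnj])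
      (use mm in \<open>auto simp: star_simps star_monomial homog_def\<close>)
qed

text \<open>Only the gauge degree is bounded, not the exponents: it is the number of homogeneous
  components that has to grow slowly under powers.\<close>

definition poly_deg :: "nat \<Rightarrow> 'a set" where
  "poly_deg N = lspan {monomial a m k b | a m k b. \<bar>int m - int k\<bar> \<le> int N}"

definition polys :: "'a set" where
  "polys = (\<Union>N. poly_deg N)"

lemma poly_deg_closed: "x \<in> poly_deg N \<Longrightarrow> x \<in> carrier A"
  unfolding poly_deg_def by (rule lspan_closed) auto

lemma poly_deg_mono: "\<lbrakk>x \<in> poly_deg N; N \<le> M\<rbrakk> \<Longrightarrow> x \<in> poly_deg M"
  unfolding poly_deg_def by (erule lspan_mono) force

lemma homog_poly_deg: "\<lbrakk>x \<in> homog d; \<bar>d\<bar> \<le> int N\<rbrakk> \<Longrightarrow> x \<in> poly_deg N"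
  unfolding poly_deg_def homog_def by (erule lspan_mono) force

lemma poly_deg_mult: "\<lbrakk>x \<in> poly_deg N; y \<in> poly_deg M\<rbrakk> \<Longrightarrow> x \<otimes> y \<in> poly_deg (N + M)"
proof -
  assume x: "x \<in> poly_deg N" and y: "y \<in> poly_deg M"
  have mm: "monomial a m k b \<otimes> monomial a' m' k' b' \<in> poly_deg (N + M)"
    if "\<bar>int m - int k\<bar> \<le> int N" "\<bar>int m' - int k'\<bar> \<le> int M" for a m k b a' m' k' b'
    using that by (intro homog_poly_deg[OF homog_mult[OF monomial_homog monomial_homog]]) linarith
  show ?thesis unfolding poly_deg_def
    by (rule lspan_mult[OF x[unfolded poly_deg_def] y[unfolded poly_deg_def]])
      (use mm in \<open>auto simp: poly_deg_def\<close>)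
qed

lemma poly_deg_add: "\<lbrakk>x \<in> poly_deg N; y \<in> poly_deg N\<rbrakk> \<Longrightarrow> x \<oplus> y \<in> poly_deg N"
  unfolding poly_deg_def by (rule lspan_add) auto

lemma poly_deg_smult: "x \<in> poly_deg N \<Longrightarrow> c \<odot> x \<in> poly_deg N"
  unfolding poly_deg_def by (rule lspan_smult) auto

lemma poly_deg_star: "x \<in> poly_deg N \<Longrightarrow> x\<^sup>\<star> \<in> poly_deg N"
proof -
  assume x: "x \<in> poly_deg N"
  have mm: "monomial b k m a \<in> poly_deg N" if "\<bar>int m - int k\<bar> \<le> int N" for a m k b
    using that by (intro homog_poly_deg[OF monomial_homog]) simp
  show ?thesis unfolding poly_deg_def
    by (rule lspan_linear[OF x[unfolded poly_deg_def], where g = cnj])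
      (use mm in \<open>auto simp: star_simps star_monomial poly_deg_def\<close>)
qed

lemma polys_closed: "x \<in> polys \<Longrightarrow> x \<in> carrier A"
  using poly_deg_closed by (auto simp: polys_def)

lemma homog_polys: "x \<in> homog d \<Longrightarrow> x \<in> polys"
  unfolding polys_def using homog_poly_deg[of x d "nat \<bar>d\<bar>"] by auto

lemma polys_mult: "\<lbrakk>x \<in> polys; y \<in> polys\<rbrakk> \<Longrightarrow> x \<otimes> y \<in> polys"
  unfolding polys_def using poly_deg_mult by blast

lemma polys_add: "\<lbrakk>x \<in> polys; y \<in> polys\<rbrakk> \<Longrightarrow> x \<oplus> y \<in> polys"
proof -
  assume "x \<in> polys" "y \<in> polys"
  then obtain N M where "x \<in> poly_deg N" "y \<in> poly_deg M" by (auto simp: polys_def)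
  then have "x \<oplus> y \<in> poly_deg (max N M)" by (intro poly_deg_add; elim poly_deg_mono) auto
  then show ?thesis by (auto simp: polys_def)
qed

lemma polys_gen: "u \<in> polys" "s \<in> polys" "\<one> \<in> polys" "\<zero> \<in> polys" "u\<^sup>\<star> \<in> polys" "s\<^sup>\<star> \<in> polys"
proof -
  have "monomial 1 0 0 0 = u" "monomial 0 1 0 0 = s" "monomial 0 0 0 0 = \<one>" "monomial (-1) 0 0 0 = u\<^sup>\<star>"
    "monomial 0 0 1 0 = s\<^sup>\<star>"
    by (simp_all add: monomial_def upow_1)
  then show "u \<in> polys" "s \<in> polys" "\<one> \<in> polys" "\<zero> \<in> polys" "u\<^sup>\<star> \<in> polys" "s\<^sup>\<star> \<in> polys"
    using homog_polys monomial_homog homog_zero by metis+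
qed

lemma generated_dense:
  assumes "cstar_generated A {u, s} = carrier A" and x: "x \<in> carrier A"
  shows "x \<in> seq_closure polys"
proof -
  have "cstar_subalgebra (seq_closure polys) A"
  proof (rule seq_closure_subalgebra)
    show "c \<odot> x \<in> polys" if "x \<in> polys" for c x using that poly_deg_smult by (auto simp: polys_def)
    show "x\<^sup>\<star> \<in> polys" if "x \<in> polys" for x using that poly_deg_star by (auto simp: polys_def)
  qed (use polys_closed polys_gen polys_add polys_mult in auto)
  moreover have "{u, s} \<subseteq> seq_closure polys"
    using seq_closureI[OF tends_const[of u]] seq_closureI[OF tends_const[of s]] polys_gen by simp
  ultimately show ?thesis using assms unfolding cstar_generated_def by blast
qed

lemma poly_deg_decompose:
  assumes "x \<in> poly_deg N"
  obtains v where "\<And>d. v d \<in> homog d" "x = (\<Oplus>d\<in>{- int N..int N}. v d)"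
proof -
  have "\<exists>v. (\<forall>d. v d \<in> homog d) \<and> x = (\<Oplus>d\<in>{- int N..int N}. v d)"
    using assms unfolding poly_deg_def
  proof (induction rule: lspan.induct)
    case lspan_zero
    then show ?case by (intro exI[of _ "\<lambda>_. \<zero>"]) auto
  next
    case (lspan_step x mm c)
    then obtain v where v: "\<And>d. v d \<in> homog d" "x = (\<Oplus>d\<in>{- int N..int N}. v d)" by auto
    obtain a m k b where mm: "mm = monomial a m k b" "\<bar>int m - int k\<bar> \<le> int N" using lspan_step by auto
    define e where "e = int m - int k"
    have mh: "c \<odot> mm \<in> homog e" unfolding mm e_def by (intro homog_smult monomial_homog)
    define w where "w d = (if e = d then c \<odot> mm else \<zero>) \<oplus> v d" for d
    have "w d \<in> homog d" for d unfolding w_def using mh v(1)[of d] homog_add by auto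
    moreover have "(\<Oplus>d\<in>{- int N..int N}. w d)
        = (\<Oplus>d\<in>{- int N..int N}. if e = d then c \<odot> mm else \<zero>) \<oplus> x"
      unfolding w_def v(2) using homog_closed[OF v(1)] homog_closed[OF mh] by (intro finsum_addf) auto
    moreover have "(\<Oplus>d\<in>{- int N..int N}. if e = d then c \<odot> mm else \<zero>) = c \<odot> mm"
      using mm mh by (intro finsum_singleton) (auto simp: e_def)
    ultimately show ?case by (metis (no_types))
  qed
  then show ?thesis using that by blast
qed

end

section \<open>The limit state\<close>

context diadic_algebra
begin

text \<open>The iterates \<open>Phi\<^sup>n x\<close> converge to a scalar multiple \<open>psi x\<close> of \<open>\<one>\<close>; so every nonzero closed ideal that
  is invariant under \<open>Phi\<close> contains \<open>\<one>\<close>, once \<open>psi\<close> is known to be faithful.\<close>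

definition Phi :: "'a \<Rightarrow> 'a" where
  "Phi x = (1/2) \<odot> (s\<^sup>\<star> \<otimes> (x \<otimes> s) \<oplus> s1\<^sup>\<star> \<otimes> (x \<otimes> s1))"

lemma Phi_closed [simp, intro]: "x \<in> carrier A \<Longrightarrow> Phi x \<in> carrier A"
  by (simp add: Phi_def)

lemma Phi_add: "\<lbrakk>x \<in> carrier A; y \<in> carrier A\<rbrakk> \<Longrightarrow> Phi (x \<oplus> y) = Phi x \<oplus> Phi y"
  unfolding Phi_def using gen_closed by algebra

lemma Phi_smult: "x \<in> carrier A \<Longrightarrow> Phi (c \<odot> x) = c \<odot> Phi x"
  by (simp add: Phi_def smult_mult_l smult_mult_r smult_smult smult_r_distr mult.commute)

lemma Phi_star: "x \<in> carrier A \<Longrightarrow> Phi (x\<^sup>\<star>) = (Phi x)\<^sup>\<star>"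
  unfolding Phi_def by (simp add: star_simps m_assoc)

lemma Phi_one: "Phi \<one> = \<one>"
  unfolding Phi_def using s1_rel gen_rel half_double[of \<one>] by simp

lemma gen_norm: "\<parallel>s\<parallel> \<le> 1" "\<parallel>s1\<parallel> \<le> 1"
  using gen_rel(3) s1_rel(1) by (auto intro: norm_isometry_le)

lemma norm_conj_isometry_le:
  assumes "x \<in> carrier A" "v \<in> carrier A" "\<parallel>v\<parallel> \<le> 1"
  shows "\<parallel>v\<^sup>\<star> \<otimes> (x \<otimes> v)\<parallel> \<le> \<parallel>x\<parallel>"
proof -
  have "\<parallel>v\<^sup>\<star> \<otimes> (x \<otimes> v)\<parallel> \<le> 1 * (\<parallel>x\<parallel> * 1)" using assms by (intro norm_mult_le) auto
  then show ?thesis by simp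
qed

lemma Phi_norm_le: "x \<in> carrier A \<Longrightarrow> \<parallel>Phi x\<parallel> \<le> \<parallel>x\<parallel>"
  unfolding Phi_def using norm_conj_isometry_le[of x s] norm_conj_isometry_le[of x s1] gen_norm
    cnorm_triangle[of "s\<^sup>\<star> \<otimes> (x \<otimes> s)" "s1\<^sup>\<star> \<otimes> (x \<otimes> s1)"]
  by (simp add: cnorm_smult)

lemma Phi_pos: assumes "pos x" shows "pos (Phi x)"
proof -
  have "pos (s\<^sup>\<star> \<otimes> x \<otimes> s \<oplus> s1\<^sup>\<star> \<otimes> x \<otimes> s1)" using assms by (intro pos_add pos_conj) auto
  then have "pos (complex_of_real (1/2) \<odot> (s\<^sup>\<star> \<otimes> x \<otimes> s \<oplus> s1\<^sup>\<star> \<otimes> x \<otimes> s1))" by (rule pos_smult) simp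
  then show ?thesis using posD[OF assms] by (simp add: Phi_def m_assoc)
qed

abbreviation Phin :: "nat \<Rightarrow> 'a \<Rightarrow> 'a" where "Phin n \<equiv> Phi ^^ n"

lemma Phin_closed [simp, intro]: "x \<in> carrier A \<Longrightarrow> Phin n x \<in> carrier A"
  by (induction n) auto

lemma Phin_add: "\<lbrakk>x \<in> carrier A; y \<in> carrier A\<rbrakk> \<Longrightarrow> Phin n (x \<oplus> y) = Phin n x \<oplus> Phin n y"
  by (induction n) (auto simp: Phi_add)

lemma Phin_smult: "x \<in> carrier A \<Longrightarrow> Phin n (c \<odot> x) = c \<odot> Phin n x"
  by (induction n) (auto simp: Phi_smult)

lemma Phin_diff: "\<lbrakk>x \<in> carrier A; y \<in> carrier A\<rbrakk> \<Longrightarrow> Phin n (x \<ominus> y) = Phin n x \<ominus> Phin n y"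
  by (simp add: minus_eq uminus_eq_smult Phin_add Phin_smult)

lemma Phin_star: "x \<in> carrier A \<Longrightarrow> Phin n (x\<^sup>\<star>) = (Phin n x)\<^sup>\<star>"
  by (induction n) (auto simp: Phi_star)

lemma Phin_norm_le: "x \<in> carrier A \<Longrightarrow> \<parallel>Phin n x\<parallel> \<le> \<parallel>x\<parallel>"
  by (induction n) (auto intro: order_trans[OF Phi_norm_le])

lemma Phin_pos: "pos x \<Longrightarrow> pos (Phin n x)"
  by (induction n) (auto intro: Phi_pos)

lemma Phin_Suc: "Phin (Suc n) x = Phin n (Phi x)"
  by (simp add: funpow_swap1)

text \<open>A relation and not a limit function, because convergence is established first for
  monomials and only later, by density, for all elements.\<close>

definition conv :: "'a \<Rightarrow> complex \<Rightarrow> bool" where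
  "conv x c \<longleftrightarrow> x \<in> carrier A \<and> (\<lambda>n. Phin n x) \<leadsto> c \<odot> \<one>"

lemma conv_add: "\<lbrakk>conv x c; conv y d\<rbrakk> \<Longrightarrow> conv (x \<oplus> y) (c + d)"
  unfolding conv_def using tends_add[of "\<lambda>n. Phin n x" "c \<odot> \<one>" "\<lambda>n. Phin n y" "d \<odot> \<one>"]
  by (simp add: Phin_add smult_l_distr)

lemma conv_smult: "conv x c \<Longrightarrow> conv (d \<odot> x) (d * c)"
  unfolding conv_def using tends_smult[of "\<lambda>n. Phin n x" "c \<odot> \<one>" d] by (simp add: Phin_smult smult_smult)

lemma conv_star: "conv x c \<Longrightarrow> conv (x\<^sup>\<star>) (cnj c)"
  unfolding conv_def using tends_star[of "\<lambda>n. Phin n x" "c \<odot> \<one>"] by (simp add: Phin_star star_smult)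

lemma conv_Phi: "\<lbrakk>conv (Phi x) c; x \<in> carrier A\<rbrakk> \<Longrightarrow> conv x c"
  unfolding conv_def using tends_shift[of "\<lambda>n. Phin n x"] by (simp only: Phin_Suc) simp

lemma conv_zero: "conv \<zero> 0"
proof -
  have "Phin n \<zero> = \<zero>" for n using Phin_smult[of \<zero> n 0] by simp
  then show ?thesis unfolding conv_def using tends_const[of \<zero>] by simp
qed

lemma conv_one: "conv \<one> 1"
proof -
  have "Phin n \<one> = \<one>" for n by (induction n) (auto simp: Phi_one)
  then show ?thesis unfolding conv_def using tends_const[of \<one>] by simp
qed

text \<open>Both compressions of a power of \<open>u\<close> agree, so \<open>Phi\<close> halves
  even exponents and annihilates odd powers. A nonzero exponent becomes odd after finitely many
  halvings.\<close>

lemma conv_upow: "conv (upow a) (of_bool (a = 0))"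
proof (induction "nat \<bar>a\<bar>" arbitrary: a rule: less_induct)
  case less
  have "u\<^sup>\<star> \<otimes> (upow a \<otimes> u) = upow a"
    using upow_add[of "-1" "a + 1"] upow_add[of a 1] by (simp add: upow_1)
  then have "s1\<^sup>\<star> \<otimes> (upow a \<otimes> s1) = s\<^sup>\<star> \<otimes> (upow a \<otimes> s)"
    by (simp add: star_mult m_assoc) (simp flip: m_assoc)
  then have Phi: "Phi (upow a) = (if even a then upow (a div 2) else \<zero>)"
    unfolding Phi_def by (simp add: compress_upow' half_double)
  show ?case
  proof (cases "a = 0")
    case False
    show ?thesis
    proof (cases "even a")
      case True
      then have "nat \<bar>a div 2\<bar> < nat \<bar>a\<bar>" "a div 2 \<noteq> 0" using False by auto
      then show ?thesis using less[of "a div 2"] conv_Phi[of "upow a"] Phi True False by simp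
    qed (use conv_Phi[of "upow a"] Phi conv_zero in auto)
  qed (use conv_one in simp)
qed

text \<open>Moving \<open>u\<close> through \<open>spow (Suc d)\<close> changes the exponent by the
  even number \<open>2 ^ Suc d\<close>, and the \<open>u\<^sup>\<star>\<close> on the left by one,
  so exactly one of the two compressions survives. The remaining factor 1/2 makes the iterates
  decay.\<close>

lemma Phi_upow_spow:
  "\<exists>b. Phi (upow a \<otimes> spow (Suc d)) = (1/2) \<odot> (upow b \<otimes> spow (Suc d))"
proof -
  have c0: "s\<^sup>\<star> \<otimes> (upow a \<otimes> spow (Suc d) \<otimes> s) = (if even a then upow (a div 2) \<otimes> spow (Suc d) else \<zero>)" for a
    using compress_upow[of "spow (Suc d)" a] by (simp add: m_assoc spow_commute)
  have "s1\<^sup>\<star> \<otimes> (upow a \<otimes> spow (Suc d) \<otimes> s1) = s\<^sup>\<star> \<otimes> (u\<^sup>\<star> \<otimes> (upow a \<otimes> (spow (Suc d) \<otimes> u)) \<otimes> s)"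
    by (simp add: star_mult m_assoc)
  also have "spow (Suc d) \<otimes> u = upow (2 ^ Suc d) \<otimes> spow (Suc d)"
    using spow_upow[of "Suc d" 1] by (simp add: upow_1)
  also have "u\<^sup>\<star> \<otimes> (upow a \<otimes> (upow (2 ^ Suc d) \<otimes> spow (Suc d))) = upow (a + 2 ^ Suc d - 1) \<otimes> spow (Suc d)"
    using upow_add_assoc[of "spow (Suc d)" "-1" "a + 2 ^ Suc d"] upow_add_assoc[of "spow (Suc d)" a "2 ^ Suc d"]
    by (simp only: upow_1 spow_closed) (simp add: algebra_simps)
  also note c0
  finally have c1: "s1\<^sup>\<star> \<otimes> (upow a \<otimes> spow (Suc d) \<otimes> s1)
    = (if odd a then upow ((a + 2 ^ Suc d - 1) div 2) \<otimes> spow (Suc d) else \<zero>)" by simp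
  show ?thesis
  proof (cases "even a")
    case True
    then show ?thesis unfolding Phi_def c0 c1 by (intro exI[of _ "a div 2"]) simp
  next
    case False
    then show ?thesis unfolding Phi_def c0 c1 by (intro exI[of _ "(a + 2 ^ Suc d - 1) div 2"]) simp
  qed
qed

lemma spow_norm_le: "\<parallel>spow d\<parallel> \<le> 1"
proof (induction d)
  case (Suc d)
  have "\<parallel>s \<otimes> spow d\<parallel> \<le> 1 * 1" using Suc gen_norm by (intro norm_mult_le) auto
  then show ?case by simp
qed (use norm_one_le in simp)

lemma conv_upow_spow: "conv (upow a \<otimes> spow (Suc d)) 0"
proof -
  have "\<parallel>Phin n (upow a \<otimes> spow (Suc d))\<parallel> \<le> (1/2) ^ n" for n
  proof (induction n arbitrary: a)
    case 0
    have "\<parallel>upow a \<otimes> spow (Suc d)\<parallel> \<le> 1 * 1" by (intro norm_mult_le upow_norm_le spow_norm_le) auto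
    then show ?case by simp
  next
    case (Suc n)
    obtain b where b: "Phi (upow a \<otimes> spow (Suc d)) = (1/2) \<odot> (upow b \<otimes> spow (Suc d))"
      using Phi_upow_spow by blast
    show ?case unfolding Phin_Suc b using Suc[of b] by (subst Phin_smult) (auto simp: cnorm_smult)
  qed
  moreover have "(\<lambda>n. (1/2::real) ^ n) \<longlonglongrightarrow> 0" by (intro LIMSEQ_power_zero) auto
  ultimately have "(\<lambda>n. Phin n (upow a \<otimes> spow (Suc d))) \<leadsto> \<zero>"
    by (intro tendsI[where e = "\<lambda>n. (1/2) ^ n"]) (auto simp: minus_eq)
  then show ?thesis unfolding conv_def by simp
qed

text \<open>The left exponent must be even for \<open>s\<^sup>\<star>\<close> to pass, and
  symmetrically the right one. Conjugation by \<open>u\<close> lowers both by one, which gives the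
  odd case.\<close>

lemma compress_monomial:
  "s\<^sup>\<star> \<otimes> (monomial a (Suc m) (Suc k) b \<otimes> s)
     = (if even a \<and> even b then monomial (a div 2) m k (b div 2) else \<zero>)"
  "s1\<^sup>\<star> \<otimes> (monomial a (Suc m) (Suc k) b \<otimes> s1)
     = (if odd a \<and> odd b then monomial (a div 2) m k (b div 2) else \<zero>)"
proof -
  have e: "s\<^sup>\<star> \<otimes> (monomial a (Suc m) (Suc k) b \<otimes> s)
     = (if even a \<and> even b then monomial (a div 2) m k (b div 2) else \<zero>)" for a b
  proof -
    have "s\<^sup>\<star> \<otimes> (monomial a (Suc m) (Suc k) b \<otimes> s)
      = s\<^sup>\<star> \<otimes> (upow a \<otimes> (s \<otimes> (spow m \<otimes> ((spow k)\<^sup>\<star> \<otimes> (s\<^sup>\<star> \<otimes> (upow (- b) \<otimes> s))))))"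
      by (simp add: monomial_def star_mult m_assoc)
    also have "\<dots> = (if even a \<and> even b then upow (a div 2) \<otimes> (spow m \<otimes> ((spow k)\<^sup>\<star> \<otimes> upow ((- b) div 2))) else \<zero>)"
      by (subst compress_upow) (auto simp: compress_upow')
    finally have *: "s\<^sup>\<star> \<otimes> (monomial a (Suc m) (Suc k) b \<otimes> s)
      = (if even a \<and> even b then upow (a div 2) \<otimes> (spow m \<otimes> ((spow k)\<^sup>\<star> \<otimes> upow ((- b) div 2))) else \<zero>)" .
    have "even b \<Longrightarrow> (- b) div 2 = - (b div 2)" by presburger
    then show ?thesis unfolding * by (auto simp: monomial_def)
  qed
  show "s\<^sup>\<star> \<otimes> (monomial a (Suc m) (Suc k) b \<otimes> s)
     = (if even a \<and> even b then monomial (a div 2) m k (b div 2) else \<zero>)" by (rule e)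
  have "s1\<^sup>\<star> \<otimes> (monomial a (Suc m) (Suc k) b \<otimes> s1) = s\<^sup>\<star> \<otimes> ((u\<^sup>\<star> \<otimes> (monomial a (Suc m) (Suc k) b \<otimes> u)) \<otimes> s)"
    by (simp add: star_mult m_assoc)
  also have "u\<^sup>\<star> \<otimes> (monomial a (Suc m) (Suc k) b \<otimes> u) = monomial (a - 1) (Suc m) (Suc k) (b - 1)"
    using upow_add_assoc[of _ "-1" a] upow_add[of "- b" 1] by (simp add: monomial_def upow_1 m_assoc del: spow.simps)
  also note e
  finally show "s1\<^sup>\<star> \<otimes> (monomial a (Suc m) (Suc k) b \<otimes> s1)
     = (if odd a \<and> odd b then monomial (a div 2) m k (b div 2) else \<zero>)"
    by (auto elim!: oddE)
qed

text \<open>Each application of \<open>Phi\<close> strips one \<open>s\<close> from both sides and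
  contributes 1/2, until one side is exhausted and \<open>conv_upow\<close> or
  \<open>conv_upow_spow\<close> applies. For equal parities \<open>a = b\<close> is equivalent to
  equality of the halves, so the diagonal condition is inherited.\<close>

lemma conv_monomial:
  "conv (monomial a m k b) (if m = k \<and> a = b then (1/2) ^ m else 0)"
proof (induction m arbitrary: k a b)
  case 0
  show ?case
  proof (cases k)
    case 0
    then have "monomial a 0 k b = upow (a - b)" by (simp add: monomial_def upow_add)
    then show ?thesis using conv_upow[of "a - b"] 0 conv_one by (cases "a = b") auto
  next
    case (Suc k')
    have "monomial a 0 k b = (monomial b k 0 a)\<^sup>\<star>" by (simp add: star_monomial)
    also have "monomial b k 0 a = upow (b - 2 ^ k * a) \<otimes> spow (Suc k')"
      using spow_upow[of k "- a"] upow_add_assoc[of "spow k" b "- (2 ^ k * a)"] Suc by (simp add: monomial_def del: spow.simps) (simp add: algebra_simps)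
    finally show ?thesis using conv_star[OF conv_upow_spow[of "b - 2 ^ k * a" k']] Suc by simp
  qed
next
  case (Suc m)
  show ?case
  proof (cases k)
    case 0
    have "monomial a (Suc m) 0 b = upow (a - 2 ^ Suc m * b) \<otimes> spow (Suc m)"
      using spow_upow[of "Suc m" "- b"] upow_add_assoc[of "spow (Suc m)" a "- (2 ^ Suc m * b)"]
      by (simp add: monomial_def del: spow_Suc)
    then show ?thesis using conv_upow_spow[of "a - 2 ^ Suc m * b" m] 0 by simp
  next
    case k: (Suc k')
    have "Phi (monomial a (Suc m) k b) = (1/2) \<odot> (if even a = even b then monomial (a div 2) m k' (b div 2) else \<zero>)"
      unfolding Phi_def k compress_monomial by auto
    moreover have "conv (if even a = even b then monomial (a div 2) m k' (b div 2) else \<zero>)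
        (if m = k' \<and> a = b then (1/2) ^ m else 0)"
    proof (cases "even a = even b")
      case True
      then have "a div 2 = b div 2 \<longleftrightarrow> a = b" by presburger
      then show ?thesis using Suc[of "a div 2" k' "b div 2"] True by simp
    qed (use conv_zero in auto)
    ultimately have "conv (Phi (monomial a (Suc m) k b)) ((1/2) * (if m = k' \<and> a = b then (1/2) ^ m else 0))"
      using conv_smult by metis
    then have "conv (monomial a (Suc m) k b) ((1/2) * (if m = k' \<and> a = b then (1/2) ^ m else 0))"
      by (rule conv_Phi) simp
    then show ?thesis using k by (auto split: if_splits)
  qed
qed

lemma conv_homog: assumes "x \<in> homog d" "d \<noteq> 0" shows "conv x 0"
  using assms(1) unfolding homog_def
proof (induction rule: lspan.induct)
  case (lspan_step x mm c)
  then obtain a m k b where "mm = monomial a m k b" "int m - int k = d" by auto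
  then have "conv mm 0" using conv_monomial[of a m k b] assms(2) by auto
  then have "conv (c \<odot> mm \<oplus> x) (c * 0 + 0)" using lspan_step by (intro conv_add conv_smult)
  then show ?case by simp
qed (rule conv_zero)

lemma conv_polys: assumes "x \<in> polys" shows "\<exists>c. conv x c"
proof -
  obtain N where "x \<in> poly_deg N" using assms by (auto simp: polys_def)
  then show ?thesis unfolding poly_deg_def
  proof (induction rule: lspan.induct)
    case (lspan_step x mm c)
    then obtain a m k b d where "mm = monomial a m k b" "conv x d" by auto
    then show ?case using conv_add[OF conv_smult[OF conv_monomial]] by blast
  qed (use conv_zero in blast)
qed

lemma norm_one: "\<parallel>\<one>\<parallel> = 1"
proof -
  have "\<parallel>\<one>\<parallel> = \<parallel>\<one>\<parallel>\<^sup>2" "\<parallel>\<one>\<parallel> \<noteq> 0" using cstar_identity[of \<one>] nontrivial by (auto simp: cnorm_eq_0)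
  then show ?thesis by (simp add: power2_eq_square)
qed

lemma norm_scalar: "\<parallel>c \<odot> \<one>\<parallel> = cmod c"
  by (simp add: cnorm_smult norm_one)

lemma conv_norm_le: assumes "conv x c" shows "cmod c \<le> \<parallel>x\<parallel>"
proof -
  have "\<parallel>c \<odot> \<one>\<parallel> \<le> \<parallel>x\<parallel>"
    by (rule tends_norm_le[of "\<lambda>n. Phin n x"]) (use assms Phin_norm_le in \<open>auto simp: conv_def\<close>)
  then show ?thesis by (simp add: norm_scalar)
qed

lemma conv_unique: "\<lbrakk>conv x c; conv x d\<rbrakk> \<Longrightarrow> c = d"
  using conv_norm_le[OF conv_add[OF _ conv_smult[of x d "-1"]], of x c]
  by (auto simp: conv_def uminus_eq_smult[symmetric] r_neg)

end

locale diadic_cstar = diadic_algebra +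
  assumes generated: "cstar_generated A {u, s} = carrier A"
begin

lemma polys_approx: assumes "x \<in> carrier A" "e > 0" obtains y where "y \<in> polys" "\<parallel>y \<ominus> x\<parallel> < e"
  using generated_dense[OF generated assms(1)] seq_closure_approx assms(2) by blast

text \<open>Contractivity does both steps: the limits of a polynomial approximation form a Cauchy
  sequence by \<open>conv_norm_le\<close>, and \<open>Phin_norm_le\<close> bounds the error
  uniformly in the iterate.\<close>

lemma conv_exists: assumes x: "x \<in> carrier A" shows "\<exists>c. conv x c"
proof -
  obtain X where X: "\<And>n. X n \<in> polys" "X \<leadsto> x"
    using generated_dense[OF generated x] by (auto simp: seq_closure_def)
  note Xc = tendsD(1)[OF X(2)]
  have "\<forall>n. \<exists>c. conv (X n) c" using conv_polys X by blast
  then obtain c where c: "\<And>n. conv (X n) (c n)" by metis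
  have cd: "cmod (c n - c m) \<le> \<parallel>X n \<ominus> X m\<parallel>" for n m
    using conv_norm_le[OF conv_add[OF c[of n] conv_smult[OF c[of m], of "-1"]]] Xc
    by (simp add: minus_eq uminus_eq_smult)
  have lim: "(\<lambda>n. \<parallel>X n \<ominus> x\<parallel>) \<longlonglongrightarrow> 0" using X(2) by (simp add: tends_def)
  have "Cauchy c"
  proof (rule metric_CauchyI)
    fix e :: real assume "e > 0"
    then obtain N where N: "\<And>n. n \<ge> N \<Longrightarrow> \<parallel>X n \<ominus> x\<parallel> < e / 2"
      using order_tendstoD(2)[OF lim, of "e / 2"] by (auto simp: eventually_sequentially)
    have "dist (c m) (c n) < e" if "m \<ge> N" "n \<ge> N" for m n
      using cd[of m n] norm_diff_triangle[of "X m" x "X n"] norm_minus_commute[of x "X n"]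
        N[OF that(1)] N[OF that(2)] Xc x by (simp add: dist_norm)
    then show "\<exists>N. \<forall>m\<ge>N. \<forall>n\<ge>N. dist (c m) (c n) < e" by blast
  qed
  then obtain c0 where c0: "c \<longlonglongrightarrow> c0" using Cauchy_convergent_iff convergent_def by blast
  have "(\<lambda>n. \<parallel>Phin n x \<ominus> c0 \<odot> \<one>\<parallel>) \<longlonglongrightarrow> 0"
  proof (rule LIMSEQ_I)
    fix e :: real assume e: "e > 0"
    have "\<forall>\<^sub>F n in sequentially. \<parallel>X n \<ominus> x\<parallel> < e / 3" using lim e by (intro order_tendstoD(2)) auto
    moreover have "\<forall>\<^sub>F n in sequentially. dist (c n) c0 < e / 3" using c0 e by (intro tendstoD) auto
    ultimately have "\<forall>\<^sub>F n in sequentially. \<parallel>X n \<ominus> x\<parallel> < e / 3 \<and> dist (c n) c0 < e / 3"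
      by (rule eventually_conj)
    then obtain n where n: "\<parallel>X n \<ominus> x\<parallel> < e / 3" "cmod (c n - c0) < e / 3"
      unfolding eventually_sequentially dist_norm by blast
    have "(\<lambda>k. \<parallel>Phin k (X n) \<ominus> c n \<odot> \<one>\<parallel>) \<longlonglongrightarrow> 0" using c[of n] by (simp add: conv_def tends_def)
    then obtain K where K: "\<And>k. k \<ge> K \<Longrightarrow> \<parallel>Phin k (X n) \<ominus> c n \<odot> \<one>\<parallel> < e / 3"
      using order_tendstoD(2)[of _ 0 sequentially "e / 3"] e unfolding eventually_sequentially by force
    have "\<parallel>Phin k x \<ominus> c0 \<odot> \<one>\<parallel> < e" if "k \<ge> K" for k
    proof -
      have "\<parallel>Phin k x \<ominus> Phin k (X n)\<parallel> \<le> \<parallel>X n \<ominus> x\<parallel>"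
        using Phin_norm_le[of "x \<ominus> X n" k] norm_minus_commute[of x "X n"] x Xc by (simp add: Phin_diff)
      moreover have "\<parallel>c n \<odot> \<one> \<ominus> c0 \<odot> \<one>\<parallel> = cmod (c n - c0)"
        using norm_scalar[of "c n - c0"] smult_l_distr[of \<one> "c n" "- c0"]
        by (simp add: minus_eq smult_uminus_left)
      moreover have "\<parallel>Phin k x \<ominus> c0 \<odot> \<one>\<parallel> \<le> \<parallel>Phin k x \<ominus> Phin k (X n)\<parallel>
          + (\<parallel>Phin k (X n) \<ominus> c n \<odot> \<one>\<parallel> + \<parallel>c n \<odot> \<one> \<ominus> c0 \<odot> \<one>\<parallel>)"
        using norm_diff_triangle[of "Phin k x" "Phin k (X n)" "c0 \<odot> \<one>"]
          norm_diff_triangle[of "Phin k (X n)" "c n \<odot> \<one>" "c0 \<odot> \<one>"] x Xc by simp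
      ultimately show ?thesis using n K[OF that] by simp
    qed
    then show "\<exists>K. \<forall>k\<ge>K. norm (\<parallel>Phin k x \<ominus> c0 \<odot> \<one>\<parallel> - 0) < e"
      using x by (intro exI[of _ K]) auto
  qed
  then have "conv x c0" unfolding conv_def tends_def using x by simp
  then show ?thesis by blast
qed

definition psi :: "'a \<Rightarrow> complex" where "psi x = (THE c. conv x c)"

lemma psi_eqI: "conv x c \<Longrightarrow> psi x = c"
  unfolding psi_def using conv_unique by blast

lemma conv_psi: "x \<in> carrier A \<Longrightarrow> conv x (psi x)"
  using conv_exists psi_eqI by metis

lemma psi_add: "\<lbrakk>x \<in> carrier A; y \<in> carrier A\<rbrakk> \<Longrightarrow> psi (x \<oplus> y) = psi x + psi y"
  by (intro psi_eqI conv_add conv_psi)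

lemma psi_smult: "x \<in> carrier A \<Longrightarrow> psi (c \<odot> x) = c * psi x"
  by (intro psi_eqI conv_smult conv_psi)

lemma psi_uminus: "x \<in> carrier A \<Longrightarrow> psi (\<ominus> x) = - psi x"
  by (simp add: uminus_eq_smult psi_smult)

lemma psi_diff: "\<lbrakk>x \<in> carrier A; y \<in> carrier A\<rbrakk> \<Longrightarrow> psi (x \<ominus> y) = psi x - psi y"
  by (simp add: minus_eq psi_add psi_uminus)

lemma psi_star: "x \<in> carrier A \<Longrightarrow> psi (x\<^sup>\<star>) = cnj (psi x)"
  by (intro psi_eqI conv_star conv_psi)

lemma psi_zero [simp]: "psi \<zero> = 0" by (rule psi_eqI[OF conv_zero])

lemma psi_one: "psi \<one> = 1" by (rule psi_eqI[OF conv_one])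

lemma psi_norm_le: "x \<in> carrier A \<Longrightarrow> cmod (psi x) \<le> \<parallel>x\<parallel>"
  by (intro conv_norm_le conv_psi)

lemma psi_Phi: "x \<in> carrier A \<Longrightarrow> psi (Phi x) = psi x"
  by (metis Phi_closed conv_Phi conv_psi psi_eqI)

lemma psi_pos: assumes "pos x" shows "psi x = complex_of_real (Re (psi x))" "0 \<le> Re (psi x)"
proof -
  have "(\<lambda>n. Phin n x) \<leadsto> psi x \<odot> \<one>" using conv_psi[OF posD(1)[OF assms]] by (simp add: conv_def)
  then have "pos (psi x \<odot> \<one>)" by (rule pos_tends) (rule Phin_pos[OF assms])
  then show "psi x = complex_of_real (Re (psi x))" "0 \<le> Re (psi x)" using pos_scalar_iff nontrivial by auto
qed

lemma psi_compress:
  "x \<in> carrier A \<Longrightarrow> psi x = (psi (s\<^sup>\<star> \<otimes> (x \<otimes> s)) + psi (s1\<^sup>\<star> \<otimes> (x \<otimes> s1))) / 2"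
  by (subst psi_Phi[symmetric]) (simp_all add: Phi_def psi_add psi_smult)

text \<open>One of the two compressions in \<open>psi_compress\<close> returns \<open>x\<close> and
  the other vanishes. This scaling excludes nonzero solutions of the shift equation and makes the
  ranges of high powers of \<open>s\<close> and \<open>s1\<close> small.\<close>

lemma psi_expand: 
  assumes x: "x \<in> carrier A"
  shows "psi (s \<otimes> (x \<otimes> s\<^sup>\<star>)) = psi x / 2" "psi (s1 \<otimes> (x \<otimes> s1\<^sup>\<star>)) = psi x / 2"
proof -
  have iso: "v\<^sup>\<star> \<otimes> ((v \<otimes> (x \<otimes> v\<^sup>\<star>)) \<otimes> v) = x" if "v \<in> carrier A" "v\<^sup>\<star> \<otimes> v = \<one>" for v
  proof -
    have "v\<^sup>\<star> \<otimes> ((v \<otimes> (x \<otimes> v\<^sup>\<star>)) \<otimes> v) = (v\<^sup>\<star> \<otimes> v) \<otimes> (x \<otimes> (v\<^sup>\<star> \<otimes> v))" using that(1) x by (simp add: m_assoc)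
    then show ?thesis using that x by simp
  qed
  have orth: "w\<^sup>\<star> \<otimes> ((v \<otimes> (x \<otimes> v\<^sup>\<star>)) \<otimes> w) = \<zero>" if "v \<in> carrier A" "w \<in> carrier A" "w\<^sup>\<star> \<otimes> v = \<zero>" for v w
  proof -
    have "w\<^sup>\<star> \<otimes> ((v \<otimes> (x \<otimes> v\<^sup>\<star>)) \<otimes> w) = (w\<^sup>\<star> \<otimes> v) \<otimes> (x \<otimes> (v\<^sup>\<star> \<otimes> w))" using that(1,2) x by (simp add: m_assoc)
    then show ?thesis using that x by simp
  qed
  show "psi (s \<otimes> (x \<otimes> s\<^sup>\<star>)) = psi x / 2"
    using psi_compress[of "s \<otimes> (x \<otimes> s\<^sup>\<star>)"] iso[of s] orth[of s s1] gen_rel(3) s1_rel x by simp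
  show "psi (s1 \<otimes> (x \<otimes> s1\<^sup>\<star>)) = psi x / 2"
    using psi_compress[of "s1 \<otimes> (x \<otimes> s1\<^sup>\<star>)"] iso[of s1] orth[of s1 s] s1_rel x by simp
qed

text \<open>By \<open>u s = s1\<close> and \<open>u s1 = s u\<close> the defect satisfies
  \<open>f(x) = f(s\<^sup>\<star> x s) / 2\<close>; iterating, it is bounded by
  \<open>2 \<parallel>x\<parallel> / 2^n\<close> for every \<open>n\<close>.\<close>

lemma psi_u_conj: assumes x: "x \<in> carrier A" shows "psi (u\<^sup>\<star> \<otimes> (x \<otimes> u)) = psi x"
proof -
  define f where "f x = psi (u\<^sup>\<star> \<otimes> (x \<otimes> u)) - psi x" for x
  have "cmod (f x) \<le> 2 * \<parallel>x\<parallel> * (1/2) ^ n" if "x \<in> carrier A" for x n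
    using that
  proof (induction n arbitrary: x)
    case 0
    have "\<parallel>u\<^sup>\<star> \<otimes> (x \<otimes> u)\<parallel> \<le> \<parallel>x\<parallel>"
      using 0 norm_isometry_le[of u] gen_rel by (intro norm_conj_isometry_le) auto
    then have "cmod (psi (u\<^sup>\<star> \<otimes> (x \<otimes> u))) \<le> \<parallel>x\<parallel>" using psi_norm_le[of "u\<^sup>\<star> \<otimes> (x \<otimes> u)"] 0 by simp
    then show ?case unfolding f_def using psi_norm_le[OF 0]
      norm_triangle_ineq4[of "psi (u\<^sup>\<star> \<otimes> (x \<otimes> u))" "psi x"] by simp
  next
    case (Suc n)
    have us1: "u \<otimes> s1 = s \<otimes> u" using gen_rel(4) .
    have "s1\<^sup>\<star> \<otimes> (u\<^sup>\<star> \<otimes> (x \<otimes> u) \<otimes> s1) = (u \<otimes> s1)\<^sup>\<star> \<otimes> (x \<otimes> (u \<otimes> s1))" using Suc.prems by (simp add: star_mult m_assoc)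
    also have "\<dots> = u\<^sup>\<star> \<otimes> ((s\<^sup>\<star> \<otimes> (x \<otimes> s)) \<otimes> u)" unfolding us1 using Suc.prems by (simp add: star_mult m_assoc)
    finally have "psi (u\<^sup>\<star> \<otimes> (x \<otimes> u)) = (psi (s1\<^sup>\<star> \<otimes> (x \<otimes> s1)) + psi (u\<^sup>\<star> \<otimes> ((s\<^sup>\<star> \<otimes> (x \<otimes> s)) \<otimes> u))) / 2"
      using psi_compress[of "u\<^sup>\<star> \<otimes> (x \<otimes> u)"] Suc.prems by (simp add: star_mult m_assoc)
    then have "f x = f (s\<^sup>\<star> \<otimes> (x \<otimes> s)) / 2" unfolding f_def
      using psi_compress[OF Suc.prems] by (simp add: field_simps)
    then have "cmod (f x) = cmod (f (s\<^sup>\<star> \<otimes> (x \<otimes> s))) / 2" by (simp only: norm_divide norm_numeral)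
    moreover have le1: "cmod (f (s\<^sup>\<star> \<otimes> (x \<otimes> s))) \<le> 2 * \<parallel>s\<^sup>\<star> \<otimes> (x \<otimes> s)\<parallel> * (1/2) ^ n"
      using Suc.prems by (intro Suc.IH) auto
    have "2 * \<parallel>s\<^sup>\<star> \<otimes> (x \<otimes> s)\<parallel> * (1/2) ^ n \<le> 2 * \<parallel>x\<parallel> * (1/2) ^ n"
      using norm_conj_isometry_le[OF Suc.prems] gen_norm by (intro mult_right_mono) auto
    from order_trans[OF le1 this] have "cmod (f (s\<^sup>\<star> \<otimes> (x \<otimes> s))) \<le> 2 * \<parallel>x\<parallel> * (1/2) ^ n" .
    ultimately show ?case by simp
  qed
  moreover have "(\<lambda>n. 2 * \<parallel>x\<parallel> * (1/2) ^ n) \<longlonglongrightarrow> 2 * \<parallel>x\<parallel> * 0"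
    by (intro tendsto_mult tendsto_const LIMSEQ_power_zero) auto
  ultimately have "cmod (f x) \<le> 2 * \<parallel>x\<parallel> * 0" using x by (intro LIMSEQ_le_const) auto
  then show ?thesis by (simp add: f_def)
qed

lemma psi_homog: "\<lbrakk>x \<in> homog d; d \<noteq> 0\<rbrakk> \<Longrightarrow> psi x = 0"
  by (intro psi_eqI conv_homog)

lemma psi_upow: "psi (upow a) = of_bool (a = 0)"
  by (intro psi_eqI conv_upow)

section \<open>The GNS seminorm of the limit state\<close>

definition l2 :: "'a \<Rightarrow> real" where "l2 x = sqrt (Re (psi (x\<^sup>\<star> \<otimes> x)))"

lemma l2_nonneg [simp]: "x \<in> carrier A \<Longrightarrow> 0 \<le> l2 x"
  using psi_pos(2)[OF pos_star_mult] by (simp add: l2_def)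

lemma psi_star_mult: "x \<in> carrier A \<Longrightarrow> psi (x\<^sup>\<star> \<otimes> x) = complex_of_real ((l2 x)\<^sup>2)"
  using psi_pos[OF pos_star_mult[of x]] by (simp add: l2_def)

lemma l2_square: "x \<in> carrier A \<Longrightarrow> (l2 x)\<^sup>2 = Re (psi (x\<^sup>\<star> \<otimes> x))"
  using psi_star_mult[of x] by simp

lemma l2_add_square:
  assumes "x \<in> carrier A" "y \<in> carrier A"
  shows "(l2 (x \<oplus> y))\<^sup>2 = (l2 x)\<^sup>2 + (l2 y)\<^sup>2 + 2 * Re (psi (x\<^sup>\<star> \<otimes> y))"
proof -
  have "psi (y\<^sup>\<star> \<otimes> x) = cnj (psi (x\<^sup>\<star> \<otimes> y))" using psi_star[of "x\<^sup>\<star> \<otimes> y"] assms by (simp add: star_mult)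
  moreover have "(x \<oplus> y)\<^sup>\<star> \<otimes> (x \<oplus> y) = (x\<^sup>\<star> \<otimes> x \<oplus> y\<^sup>\<star> \<otimes> y) \<oplus> (x\<^sup>\<star> \<otimes> y \<oplus> y\<^sup>\<star> \<otimes> x)" using assms by algebra
  ultimately show ?thesis using assms by (simp add: l2_square psi_add)
qed

lemma l2_smult: "x \<in> carrier A \<Longrightarrow> l2 (c \<odot> x) = cmod c * l2 x"
proof -
  assume x: "x \<in> carrier A"
  have "(c \<odot> x)\<^sup>\<star> \<otimes> (c \<odot> x) = complex_of_real ((cmod c)\<^sup>2) \<odot> (x\<^sup>\<star> \<otimes> x)"
    unfolding complex_norm_square using x
    by (simp add: star_smult smult_mult_l smult_mult_r smult_smult mult.commute)
  then have "(l2 (c \<odot> x))\<^sup>2 = (cmod c * l2 x)\<^sup>2"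
    using x by (simp add: l2_square psi_smult power_mult_distrib)
  then show ?thesis using x by (simp add: power2_eq_iff_nonneg)
qed

lemma cauchy_schwarz:
  assumes x: "x \<in> carrier A" and y: "y \<in> carrier A"
  shows "cmod (psi (x\<^sup>\<star> \<otimes> y)) \<le> l2 x * l2 y"
proof -
  define c where "c = psi (x\<^sup>\<star> \<otimes> y)"
  have pos: "0 \<le> (l2 x)\<^sup>2 + r\<^sup>2 * (cmod c)\<^sup>2 * (l2 y)\<^sup>2 - 2 * r * (cmod c)\<^sup>2" for r
  proof -
    \<comment> \<open>The phase of \<open>t\<close> makes the cross term real, so that the square
      becomes a real quadratic polynomial in \<open>r\<close>.\<close>
    define t where "t = - complex_of_real r * cnj c"
    have "psi (x\<^sup>\<star> \<otimes> (t \<odot> y)) = t * c" unfolding c_def using x y by (simp add: smult_mult_r psi_smult)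
    then have "(l2 (x \<oplus> t \<odot> y))\<^sup>2 = (l2 x)\<^sup>2 + (l2 (t \<odot> y))\<^sup>2 + 2 * Re (t * c)"
      using l2_add_square[of x "t \<odot> y"] x y by simp
    moreover have "t * c = - complex_of_real (r * (cmod c)\<^sup>2)"
      unfolding t_def by (simp add: mult.assoc mult.commute[of "cnj c"] complex_mult_cnj cmod_power2)
    moreover have "(l2 (t \<odot> y))\<^sup>2 = r\<^sup>2 * (cmod c)\<^sup>2 * (l2 y)\<^sup>2" unfolding t_def using y
      by (simp add: l2_smult norm_mult power_mult_distrib)
    ultimately have "(l2 (x \<oplus> t \<odot> y))\<^sup>2 = (l2 x)\<^sup>2 + r\<^sup>2 * (cmod c)\<^sup>2 * (l2 y)\<^sup>2 - 2 * r * (cmod c)\<^sup>2"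
      by simp
    then show ?thesis by (metis zero_le_power2)
  qed
  show ?thesis
  proof (cases "l2 y = 0")
    case True
    have "c = 0"
    proof (rule ccontr)
      assume "c \<noteq> 0"
      \<comment> \<open>For \<open>l2 y = 0\<close> the polynomial is affine with negative slope;
        this \<open>r\<close> makes it negative.\<close>
      then have "2 * (((l2 x)\<^sup>2 + 1) / (cmod c)\<^sup>2) * (cmod c)\<^sup>2 = 2 * ((l2 x)\<^sup>2 + 1)" by simp
      then show False
        using pos[of "((l2 x)\<^sup>2 + 1) / (cmod c)\<^sup>2"] True zero_le_power2[of "l2 x"] by simp
    qed
    then show ?thesis using True by (simp add: c_def)
  next
    case False
    then have ly: "(l2 y)\<^sup>2 > 0" by simp
    \<comment> \<open>The minimum of the polynomial is attained at
      \<open>r = 1 / (l2 y)^2\<close>.\<close>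
    have "(1 / (l2 y)\<^sup>2)\<^sup>2 * (cmod c)\<^sup>2 * (l2 y)\<^sup>2 = (cmod c)\<^sup>2 / (l2 y)\<^sup>2"
      using ly by (simp add: power2_eq_square)
    then have "0 \<le> (l2 x)\<^sup>2 - (cmod c)\<^sup>2 / (l2 y)\<^sup>2"
      using pos[of "1 / (l2 y)\<^sup>2"] by simp
    then have "(cmod c)\<^sup>2 \<le> (l2 x * l2 y)\<^sup>2" using ly by (simp add: field_simps power_mult_distrib)
    then show ?thesis using x y by (simp add: c_def power2_le_iff_abs_le abs_le_square_iff flip: abs_le_square_iff)
  qed
qed

lemma l2_triangle: assumes "x \<in> carrier A" "y \<in> carrier A" shows "l2 (x \<oplus> y) \<le> l2 x + l2 y"
proof -
  have "Re (psi (x\<^sup>\<star> \<otimes> y)) \<le> l2 x * l2 y"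
    using cauchy_schwarz[OF assms] complex_Re_le_cmod order_trans by blast
  then have "(l2 (x \<oplus> y))\<^sup>2 \<le> (l2 x + l2 y)\<^sup>2"
    using l2_add_square[OF assms] by (simp add: power2_sum)
  then show ?thesis by (rule power2_le_imp_le) (use assms in auto)
qed

lemma l2_zero [simp]: "l2 \<zero> = 0" by (simp add: l2_def)

lemma l2_mono: 
  assumes "x \<in> carrier A" "y \<in> carrier A" "pos (y\<^sup>\<star> \<otimes> y \<ominus> x\<^sup>\<star> \<otimes> x)" shows "l2 x \<le> l2 y"
  using psi_pos(2)[OF assms(3)] assms unfolding l2_def by (simp add: psi_diff)

lemma l2_mult_le: assumes x: "x \<in> carrier A" and w: "w \<in> carrier A" shows "l2 (x \<otimes> w) \<le> \<parallel>x\<parallel> * l2 w"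
proof -
  have "pos (w\<^sup>\<star> \<otimes> (complex_of_real (\<parallel>x\<parallel>\<^sup>2) \<odot> \<one> \<ominus> x\<^sup>\<star> \<otimes> x) \<otimes> w)"
    by (intro pos_conj pos_norm_minus_star_mult x w)
  also have "w\<^sup>\<star> \<otimes> (complex_of_real (\<parallel>x\<parallel>\<^sup>2) \<odot> \<one> \<ominus> x\<^sup>\<star> \<otimes> x) \<otimes> w
     = complex_of_real (\<parallel>x\<parallel>\<^sup>2) \<odot> (w\<^sup>\<star> \<otimes> w) \<ominus> (x \<otimes> w)\<^sup>\<star> \<otimes> (x \<otimes> w)" using x w by algebra
  also have "complex_of_real (\<parallel>x\<parallel>\<^sup>2) \<odot> (w\<^sup>\<star> \<otimes> w) = (complex_of_real \<parallel>x\<parallel> \<odot> w)\<^sup>\<star> \<otimes> (complex_of_real \<parallel>x\<parallel> \<odot> w)"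
    using w by (simp add: star_smult smult_mult_l smult_mult_r smult_smult power2_eq_square)
  finally have "l2 (x \<otimes> w) \<le> l2 (complex_of_real \<parallel>x\<parallel> \<odot> w)" using x w by (intro l2_mono) auto
  then show ?thesis using w x by (simp add: l2_smult)
qed

lemma l2_one: "l2 \<one> = 1" by (simp add: l2_def psi_one)

lemma l2_le_norm: "x \<in> carrier A \<Longrightarrow> l2 x \<le> \<parallel>x\<parallel>"
  using l2_mult_le[of x \<one>] by (simp add: l2_one)

lemma l2_contract: "\<lbrakk>x \<in> carrier A; \<parallel>x\<parallel> \<le> 1; w \<in> carrier A\<rbrakk> \<Longrightarrow> l2 (x \<otimes> w) \<le> l2 w"
  using l2_mult_le[of x w] mult_right_mono[of "\<parallel>x\<parallel>" 1 "l2 w"] by simp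

text \<open>In the seminorm of a state only left multiplication is bounded in general. Right
  multiplication by the generators is bounded by invariance under \<open>u\<close>, by averaging
  over \<open>s\<close> and \<open>s1\<close>, and by the scaling under \<open>s\<close>. The factor
  2 is a convenient bound for \<open>sqrt 2\<close>.\<close>

lemma l2_right_gen:
  assumes v: "v \<in> carrier A"
  shows "l2 (v \<otimes> u) \<le> l2 v" "l2 (v \<otimes> u\<^sup>\<star>) \<le> l2 v" "l2 (v \<otimes> s) \<le> 2 * l2 v" "l2 (v \<otimes> s\<^sup>\<star>) \<le> l2 v"
    "l2 (v \<otimes> s1) \<le> 2 * l2 v"
proof -
  have u: "l2 (v \<otimes> u) = l2 v" if "v \<in> carrier A" for v
    using psi_u_conj[of "v\<^sup>\<star> \<otimes> v"] that by (simp add: l2_def star_mult m_assoc)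
  show "l2 (v \<otimes> u) \<le> l2 v" using u v by simp
  show "l2 (v \<otimes> u\<^sup>\<star>) \<le> l2 v" using u[of "v \<otimes> u\<^sup>\<star>"] v gen_rel by (simp add: m_assoc)
  have sum: "(l2 v)\<^sup>2 = ((l2 (v \<otimes> s))\<^sup>2 + (l2 (v \<otimes> s1))\<^sup>2) / 2"
    using arg_cong[OF psi_compress[of "v\<^sup>\<star> \<otimes> v"], of Re] v by (simp add: l2_square star_mult m_assoc)
  have "a \<le> 2 * c" if "c\<^sup>2 = (a\<^sup>2 + b\<^sup>2) / 2" "c \<ge> 0" for a b c :: real
  proof (rule power2_le_imp_le)
    have "0 \<le> a\<^sup>2" "0 \<le> b\<^sup>2" by auto
    then have "a\<^sup>2 \<le> 2 * (a\<^sup>2 + b\<^sup>2)" by argo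
    also have "\<dots> = (2 * c)\<^sup>2" unfolding power_mult_distrib that(1) by simp
    finally show "a\<^sup>2 \<le> (2 * c)\<^sup>2" .
  qed (use that in simp)
  then show "l2 (v \<otimes> s) \<le> 2 * l2 v" "l2 (v \<otimes> s1) \<le> 2 * l2 v" using sum v by (auto simp: add.commute)
  have "(l2 (v \<otimes> s\<^sup>\<star>))\<^sup>2 = (l2 v)\<^sup>2 / 2"
    using arg_cong[OF psi_expand(1)[of "v\<^sup>\<star> \<otimes> v"], of Re] v by (simp add: l2_square star_mult m_assoc)
  then have "(l2 (v \<otimes> s\<^sup>\<star>))\<^sup>2 \<le> (l2 v)\<^sup>2" using zero_le_power2[of "l2 v"] by linarith
  then show "l2 (v \<otimes> s\<^sup>\<star>) \<le> l2 v" by (rule power2_le_imp_le) (use v in simp)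
qed

text \<open>Closed under sums and products, hence containing all polynomials. This makes the null
  space of \<open>l2\<close> stable under right multiplication by polynomials.\<close>

definition right_bounded :: "'a set" where
  "right_bounded = {w \<in> carrier A. \<exists>C. \<forall>v\<in>carrier A. l2 (v \<otimes> w) \<le> C * l2 v}"

lemma right_bounded_mult: assumes "x \<in> right_bounded" "y \<in> right_bounded" shows "x \<otimes> y \<in> right_bounded"
proof -
  obtain C D where C: "\<And>v. v \<in> carrier A \<Longrightarrow> l2 (v \<otimes> x) \<le> C * l2 v"
    and D: "\<And>v. v \<in> carrier A \<Longrightarrow> l2 (v \<otimes> y) \<le> D * l2 v" and xy: "x \<in> carrier A" "y \<in> carrier A"
    using assms by (auto simp: right_bounded_def)
  have "l2 (v \<otimes> (x \<otimes> y)) \<le> (\<bar>D\<bar> * C) * l2 v" if v: "v \<in> carrier A" for v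
  proof -
    have "l2 (v \<otimes> (x \<otimes> y)) = l2 ((v \<otimes> x) \<otimes> y)" using v xy by (simp add: m_assoc)
    also have "\<dots> \<le> D * l2 (v \<otimes> x)" using D v xy by simp
    also have "\<dots> \<le> \<bar>D\<bar> * l2 (v \<otimes> x)" using v xy by (intro mult_right_mono) auto
    also have "\<dots> \<le> \<bar>D\<bar> * (C * l2 v)" using C[OF v] by (intro mult_left_mono) auto
    finally show ?thesis by (simp add: mult.assoc)
  qed
  then show ?thesis using xy unfolding right_bounded_def by blast
qed

lemma right_bounded_add: assumes "x \<in> right_bounded" "y \<in> right_bounded" shows "x \<oplus> y \<in> right_bounded"
proof -
  obtain C D where C: "\<And>v. v \<in> carrier A \<Longrightarrow> l2 (v \<otimes> x) \<le> C * l2 v"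
    and D: "\<And>v. v \<in> carrier A \<Longrightarrow> l2 (v \<otimes> y) \<le> D * l2 v" and xy: "x \<in> carrier A" "y \<in> carrier A"
    using assms by (auto simp: right_bounded_def)
  have "l2 (v \<otimes> (x \<oplus> y)) \<le> (C + D) * l2 v" if v: "v \<in> carrier A" for v
    using l2_triangle[of "v \<otimes> x" "v \<otimes> y"] C[OF v] D[OF v] v xy by (simp add: r_distr algebra_simps)
  then show ?thesis using xy unfolding right_bounded_def by blast
qed

lemma right_bounded_smult: assumes "x \<in> right_bounded" shows "c \<odot> x \<in> right_bounded"
proof -
  obtain C where C: "\<And>v. v \<in> carrier A \<Longrightarrow> l2 (v \<otimes> x) \<le> C * l2 v" and x: "x \<in> carrier A"
    using assms by (auto simp: right_bounded_def)
  have "l2 (v \<otimes> (c \<odot> x)) \<le> (cmod c * C) * l2 v" if v: "v \<in> carrier A" for v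
    using mult_left_mono[OF C[OF v], of "cmod c"] v x by (simp add: smult_mult_r l2_smult mult.assoc)
  then show ?thesis using x unfolding right_bounded_def by blast
qed

lemma right_bounded_gen:
  "u \<in> right_bounded" "u\<^sup>\<star> \<in> right_bounded" "s \<in> right_bounded" "s\<^sup>\<star> \<in> right_bounded"
  "\<one> \<in> right_bounded" "\<zero> \<in> right_bounded"
proof -
  have I: "w \<in> right_bounded" if "w \<in> carrier A" "\<And>v. v \<in> carrier A \<Longrightarrow> l2 (v \<otimes> w) \<le> C * l2 v" for w C
    unfolding right_bounded_def using that by blast
  show "u \<in> right_bounded" "u\<^sup>\<star> \<in> right_bounded" "s\<^sup>\<star> \<in> right_bounded" "\<one> \<in> right_bounded" "\<zero> \<in> right_bounded"
    using l2_right_gen by (auto intro!: I[of _ 1])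
  show "s \<in> right_bounded" using l2_right_gen by (auto intro!: I[of _ 2])
qed

lemma right_bounded_polys: assumes "x \<in> polys" shows "x \<in> right_bounded"
proof -
  have up: "upow a \<in> right_bounded" for a
  proof (induction a rule: int_induct[where k = 0])
    case (step1 i)
    then show ?case using right_bounded_mult[OF right_bounded_gen(1)] by (simp flip: u_upow)
  next
    case (step2 i)
    then show ?case using right_bounded_mult[OF right_bounded_gen(2)] by (simp flip: ustar_upow)
  qed (use right_bounded_gen in simp)
  have sp: "spow n \<in> right_bounded" for n
    by (induction n) (use right_bounded_gen right_bounded_mult in auto)
  have ss: "(spow n)\<^sup>\<star> \<in> right_bounded" for n
    by (induction n) (use right_bounded_gen right_bounded_mult in \<open>auto simp: star_mult\<close>)
  have mon: "monomial a m k b \<in> right_bounded" for a m k b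
    unfolding monomial_def by (intro right_bounded_mult up sp ss)
  obtain N where "x \<in> poly_deg N" using assms by (auto simp: polys_def)
  then show ?thesis unfolding poly_deg_def
  proof (induction rule: lspan.induct)
    case (lspan_step x mm c)
    then show ?case using mon by (auto intro!: right_bounded_add right_bounded_smult)
  qed (rule right_bounded_gen)
qed

lemma l2_right_poly:
  assumes "w \<in> polys" obtains C where "\<And>v. v \<in> carrier A \<Longrightarrow> l2 (v \<otimes> w) \<le> C * l2 v"
  using right_bounded_polys[OF assms] unfolding right_bounded_def by blast

end

section \<open>Faithfulness of the limit state\<close>

text \<open>If \<open>t < a\<close>, then \<open>N (t / a)^N\<close> tends to 0 along
  \<open>N = 2^i\<close>. This removes factors that grow linearly in the power.\<close>

lemma le_of_power_growth:
  fixes a t C :: real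
  assumes a: "0 \<le> a" and t: "0 \<le> t" and le: "\<And>i. a ^ (2 ^ i) \<le> C * 2 ^ i * t ^ (2 ^ i)"
  shows "a \<le> t"
proof (rule ccontr)
  assume "\<not> a \<le> t"
  then have at: "t < a" "a > 0" using t by auto
  have "(\<lambda>n. of_nat n * (t / a) ^ n) \<longlonglongrightarrow> 0"
    using at t by (intro powser_times_n_limit_0) (simp add: abs_of_nonneg)
  moreover have "strict_mono (\<lambda>i. 2 ^ i :: nat)" by (rule strict_monoI) simp
  ultimately have "(\<lambda>i. of_nat (2 ^ i) * (t / a) ^ (2 ^ i)) \<longlonglongrightarrow> 0"
    using LIMSEQ_subseq_LIMSEQ[of "\<lambda>n. of_nat n * (t / a) ^ n" 0 "\<lambda>i. 2 ^ i"] by (simp add: o_def)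
  then have "(\<lambda>i. C * (of_nat (2 ^ i) * (t / a) ^ (2 ^ i))) \<longlonglongrightarrow> C * 0"
    by (intro tendsto_mult tendsto_const)
  moreover have "1 \<le> C * (of_nat (2 ^ i) * (t / a) ^ (2 ^ i))" for i
    using le[of i] at by (simp add: power_divide field_simps)
  ultimately have "1 \<le> C * 0" by (intro LIMSEQ_le_const) auto
  then show False by simp
qed

context cstar_algebra
begin

lemma norm_finsum_le:
  "finite I \<Longrightarrow> (\<And>i. i \<in> I \<Longrightarrow> f i \<in> carrier A) \<Longrightarrow> \<parallel>\<Oplus>i\<in>I. f i\<parallel> \<le> (\<Sum>i\<in>I. \<parallel>f i\<parallel>)"
proof (induction I rule: finite_induct)
  case (insert i I)
  then have "f \<in> I \<rightarrow> carrier A" by auto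
  then show ?case using insert cnorm_triangle[of "f i" "\<Oplus>i\<in>I. f i"] by simp
qed simp

text \<open>Repeated squaring, because for selfadjoint elements the C*-identity gives the norm of
  these powers exactly.\<close>

primrec sq_iter :: "'a \<Rightarrow> nat \<Rightarrow> 'a" where
  "sq_iter z 0 = z"
| "sq_iter z (Suc i) = sq_iter z i \<otimes> sq_iter z i"

lemma sq_iter:
  assumes "z \<in> carrier A" "z\<^sup>\<star> = z"
  shows "sq_iter z i \<in> carrier A \<and> (sq_iter z i)\<^sup>\<star> = sq_iter z i \<and> \<parallel>sq_iter z i\<parallel> = \<parallel>z\<parallel> ^ (2 ^ i)"
proof (induction i)
  case (Suc i)
  then show ?case using selfadjoint_norm_square[of "sq_iter z i"]
    by (simp add: star_mult power_mult[symmetric] mult.commute)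
qed (use assms in simp)

end

context diadic_cstar
begin

section \<open>Comparison of the norm with \<open>l2\<close> in degree 0\<close>

definition laurent :: "nat \<Rightarrow> 'a set" where
  "laurent D = lspan {upow k | k. \<bar>k\<bar> \<le> int D}"

lemma laurent_closed: "f \<in> laurent D \<Longrightarrow> f \<in> carrier A"
  unfolding laurent_def by (rule lspan_closed) auto

lemma upow_laurent: "\<bar>k\<bar> \<le> int D \<Longrightarrow> upow k \<in> laurent D"
  unfolding laurent_def by (rule lspan_base) auto

lemma laurent_mono: "\<lbrakk>f \<in> laurent D; D \<le> E\<rbrakk> \<Longrightarrow> f \<in> laurent E"
  unfolding laurent_def by (erule lspan_mono) force

lemma laurent_mult: "\<lbrakk>f \<in> laurent D; g \<in> laurent E\<rbrakk> \<Longrightarrow> f \<otimes> g \<in> laurent (D + E)"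
proof -
  assume f: "f \<in> laurent D" and g: "g \<in> laurent E"
  have m: "upow k \<otimes> upow l \<in> laurent (D + E)" if "\<bar>k\<bar> \<le> int D" "\<bar>l\<bar> \<le> int E" for k l
    unfolding upow_add using that by (intro upow_laurent) simp
  show ?thesis unfolding laurent_def
    by (rule lspan_mult[OF f[unfolded laurent_def] g[unfolded laurent_def]])
      (use m in \<open>auto simp: laurent_def\<close>)
qed

lemma l2_upow: "l2 (upow k) \<le> 1"
  using l2_le_norm[of "upow k"] upow_norm_le[of k] by simp

text \<open>Fourier expansion: the powers of \<open>u\<close> are orthonormal for
  \<open>psi\<close>.\<close>

lemma laurent_expand:
  assumes "f \<in> laurent D"
  shows "f = (\<Oplus>k\<in>{- int D..int D}. psi (upow (- k) \<otimes> f) \<odot> upow k)"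
  using assms unfolding laurent_def
proof (induction rule: lspan.induct)
  case lspan_zero
  then show ?case by simp
next
  case (lspan_step x m c)
  then obtain l where l: "m = upow l" "\<bar>l\<bar> \<le> int D" by auto
  have xc: "x \<in> carrier A" using lspan_step(1) by (rule lspan_closed) auto
  let ?I = "{- int D..int D}"
  have "psi (upow (- k) \<otimes> (c \<odot> m \<oplus> x)) = (if l = k then c else 0) + psi (upow (- k) \<otimes> x)" for k
    using xc l by (simp add: r_distr smult_mult_r psi_add psi_smult upow_add psi_upow)
  then have "(\<Oplus>k\<in>?I. psi (upow (- k) \<otimes> (c \<odot> m \<oplus> x)) \<odot> upow k)
      = (\<Oplus>k\<in>?I. (if l = k then c \<odot> upow k else \<zero>) \<oplus> psi (upow (- k) \<otimes> x) \<odot> upow k)"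
    by (intro finsum_cong') (auto simp: smult_l_distr)
  also have "\<dots> = (\<Oplus>k\<in>?I. if l = k then c \<odot> upow k else \<zero>)
      \<oplus> (\<Oplus>k\<in>?I. psi (upow (- k) \<otimes> x) \<odot> upow k)" by (intro finsum_addf) auto
  also have "(\<Oplus>k\<in>?I. if l = k then c \<odot> upow k else \<zero>) = c \<odot> upow l"
    using l by (intro finsum_singleton) auto
  also have "(\<Oplus>k\<in>?I. psi (upow (- k) \<otimes> x) \<odot> upow k) = x" by (rule lspan_step(3)[symmetric])
  finally show ?case using l by simp
qed

text \<open>There are \<open>2 D + 1\<close> Fourier coefficients, each at most \<open>l2 f\<close>
  by Cauchy--Schwarz. The linear dependence on \<open>D\<close> is what
  \<open>le_of_power_growth\<close> can absorb.\<close>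

lemma laurent_norm_le:
  assumes f: "f \<in> laurent D" shows "\<parallel>f\<parallel> \<le> (2 * real D + 1) * l2 f"
proof -
  note fc = laurent_closed[OF f]
  have le: "\<parallel>psi (upow (- k) \<otimes> f) \<odot> upow k\<parallel> \<le> l2 f" for k
  proof -
    have "cmod (psi ((upow k)\<^sup>\<star> \<otimes> f)) \<le> l2 (upow k) * l2 f" using fc by (intro cauchy_schwarz) auto
    also have "\<dots> \<le> 1 * l2 f" using fc l2_upow by (intro mult_right_mono) auto
    finally have "cmod (psi (upow (- k) \<otimes> f)) \<le> l2 f" by (simp add: upow_star)
    then have "cmod (psi (upow (- k) \<otimes> f)) * \<parallel>upow k\<parallel> \<le> l2 f * 1"
      using fc upow_norm_le by (intro mult_mono) auto
    then show ?thesis by (simp add: cnorm_smult)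
  qed
  have "\<parallel>f\<parallel> = \<parallel>\<Oplus>k\<in>{- int D..int D}. psi (upow (- k) \<otimes> f) \<odot> upow k\<parallel>"
    by (rule arg_cong[OF laurent_expand[OF f]])
  also have "\<dots> \<le> (\<Sum>k\<in>{- int D..int D}. \<parallel>psi (upow (- k) \<otimes> f) \<odot> upow k\<parallel>)"
    using fc by (intro norm_finsum_le) auto
  also have "\<dots> \<le> real (card {- int D..int D}) * l2 f" using le by (intro sum_bounded_above) auto
  finally show ?thesis by simp
qed

text \<open>Level \<open>n\<close> consists of the \<open>2\<^sup>n \<times> 2\<^sup>n\<close> matrices over the Laurent polynomials in \<open>u\<close>,
  identified with elements through the isometries \<open>s\<close> and \<open>s1\<close>.\<close>

primrec level :: "nat \<Rightarrow> nat \<Rightarrow> 'a set" where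
  "level 0 D = laurent D"
| "level (Suc n) D = {x \<in> carrier A. \<forall>v\<in>{s, s1}. \<forall>w\<in>{s, s1}. v\<^sup>\<star> \<otimes> (x \<otimes> w) \<in> level n D}"

lemma level_zero: "\<zero> \<in> level n D"
proof (induction n)
  case 0
  then show ?case unfolding level.simps laurent_def by (rule lspan_zero)
qed auto

lemma level_add: "\<lbrakk>x \<in> level n D; y \<in> level n D\<rbrakk> \<Longrightarrow> x \<oplus> y \<in> level n D"
proof (induction n arbitrary: x y)
  case 0
  then show ?case unfolding level.simps laurent_def by (intro lspan_add) auto
next
  case (Suc n)
  then have c: "x \<in> carrier A" "y \<in> carrier A" by auto
  have "v\<^sup>\<star> \<otimes> ((x \<oplus> y) \<otimes> w) \<in> level n D" if "v \<in> {s, s1}" "w \<in> {s, s1}" for v w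
  proof -
    have "v \<in> carrier A" "w \<in> carrier A" using that by auto
    then have "v\<^sup>\<star> \<otimes> ((x \<oplus> y) \<otimes> w) = v\<^sup>\<star> \<otimes> (x \<otimes> w) \<oplus> v\<^sup>\<star> \<otimes> (y \<otimes> w)" using c by algebra
    moreover have "v\<^sup>\<star> \<otimes> (x \<otimes> w) \<in> level n D" "v\<^sup>\<star> \<otimes> (y \<otimes> w) \<in> level n D"
      using Suc.prems that by auto
    ultimately show ?thesis using Suc.IH by simp
  qed
  then show ?case using c by simp
qed

lemma level_smult: "x \<in> level n D \<Longrightarrow> c \<odot> x \<in> level n D"
proof (induction n arbitrary: x)
  case 0
  then show ?case unfolding level.simps laurent_def by (intro lspan_smult) auto
qed (auto simp: smult_mult_l smult_mult_r)

lemma level_mono: "\<lbrakk>x \<in> level n D; D \<le> E\<rbrakk> \<Longrightarrow> x \<in> level n E"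
  by (induction n arbitrary: x) (auto intro: laurent_mono)

text \<open>As for matrices over Laurent polynomials: the size parameter \<open>n\<close> stays
  fixed and the degrees add, after the range relation is inserted between the factors.\<close>

lemma level_mult: "\<lbrakk>x \<in> level n D; y \<in> level n E\<rbrakk> \<Longrightarrow> x \<otimes> y \<in> level n (D + E)"
proof (induction n arbitrary: x y)
  case 0
  then show ?case by (simp add: laurent_mult)
next
  case (Suc n)
  then have c: "x \<in> carrier A" "y \<in> carrier A" by auto
  have "v\<^sup>\<star> \<otimes> ((x \<otimes> y) \<otimes> w) \<in> level n (D + E)" if "v \<in> {s, s1}" "w \<in> {s, s1}" for v w
  proof -
    have vw: "v \<in> carrier A" "w \<in> carrier A" using that by auto
    have "v\<^sup>\<star> \<otimes> ((x \<otimes> y) \<otimes> w) = v\<^sup>\<star> \<otimes> (x \<otimes> (s \<otimes> s\<^sup>\<star> \<oplus> s1 \<otimes> s1\<^sup>\<star>) \<otimes> y \<otimes> w)"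
      unfolding range_sum using c vw by (simp add: m_assoc)
    also have "\<dots> = (v\<^sup>\<star> \<otimes> (x \<otimes> s)) \<otimes> (s\<^sup>\<star> \<otimes> (y \<otimes> w)) \<oplus> (v\<^sup>\<star> \<otimes> (x \<otimes> s1)) \<otimes> (s1\<^sup>\<star> \<otimes> (y \<otimes> w))"
      using c vw gen_closed by algebra
    finally show ?thesis using Suc that by (auto intro!: level_add Suc.IH)
  qed
  then show ?case using c by simp
qed

lemma compress_upow_laurent:
  assumes "\<bar>k\<bar> \<le> int D" "v \<in> {s, s1}" "w \<in> {s, s1}"
  shows "v\<^sup>\<star> \<otimes> (upow k \<otimes> w) \<in> laurent D"
proof -
  \<comment> \<open>The offset \<open>i\<close> accounts for the extra \<open>u\<close> in
    \<open>s1\<close>, which contributes -1 on the left and 1 on the right.\<close>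
  have base: "s\<^sup>\<star> \<otimes> (upow (k + i) \<otimes> s) \<in> laurent D" if "\<bar>i\<bar> \<le> 1" for i
  proof (cases "even (k + i)")
    case True
    then obtain c where c: "k + i = 2 * c" by (elim evenE)
    then have "\<bar>c\<bar> \<le> int D" using assms(1) that by linarith
    then have "\<bar>(k + i) div 2\<bar> \<le> int D" using c by simp
    then show ?thesis using True by (simp add: compress_upow' upow_laurent)
  next
    case False
    then show ?thesis using level_zero[of 0 D] by (simp add: compress_upow')
  qed
  have l: "s1\<^sup>\<star> \<otimes> (upow k \<otimes> y) = s\<^sup>\<star> \<otimes> (upow (k - 1) \<otimes> y)" if "y \<in> carrier A" for k y
    using that upow_add_assoc[of y "-1" k] by (simp add: star_mult m_assoc upow_1)
  have r: "upow k \<otimes> s1 = upow (k + 1) \<otimes> s" for k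
    using upow_add_assoc[of s k 1] by (simp add: upow_1)
  show ?thesis using assms(2,3) base[of 0] base[of 1] base[of "-1"] by (auto simp: l r)
qed

text \<open>The compressions of a Laurent polynomial have no larger degree, so levels increase with
  \<open>n\<close> at the same \<open>D\<close>.\<close>

lemma level_Suc: "x \<in> level n D \<Longrightarrow> x \<in> level (Suc n) D"
proof (induction n arbitrary: x)
  case 0
  have "v\<^sup>\<star> \<otimes> (x \<otimes> w) \<in> laurent D" if "v \<in> {s, s1}" "w \<in> {s, s1}" for v w
  proof -
    have vw: "v \<in> carrier A" "w \<in> carrier A" using that by auto
    show ?thesis unfolding laurent_def
      by (rule lspan_linear[OF 0[unfolded level.simps laurent_def], where g = "\<lambda>c. c"])
        (use vw compress_upow_laurent that in \<open>auto simp: l_distr r_distr smult_mult_l smult_mult_r laurent_def\<close>)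
  qed
  then show ?case using 0 laurent_closed by simp
next
  case (Suc n)
  then show ?case by (simp only: level.simps(2)) auto
qed

lemma level_Suc_mono: assumes "x \<in> level n D" "n \<le> m" shows "x \<in> level m D"
  using assms(2) by (induction m rule: dec_induct) (use assms(1) level_Suc in blast)+

text \<open>After \<open>n\<close> compressions either nothing or a power of \<open>u\<close> is
  left, whose exponent is a difference of two numbers still bounded by \<open>E\<close>.\<close>

lemma monomial_level:
  "\<lbrakk>\<bar>a\<bar> \<le> int E; \<bar>b\<bar> \<le> int E\<rbrakk> \<Longrightarrow> monomial a n n b \<in> level n (2 * E)"
proof (induction n arbitrary: a b)
  case 0
  have "monomial a 0 0 b = upow (a - b)" by (simp add: monomial_def upow_add)
  then show ?case using 0 by (simp add: upow_laurent)
next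
  case (Suc n)
  have base: "s\<^sup>\<star> \<otimes> (monomial (a - i) (Suc n) (Suc n) (b - j) \<otimes> s) \<in> level n (2 * E)"
    if "i \<in> {0, 1}" "j \<in> {0, 1}" for i j
  proof (cases "even (a - i) \<and> even (b - j)")
    case True
    have "(c - l) div 2 = c div 2" if "even (c - l)" "l \<in> {0, 1}" for c l :: int
      using that by (cases "l = 0") (auto elim!: oddE)
    then have "(a - i) div 2 = a div 2" "(b - j) div 2 = b div 2" using that True by blast+
    moreover have "\<bar>a div 2\<bar> \<le> int E" "\<bar>b div 2\<bar> \<le> int E" using Suc.prems by linarith+
    ultimately show ?thesis using Suc.IH True by (simp add: compress_monomial)
  next
    case False
    then show ?thesis by (auto simp: compress_monomial level_zero)
  qed
  have l: "s1\<^sup>\<star> \<otimes> (monomial a m k b \<otimes> y) = s\<^sup>\<star> \<otimes> (monomial (a - 1) m k b \<otimes> y)" if "y \<in> carrier A" for a m k b y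
    using that upow_add_assoc[of _ "-1" a] by (simp add: star_mult m_assoc monomial_def upow_1)
  have r: "monomial a m k b \<otimes> s1 = monomial a m k (b - 1) \<otimes> s" for a m k b
    using upow_add_assoc[of s "- b" 1] by (simp add: m_assoc monomial_def upow_1)
  have "v\<^sup>\<star> \<otimes> (monomial a (Suc n) (Suc n) b \<otimes> w) \<in> level n (2 * E)" if "v \<in> {s, s1}" "w \<in> {s, s1}" for v w
    using that base[of 0 0] base[of 0 1] base[of 1 0] base[of 1 1] by (auto simp: l r simp del: spow.simps)
  then show ?case by simp
qed

lemma homog_0_level: assumes "x \<in> homog 0" shows "\<exists>n D. x \<in> level n D"
  using assms unfolding homog_def
proof (induction rule: lspan.induct)
  case lspan_zero
  then show ?case using level_zero by blast
next
  case (lspan_step x mm c)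
  then obtain n D a m k b where x: "x \<in> level n D" and mm: "mm = monomial a m k b" "int m - int k = 0" by auto
  define E where "E = nat \<bar>a\<bar> + nat \<bar>b\<bar>"
  have "mm \<in> level m (2 * E)" using mm monomial_level[of a E b m] by (simp add: E_def)
  then have "mm \<in> level (max m n) (max (2 * E) D)"
    using level_mono[OF level_Suc_mono[of mm m "2 * E" "max m n"]] by simp
  moreover have "x \<in> level (max m n) (max (2 * E) D)"
    using level_mono[OF level_Suc_mono[OF x, of "max m n"]] by simp
  ultimately show ?case using level_add level_smult by blast
qed

text \<open>Each step reassembles \<open>x\<close> from its four blocks, and right multiplication by
  \<open>s\<close> or \<open>s1\<close> costs a factor 2 in \<open>l2\<close>; together this is the
  8.\<close>

lemma level_norm_le: "x \<in> level n D \<Longrightarrow> \<parallel>x\<parallel> \<le> 8 ^ n * (2 * real D + 1) * l2 x"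
proof (induction n arbitrary: x)
  case 0
  then show ?case using laurent_norm_le by simp
next
  case (Suc n)
  then have xc: "x \<in> carrier A" by simp
  define K where "K = 8 ^ n * (2 * real D + 1)"
  have K: "K \<ge> 0" unfolding K_def by simp
  have summand: "\<parallel>v \<otimes> (v\<^sup>\<star> \<otimes> (x \<otimes> w)) \<otimes> w\<^sup>\<star>\<parallel> \<le> 2 * K * l2 x" if "v \<in> {s, s1}" "w \<in> {s, s1}" for v w
  proof -
    have vw: "v \<in> carrier A" "w \<in> carrier A" "\<parallel>v\<parallel> \<le> 1" "\<parallel>w\<parallel> \<le> 1" using that gen_norm by auto
    have "\<parallel>v \<otimes> (v\<^sup>\<star> \<otimes> (x \<otimes> w)) \<otimes> w\<^sup>\<star>\<parallel> \<le> 1 * \<parallel>v\<^sup>\<star> \<otimes> (x \<otimes> w)\<parallel> * 1" using vw xc by (intro norm_mult_le) auto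
    also have "\<dots> \<le> K * l2 (v\<^sup>\<star> \<otimes> (x \<otimes> w))" using Suc that by (auto simp: K_def)
    also have "l2 (v\<^sup>\<star> \<otimes> (x \<otimes> w)) \<le> l2 (x \<otimes> w)" using vw xc by (intro l2_contract) auto
    also have "l2 (x \<otimes> w) \<le> 2 * l2 x" using that l2_right_gen[OF xc] by auto
    finally show ?thesis using K by (simp add: mult_left_mono)
  qed
  have "x = (s \<otimes> s\<^sup>\<star> \<oplus> s1 \<otimes> s1\<^sup>\<star>) \<otimes> (x \<otimes> (s \<otimes> s\<^sup>\<star> \<oplus> s1 \<otimes> s1\<^sup>\<star>))"
    unfolding range_sum using xc by simp
  also have "\<dots> = (s \<otimes> (s\<^sup>\<star> \<otimes> (x \<otimes> s)) \<otimes> s\<^sup>\<star> \<oplus> s1 \<otimes> (s1\<^sup>\<star> \<otimes> (x \<otimes> s)) \<otimes> s\<^sup>\<star>)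
      \<oplus> (s \<otimes> (s\<^sup>\<star> \<otimes> (x \<otimes> s1)) \<otimes> s1\<^sup>\<star> \<oplus> s1 \<otimes> (s1\<^sup>\<star> \<otimes> (x \<otimes> s1)) \<otimes> s1\<^sup>\<star>)"
    using xc gen_closed by algebra
  finally have "\<parallel>x\<parallel> = \<parallel>(s \<otimes> (s\<^sup>\<star> \<otimes> (x \<otimes> s)) \<otimes> s\<^sup>\<star> \<oplus> s1 \<otimes> (s1\<^sup>\<star> \<otimes> (x \<otimes> s)) \<otimes> s\<^sup>\<star>)
      \<oplus> (s \<otimes> (s\<^sup>\<star> \<otimes> (x \<otimes> s1)) \<otimes> s1\<^sup>\<star> \<oplus> s1 \<otimes> (s1\<^sup>\<star> \<otimes> (x \<otimes> s1)) \<otimes> s1\<^sup>\<star>)\<parallel>" by (rule arg_cong)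
  also have "\<dots> \<le> (2 * K * l2 x + 2 * K * l2 x) + (2 * K * l2 x + 2 * K * l2 x)"
    using summand xc by (intro order_trans[OF cnorm_triangle] add_mono) auto
  also have "\<dots> = 8 ^ Suc n * (2 * real D + 1) * l2 x" by (simp add: K_def mult_ac)
  finally show ?case .
qed

text \<open>\<open>l2_bounded x t\<close> bounds the norm of \<open>x\<close> in the GNS representation of \<open>psi\<close>. It implies
  \<open>\<parallel>x\<parallel> \<le> t\<close>: for \<open>x\<close> of degree \<open>0\<close> because the norm and \<open>l2\<close> are equivalent on each level up to a
  factor growing linearly with the degree of the Laurent polynomials, so that the factor disappears in
  the roots of \<open>\<parallel>x\<parallel>\<^sup>N\<close>, \<open>N = 2\<^sup>i\<close>; in general because \<open>(x\<^sup>\<star> x)\<^sup>N\<close> has only \<open>O(N)\<close> homogeneous components.\<close>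

definition l2_bounded :: "'a \<Rightarrow> real \<Rightarrow> bool" where
  "l2_bounded x t \<longleftrightarrow> (\<forall>w\<in>polys. l2 (x \<otimes> w) \<le> t * l2 w)"

lemma l2_bounded_mult:
  assumes "x \<in> polys" "y \<in> polys" "l2_bounded x r" "l2_bounded y t" "r \<ge> 0"
  shows "l2_bounded (x \<otimes> y) (r * t)"
  unfolding l2_bounded_def
proof
  fix w assume w: "w \<in> polys"
  have "l2 ((x \<otimes> y) \<otimes> w) = l2 (x \<otimes> (y \<otimes> w))" using assms w polys_closed by (simp add: m_assoc)
  also have "\<dots> \<le> r * l2 (y \<otimes> w)" using assms w polys_mult by (auto simp: l2_bounded_def)
  also have "\<dots> \<le> r * (t * l2 w)" using assms w by (intro mult_left_mono) (auto simp: l2_bounded_def)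
  finally show "l2 ((x \<otimes> y) \<otimes> w) \<le> r * t * l2 w" by (simp add: mult.assoc)
qed

lemma polys_star: "x \<in> polys \<Longrightarrow> x\<^sup>\<star> \<in> polys"
  using poly_deg_star by (auto simp: polys_def)

text \<open>For \<open>v = x\<^sup>\<star> w\<close> the square of \<open>l2 v\<close> is
  \<open>psi ((x v)\<^sup>\<star> w)\<close>, at most \<open>t\<close> times \<open>l2 v\<close>
  times \<open>l2 w\<close>; cancel \<open>l2 v\<close>.\<close>

lemma l2_bounded_star:
  assumes x: "x \<in> polys" "l2_bounded x t" and t: "t \<ge> 0"
  shows "l2_bounded (x\<^sup>\<star>) t"
  unfolding l2_bounded_def
proof
  fix w assume w: "w \<in> polys"
  define v where "v = x\<^sup>\<star> \<otimes> w"
  have v: "v \<in> polys" unfolding v_def using x w polys_mult polys_star by blast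
  note c = polys_closed[OF x(1)] polys_closed[OF w] polys_closed[OF v]
  have "v\<^sup>\<star> \<otimes> v = (x \<otimes> v)\<^sup>\<star> \<otimes> w" using c by (simp add: v_def star_mult m_assoc)
  then have "(l2 v)\<^sup>2 \<le> cmod (psi ((x \<otimes> v)\<^sup>\<star> \<otimes> w))" using l2_square[OF c(3)] complex_Re_le_cmod by simp
  also have "\<dots> \<le> l2 (x \<otimes> v) * l2 w" using c by (intro cauchy_schwarz) auto
  also have "\<dots> \<le> (t * l2 v) * l2 w" using x v c by (intro mult_right_mono) (auto simp: l2_bounded_def)
  finally have "l2 v * l2 v \<le> l2 v * (t * l2 w)" by (simp add: power2_eq_square algebra_simps)
  then show "l2 (x\<^sup>\<star> \<otimes> w) \<le> t * l2 w"
    using l2_nonneg[OF c(3)] l2_nonneg[OF c(2)] t unfolding v_def[symmetric]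
    by (cases "l2 v = 0") auto
qed

lemma sq_iter_polys: "\<lbrakk>z \<in> polys; l2_bounded z t; t \<ge> 0\<rbrakk>
  \<Longrightarrow> sq_iter z i \<in> polys \<and> l2_bounded (sq_iter z i) (t ^ (2 ^ i))"
proof (induction i)
  case (Suc i)
  then show ?case using l2_bounded_mult[of "sq_iter z i" "sq_iter z i" "t ^ 2 ^ i" "t ^ 2 ^ i"] polys_mult
    by (simp add: mult.commute mult_2 power_add)
qed simp

lemma homog_0_norm_le:
  assumes z: "z \<in> homog 0" "z\<^sup>\<star> = z" "l2_bounded z t" and t: "t \<ge> 0"
  shows "\<parallel>z\<parallel> \<le> t"
proof -
  obtain n D where zl: "z \<in> level n D" using homog_0_level z by blast
  note zc = homog_closed[OF z(1)]
  have lev: "sq_iter z i \<in> level n (2 ^ i * D)" for i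
    by (induction i) (use zl level_mult in \<open>auto simp: mult_2 distrib_right simp del: level.simps\<close>)
  show ?thesis
  proof (rule le_of_power_growth[where C = "8 ^ n * (2 * real D + 1)"])
    fix i
    have p: "sq_iter z i \<in> polys" "l2_bounded (sq_iter z i) (t ^ (2 ^ i))"
      using sq_iter_polys[OF homog_polys[OF z(1)] z(3) t] by auto
    \<comment> \<open>Evaluate the operator bound at the vector \<open>w = \<one>\<close>, which has
      \<open>l2\<close> equal to 1.\<close>
    have "l2 (sq_iter z i) \<le> t ^ (2 ^ i)"
      using p polys_gen(3) polys_closed[OF p(1)] unfolding l2_bounded_def by (force simp: l2_one)
    have "\<parallel>z\<parallel> ^ (2 ^ i) \<le> 8 ^ n * (2 * real (2 ^ i * D) + 1) * l2 (sq_iter z i)"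
      using level_norm_le[OF lev[of i]] sq_iter[OF zc z(2), of i] by simp
    also have "\<dots> \<le> 8 ^ n * (2 * real (2 ^ i * D) + 1) * t ^ (2 ^ i)"
      using \<open>l2 (sq_iter z i) \<le> _\<close> by (intro mult_left_mono) auto
    also have "\<dots> \<le> 8 ^ n * (2 * real D + 1) * 2 ^ i * t ^ (2 ^ i)"
    proof -
      have "(1::real) \<le> 2 ^ i" by simp
      then have "2 * real (2 ^ i * D) + 1 \<le> (2 * real D + 1) * 2 ^ i" by (simp add: algebra_simps)
      then have "8 ^ n * (2 * real (2 ^ i * D) + 1) \<le> 8 ^ n * ((2 * real D + 1) * 2 ^ i)"
        by (intro mult_left_mono) auto
      then show ?thesis using t by (intro mult_right_mono) (auto simp: mult.assoc)
    qed
    finally show "\<parallel>z\<parallel> ^ (2 ^ i) \<le> 8 ^ n * (2 * real D + 1) * 2 ^ i * t ^ (2 ^ i)" .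
  qed (use zc t in auto)
qed

lemma psi_orthogonal_finsum:
  assumes "finite I" "\<And>i. i \<in> I \<Longrightarrow> v i \<in> homog (g i)" "x \<in> homog e" "\<And>i. i \<in> I \<Longrightarrow> g i \<noteq> e"
  shows "psi (x\<^sup>\<star> \<otimes> (\<Oplus>i\<in>I. v i)) = 0"
  using assms
proof (induction I rule: finite_induct)
  case (insert i I)
  have c: "v \<in> I \<rightarrow> carrier A" "v i \<in> carrier A" "x \<in> carrier A"
    using insert.prems homog_closed by (auto simp: Pi_iff) (blast intro: homog_closed)+
  have "x\<^sup>\<star> \<otimes> v i \<in> homog (- e + g i)" using insert.prems by (intro homog_mult homog_star) auto
  then have "psi (x\<^sup>\<star> \<otimes> v i) = 0" using insert.prems by (intro psi_homog) auto
  then show ?case using insert c by (simp add: r_distr psi_add)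
qed simp

text \<open>\<open>psi\<close> vanishes outside degree 0, so components of different degrees are
  orthogonal. The degree map \<open>g\<close> is left general because the lemma is applied to
  products, where degrees are shifted.\<close>

lemma l2_pythagoras:
  assumes "finite I" "\<And>i. i \<in> I \<Longrightarrow> v i \<in> homog (g i)" "inj_on g I"
  shows "(l2 (\<Oplus>i\<in>I. v i))\<^sup>2 = (\<Sum>i\<in>I. (l2 (v i))\<^sup>2)"
  using assms
proof (induction I rule: finite_induct)
  case (insert i I)
  have c: "v \<in> I \<rightarrow> carrier A" "v i \<in> carrier A"
    using insert.prems homog_closed by (auto simp: Pi_iff) (blast intro: homog_closed)+
  have "psi ((v i)\<^sup>\<star> \<otimes> (\<Oplus>i\<in>I. v i)) = 0"
  proof (rule psi_orthogonal_finsum[where g = g and e = "g i"])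
    show "g j \<noteq> g i" if "j \<in> I" for j using insert.prems(2) insert.hyps that by (auto simp: inj_on_def)
  qed (use insert in auto)
  then show ?case using insert c by (simp add: l2_add_square inj_on_insert)
qed simp

text \<open>On a homogeneous vector the products with the components of \<open>y\<close> have
  distinct degrees, so each is dominated by the whole. A general vector is treated componentwise,
  again by orthogonality.\<close>

lemma l2_bounded_component:
  assumes y: "y = (\<Oplus>d\<in>I. h d)" "finite I" "\<And>d. h d \<in> homog d" "l2_bounded y t" and d: "d \<in> I" and t: "t \<ge> 0"
  shows "l2_bounded (h d) t"
  unfolding l2_bounded_def
proof
  fix w assume w: "w \<in> polys"
  then obtain M where "w \<in> poly_deg M" by (auto simp: polys_def)
  then obtain we where we: "\<And>e. we e \<in> homog e" "w = (\<Oplus>e\<in>{- int M..int M}. we e)"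
    using poly_deg_decompose by blast
  let ?J = "{- int M..int M}"
  have hc: "h d \<in> carrier A" for d using homog_closed[OF y(3)] .
  have wc: "we e \<in> carrier A" for e using homog_closed[OF we(1)] .
  have comp: "l2 (h d \<otimes> we e) \<le> t * l2 (we e)" for e
  proof -
    have "y \<otimes> we e = (\<Oplus>d\<in>I. h d \<otimes> we e)" unfolding y(1) using hc wc y(2) by (intro finsum_ldistr) auto
    then have "(l2 (y \<otimes> we e))\<^sup>2 = (\<Sum>d\<in>I. (l2 (h d \<otimes> we e))\<^sup>2)"
      using l2_pythagoras[OF y(2), of "\<lambda>d. h d \<otimes> we e" "\<lambda>d. d + e"] homog_mult[OF y(3) we(1)]
      by (simp add: inj_on_def)
    moreover have "(l2 (h d \<otimes> we e))\<^sup>2 \<le> (\<Sum>d\<in>I. (l2 (h d \<otimes> we e))\<^sup>2)"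
      using d y(2) by (intro member_le_sum) auto
    ultimately have sq: "(l2 (h d \<otimes> we e))\<^sup>2 \<le> (l2 (y \<otimes> we e))\<^sup>2" by simp
    have yc: "y \<in> carrier A" unfolding y(1) using hc by (intro finsum_closed) auto
    have "l2 (h d \<otimes> we e) \<le> l2 (y \<otimes> we e)"
      by (rule power2_le_imp_le[OF sq]) (use yc wc in simp)
    also have "\<dots> \<le> t * l2 (we e)" using y(4) homog_polys[OF we(1)] by (auto simp: l2_bounded_def)
    finally show ?thesis .
  qed
  have "h d \<otimes> w = (\<Oplus>e\<in>?J. h d \<otimes> we e)" unfolding we(2) using hc wc by (intro finsum_rdistr) auto
  then have "(l2 (h d \<otimes> w))\<^sup>2 = (\<Sum>e\<in>?J. (l2 (h d \<otimes> we e))\<^sup>2)"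
    using l2_pythagoras[of ?J "\<lambda>e. h d \<otimes> we e" "\<lambda>e. d + e"] homog_mult[OF y(3) we(1)]
    by (simp add: inj_on_def)
  also have "\<dots> \<le> (\<Sum>e\<in>?J. (t * l2 (we e))\<^sup>2)"
    using comp hc wc by (intro sum_mono power_mono) auto
  also have "\<dots> = t\<^sup>2 * (l2 w)\<^sup>2"
    unfolding we(2) using l2_pythagoras[of ?J we "\<lambda>e. e"] we(1) by (simp add: power_mult_distrib sum_distrib_left)
  also have "\<dots> = (t * l2 w)\<^sup>2" by (simp add: power_mult_distrib)
  finally show "l2 (h d \<otimes> w) \<le> t * l2 w"
    by (rule power2_le_imp_le) (use t polys_closed[OF w] in auto)
qed

lemma polys_norm_le:
  assumes x: "x \<in> polys" "l2_bounded x t" and t: "t \<ge> 0"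
  shows "\<parallel>x\<parallel> \<le> t"
proof -
  note xc = polys_closed[OF x(1)]
  define z where "z = x\<^sup>\<star> \<otimes> x"
  have z: "z \<in> polys" "z \<in> carrier A" "z\<^sup>\<star> = z" unfolding z_def using x xc polys_mult polys_star by (auto simp: star_mult)
  have zb: "l2_bounded z (t * t)" unfolding z_def
    using x t by (intro l2_bounded_mult l2_bounded_star polys_star) auto
  obtain M where M: "z \<in> poly_deg M" using z by (auto simp: polys_def)
  have deg: "sq_iter z i \<in> poly_deg (2 ^ i * M)" for i
  proof (induction i)
    case (Suc i)
    then show ?case using poly_deg_mult[OF Suc Suc] by (simp add: mult_2 distrib_right)
  qed (use M in simp)
  have "\<parallel>z\<parallel> \<le> t * t"
  proof (rule le_of_power_growth[where C = "2 * real M + 1"])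
    fix i
    define T where "T = (t * t) ^ (2 ^ i)"
    have T: "T \<ge> 0" unfolding T_def using t by simp
    have pb: "l2_bounded (sq_iter z i) T"
      using sq_iter_polys[OF z(1) zb] t unfolding T_def by simp
    let ?I = "{- int (2 ^ i * M)..int (2 ^ i * M)}"
    obtain h where h: "\<And>d. h d \<in> homog d" "sq_iter z i = (\<Oplus>d\<in>?I. h d)"
      using poly_deg_decompose[OF deg[of i]] by blast
    have hn: "\<parallel>h d\<parallel> \<le> T" if "d \<in> ?I" for d
    proof -
      note hc = homog_closed[OF h(1)[of d]] and hp = homog_polys[OF h(1)[of d]]
      have hb: "l2_bounded (h d) T" using l2_bounded_component[OF h(2) _ h(1) pb that T] by simp
      \<comment> \<open>A component need not be selfadjoint or of degree 0, but
        \<open>(h d)\<^sup>\<star> \<otimes> h d\<close> is both.\<close>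
      then have "l2_bounded ((h d)\<^sup>\<star> \<otimes> h d) (T * T)"
        using hp T by (intro l2_bounded_mult l2_bounded_star polys_star) auto
      moreover have "(h d)\<^sup>\<star> \<otimes> h d \<in> homog 0" using homog_mult[OF homog_star[OF h(1)[of d]] h(1)[of d]] by simp
      ultimately have "\<parallel>(h d)\<^sup>\<star> \<otimes> h d\<parallel> \<le> T * T" using hc T by (intro homog_0_norm_le) (auto simp: star_mult)
      then have "\<parallel>h d\<parallel>\<^sup>2 \<le> T\<^sup>2" using cstar_identity[OF hc] by (simp add: power2_eq_square)
      then show ?thesis by (rule power2_le_imp_le) (rule T)
    qed
    have "\<parallel>z\<parallel> ^ (2 ^ i) = \<parallel>\<Oplus>d\<in>?I. h d\<parallel>" using sq_iter[OF z(2,3), of i] h(2) by simp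
    also have "\<dots> \<le> (\<Sum>d\<in>?I. \<parallel>h d\<parallel>)" using homog_closed[OF h(1)] by (intro norm_finsum_le) auto
    also have "\<dots> \<le> real (card ?I) * T" using hn by (intro sum_bounded_above) auto
    also have "\<dots> \<le> ((2 * real M + 1) * 2 ^ i) * T"
    proof (rule mult_right_mono[OF _ T])
      have "(1::real) \<le> 2 ^ i" by simp
      moreover have "real (card ?I) = 2 * (2 ^ i * real M) + 1" by (simp add: nat_add_distrib nat_mult_distrib)
      ultimately show "real (card ?I) \<le> (2 * real M + 1) * 2 ^ i" by (simp add: algebra_simps)
    qed
    finally show "\<parallel>z\<parallel> ^ (2 ^ i) \<le> (2 * real M + 1) * 2 ^ i * (t * t) ^ (2 ^ i)" by (simp add: T_def)
  qed (use z t in auto)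
  then have "\<parallel>x\<parallel>\<^sup>2 \<le> t\<^sup>2" using cstar_identity[OF xc] by (simp add: z_def power2_eq_square)
  then show ?thesis by (rule power2_le_imp_le) (rule t)
qed

text \<open>A null vector \<open>x\<close> satisfies \<open>l2 (x \<otimes> w) = 0\<close> for all
  polynomials \<open>w\<close>. An approximating polynomial \<open>y\<close> therefore acts with
  bound \<open>e / 2\<close> in the GNS seminorm, so its norm is at most \<open>e / 2\<close> as
  well.\<close>

theorem l2_faithful: assumes x: "x \<in> carrier A" and 0: "l2 x = 0" shows "x = \<zero>"
proof -
  have "\<parallel>x\<parallel> \<le> e" if e: "e > 0" for e
  proof -
    obtain y where y: "y \<in> polys" "\<parallel>y \<ominus> x\<parallel> < e / 2" using polys_approx[OF x, of "e / 2"] e by auto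
    note yc = polys_closed[OF y(1)]
    have "l2_bounded y (e / 2)"
      unfolding l2_bounded_def
    proof
      fix w assume w: "w \<in> polys"
      note wc = polys_closed[OF w]
      obtain C where "\<And>v. v \<in> carrier A \<Longrightarrow> l2 (v \<otimes> w) \<le> C * l2 v" using l2_right_poly[OF w] by blast
      then have xw: "l2 (x \<otimes> w) \<le> 0" using x 0 by force
      have "y \<otimes> w = (y \<ominus> x) \<otimes> w \<oplus> x \<otimes> w" using x yc wc by algebra
      then have "l2 (y \<otimes> w) \<le> l2 ((y \<ominus> x) \<otimes> w) + l2 (x \<otimes> w)" using l2_triangle x yc wc by simp
      also have "l2 ((y \<ominus> x) \<otimes> w) \<le> \<parallel>y \<ominus> x\<parallel> * l2 w" using x yc wc by (intro l2_mult_le) auto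
      also have "\<parallel>y \<ominus> x\<parallel> * l2 w \<le> e / 2 * l2 w" using y wc by (intro mult_right_mono) auto
      finally show "l2 (y \<otimes> w) \<le> e / 2 * l2 w" using xw by simp
    qed
    from polys_norm_le[OF y(1) this] have "\<parallel>y\<parallel> \<le> e / 2" using e by linarith
    then show ?thesis using norm_le_diff[OF x yc] norm_minus_commute[OF x yc] y(2) by simp
  qed
  then have "\<parallel>x\<parallel> \<le> 0" by (meson dense_ge)
  then have "\<parallel>x\<parallel> = 0" using cnorm_nonneg[OF x] by (rule antisym)
  then show ?thesis using cnorm_eq_0[OF x] by simp
qed

lemma fixed_by_shift_eq_0:
  assumes D: "D \<in> carrier A" "D = s \<otimes> (D \<otimes> s1\<^sup>\<star>)" shows "D = \<zero>"
proof -
  have "D\<^sup>\<star> \<otimes> D = (s \<otimes> (D \<otimes> s1\<^sup>\<star>))\<^sup>\<star> \<otimes> (s \<otimes> (D \<otimes> s1\<^sup>\<star>))" using D(2) by simp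
  also have "\<dots> = s1 \<otimes> ((D\<^sup>\<star> \<otimes> D) \<otimes> s1\<^sup>\<star>)" using D(1) by (simp add: star_mult m_assoc gen_rel_assoc)
  finally have "psi (D\<^sup>\<star> \<otimes> D) = psi (D\<^sup>\<star> \<otimes> D) / 2" using psi_expand(2)[of "D\<^sup>\<star> \<otimes> D"] D(1) by simp
  then have "psi (D\<^sup>\<star> \<otimes> D) = 0" by simp
  then show ?thesis using l2_faithful[OF D(1)] by (simp add: l2_def)
qed

primrec vpow :: "'a \<Rightarrow> nat \<Rightarrow> 'a" where
  "vpow v 0 = \<one>"
| "vpow v (Suc n) = v \<otimes> vpow v n"

lemma vpow_closed [simp]: "v \<in> carrier A \<Longrightarrow> vpow v n \<in> carrier A"
  by (induction n) auto

lemma vpow_isometry: "\<lbrakk>v \<in> carrier A; v\<^sup>\<star> \<otimes> v = \<one>\<rbrakk> \<Longrightarrow> (vpow v n)\<^sup>\<star> \<otimes> vpow v n = \<one>"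
proof (induction n)
  case (Suc n)
  have "(vpow v (Suc n))\<^sup>\<star> \<otimes> vpow v (Suc n) = (vpow v n)\<^sup>\<star> \<otimes> ((v\<^sup>\<star> \<otimes> v) \<otimes> vpow v n)"
    using Suc.prems(1) by (simp add: star_mult m_assoc)
  then show ?case using Suc by simp
qed simp

text \<open>The range projection of \<open>v^n\<close> has \<open>psi\<close> equal to
  \<open>2^(-n)\<close>, so the claim holds for \<open>x = \<one>\<close>, then for polynomials by
  boundedness of right multiplication, and finally by approximation.\<close>

lemma l2_vpow_star_tends:
  assumes v: "v \<in> {s, s1}" and x: "x \<in> carrier A"
  shows "(\<lambda>n. l2 ((vpow v n)\<^sup>\<star> \<otimes> x)) \<longlonglongrightarrow> 0"
proof (rule LIMSEQ_I)
  have vc: "v \<in> carrier A" "v\<^sup>\<star> \<otimes> v = \<one>" using v gen_rel s1_rel by auto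
  have half: "psi (v \<otimes> (y \<otimes> v\<^sup>\<star>)) = psi y / 2" if "y \<in> carrier A" for y using v psi_expand that by auto
  have "psi (vpow v n \<otimes> (vpow v n)\<^sup>\<star>) = (1/2) ^ n" for n
  proof (induction n)
    case (Suc n)
    have "vpow v (Suc n) \<otimes> (vpow v (Suc n))\<^sup>\<star> = v \<otimes> ((vpow v n \<otimes> (vpow v n)\<^sup>\<star>) \<otimes> v\<^sup>\<star>)"
      using vc by (simp add: star_mult m_assoc)
    then show ?case using half[of "vpow v n \<otimes> (vpow v n)\<^sup>\<star>"] Suc vc by simp
  qed (simp add: psi_one)
  then have l2v: "l2 ((vpow v n)\<^sup>\<star>) = sqrt ((1/2) ^ n)" for n
    using vc by (simp add: l2_def)
  fix e :: real assume e: "e > 0"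
  obtain w where w: "w \<in> polys" "\<parallel>w \<ominus> x\<parallel> < e / 2" using polys_approx[OF x, of "e / 2"] e by auto
  note wc = polys_closed[OF w(1)]
  obtain C where C: "\<And>v. v \<in> carrier A \<Longrightarrow> l2 (v \<otimes> w) \<le> C * l2 v" using l2_right_poly[OF w(1)] by blast
  have "(\<lambda>n. C * sqrt ((1/2) ^ n)) \<longlonglongrightarrow> C * sqrt 0"
    by (intro tendsto_mult tendsto_const tendsto_real_sqrt LIMSEQ_power_zero) auto
  then have "\<forall>\<^sub>F n in sequentially. C * sqrt ((1/2) ^ n) < e / 2"
    using e by (intro order_tendstoD(2)) auto
  then obtain N where N: "\<And>n. n \<ge> N \<Longrightarrow> C * sqrt ((1/2) ^ n) < e / 2" by (auto simp: eventually_sequentially)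
  have "l2 ((vpow v n)\<^sup>\<star> \<otimes> x) < e" if "n \<ge> N" for n
  proof -
    let ?p = "(vpow v n)\<^sup>\<star>"
    have p: "?p \<in> carrier A" "\<parallel>?p\<parallel> \<le> 1"
      using vc vpow_isometry[OF vc] norm_isometry_le[of "vpow v n"] by auto
    have "?p \<otimes> x = ?p \<otimes> w \<oplus> ?p \<otimes> (x \<ominus> w)" using p(1) x wc by algebra
    then have "l2 (?p \<otimes> x) \<le> l2 (?p \<otimes> w) + l2 (?p \<otimes> (x \<ominus> w))" using l2_triangle p(1) x wc by simp
    also have "l2 (?p \<otimes> w) \<le> C * sqrt ((1/2) ^ n)" using C[OF p(1)] l2v by simp
    also have "l2 (?p \<otimes> (x \<ominus> w)) \<le> l2 (x \<ominus> w)" using p x wc by (intro l2_contract) auto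
    also have "l2 (x \<ominus> w) \<le> \<parallel>x \<ominus> w\<parallel>" using x wc by (intro l2_le_norm) auto
    finally show ?thesis using N[OF that] w(2) norm_minus_commute[OF x wc] by simp
  qed
  then show "\<exists>N. \<forall>n\<ge>N. norm (l2 ((vpow v n)\<^sup>\<star> \<otimes> x) - 0) < e"
    using vc x by (intro exI[of _ N]) auto
qed

end

section \<open>Irreducibility and rigidity\<close>

context cstar_algebra
begin

lemma cstar_generated_subalgebra:
  assumes "X \<subseteq> carrier A" shows "cstar_subalgebra (cstar_generated A X) A"
proof -
  have full: "cstar_subalgebra (carrier A) A"
    unfolding cstar_subalgebra_def norm_closed_iff by (auto dest: tendsD)
  have sub: "cstar_generated A X \<subseteq> carrier A" unfolding cstar_generated_def using full assms by blast
  have D: "C \<subseteq> carrier A" "\<zero> \<in> C" "\<And>x y. \<lbrakk>x \<in> C; y \<in> C\<rbrakk> \<Longrightarrow> x \<oplus> y \<in> C"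
    "\<And>x y. \<lbrakk>x \<in> C; y \<in> C\<rbrakk> \<Longrightarrow> x \<otimes> y \<in> C" "\<And>c x. x \<in> C \<Longrightarrow> c \<odot> x \<in> C"
    "\<And>x. x \<in> C \<Longrightarrow> x\<^sup>\<star> \<in> C"
    if "cstar_subalgebra C A" for C
    using that unfolding cstar_subalgebra_def by auto
  have lim: "x \<in> C" if "cstar_subalgebra C A" "\<forall>n. F n \<in> C" "F \<leadsto> x" for C F x
    using that unfolding cstar_subalgebra_def norm_closed_iff by blast
  have "norm_closed A (cstar_generated A X)"
    unfolding norm_closed_iff
  proof (intro conjI allI impI sub)
    fix F x assume F: "(\<forall>n. F n \<in> cstar_generated A X) \<and> F \<leadsto> x"
    show "x \<in> cstar_generated A X" unfolding cstar_generated_def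
    proof
      fix C assume "C \<in> {C. cstar_subalgebra C A \<and> X \<subseteq> C}"
      then show "x \<in> C" using F lim[of C F x] by (auto simp: cstar_generated_def)
    qed
  qed
  then show ?thesis
    unfolding cstar_subalgebra_def using sub D unfolding cstar_generated_def by auto
qed

lemma cstar_generated_superset: "X \<subseteq> cstar_generated A X"
  by (auto simp: cstar_generated_def)

lemma cstar_generated_least: "\<lbrakk>cstar_subalgebra C A; X \<subseteq> C\<rbrakk> \<Longrightarrow> cstar_generated A X \<subseteq> C"
  by (auto simp: cstar_generated_def)

end

lemma pos_matrix_cong:
  "(\<And>i j. \<lbrakk>i < n; j < n\<rbrakk> \<Longrightarrow> x i j = y i j) \<Longrightarrow> pos_matrix A n x \<longleftrightarrow> pos_matrix A n y"
  by (simp add: pos_matrix_def)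

lemma pos_matrix_0: "pos_matrix A 0 x"
  by (simp add: pos_matrix_def)

lemma operator_system_carrier:
  assumes "cstar_algebra A" shows "operator_system (carrier A) A"
proof -
  interpret cstar_algebra A by (rule assms)
  show ?thesis by (simp add: operator_system_def)
qed

lemma (in cstar_hom) operator_system_image: "operator_system (h ` carrier A) B"
proof -
  have "h x \<oplus>\<^bsub>B\<^esub> h y \<in> h ` carrier A" if "x \<in> carrier A" "y \<in> carrier A" for x y
    by (rule image_eqI[of _ _ "x \<oplus>\<^bsub>A\<^esub> y"]) (use that in auto)
  moreover have "c \<odot>\<^bsub>B\<^esub> h x \<in> h ` carrier A" if "x \<in> carrier A" for c x
    by (rule image_eqI[of _ _ "c \<odot>\<^bsub>A\<^esub> x"]) (use that in auto)
  moreover have "star B (h x) \<in> h ` carrier A" if "x \<in> carrier A" for x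
    by (rule image_eqI[of _ _ "star A x"]) (use that in auto)
  moreover have "\<one>\<^bsub>B\<^esub> \<in> h ` carrier A" by (rule image_eqI[of _ _ "\<one>\<^bsub>A\<^esub>"]) auto
  ultimately show ?thesis unfolding operator_system_def by auto
qed

text \<open>This is the identity of \<open>S\<close>, read from one copy to the other. Positivity of
  matrices is pulled back along the injective \<open>h\<close>, by means of the Cuntz families in
  \<open>S\<close>, and pushed forward along \<open>k\<close>.\<close>

lemma ucp_between_images:
  assumes h: "cstar_hom S B h" and k: "cstar_hom S C k" and inj: "inj_on h (carrier S)"
    and fam: "\<And>n. n \<ge> 1 \<Longrightarrow> \<exists>T. cstar_algebra.iso_family S T n"
  shows "ucp (h ` carrier S) B C (\<lambda>y. k (inv_into (carrier S) h y))"
proof -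
  interpret h: cstar_hom S B h by (rule h)
  interpret k: cstar_hom S C k by (rule k)
  define g where "g = inv_into (carrier S) h"
  have gh: "g (h x) = x" if "x \<in> carrier S" for x unfolding g_def using inj that by simp
  show ?thesis
    unfolding g_def[symmetric] ucp_def
  proof (intro conjI ballI allI impI)
    fix n x assume x: "(\<forall>i<n. \<forall>j<n. x i j \<in> h ` carrier S) \<and> pos_matrix B n x"
    show "pos_matrix C n (\<lambda>i j. k (g (x i j)))"
    proof (cases "n = 0")
      case False
      then obtain T where T: "h.A.iso_family T n" using fam[of n] by auto
      have gx: "g (x i j) \<in> carrier S" "h (g (x i j)) = x i j" if ij: "i < n" "j < n" for i j
      proof -
        have "x i j \<in> h ` carrier S" using x ij by blast
        then obtain a where "a \<in> carrier S" "x i j = h a" by blast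
        then show "g (x i j) \<in> carrier S" "h (g (x i j)) = x i j" using gh by auto
      qed
      have px: "pos_matrix B n (\<lambda>i j. h (g (x i j)))"
        using x pos_matrix_cong[of n "\<lambda>i j. h (g (x i j))" x B] gx(2) by simp
      have "pos_matrix S n (\<lambda>i j. g (x i j))"
        by (rule h.pos_matrix_hom_imp[OF inj T gx(1) px])
      then show ?thesis by (rule k.hom_pos_matrix)
    qed (simp add: pos_matrix_0)
  next
    show "k (g \<one>\<^bsub>B\<^esub>) = \<one>\<^bsub>C\<^esub>" using gh[of "\<one>\<^bsub>S\<^esub>"] by simp
  next
    fix x y assume "x \<in> h ` carrier S" "y \<in> h ` carrier S"
    then obtain a b where "a \<in> carrier S" "b \<in> carrier S" "x = h a" "y = h b" by auto
    then show "k (g (x \<oplus>\<^bsub>B\<^esub> y)) = k (g x) \<oplus>\<^bsub>C\<^esub> k (g y)"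
      using gh[of "a \<oplus>\<^bsub>S\<^esub> b"] gh by simp
  next
    fix c x assume "x \<in> h ` carrier S"
    then obtain a where "a \<in> carrier S" "x = h a" by auto
    then show "k (g (c \<odot>\<^bsub>B\<^esub> x)) = c \<odot>\<^bsub>C\<^esub> k (g x)" using gh[of "c \<odot>\<^bsub>S\<^esub> a"] gh by simp
  next
    fix x assume "x \<in> h ` carrier S"
    then show "k (g x) \<in> carrier C" using gh by auto
  qed
qed

context diadic_cstar
begin

abbreviation cuntz :: "'a set" where "cuntz \<equiv> cstar_generated A {s1, s}"

lemma cuntz_subalgebra: "cstar_subalgebra cuntz A"
  by (rule cstar_generated_subalgebra) auto

lemma cuntz_gen: "s1 \<in> cuntz" "s \<in> cuntz"
  using cstar_generated_superset[of "{s1, s}"] by auto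

lemma cuntz_one: "\<one> \<in> cuntz"
proof -
  have "s \<otimes> s\<^sup>\<star> \<oplus> s1 \<otimes> s1\<^sup>\<star> \<in> cuntz"
    using cuntz_subalgebra cuntz_gen unfolding cstar_subalgebra_def by blast
  then show ?thesis by (simp only: range_sum)
qed

lemma intermediate_simple:
  assumes C: "cstar_subalgebra C A" "cuntz \<subseteq> C"
  shows "simple_cstar (A\<lparr>carrier := C\<rparr>)"
proof -
  let ?S = "A\<lparr>carrier := C\<rparr>"
  have 1: "\<one> \<in> C" using C cuntz_one by blast
  note D = subalgebraD[OF C(1) 1]
  have sC: "s \<in> C" "s1 \<in> C" using cuntz_gen C by auto
  interpret S: cstar_algebra ?S by (rule subalgebra_cstar[OF C(1) 1])
  have "J = {\<zero>} \<or> J = C" if J: "ideal J ?S" "norm_closed ?S J" for J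
  proof -
    interpret J: ideal J ?S by (rule J(1))
    have JC: "J \<subseteq> C" using J(2) unfolding S.norm_closed_iff by simp
    have left: "\<And>a y. \<lbrakk>y \<in> J; a \<in> C\<rbrakk> \<Longrightarrow> a \<otimes> y \<in> J" using J.I_l_closed by simp
    have right: "\<And>a y. \<lbrakk>y \<in> J; a \<in> C\<rbrakk> \<Longrightarrow> y \<otimes> a \<in> J" using J.I_r_closed by simp
    have add: "\<And>x y. \<lbrakk>x \<in> J; y \<in> J\<rbrakk> \<Longrightarrow> x \<oplus> y \<in> J" using J.a_closed by simp
    have zero: "\<zero> \<in> J" using J.zero_closed by simp
    \<comment> \<open>\<open>ideal\<close> is a ring-theoretic notion; scalars enter as
      multiplication by \<open>c \<odot> \<one>\<close>.\<close>
    have smult: "c \<odot> y \<in> J" if "y \<in> J" for c y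
    proof -
      have "(c \<odot> \<one>) \<otimes> y \<in> J" using that D(5)[OF 1] by (intro left) auto
      then show ?thesis using that JC D(1) by (simp add: smult_mult_l subset_iff)
    qed
    show ?thesis
    proof (cases "J \<subseteq> {\<zero>}")
      case False
      then obtain x where x: "x \<in> J" "x \<noteq> \<zero>" by auto
      have xc: "x \<in> carrier A" using x JC D(1) by blast
      let ?y = "x\<^sup>\<star> \<otimes> x"
      have Phi: "Phi y \<in> J" if "y \<in> J" for y
        unfolding Phi_def
        by (rule smult[OF add[OF left[OF right[OF that sC(1)] D(6)[OF sC(1)]]
              left[OF right[OF that sC(2)] D(6)[OF sC(2)]]]])
      have PJ: "Phin n ?y \<in> J" for n
        by (induction n) (use x JC D(6) left Phi in \<open>auto simp: subset_iff\<close>)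
      have "conv ?y (psi ?y)" using xc by (intro conv_psi) auto
      then have t: "(\<lambda>n. Phin n ?y) \<leadsto> psi ?y \<odot> \<one>" by (simp add: conv_def)
      have St: "S.tends (\<lambda>n. Phin n ?y) (psi ?y \<odot> \<one>)"
        using subalgebra_tends_iff[OF C(1) 1, of "\<lambda>n. Phin n ?y" "psi ?y \<odot> \<one>"] PJ JC D(5)[OF 1] t
        by blast
      have "\<forall>X z. (\<forall>n. X n \<in> J) \<and> S.tends X z \<longrightarrow> z \<in> J"
        using J(2) unfolding S.norm_closed_iff by blast
      from this[rule_format, OF conjI, OF allI, OF PJ St] have yJ: "psi ?y \<odot> \<one> \<in> J" .
      have "psi ?y \<noteq> 0" using l2_faithful[OF xc] x psi_star_mult[OF xc] by auto
      have "(1 / psi ?y) \<odot> (psi ?y \<odot> \<one>) \<in> J" by (rule smult[OF yJ])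
      moreover have "(1 / psi ?y) \<odot> (psi ?y \<odot> \<one>) = \<one>"
        using \<open>psi ?y \<noteq> 0\<close> smult_smult[of \<one> "1 / psi ?y" "psi ?y"] by simp
      ultimately have "\<one> \<in> J" by metis
      then have "C \<subseteq> J" using left D(1) by force
      then show ?thesis using JC by auto
    qed (use zero in auto)
  qed
  moreover have "C \<noteq> {\<zero>}" using 1 nontrivial by auto
  ultimately show ?thesis unfolding simple_cstar_def using S.cstar_algebra_axioms by simp
qed

lemma cuntz_irreducible: "cstar_irreducible cuntz A"
  unfolding cstar_irreducible_def unital_inclusion_def
  using intermediate_simple cuntz_subalgebra cuntz_one cstar_algebra_axioms by blast

text \<open>Formulated along a homomorphism \<open>j\<close>, so that it serves both rigidity, with
  \<open>j\<close> the identity, and the envelope. The multiplicative domain yields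
  \<open>D S = 0\<close> and \<open>D T = S D\<close> for the images \<open>S\<close>,
  \<open>T\<close> of \<open>s\<close>, \<open>s1\<close>; expanding \<open>D\<close> along
  \<open>S S\<^sup>\<star> + T T\<^sup>\<star> = 1\<close> gives the claim.\<close>

lemma ucp_shift_equation:
  assumes h: "cstar_hom A B j" and r: "ucp_map B B \<rho>"
    and fixed: "\<And>x. x \<in> cuntz \<Longrightarrow> \<rho> (j x) = j x" and D: "D = j u \<ominus>\<^bsub>B\<^esub> \<rho> (j u)"
  shows "D = j s \<otimes>\<^bsub>B\<^esub> (D \<otimes>\<^bsub>B\<^esub> star B (j s1))"
proof -
  interpret h: cstar_hom A B j by (rule h)
  interpret r: ucp_map B B \<rho> by (rule r)
  define U where "U = j u"
  define V where "V = \<rho> (j u)"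
  define S where "S = j s"
  define T where "T = j s1"
  have c: "U \<in> carrier B" "V \<in> carrier B" "S \<in> carrier B" "T \<in> carrier B"
    unfolding U_def V_def S_def T_def by auto
  have fS: "\<rho> S = S" "\<rho> T = T" unfolding S_def T_def by (rule fixed, rule cuntz_gen)+
  have iso: "star B S \<otimes>\<^bsub>B\<^esub> S = \<one>\<^bsub>B\<^esub>" using arg_cong[OF gen_rel(3), of j] unfolding S_def by simp
  have US: "U \<otimes>\<^bsub>B\<^esub> S = T" unfolding U_def S_def T_def by simp
  have UT: "U \<otimes>\<^bsub>B\<^esub> T = S \<otimes>\<^bsub>B\<^esub> U" using arg_cong[OF gen_rel(4), of j]
    unfolding U_def S_def T_def by simp
  have isoT: "star B T \<otimes>\<^bsub>B\<^esub> T = \<one>\<^bsub>B\<^esub>" using arg_cong[OF s1_rel(1), of j] unfolding T_def by (simp del: hom_mult)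
  have sum: "S \<otimes>\<^bsub>B\<^esub> star B S \<oplus>\<^bsub>B\<^esub> T \<otimes>\<^bsub>B\<^esub> star B T = \<one>\<^bsub>B\<^esub>"
    using arg_cong[OF range_sum, of j] unfolding S_def T_def by simp
  have VS: "V \<otimes>\<^bsub>B\<^esub> S = T"
    using r.multiplicative_domain(2)[of S U] c iso fS US by (simp add: U_def V_def)
  have VT: "V \<otimes>\<^bsub>B\<^esub> T = \<rho> (S \<otimes>\<^bsub>B\<^esub> U)"
    using r.multiplicative_domain(2)[of T U] c isoT fS UT by (simp add: U_def V_def)
  \<comment> \<open>Pulling \<open>S\<close> out on the left requires \<open>S\<^sup>\<star>\<close>
    to satisfy the multiplicative domain condition, which holds because \<open>\<rho>\<close> fixes
    \<open>S S\<^sup>\<star>\<close>.\<close>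
  have "s \<otimes> s\<^sup>\<star> \<in> cuntz" using cuntz_subalgebra cuntz_gen unfolding cstar_subalgebra_def by blast
  from fixed[OF this] have "\<rho> (S \<otimes>\<^bsub>B\<^esub> star B S) = S \<otimes>\<^bsub>B\<^esub> star B S" unfolding S_def by simp
  then have SU: "\<rho> (S \<otimes>\<^bsub>B\<^esub> U) = S \<otimes>\<^bsub>B\<^esub> V"
    using r.multiplicative_domain(1)[of "star B S" U] c fS by (simp add: U_def V_def)
  have Dc: "D \<in> carrier B" and D': "D = U \<ominus>\<^bsub>B\<^esub> V" unfolding D U_def V_def by auto
  have "D \<otimes>\<^bsub>B\<^esub> S = U \<otimes>\<^bsub>B\<^esub> S \<ominus>\<^bsub>B\<^esub> V \<otimes>\<^bsub>B\<^esub> S" unfolding D' using c by algebra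
  then have DS: "D \<otimes>\<^bsub>B\<^esub> S = \<zero>\<^bsub>B\<^esub>" unfolding US VS using c by (simp add: h.B.minus_eq h.B.r_neg)
  have "D \<otimes>\<^bsub>B\<^esub> T = U \<otimes>\<^bsub>B\<^esub> T \<ominus>\<^bsub>B\<^esub> V \<otimes>\<^bsub>B\<^esub> T" unfolding D' using c by algebra
  also have "\<dots> = S \<otimes>\<^bsub>B\<^esub> D" unfolding UT VT SU D' using c by algebra
  finally have DT: "D \<otimes>\<^bsub>B\<^esub> T = S \<otimes>\<^bsub>B\<^esub> D" .
  have "D = D \<otimes>\<^bsub>B\<^esub> (S \<otimes>\<^bsub>B\<^esub> star B S \<oplus>\<^bsub>B\<^esub> T \<otimes>\<^bsub>B\<^esub> star B T)" unfolding sum using Dc by simp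
  also have "\<dots> = (D \<otimes>\<^bsub>B\<^esub> S) \<otimes>\<^bsub>B\<^esub> star B S \<oplus>\<^bsub>B\<^esub> (D \<otimes>\<^bsub>B\<^esub> T) \<otimes>\<^bsub>B\<^esub> star B T"
    using c Dc by algebra
  also have "\<dots> = S \<otimes>\<^bsub>B\<^esub> (D \<otimes>\<^bsub>B\<^esub> star B T)" unfolding DS DT using c Dc by (simp add: h.B.m_assoc)
  finally show ?thesis unfolding S_def T_def .
qed

text \<open>The fixed points of a ucp map need not form an algebra; the set \<open>K\<close> of
  elements over which \<open>\<rho>\<close> is a bimodule map does, and it is closed. As
  \<open>u\<close> is unitary and \<open>s\<close> isometric, \<open>s s\<^sup>\<star>\<close> is
  the only product whose fixing has to be assumed for the multiplicative domain.\<close>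

lemma ucp_fixes_all:
  assumes h: "cstar_hom A B j" and r: "ucp_map B B \<rho>"
    and fixed: "\<rho> (j u) = j u" "\<rho> (j s) = j s" "\<rho> (j (s \<otimes> s\<^sup>\<star>)) = j (s \<otimes> s\<^sup>\<star>)" and x: "x \<in> carrier A"
  shows "\<rho> (j x) = j x"
proof -
  interpret h: cstar_hom A B j by (rule h)
  interpret r: ucp_map B B \<rho> by (rule r)
  define K where "K = {x \<in> carrier A. \<forall>b\<in>carrier B. \<rho> (j x \<otimes>\<^bsub>B\<^esub> b) = j x \<otimes>\<^bsub>B\<^esub> \<rho> b \<and> \<rho> (b \<otimes>\<^bsub>B\<^esub> j x) = \<rho> b \<otimes>\<^bsub>B\<^esub> j x}"
  have gen: "x \<in> K" if "x \<in> carrier A" "\<rho> (j x) = j x" "\<rho> (j (x\<^sup>\<star> \<otimes> x)) = j (x\<^sup>\<star> \<otimes> x)"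
    "\<rho> (j (x \<otimes> x\<^sup>\<star>)) = j (x \<otimes> x\<^sup>\<star>)" for x
  proof -
    have "\<rho> (j x \<otimes>\<^bsub>B\<^esub> b) = j x \<otimes>\<^bsub>B\<^esub> \<rho> b" if b: "b \<in> carrier B" for b
      using r.multiplicative_domain(1)[of "star B (j x)" b] b \<open>x \<in> carrier A\<close> \<open>\<rho> (j x) = j x\<close> \<open>\<rho> (j (x \<otimes> x\<^sup>\<star>)) = _\<close> by simp
    moreover have "\<rho> (b \<otimes>\<^bsub>B\<^esub> j x) = \<rho> b \<otimes>\<^bsub>B\<^esub> j x" if b: "b \<in> carrier B" for b
      using r.multiplicative_domain(2)[of "j x" b] b \<open>x \<in> carrier A\<close> \<open>\<rho> (j x) = j x\<close> \<open>\<rho> (j (x\<^sup>\<star> \<otimes> x)) = _\<close> by simp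
    ultimately show ?thesis unfolding K_def using that by blast
  qed
  have one: "\<rho> (j \<one>) = j \<one>" by simp
  have uK: "u \<in> K" by (rule gen) (use fixed gen_rel in auto)
  have sK: "s \<in> K" by (rule gen) (use fixed gen_rel in auto)
  have Kc: "K \<subseteq> carrier A" unfolding K_def by auto
  have KD: "\<And>x b. \<lbrakk>x \<in> K; b \<in> carrier B\<rbrakk> \<Longrightarrow> \<rho> (j x \<otimes>\<^bsub>B\<^esub> b) = j x \<otimes>\<^bsub>B\<^esub> \<rho> b"
    "\<And>x b. \<lbrakk>x \<in> K; b \<in> carrier B\<rbrakk> \<Longrightarrow> \<rho> (b \<otimes>\<^bsub>B\<^esub> j x) = \<rho> b \<otimes>\<^bsub>B\<^esub> j x" unfolding K_def by auto
  have KI: "\<lbrakk>x \<in> carrier A; \<And>b. b \<in> carrier B \<Longrightarrow> \<rho> (j x \<otimes>\<^bsub>B\<^esub> b) = j x \<otimes>\<^bsub>B\<^esub> \<rho> b;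
      \<And>b. b \<in> carrier B \<Longrightarrow> \<rho> (b \<otimes>\<^bsub>B\<^esub> j x) = \<rho> b \<otimes>\<^bsub>B\<^esub> j x\<rbrakk> \<Longrightarrow> x \<in> K" for x unfolding K_def by auto
  have "cstar_subalgebra K A"
    unfolding cstar_subalgebra_def
  proof (intro conjI ballI allI Kc)
    show "\<zero> \<in> K" by (rule KI) auto
    fix x assume xK: "x \<in> K"
    then have x: "x \<in> carrier A" using Kc by auto
    show "c \<odot> x \<in> K" for c
      by (rule KI) (use xK x KD in \<open>auto simp: h.B.smult_mult_l h.B.smult_mult_r\<close>)
    show "x\<^sup>\<star> \<in> K"
    proof (rule KI)
      fix b assume b: "b \<in> carrier B"
      have "star B (\<rho> (star B b \<otimes>\<^bsub>B\<^esub> j x)) = star B (\<rho> (star B b) \<otimes>\<^bsub>B\<^esub> j x)" using KD(2)[OF xK] b by simp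
      moreover have "star B (\<rho> (star B b \<otimes>\<^bsub>B\<^esub> j x)) = \<rho> (star B (star B b \<otimes>\<^bsub>B\<^esub> j x))" using b x by (simp del: h.B.star_mult)
      ultimately show "\<rho> (j (x\<^sup>\<star>) \<otimes>\<^bsub>B\<^esub> b) = j (x\<^sup>\<star>) \<otimes>\<^bsub>B\<^esub> \<rho> b" using b x by (simp add: h.B.star_mult)
      have "star B (\<rho> (j x \<otimes>\<^bsub>B\<^esub> star B b)) = star B (j x \<otimes>\<^bsub>B\<^esub> \<rho> (star B b))" using KD(1)[OF xK] b by simp
      moreover have "star B (\<rho> (j x \<otimes>\<^bsub>B\<^esub> star B b)) = \<rho> (star B (j x \<otimes>\<^bsub>B\<^esub> star B b))" using b x by (simp del: h.B.star_mult)
      ultimately show "\<rho> (b \<otimes>\<^bsub>B\<^esub> j (x\<^sup>\<star>)) = \<rho> b \<otimes>\<^bsub>B\<^esub> j (x\<^sup>\<star>)" using b x by (simp add: h.B.star_mult)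
    qed (use x in simp)
    fix y assume yK: "y \<in> K"
    then have y: "y \<in> carrier A" using Kc by auto
    show "x \<oplus> y \<in> K" by (rule KI) (use xK yK x y KD in \<open>auto simp: h.B.l_distr h.B.r_distr\<close>)
    show "x \<otimes> y \<in> K"
    proof (rule KI)
      fix b assume b: "b \<in> carrier B"
      have "\<rho> (j x \<otimes>\<^bsub>B\<^esub> (j y \<otimes>\<^bsub>B\<^esub> b)) = j x \<otimes>\<^bsub>B\<^esub> (j y \<otimes>\<^bsub>B\<^esub> \<rho> b)"
        using KD(1)[OF xK, of "j y \<otimes>\<^bsub>B\<^esub> b"] KD(1)[OF yK b] y b by simp
      then show "\<rho> (j (x \<otimes> y) \<otimes>\<^bsub>B\<^esub> b) = j (x \<otimes> y) \<otimes>\<^bsub>B\<^esub> \<rho> b" using x y b by (simp add: h.B.m_assoc)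
      have "\<rho> ((b \<otimes>\<^bsub>B\<^esub> j x) \<otimes>\<^bsub>B\<^esub> j y) = (\<rho> b \<otimes>\<^bsub>B\<^esub> j x) \<otimes>\<^bsub>B\<^esub> j y"
        using KD(2)[OF yK, of "b \<otimes>\<^bsub>B\<^esub> j x"] KD(2)[OF xK b] x b by simp
      then show "\<rho> (b \<otimes>\<^bsub>B\<^esub> j (x \<otimes> y)) = \<rho> b \<otimes>\<^bsub>B\<^esub> j (x \<otimes> y)" using x y b by (simp add: h.B.m_assoc)
    qed (use x y in simp)
  next
    show "norm_closed A K" unfolding norm_closed_iff
    proof (intro conjI allI impI Kc)
      fix X x assume "(\<forall>n. X n \<in> K) \<and> X \<leadsto> x"
      then have XK: "\<And>n. X n \<in> K" and X: "X \<leadsto> x" by auto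
      show "x \<in> K"
      proof (rule KI)
        show "x \<in> carrier A" using tendsD[OF X] by simp
        fix b assume b: "b \<in> carrier B"
        note jX = h.hom_tends[OF X]
        have "h.B.tends (\<lambda>n. \<rho> (j (X n) \<otimes>\<^bsub>B\<^esub> b)) (\<rho> (j x \<otimes>\<^bsub>B\<^esub> b))"
          by (intro r.ucp_tends h.B.tends_mult jX h.B.tends_const b)
        then have "h.B.tends (\<lambda>n. j (X n) \<otimes>\<^bsub>B\<^esub> \<rho> b) (\<rho> (j x \<otimes>\<^bsub>B\<^esub> b))" by (simp only: KD(1)[OF XK b])
        moreover have "h.B.tends (\<lambda>n. j (X n) \<otimes>\<^bsub>B\<^esub> \<rho> b) (j x \<otimes>\<^bsub>B\<^esub> \<rho> b)"
          using b by (intro h.B.tends_mult jX h.B.tends_const) auto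
        ultimately show "\<rho> (j x \<otimes>\<^bsub>B\<^esub> b) = j x \<otimes>\<^bsub>B\<^esub> \<rho> b" by (rule h.B.tends_unique)
        have "h.B.tends (\<lambda>n. \<rho> (b \<otimes>\<^bsub>B\<^esub> j (X n))) (\<rho> (b \<otimes>\<^bsub>B\<^esub> j x))"
          by (intro r.ucp_tends h.B.tends_mult jX h.B.tends_const b)
        then have "h.B.tends (\<lambda>n. \<rho> b \<otimes>\<^bsub>B\<^esub> j (X n)) (\<rho> (b \<otimes>\<^bsub>B\<^esub> j x))" by (simp only: KD(2)[OF XK b])
        moreover have "h.B.tends (\<lambda>n. \<rho> b \<otimes>\<^bsub>B\<^esub> j (X n)) (\<rho> b \<otimes>\<^bsub>B\<^esub> j x)"
          using b by (intro h.B.tends_mult jX h.B.tends_const) auto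
        ultimately show "\<rho> (b \<otimes>\<^bsub>B\<^esub> j x) = \<rho> b \<otimes>\<^bsub>B\<^esub> j x" by (rule h.B.tends_unique)
      qed
    qed
  qed
  then have "carrier A \<subseteq> K" using cstar_generated_least[of K "{u, s}"] uK sK generated by simp
  then have "\<rho> (j x \<otimes>\<^bsub>B\<^esub> \<one>\<^bsub>B\<^esub>) = j x \<otimes>\<^bsub>B\<^esub> \<rho> \<one>\<^bsub>B\<^esub>" using KD(1) x by blast
  then show ?thesis using x by simp
qed

lemma cuntz_rigid: "rigid cuntz A"
  unfolding rigid_def
proof (intro conjI allI impI ballI)
  show "unital_inclusion cuntz A"
    unfolding unital_inclusion_def using cuntz_subalgebra cuntz_one cstar_algebra_axioms by blast
  fix \<phi> x assume \<phi>: "ucp (carrier A) A A \<phi> \<and> (\<forall>a\<in>cuntz. \<phi> a = a)" and x: "x \<in> carrier A"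
  interpret r: ucp_map A A \<phi> by unfold_locales (use \<phi> in simp)
  have h: "cstar_hom A A (\<lambda>x. x)" by unfold_locales (auto simp: star_hom_def ring_hom_def)
  define D where "D = u \<ominus> \<phi> u"
  have Dc: "D \<in> carrier A" unfolding D_def by simp
  have "D = s \<otimes> (D \<otimes> s1\<^sup>\<star>)"
    using ucp_shift_equation[OF h r.ucp_map_axioms, of D] \<phi> by (simp add: D_def)
  then have "D = \<zero>" using fixed_by_shift_eq_0 Dc by blast
  then have "\<phi> u = u" using diff_eq_0_iff[of u "\<phi> u"] unfolding D_def by simp
  moreover have "s \<otimes> s\<^sup>\<star> \<in> cuntz" using cuntz_subalgebra cuntz_gen unfolding cstar_subalgebra_def by blast
  ultimately show "\<phi> x = x" using ucp_fixes_all[OF h r.ucp_map_axioms _ _ _ x] \<phi> cuntz_gen by auto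
qed

end

section \<open>Injective envelopes\<close>

context diadic_cstar
begin

text \<open>The \<open>G n\<close> tend strongly to 1 in the GNS representation, so compressions by
  them converge weakly. The difference splits into \<open>((1 - G) a)\<^sup>\<star> (x b)\<close>
  and \<open>(x\<^sup>\<star> G a)\<^sup>\<star> ((1 - G) b)\<close>, each small by
  Cauchy--Schwarz.\<close>

lemma compress_tends:
  assumes G: "\<And>n. G n \<in> carrier A" "\<And>n. (G n)\<^sup>\<star> = G n" "\<And>n. \<parallel>G n\<parallel> \<le> C"
    and lim: "\<And>v. v \<in> carrier A \<Longrightarrow> (\<lambda>n. l2 ((\<one> \<ominus> G n) \<otimes> v)) \<longlonglongrightarrow> 0"
    and x: "x \<in> carrier A" and a: "a \<in> carrier A" and b: "b \<in> carrier A"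
  shows "(\<lambda>n. psi (a\<^sup>\<star> \<otimes> (G n \<otimes> (x \<otimes> (G n \<otimes> b))))) \<longlonglongrightarrow> psi (a\<^sup>\<star> \<otimes> (x \<otimes> b))"
proof (rule LIM_zero_cancel, rule Lim_null_comparison)
  let ?e = "\<lambda>n. l2 ((\<one> \<ominus> G n) \<otimes> a) * l2 (x \<otimes> b) + (\<parallel>x\<parallel> * (C * l2 a)) * l2 ((\<one> \<ominus> G n) \<otimes> b)"
  have "?e \<longlonglongrightarrow> 0 * l2 (x \<otimes> b) + (\<parallel>x\<parallel> * (C * l2 a)) * 0"
    using lim[OF a] lim[OF b] by (intro tendsto_intros)
  then show "?e \<longlonglongrightarrow> 0" by simp
  have "norm (psi (a\<^sup>\<star> \<otimes> (G n \<otimes> (x \<otimes> (G n \<otimes> b)))) - psi (a\<^sup>\<star> \<otimes> (x \<otimes> b))) \<le> ?e n" for n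
  proof -
    let ?g = "G n"
    note c = G(1)[of n] x a b
    let ?r = "((\<one> \<ominus> ?g) \<otimes> a)\<^sup>\<star> \<otimes> (x \<otimes> b)"
    let ?t = "(x\<^sup>\<star> \<otimes> (?g \<otimes> a))\<^sup>\<star> \<otimes> ((\<one> \<ominus> ?g) \<otimes> b)"
    have "((\<one> \<ominus> ?g) \<otimes> a)\<^sup>\<star> = a\<^sup>\<star> \<otimes> (\<one> \<ominus> ?g)" using c by (simp add: star_mult star_diff G(2))
    moreover have "(x\<^sup>\<star> \<otimes> (?g \<otimes> a))\<^sup>\<star> = a\<^sup>\<star> \<otimes> ?g \<otimes> x" using c by (simp add: star_mult G(2) m_assoc)
    ultimately have eq: "a\<^sup>\<star> \<otimes> (x \<otimes> b) = a\<^sup>\<star> \<otimes> (?g \<otimes> (x \<otimes> (?g \<otimes> b))) \<oplus> (?r \<oplus> ?t)"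
      using c by (simp only:) algebra
    have "psi (a\<^sup>\<star> \<otimes> (x \<otimes> b)) = psi (a\<^sup>\<star> \<otimes> (?g \<otimes> (x \<otimes> (?g \<otimes> b)))) + (psi ?r + psi ?t)"
      unfolding eq using c by (simp add: psi_add)
    then have "norm (psi (a\<^sup>\<star> \<otimes> (?g \<otimes> (x \<otimes> (?g \<otimes> b)))) - psi (a\<^sup>\<star> \<otimes> (x \<otimes> b))) \<le> norm (psi ?r) + norm (psi ?t)"
      using norm_triangle_ineq[of "psi ?r" "psi ?t"] norm_minus_cancel[of "psi ?r + psi ?t"] by (simp add: algebra_simps)
    also have "norm (psi ?r) \<le> l2 ((\<one> \<ominus> ?g) \<otimes> a) * l2 (x \<otimes> b)" using c by (intro cauchy_schwarz) auto
    also have "norm (psi ?t) \<le> l2 (x\<^sup>\<star> \<otimes> (?g \<otimes> a)) * l2 ((\<one> \<ominus> ?g) \<otimes> b)" using c by (intro cauchy_schwarz) auto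
    also have "l2 (x\<^sup>\<star> \<otimes> (?g \<otimes> a)) * l2 ((\<one> \<ominus> ?g) \<otimes> b) \<le> (\<parallel>x\<parallel> * (C * l2 a)) * l2 ((\<one> \<ominus> ?g) \<otimes> b)"
    proof (rule mult_right_mono)
      have "l2 (x\<^sup>\<star> \<otimes> (?g \<otimes> a)) \<le> \<parallel>x\<parallel> * l2 (?g \<otimes> a)" using l2_mult_le[of "x\<^sup>\<star>" "?g \<otimes> a"] c by simp
      also have "l2 (?g \<otimes> a) \<le> \<parallel>?g\<parallel> * l2 a" using c by (intro l2_mult_le) auto
      also have "\<parallel>?g\<parallel> * l2 a \<le> C * l2 a" using G(3) a by (intro mult_right_mono) auto
      finally show "l2 (x\<^sup>\<star> \<otimes> (?g \<otimes> a)) \<le> \<parallel>x\<parallel> * (C * l2 a)" using x by (simp add: mult_left_mono)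
    qed (use c in simp)
    finally show ?thesis by simp
  qed
  then show "\<forall>\<^sub>F n in sequentially.
      norm (psi (a\<^sup>\<star> \<otimes> (G n \<otimes> (x \<otimes> (G n \<otimes> b)))) - psi (a\<^sup>\<star> \<otimes> (x \<otimes> b))) \<le> ?e n" by simp
qed

text \<open>Take \<open>a = x\<close> and \<open>b = \<one>\<close> in \<open>compress_tends\<close>
  and use faithfulness.\<close>

lemma compress_eq_0:
  assumes G: "\<And>n. G n \<in> carrier A" "\<And>n. (G n)\<^sup>\<star> = G n" "\<And>n. \<parallel>G n\<parallel> \<le> C"
    and lim: "\<And>v. v \<in> carrier A \<Longrightarrow> (\<lambda>n. l2 ((\<one> \<ominus> G n) \<otimes> v)) \<longlonglongrightarrow> 0"
    and x: "x \<in> carrier A" and z: "\<And>n. G n \<otimes> (x \<otimes> G n) = \<zero>"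
  shows "x = \<zero>"
proof -
  have "(\<lambda>n. psi (x\<^sup>\<star> \<otimes> (G n \<otimes> (x \<otimes> (G n \<otimes> \<one>))))) \<longlonglongrightarrow> psi (x\<^sup>\<star> \<otimes> (x \<otimes> \<one>))"
    by (rule compress_tends[OF G lim x x one_closed])
  then have "(\<lambda>n. 0) \<longlonglongrightarrow> psi (x\<^sup>\<star> \<otimes> x)" using G(1) x z by simp
  then have "psi (x\<^sup>\<star> \<otimes> x) = 0" by (simp add: LIMSEQ_const_iff)
  then show ?thesis using l2_faithful[OF x] by (simp add: l2_def)
qed

text \<open>Selfadjointness comes from \<open>compress_eq_0\<close> for
  \<open>x\<^sup>\<star> - x\<close>. For a witness \<open>b x b = - c^2\<close> the number
  \<open>psi (b x b)\<close> is a limit of numbers with nonnegative real part, so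
  \<open>l2 c = 0\<close> and \<open>c = 0\<close> by faithfulness.\<close>

lemma compress_pos:
  assumes G: "\<And>n. G n \<in> carrier A" "\<And>n. (G n)\<^sup>\<star> = G n" "\<And>n. \<parallel>G n\<parallel> \<le> C"
    and lim: "\<And>v. v \<in> carrier A \<Longrightarrow> (\<lambda>n. l2 ((\<one> \<ominus> G n) \<otimes> v)) \<longlonglongrightarrow> 0"
    and x: "x \<in> carrier A" and p: "\<And>n. pos (G n \<otimes> (x \<otimes> G n))"
  shows "pos x"
proof -
  have "x\<^sup>\<star> \<ominus> x = \<zero>"
  proof (rule compress_eq_0[OF G lim])
    fix n
    have "G n \<otimes> (x\<^sup>\<star> \<otimes> G n) = G n \<otimes> (x \<otimes> G n)"
      using posD(2)[OF p[of n]] G x by (simp add: star_mult m_assoc)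
    moreover have "G n \<otimes> ((x\<^sup>\<star> \<ominus> x) \<otimes> G n) = G n \<otimes> (x\<^sup>\<star> \<otimes> G n) \<ominus> G n \<otimes> (x \<otimes> G n)"
      using G(1)[of n] x by algebra
    ultimately show "G n \<otimes> ((x\<^sup>\<star> \<ominus> x) \<otimes> G n) = \<zero>" using G(1) x by (simp add: minus_eq r_neg)
  qed (use x in auto)
  then have sa: "x\<^sup>\<star> = x" using diff_eq_0_iff x by simp
  obtain b c where bc: "b \<in> carrier A" "c \<in> carrier A" "b\<^sup>\<star> = b" "c\<^sup>\<star> = c"
    "b \<otimes> x \<otimes> b = \<ominus> (c \<otimes> c)" "c = \<zero> \<Longrightarrow> pos x"
    using pos_or_witness[OF x sa] by blast
  have l: "(\<lambda>n. psi (b\<^sup>\<star> \<otimes> (G n \<otimes> (x \<otimes> (G n \<otimes> b))))) \<longlonglongrightarrow> psi (b\<^sup>\<star> \<otimes> (x \<otimes> b))"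
    by (rule compress_tends[OF G lim x bc(1) bc(1)])
  have "0 \<le> Re (psi (b\<^sup>\<star> \<otimes> (G n \<otimes> (x \<otimes> (G n \<otimes> b)))))" for n
    using psi_pos(2)[OF pos_conj[OF p[of n] bc(1)]] G(1)[of n] x bc(1) by (simp add: m_assoc)
  then have "0 \<le> Re (psi (b\<^sup>\<star> \<otimes> (x \<otimes> b)))"
    using tendsto_Re[OF l] by (intro LIMSEQ_le_const[OF tendsto_Re[OF l]]) auto
  also have "b\<^sup>\<star> \<otimes> (x \<otimes> b) = \<ominus> (c\<^sup>\<star> \<otimes> c)" using bc x by (simp add: m_assoc)
  also have "Re (psi (\<ominus> (c\<^sup>\<star> \<otimes> c))) = - ((l2 c)\<^sup>2)" using l2_square[OF bc(2)] bc(2) by (simp add: psi_uminus del: bc)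
  finally have "l2 c = 0" by simp
  then show ?thesis using l2_faithful bc by blast
qed

text \<open>The projection cutting off the ranges of \<open>s ^ n\<close> and \<open>s1 ^ n\<close>. An element
  \<open>d = s\<^sup>n d (s1\<^sup>\<star>)\<^sup>n\<close> satisfies \<open>cutoff n * d * cutoff n = 0\<close>, whereas \<open>cutoff n\<close>
  tends to \<open>\<one>\<close> in the seminorm \<open>l2\<close>.\<close>

definition cutoff :: "nat \<Rightarrow> 'a" where
  "cutoff n = \<one> \<ominus> (vpow s (Suc n) \<otimes> (vpow s (Suc n))\<^sup>\<star> \<oplus> vpow s1 (Suc n) \<otimes> (vpow s1 (Suc n))\<^sup>\<star>)"

lemma vpow_gen:
  shows "vpow s n \<in> carrier A" "vpow s1 n \<in> carrier A"
    "(vpow s n)\<^sup>\<star> \<otimes> vpow s n = \<one>" "(vpow s1 n)\<^sup>\<star> \<otimes> vpow s1 n = \<one>"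
    "\<parallel>vpow s n\<parallel> \<le> 1" "\<parallel>vpow s1 n\<parallel> \<le> 1"
  using vpow_isometry[of s n] vpow_isometry[of s1 n] gen_rel s1_rel norm_isometry_le[of "vpow s n"]
    norm_isometry_le[of "vpow s1 n"] by auto

lemma cutoff_closed [simp, intro]: "cutoff n \<in> carrier A"
  unfolding cutoff_def by (intro minus_closed a_closed m_closed star_closed vpow_gen one_closed)

lemma cutoff_star: "(cutoff n)\<^sup>\<star> = cutoff n"
proof -
  have "(\<one> \<ominus> (p \<otimes> p\<^sup>\<star> \<oplus> q \<otimes> q\<^sup>\<star>))\<^sup>\<star> = \<one> \<ominus> (p \<otimes> p\<^sup>\<star> \<oplus> q \<otimes> q\<^sup>\<star>)"
    if "p \<in> carrier A" "q \<in> carrier A" for p q using that by (simp add: star_diff star_add star_mult)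
  from this[OF vpow_gen(1,2)[of "Suc n"]] show ?thesis unfolding cutoff_def .
qed

text \<open>Any bound independent of \<open>n\<close> will do; 3 comes from the triangle
  inequality.\<close>

lemma cutoff_norm_le: "\<parallel>cutoff n\<parallel> \<le> 3"
proof -
  have "\<parallel>\<one> \<ominus> (p \<otimes> p\<^sup>\<star> \<oplus> q \<otimes> q\<^sup>\<star>)\<parallel> \<le> 3"
    if "p \<in> carrier A" "q \<in> carrier A" "\<parallel>p\<parallel> \<le> 1" "\<parallel>q\<parallel> \<le> 1" for p q
  proof -
    have "\<parallel>p \<otimes> p\<^sup>\<star>\<parallel> \<le> 1 * 1" using that by (intro norm_mult_le) auto
    moreover have "\<parallel>q \<otimes> q\<^sup>\<star>\<parallel> \<le> 1 * 1" using that by (intro norm_mult_le) auto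
    ultimately show ?thesis
      using norm_diff_le[of \<one> "p \<otimes> p\<^sup>\<star> \<oplus> q \<otimes> q\<^sup>\<star>"] cnorm_triangle[of "p \<otimes> p\<^sup>\<star>" "q \<otimes> q\<^sup>\<star>"] norm_one that by simp
  qed
  from this[OF vpow_gen(1,2,5,6)[of "Suc n"]] show ?thesis unfolding cutoff_def .
qed

lemma cutoff_tends: assumes v: "v \<in> carrier A" shows "(\<lambda>n. l2 ((\<one> \<ominus> cutoff n) \<otimes> v)) \<longlonglongrightarrow> 0"
proof (rule Lim_null_comparison)
  let ?p = "\<lambda>n. vpow s (Suc n)" and ?q = "\<lambda>n. vpow s1 (Suc n)"
  have le: "l2 ((\<one> \<ominus> cutoff n) \<otimes> v) \<le> l2 ((?p n)\<^sup>\<star> \<otimes> v) + l2 ((?q n)\<^sup>\<star> \<otimes> v)" for n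
  proof -
    have "(\<one> \<ominus> (\<one> \<ominus> (p \<otimes> p\<^sup>\<star> \<oplus> q \<otimes> q\<^sup>\<star>))) \<otimes> v = p \<otimes> (p\<^sup>\<star> \<otimes> v) \<oplus> q \<otimes> (q\<^sup>\<star> \<otimes> v)"
      if "p \<in> carrier A" "q \<in> carrier A" for p q using that v by algebra
    from this[OF vpow_gen(1,2)[of "Suc n"]]
    have eq: "(\<one> \<ominus> cutoff n) \<otimes> v = ?p n \<otimes> ((?p n)\<^sup>\<star> \<otimes> v) \<oplus> ?q n \<otimes> ((?q n)\<^sup>\<star> \<otimes> v)"
      unfolding cutoff_def .
    have cp: "(?p n)\<^sup>\<star> \<otimes> v \<in> carrier A" "(?q n)\<^sup>\<star> \<otimes> v \<in> carrier A"
      by (rule m_closed[OF star_closed[OF vpow_gen(1)] v], rule m_closed[OF star_closed[OF vpow_gen(2)] v])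
    have "l2 ((\<one> \<ominus> cutoff n) \<otimes> v) \<le> l2 (?p n \<otimes> ((?p n)\<^sup>\<star> \<otimes> v)) + l2 (?q n \<otimes> ((?q n)\<^sup>\<star> \<otimes> v))"
      unfolding eq by (rule l2_triangle[OF m_closed[OF vpow_gen(1) cp(1)] m_closed[OF vpow_gen(2) cp(2)]])
    also have "l2 (?p n \<otimes> ((?p n)\<^sup>\<star> \<otimes> v)) \<le> l2 ((?p n)\<^sup>\<star> \<otimes> v)"
      by (rule l2_contract[OF vpow_gen(1) vpow_gen(5) cp(1)])
    also have "l2 (?q n \<otimes> ((?q n)\<^sup>\<star> \<otimes> v)) \<le> l2 ((?q n)\<^sup>\<star> \<otimes> v)"
      by (rule l2_contract[OF vpow_gen(2) vpow_gen(6) cp(2)])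
    finally show ?thesis by simp
  qed
  have "l2 ((\<one> \<ominus> cutoff n) \<otimes> v) \<ge> 0" for n using v by simp
  then show "\<forall>\<^sub>F n in sequentially. norm (l2 ((\<one> \<ominus> cutoff n) \<otimes> v)) \<le> l2 ((?p n)\<^sup>\<star> \<otimes> v) + l2 ((?q n)\<^sup>\<star> \<otimes> v)"
    using le by simp
  have "(\<lambda>n. l2 ((?p n)\<^sup>\<star> \<otimes> v)) \<longlonglongrightarrow> 0" "(\<lambda>n. l2 ((?q n)\<^sup>\<star> \<otimes> v)) \<longlonglongrightarrow> 0"
    using LIMSEQ_Suc[OF l2_vpow_star_tends[of s v]] LIMSEQ_Suc[OF l2_vpow_star_tends[of s1 v]] v by auto
  then show "(\<lambda>n. l2 ((?p n)\<^sup>\<star> \<otimes> v) + l2 ((?q n)\<^sup>\<star> \<otimes> v)) \<longlonglongrightarrow> 0" by (rule tendsto_add_zero)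
qed

text \<open>False for zeroth powers, which is why \<open>cutoff n\<close> uses the exponent
  \<open>Suc n\<close>.\<close>

lemma vpow_orthogonal: "(vpow s (Suc n))\<^sup>\<star> \<otimes> vpow s1 (Suc n) = \<zero>"
proof -
  have "(vpow s (Suc n))\<^sup>\<star> \<otimes> vpow s1 (Suc n) = (vpow s n)\<^sup>\<star> \<otimes> ((s\<^sup>\<star> \<otimes> s1) \<otimes> vpow s1 n)"
    using vpow_gen(1,2)[of n] by (simp add: star_mult m_assoc)
  then show ?thesis unfolding s1_rel(3) using vpow_gen by simp
qed

lemma l2_finsum_le:
  "finite I \<Longrightarrow> (\<And>i. i \<in> I \<Longrightarrow> f i \<in> carrier A) \<Longrightarrow> l2 (\<Oplus>i\<in>I. f i) \<le> (\<Sum>i\<in>I. l2 (f i))"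
proof (induction I rule: finite_induct)
  case (insert i I)
  then have "f \<in> I \<rightarrow> carrier A" by auto
  then show ?case using insert l2_triangle[of "f i" "\<Oplus>i\<in>I. f i"] by simp
qed simp

context
  fixes T m assumes T: "iso_family T m"
begin

text \<open>Corresponds under \<open>of_matrix\<close> to the diagonal matrix with constant entry
  \<open>cutoff n\<close>, which compresses all matrix entries at once.\<close>

definition diag_cutoff :: "nat \<Rightarrow> 'a" where
  "diag_cutoff n = (\<Oplus>k\<in>{..<m}. T k \<otimes> (cutoff n \<otimes> (T k)\<^sup>\<star>))"

lemma diag_cutoff_closed [simp]: "diag_cutoff n \<in> carrier A"
  unfolding diag_cutoff_def using iso_familyD(1)[OF T] by (intro finsum_closed) auto

lemma diag_cutoff_star: "(diag_cutoff n)\<^sup>\<star> = diag_cutoff n"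
proof -
  have "(diag_cutoff n)\<^sup>\<star> = (\<Oplus>k\<in>{..<m}. (T k \<otimes> (cutoff n \<otimes> (T k)\<^sup>\<star>))\<^sup>\<star>)"
    unfolding diag_cutoff_def using iso_familyD(1)[OF T] by (intro star_finsum) auto
  also have "\<dots> = diag_cutoff n" unfolding diag_cutoff_def
    using iso_familyD(1)[OF T] by (intro finsum_cong') (auto simp: star_mult cutoff_star m_assoc)
  finally show ?thesis .
qed

lemma iso_family_norm: "k < m \<Longrightarrow> \<parallel>T k\<parallel> \<le> 1"
  using iso_familyD(1,2)[OF T] by (intro norm_isometry_le) auto

lemma diag_cutoff_norm_le: "\<parallel>diag_cutoff n\<parallel> \<le> real m * 3"
proof -
  have "\<parallel>diag_cutoff n\<parallel> \<le> (\<Sum>k\<in>{..<m}. \<parallel>T k \<otimes> (cutoff n \<otimes> (T k)\<^sup>\<star>)\<parallel>)"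
    unfolding diag_cutoff_def using iso_familyD(1)[OF T] by (intro norm_finsum_le) auto
  also have "\<dots> \<le> (\<Sum>k\<in>{..<m}. 1 * (3 * 1))"
    using iso_familyD(1)[OF T] iso_family_norm cutoff_norm_le by (intro sum_mono norm_mult_le) auto
  finally show ?thesis by simp
qed

lemma star_family_diag_cutoff:
  assumes i: "i < m" shows "(T i)\<^sup>\<star> \<otimes> diag_cutoff n = cutoff n \<otimes> (T i)\<^sup>\<star>"
proof -
  note D = iso_familyD[OF T]
  have "(T i)\<^sup>\<star> \<otimes> diag_cutoff n = (\<Oplus>k\<in>{..<m}. (T i)\<^sup>\<star> \<otimes> (T k \<otimes> (cutoff n \<otimes> (T k)\<^sup>\<star>)))"
    unfolding diag_cutoff_def using D(1) i by (intro finsum_rdistr) auto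
  also have "\<dots> = (\<Oplus>k\<in>{..<m}. ((T i)\<^sup>\<star> \<otimes> T k) \<otimes> (cutoff n \<otimes> (T k)\<^sup>\<star>))"
    using D(1) i by (intro finsum_cong') (auto simp: m_assoc)
  also have "\<dots> = ((T i)\<^sup>\<star> \<otimes> T i) \<otimes> (cutoff n \<otimes> (T i)\<^sup>\<star>)" using D i by (intro finsum_delta) auto
  also have "\<dots> = cutoff n \<otimes> (T i)\<^sup>\<star>" using D i by simp
  finally show ?thesis .
qed

lemma diag_cutoff_family: assumes i: "i < m" shows "diag_cutoff n \<otimes> T i = T i \<otimes> cutoff n"
  using arg_cong[OF star_family_diag_cutoff[OF i, of n], of "star A"] iso_familyD(1)[OF T i]
  by (simp add: star_mult diag_cutoff_star cutoff_star)

text \<open>By the partition of unity the defect at \<open>v\<close> is assembled from the defects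
  of \<open>cutoff n\<close> at the finitely many vectors
  \<open>(T k)\<^sup>\<star> v\<close>.\<close>

lemma diag_cutoff_tends:
  assumes v: "v \<in> carrier A" shows "(\<lambda>n. l2 ((\<one> \<ominus> diag_cutoff n) \<otimes> v)) \<longlonglongrightarrow> 0"
proof (rule Lim_null_comparison)
  note D = iso_familyD[OF T]
  have le: "l2 ((\<one> \<ominus> diag_cutoff n) \<otimes> v) \<le> (\<Sum>k\<in>{..<m}. l2 ((\<one> \<ominus> cutoff n) \<otimes> ((T k)\<^sup>\<star> \<otimes> v)))" for n
  proof -
    have "\<one> \<otimes> v = (\<Oplus>k\<in>{..<m}. (\<one> \<otimes> T k) \<otimes> ((T k)\<^sup>\<star> \<otimes> v))"
      using v by (intro iso_family_insert[OF T]) auto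
    also have "\<dots> = (\<Oplus>k\<in>{..<m}. T k \<otimes> (cutoff n \<otimes> ((T k)\<^sup>\<star> \<otimes> v)) \<oplus> T k \<otimes> ((\<one> \<ominus> cutoff n) \<otimes> ((T k)\<^sup>\<star> \<otimes> v)))"
    proof (intro finsum_cong')
      fix k assume "k \<in> {..<m}"
      then have "T k \<in> carrier A" using D(1) by simp
      moreover have "(\<one> \<otimes> t) \<otimes> (t\<^sup>\<star> \<otimes> v) = t \<otimes> (c \<otimes> (t\<^sup>\<star> \<otimes> v)) \<oplus> t \<otimes> ((\<one> \<ominus> c) \<otimes> (t\<^sup>\<star> \<otimes> v))"
        if "t \<in> carrier A" "c \<in> carrier A" for t c using that v by algebra
      ultimately show "(\<one> \<otimes> T k) \<otimes> ((T k)\<^sup>\<star> \<otimes> v)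
        = T k \<otimes> (cutoff n \<otimes> ((T k)\<^sup>\<star> \<otimes> v)) \<oplus> T k \<otimes> ((\<one> \<ominus> cutoff n) \<otimes> ((T k)\<^sup>\<star> \<otimes> v))" by blast
    qed (use D(1) v in auto)
    also have "\<dots> = (\<Oplus>k\<in>{..<m}. T k \<otimes> (cutoff n \<otimes> ((T k)\<^sup>\<star> \<otimes> v)))
        \<oplus> (\<Oplus>k\<in>{..<m}. T k \<otimes> ((\<one> \<ominus> cutoff n) \<otimes> ((T k)\<^sup>\<star> \<otimes> v)))" (is "_ = _ \<oplus> ?R")
      using D(1) v by (intro finsum_addf) auto
    also have "(\<Oplus>k\<in>{..<m}. T k \<otimes> (cutoff n \<otimes> ((T k)\<^sup>\<star> \<otimes> v))) = (\<Oplus>k\<in>{..<m}. T k \<otimes> (cutoff n \<otimes> (T k)\<^sup>\<star>) \<otimes> v)"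
      using D(1) v by (intro finsum_cong') (auto simp: m_assoc)
    also have "\<dots> = diag_cutoff n \<otimes> v"
      unfolding diag_cutoff_def using D(1) v by (intro finsum_ldistr[symmetric]) auto
    finally have "v = diag_cutoff n \<otimes> v \<oplus> ?R" using v by simp
    moreover have R: "?R \<in> carrier A" using D(1) v by (intro finsum_closed) auto
    moreover have "(\<one> \<ominus> g) \<otimes> v = r" if "v = g \<otimes> v \<oplus> r" "g \<in> carrier A" "r \<in> carrier A" for g r
    proof -
      have "(\<one> \<ominus> g) \<otimes> v = v \<ominus> g \<otimes> v" using that(2) v by algebra
      also have "\<dots> = (g \<otimes> v \<oplus> r) \<ominus> g \<otimes> v" using that(1) by simp
      also have "\<dots> = r" using that(2,3) v by algebra
      finally show ?thesis .
    qed
    ultimately have "(\<one> \<ominus> diag_cutoff n) \<otimes> v = ?R" by simp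
    then have "l2 ((\<one> \<ominus> diag_cutoff n) \<otimes> v) = l2 ?R" by simp
    also have "\<dots> \<le> (\<Sum>k\<in>{..<m}. l2 (T k \<otimes> ((\<one> \<ominus> cutoff n) \<otimes> ((T k)\<^sup>\<star> \<otimes> v))))"
      using D(1) v by (intro l2_finsum_le) auto
    also have "\<dots> \<le> (\<Sum>k\<in>{..<m}. l2 ((\<one> \<ominus> cutoff n) \<otimes> ((T k)\<^sup>\<star> \<otimes> v)))"
      using D(1) v iso_family_norm by (intro sum_mono l2_contract) auto
    finally show ?thesis .
  qed
  have "l2 ((\<one> \<ominus> diag_cutoff n) \<otimes> v) \<ge> 0" for n using v by simp
  then show "\<forall>\<^sub>F n in sequentially. norm (l2 ((\<one> \<ominus> diag_cutoff n) \<otimes> v))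
      \<le> (\<Sum>k\<in>{..<m}. l2 ((\<one> \<ominus> cutoff n) \<otimes> ((T k)\<^sup>\<star> \<otimes> v)))" using le by simp
  show "(\<lambda>n. \<Sum>k\<in>{..<m}. l2 ((\<one> \<ominus> cutoff n) \<otimes> ((T k)\<^sup>\<star> \<otimes> v))) \<longlonglongrightarrow> 0"
    using D(1) v cutoff_tends by (intro tendsto_null_sum) auto
qed

end

lemma iso_family_carrier: "n \<ge> 1 \<Longrightarrow> \<exists>T. iso_family T n"
  using iso_family_exists[of "carrier A" s1 s n] s1_rel gen_rel range_sum by (auto simp: a_comm)

text \<open>The map killing \<open>D\<close> and fixing \<open>A\<close> is ucp on an operator system containing both, because
  \<open>D\<close> is invisible to compressions by the cutoffs. Extended to the injective envelope it is
  the identity, so \<open>D = \<zero>\<close>.\<close>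

lemma envelope_shift_eq_0:
  fixes I :: "'b cstar_alg"
  assumes env: "injective_envelope A I j" and D: "D \<in> carrier I"
    and shift: "D = j s \<otimes>\<^bsub>I\<^esub> (D \<otimes>\<^bsub>I\<^esub> star I (j s1))"
  shows "D = \<zero>\<^bsub>I\<^esub>"
proof -
  have Ic: "injective_cstar I" and inj: "inj_on j (carrier A)" and
    rig: "\<And>\<phi> x. \<lbrakk>ucp (carrier I) I I \<phi>; \<And>a. a \<in> carrier A \<Longrightarrow> \<phi> (j a) = j a; x \<in> carrier I\<rbrakk> \<Longrightarrow> \<phi> x = x"
    using env by (auto simp: injective_envelope_def)
  interpret h: cstar_hom A I j
    using env by (auto simp: injective_envelope_def injective_cstar_def cstar_hom_def cstar_hom_axioms_def)
  \<comment> \<open>\<open>R y x\<close> says that \<open>y\<close> differs from \<open>j x\<close>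
    only by something invisible to every cutoff compression; \<open>E\<close> consists of the
    elements of the envelope that are in this sense congruent to an element of
    \<open>A\<close>.\<close>
  define R where "R y x \<longleftrightarrow> (\<forall>n. j (cutoff n) \<otimes>\<^bsub>I\<^esub> ((y \<ominus>\<^bsub>I\<^esub> j x) \<otimes>\<^bsub>I\<^esub> j (cutoff n)) = \<zero>\<^bsub>I\<^esub>)" for y x
  define E where "E = {y \<in> carrier I. \<exists>x\<in>carrier A. R y x}"
  have jg: "j (cutoff n) \<in> carrier I" for n by simp
  have jgs: "star I (j (cutoff n)) = j (cutoff n)" for n using arg_cong[OF cutoff_star[of n], of j] by simp
  have R_self: "R (j x) x" if "x \<in> carrier A" for x unfolding R_def using that by (simp add: h.B.minus_eq h.B.r_neg)
  have R_add: "R (y \<oplus>\<^bsub>I\<^esub> y') (x \<oplus> x')" if "R y x" "R y' x'" "y \<in> carrier I" "y' \<in> carrier I" "x \<in> carrier A" "x' \<in> carrier A" for y y' x x'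
  proof -
    have "g \<otimes>\<^bsub>I\<^esub> ((y \<oplus>\<^bsub>I\<^esub> y' \<ominus>\<^bsub>I\<^esub> (p \<oplus>\<^bsub>I\<^esub> p')) \<otimes>\<^bsub>I\<^esub> g) = g \<otimes>\<^bsub>I\<^esub> ((y \<ominus>\<^bsub>I\<^esub> p) \<otimes>\<^bsub>I\<^esub> g) \<oplus>\<^bsub>I\<^esub> g \<otimes>\<^bsub>I\<^esub> ((y' \<ominus>\<^bsub>I\<^esub> p') \<otimes>\<^bsub>I\<^esub> g)"
      if "g \<in> carrier I" "p \<in> carrier I" "p' \<in> carrier I" for g p p'
      using that \<open>y \<in> carrier I\<close> \<open>y' \<in> carrier I\<close> by algebra
    then show ?thesis using that unfolding R_def by simp
  qed
  have R_smult: "R (c \<odot>\<^bsub>I\<^esub> y) (c \<odot> x)" if "R y x" "y \<in> carrier I" "x \<in> carrier A" for c y x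
  proof -
    have "g \<otimes>\<^bsub>I\<^esub> ((c \<odot>\<^bsub>I\<^esub> y \<ominus>\<^bsub>I\<^esub> c \<odot>\<^bsub>I\<^esub> p) \<otimes>\<^bsub>I\<^esub> g) = c \<odot>\<^bsub>I\<^esub> (g \<otimes>\<^bsub>I\<^esub> ((y \<ominus>\<^bsub>I\<^esub> p) \<otimes>\<^bsub>I\<^esub> g))"
      if "g \<in> carrier I" "p \<in> carrier I" for g p using that \<open>y \<in> carrier I\<close> by algebra
    then show ?thesis using that unfolding R_def by simp
  qed
  have R_star: "R (star I y) (x\<^sup>\<star>)" if "R y x" "y \<in> carrier I" "x \<in> carrier A" for y x
    unfolding R_def
  proof
    fix n
    have "star I (j (cutoff n) \<otimes>\<^bsub>I\<^esub> ((y \<ominus>\<^bsub>I\<^esub> j x) \<otimes>\<^bsub>I\<^esub> j (cutoff n))) = \<zero>\<^bsub>I\<^esub>" using that unfolding R_def by simp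
    then show "j (cutoff n) \<otimes>\<^bsub>I\<^esub> ((star I y \<ominus>\<^bsub>I\<^esub> j (x\<^sup>\<star>)) \<otimes>\<^bsub>I\<^esub> j (cutoff n)) = \<zero>\<^bsub>I\<^esub>"
      using that by (simp add: h.B.star_mult h.B.star_diff jgs h.B.m_assoc)
  qed
  have R_unique: "x = x'" if "R y x" "R y x'" "y \<in> carrier I" "x \<in> carrier A" "x' \<in> carrier A" for y x x'
  proof -
    have "x \<ominus> x' = \<zero>"
    proof (rule compress_eq_0[OF _ cutoff_star cutoff_norm_le cutoff_tends])
      fix n
      have "g \<otimes>\<^bsub>I\<^esub> ((p \<ominus>\<^bsub>I\<^esub> p') \<otimes>\<^bsub>I\<^esub> g) = g \<otimes>\<^bsub>I\<^esub> ((y \<ominus>\<^bsub>I\<^esub> p') \<otimes>\<^bsub>I\<^esub> g) \<ominus>\<^bsub>I\<^esub> g \<otimes>\<^bsub>I\<^esub> ((y \<ominus>\<^bsub>I\<^esub> p) \<otimes>\<^bsub>I\<^esub> g)"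
        if "g \<in> carrier I" "p \<in> carrier I" "p' \<in> carrier I" for g p p'
        using that \<open>y \<in> carrier I\<close> by algebra
      from this[OF jg[of n], of "j x" "j x'"]
      have eq: "j (cutoff n) \<otimes>\<^bsub>I\<^esub> ((j x \<ominus>\<^bsub>I\<^esub> j x') \<otimes>\<^bsub>I\<^esub> j (cutoff n)) = \<zero>\<^bsub>I\<^esub>"
        using that unfolding R_def by (simp add: h.B.minus_eq)
      then have "j (cutoff n \<otimes> ((x \<ominus> x') \<otimes> cutoff n)) = \<zero>\<^bsub>I\<^esub>"
        using that by simp
      then show "cutoff n \<otimes> ((x \<ominus> x') \<otimes> cutoff n) = \<zero>"
        using inj_onD[OF inj, of "cutoff n \<otimes> ((x \<ominus> x') \<otimes> cutoff n)" \<zero>] that by simp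
    qed (use that in auto)
    then show ?thesis using diff_eq_0_iff that by simp
  qed
  \<comment> \<open>Well defined on \<open>E\<close> by \<open>R_unique\<close>, which rests on the
    faithfulness of \<open>psi\<close>.\<close>
  define \<Theta> where "\<Theta> y = j (THE x. x \<in> carrier A \<and> R y x)" for y
  have \<Theta>: "\<Theta> y = j x" if "R y x" "y \<in> carrier I" "x \<in> carrier A" for y x
  proof -
    have "(THE x. x \<in> carrier A \<and> R y x) = x" using that R_unique by blast
    then show ?thesis by (simp add: \<Theta>_def)
  qed
  have E_sys: "operator_system E I"
    unfolding operator_system_def
  proof (intro conjI ballI allI)
    show "E \<subseteq> carrier I" by (auto simp: E_def)
    show "\<one>\<^bsub>I\<^esub> \<in> E" using R_self[of \<one>] by (auto simp: E_def)
    fix y assume "y \<in> E"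
    then obtain x where x: "x \<in> carrier A" "R y x" "y \<in> carrier I" by (auto simp: E_def)
    show "c \<odot>\<^bsub>I\<^esub> y \<in> E" for c using R_smult[of y x c] x by (auto simp: E_def)
    show "star I y \<in> E" using R_star[of y x] x by (auto simp: E_def)
    fix y' assume "y' \<in> E"
    then obtain x' where x': "x' \<in> carrier A" "R y' x'" "y' \<in> carrier I" by (auto simp: E_def)
    show "y \<oplus>\<^bsub>I\<^esub> y' \<in> E" using R_add[of y x y' x'] x x' by (auto simp: E_def)
  qed
  \<comment> \<open>Complete positivity of \<open>\<Theta>\<close>. Compressed by
    \<open>diag_cutoff\<close>, the matrix \<open>Y\<close> and the image of \<open>Q\<close>
    coincide; so the compressions of \<open>Q\<close> are positive, and \<open>compress_pos\<close>
    gives positivity of \<open>Q\<close> in \<open>A\<close>.\<close>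
  have mat: "pos_matrix I m (\<lambda>i k. \<Theta> (y i k))"
    if y: "\<forall>i<m. \<forall>k<m. y i k \<in> E" and p: "pos_matrix I m y" for m y
  proof (cases "m = 0")
    case False
    then obtain T where T: "iso_family T m" using iso_family_carrier[of m] by auto
    note T' = h.hom_iso_family[OF T]
    have "\<forall>i k. \<exists>x. i < m \<and> k < m \<longrightarrow> x \<in> carrier A \<and> R (y i k) x" using y by (auto simp: E_def)
    then obtain q where q: "\<And>i k. \<lbrakk>i < m; k < m\<rbrakk> \<Longrightarrow> q i k \<in> carrier A" "\<And>i k. \<lbrakk>i < m; k < m\<rbrakk> \<Longrightarrow> R (y i k) (q i k)"
      by metis
    have yc: "\<And>i k. \<lbrakk>i < m; k < m\<rbrakk> \<Longrightarrow> y i k \<in> carrier I" using y by (auto simp: E_def)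
    define Y where "Y = h.B.of_matrix (\<lambda>i. j (T i)) m y"
    define Q where "Q = of_matrix T m q"
    have Yc: "Y \<in> carrier I" unfolding Y_def by (rule h.B.of_matrix_closed[OF T' yc])
    have Qc: "Q \<in> carrier A" unfolding Q_def by (rule of_matrix_closed[OF T q(1)])
    have Yp: "h.B.pos Y" unfolding Y_def using h.B.pos_matrix_iff_pos[OF T', of y] yc p by blast
    have "pos Q"
    proof (rule compress_pos[OF diag_cutoff_closed[OF T] diag_cutoff_star[OF T] diag_cutoff_norm_le[OF T] diag_cutoff_tends[OF T] Qc])
      fix n
      let ?G = "diag_cutoff T m n"
      note Gc = diag_cutoff_closed[OF T, of n]
      have Gs: "star I (j ?G) = j ?G" using arg_cong[OF diag_cutoff_star[OF T, of n], of j] Gc by simp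
      have "j ?G \<otimes>\<^bsub>I\<^esub> ((Y \<ominus>\<^bsub>I\<^esub> j Q) \<otimes>\<^bsub>I\<^esub> j ?G) = \<zero>\<^bsub>I\<^esub>"
      proof (rule h.B.iso_family_eqI[OF T'])
        fix i k assume ik: "i < m" "k < m"
        note Ti = iso_familyD(1)[OF T ik(1)] and Tk = iso_familyD(1)[OF T ik(2)]
        let ?g = "j (cutoff n)"
        have l: "star I (j (T i)) \<otimes>\<^bsub>I\<^esub> j ?G = ?g \<otimes>\<^bsub>I\<^esub> star I (j (T i))"
          using arg_cong[OF star_family_diag_cutoff[OF T ik(1), of n], of j] Gc Ti by simp
        have r: "j ?G \<otimes>\<^bsub>I\<^esub> j (T k) = j (T k) \<otimes>\<^bsub>I\<^esub> ?g"
          using arg_cong[OF diag_cutoff_family[OF T ik(2), of n], of j] Gc Tk by simp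
        have eY: "star I (j (T i)) \<otimes>\<^bsub>I\<^esub> Y \<otimes>\<^bsub>I\<^esub> j (T k) = y i k"
          unfolding Y_def by (rule h.B.of_matrix_entry[OF T' yc ik])
        have eQ: "star I (j (T i)) \<otimes>\<^bsub>I\<^esub> j Q \<otimes>\<^bsub>I\<^esub> j (T k) = j (q i k)"
        proof -
          have "(T i)\<^sup>\<star> \<otimes> Q \<otimes> T k = q i k" unfolding Q_def by (rule of_matrix_entry[OF T q(1) ik])
          from arg_cong[OF this, of j] show ?thesis using Ti Tk Qc by simp
        qed
        have "star I t \<otimes>\<^bsub>I\<^esub> (G \<otimes>\<^bsub>I\<^esub> ((Y \<ominus>\<^bsub>I\<^esub> p) \<otimes>\<^bsub>I\<^esub> G)) \<otimes>\<^bsub>I\<^esub> t' = (star I t \<otimes>\<^bsub>I\<^esub> G) \<otimes>\<^bsub>I\<^esub> ((Y \<ominus>\<^bsub>I\<^esub> p) \<otimes>\<^bsub>I\<^esub> (G \<otimes>\<^bsub>I\<^esub> t'))"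
          if "t \<in> carrier I" "t' \<in> carrier I" "G \<in> carrier I" "p \<in> carrier I" for t t' G p
          using that Yc by algebra
        then have "star I (j (T i)) \<otimes>\<^bsub>I\<^esub> (j ?G \<otimes>\<^bsub>I\<^esub> ((Y \<ominus>\<^bsub>I\<^esub> j Q) \<otimes>\<^bsub>I\<^esub> j ?G)) \<otimes>\<^bsub>I\<^esub> j (T k)
          = (?g \<otimes>\<^bsub>I\<^esub> star I (j (T i))) \<otimes>\<^bsub>I\<^esub> ((Y \<ominus>\<^bsub>I\<^esub> j Q) \<otimes>\<^bsub>I\<^esub> (j (T k) \<otimes>\<^bsub>I\<^esub> ?g))"
          unfolding l[symmetric] r[symmetric] using Ti Tk Gc Qc by simp
        also have "\<dots> = ?g \<otimes>\<^bsub>I\<^esub> ((star I (j (T i)) \<otimes>\<^bsub>I\<^esub> Y \<otimes>\<^bsub>I\<^esub> j (T k) \<ominus>\<^bsub>I\<^esub> star I (j (T i)) \<otimes>\<^bsub>I\<^esub> j Q \<otimes>\<^bsub>I\<^esub> j (T k)) \<otimes>\<^bsub>I\<^esub> ?g)"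
        proof -
          have "(g \<otimes>\<^bsub>I\<^esub> star I t) \<otimes>\<^bsub>I\<^esub> ((Y \<ominus>\<^bsub>I\<^esub> p) \<otimes>\<^bsub>I\<^esub> (t' \<otimes>\<^bsub>I\<^esub> g)) = g \<otimes>\<^bsub>I\<^esub> ((star I t \<otimes>\<^bsub>I\<^esub> Y \<otimes>\<^bsub>I\<^esub> t' \<ominus>\<^bsub>I\<^esub> star I t \<otimes>\<^bsub>I\<^esub> p \<otimes>\<^bsub>I\<^esub> t') \<otimes>\<^bsub>I\<^esub> g)"
            if "t \<in> carrier I" "t' \<in> carrier I" "g \<in> carrier I" "p \<in> carrier I" for t t' g p
            using that Yc by algebra
          then show ?thesis using Ti Tk Qc by simp
        qed
        also have "\<dots> = \<zero>\<^bsub>I\<^esub>" unfolding eY eQ using q(2)[OF ik] by (simp add: R_def)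
        finally show "star I (j (T i)) \<otimes>\<^bsub>I\<^esub> (j ?G \<otimes>\<^bsub>I\<^esub> ((Y \<ominus>\<^bsub>I\<^esub> j Q) \<otimes>\<^bsub>I\<^esub> j ?G)) \<otimes>\<^bsub>I\<^esub> j (T k)
          = star I (j (T i)) \<otimes>\<^bsub>I\<^esub> \<zero>\<^bsub>I\<^esub> \<otimes>\<^bsub>I\<^esub> j (T k)" using Ti Tk by simp
      qed (use Gc Yc Qc in auto)
      moreover have "j ?G \<otimes>\<^bsub>I\<^esub> ((Y \<ominus>\<^bsub>I\<^esub> j Q) \<otimes>\<^bsub>I\<^esub> j ?G) = j ?G \<otimes>\<^bsub>I\<^esub> Y \<otimes>\<^bsub>I\<^esub> j ?G \<ominus>\<^bsub>I\<^esub> j ?G \<otimes>\<^bsub>I\<^esub> (j Q \<otimes>\<^bsub>I\<^esub> j ?G)"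
      proof -
        have "G \<otimes>\<^bsub>I\<^esub> ((Y \<ominus>\<^bsub>I\<^esub> p) \<otimes>\<^bsub>I\<^esub> G) = G \<otimes>\<^bsub>I\<^esub> Y \<otimes>\<^bsub>I\<^esub> G \<ominus>\<^bsub>I\<^esub> G \<otimes>\<^bsub>I\<^esub> (p \<otimes>\<^bsub>I\<^esub> G)"
          if "G \<in> carrier I" "p \<in> carrier I" for G p using that Yc by algebra
        from this[of "j ?G" "j Q"] show ?thesis using Gc Qc by simp
      qed
      ultimately have "j ?G \<otimes>\<^bsub>I\<^esub> Y \<otimes>\<^bsub>I\<^esub> j ?G = j ?G \<otimes>\<^bsub>I\<^esub> (j Q \<otimes>\<^bsub>I\<^esub> j ?G)"
        using h.B.diff_eq_0_iff Gc Qc Yc by simp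
      moreover have "h.B.pos (j ?G \<otimes>\<^bsub>I\<^esub> Y \<otimes>\<^bsub>I\<^esub> j ?G)" using h.B.pos_conj[OF Yp, of "j ?G"] Gs Gc by simp
      ultimately have "h.B.pos (j (?G \<otimes> (Q \<otimes> ?G)))" using Gc Qc by simp
      then show "pos (?G \<otimes> (Q \<otimes> ?G))" using h.pos_hom_imp_pos[OF inj] Gc Qc by simp
    qed
    then have "pos_matrix A m q" unfolding Q_def using pos_matrix_iff_pos[OF T, of q] q(1) by blast
    then have "pos_matrix I m (\<lambda>i k. j (q i k))" by (rule h.hom_pos_matrix)
    then show ?thesis using pos_matrix_cong[of m "\<lambda>i k. \<Theta> (y i k)" "\<lambda>i k. j (q i k)" I] \<Theta> q yc by simp
  qed (simp add: pos_matrix_0)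
  have "ucp E I I \<Theta>"
    unfolding ucp_def
  proof (intro conjI ballI allI impI)
    show "\<Theta> \<one>\<^bsub>I\<^esub> = \<one>\<^bsub>I\<^esub>" using \<Theta>[of "\<one>\<^bsub>I\<^esub>" \<one>] R_self[of \<one>] by simp
    fix y assume "y \<in> E"
    then obtain x where x: "x \<in> carrier A" "R y x" "y \<in> carrier I" by (auto simp: E_def)
    show "\<Theta> y \<in> carrier I" using \<Theta> x by simp
    show "\<Theta> (c \<odot>\<^bsub>I\<^esub> y) = c \<odot>\<^bsub>I\<^esub> \<Theta> y" for c using \<Theta>[OF R_smult, of y x c] \<Theta>[of y x] x by simp
    fix y' assume "y' \<in> E"
    then obtain x' where x': "x' \<in> carrier A" "R y' x'" "y' \<in> carrier I" by (auto simp: E_def)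
    show "\<Theta> (y \<oplus>\<^bsub>I\<^esub> y') = \<Theta> y \<oplus>\<^bsub>I\<^esub> \<Theta> y'" using \<Theta>[OF R_add, of y x y' x'] \<Theta>[of y x] \<Theta>[of y' x'] x x' by simp
  qed (use mat in blast)
  moreover have "E \<subseteq> carrier I" by (auto simp: E_def)
  ultimately obtain \<Psi> where \<Psi>: "ucp (carrier I) I I \<Psi>" "\<And>y. y \<in> E \<Longrightarrow> \<Psi> y = \<Theta> y"
    using injective_cstar_extend[OF Ic h.B.cstar_algebra_axioms E_sys operator_system_carrier[OF h.B.cstar_algebra_axioms]]
    by blast
  \<comment> \<open>\<open>\<Psi>\<close> fixes the copy of \<open>A\<close>, so rigidity of the
    envelope makes it the identity, although it was built to send \<open>D\<close> to zero.\<close>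
  have "\<Psi> (j a) = j a" if "a \<in> carrier A" for a
    using \<Psi>(2)[of "j a"] \<Theta>[OF R_self] R_self that by (auto simp: E_def)
  then have "\<Psi> D = D" using rig \<Psi>(1) D by blast
  moreover have "R D \<zero>"
    unfolding R_def
  proof
    fix n
    \<comment> \<open>Iterating the shift equation places \<open>D\<close> between arbitrarily high
      powers of \<open>s\<close> and of \<open>s1\<^sup>\<star>\<close>; the adjoint of the
      \<open>Suc n\<close>-th power of \<open>s1\<close> annihilates
      \<open>cutoff n\<close>.\<close>
    have Dn: "D = j (vpow s n) \<otimes>\<^bsub>I\<^esub> (D \<otimes>\<^bsub>I\<^esub> star I (j (vpow s1 n)))" for n
    proof (induction n)
      case (Suc n)
      have "D = j s \<otimes>\<^bsub>I\<^esub> ((j (vpow s n) \<otimes>\<^bsub>I\<^esub> (D \<otimes>\<^bsub>I\<^esub> star I (j (vpow s1 n)))) \<otimes>\<^bsub>I\<^esub> star I (j s1))"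
        using shift Suc by simp
      also have "\<dots> = j (vpow s (Suc n)) \<otimes>\<^bsub>I\<^esub> (D \<otimes>\<^bsub>I\<^esub> star I (j (vpow s1 (Suc n))))"
        using D vpow_gen(1,2)[of n] by (simp add: h.B.star_mult h.B.m_assoc)
      finally show ?case .
    qed (use D in simp)
    let ?p = "vpow s (Suc n)" and ?q = "vpow s1 (Suc n)"
    note c = vpow_gen(1,2)[of "Suc n"]
    have qp: "?q\<^sup>\<star> \<otimes> ?p = \<zero>"
      using arg_cong[OF vpow_orthogonal[of n], of "star A"] c by (simp add: star_mult del: vpow.simps)
    have "?q\<^sup>\<star> \<otimes> cutoff n = ?q\<^sup>\<star> \<ominus> ((?q\<^sup>\<star> \<otimes> ?p) \<otimes> ?p\<^sup>\<star> \<oplus> (?q\<^sup>\<star> \<otimes> ?q) \<otimes> ?q\<^sup>\<star>)"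
    proof -
      have "q\<^sup>\<star> \<otimes> (\<one> \<ominus> (p \<otimes> p\<^sup>\<star> \<oplus> q \<otimes> q\<^sup>\<star>)) = q\<^sup>\<star> \<ominus> ((q\<^sup>\<star> \<otimes> p) \<otimes> p\<^sup>\<star> \<oplus> (q\<^sup>\<star> \<otimes> q) \<otimes> q\<^sup>\<star>)"
        if "p \<in> carrier A" "q \<in> carrier A" for p q using that by algebra
      then show ?thesis unfolding cutoff_def using c by blast
    qed
    also have "\<dots> = \<zero>" unfolding qp vpow_gen(4) using c by (simp add: minus_eq r_neg del: vpow.simps)
    finally have qz: "?q\<^sup>\<star> \<otimes> cutoff n = \<zero>" .
    have qg: "star I (j ?q) \<otimes>\<^bsub>I\<^esub> j (cutoff n) = \<zero>\<^bsub>I\<^esub>"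
      using arg_cong[OF qz, of j] c by (simp del: vpow.simps)
    have "D \<otimes>\<^bsub>I\<^esub> j (cutoff n) = (j ?p \<otimes>\<^bsub>I\<^esub> (D \<otimes>\<^bsub>I\<^esub> star I (j ?q))) \<otimes>\<^bsub>I\<^esub> j (cutoff n)" using Dn by metis
    also have "\<dots> = j ?p \<otimes>\<^bsub>I\<^esub> (D \<otimes>\<^bsub>I\<^esub> (star I (j ?q) \<otimes>\<^bsub>I\<^esub> j (cutoff n)))"
      using D c by (simp add: h.B.m_assoc del: vpow.simps)
    also have "\<dots> = \<zero>\<^bsub>I\<^esub>" unfolding qg using D c by (simp del: vpow.simps)
    finally show "j (cutoff n) \<otimes>\<^bsub>I\<^esub> ((D \<ominus>\<^bsub>I\<^esub> j \<zero>) \<otimes>\<^bsub>I\<^esub> j (cutoff n)) = \<zero>\<^bsub>I\<^esub>" using D by (simp add: h.B.minus_eq)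
  qed
  then have "\<Psi> D = j \<zero>" using \<Psi>(2)[of D] \<Theta>[of D \<zero>] D by (auto simp: E_def)
  ultimately show ?thesis by simp
qed

lemma cuntz_iso_family: "n \<ge> 1 \<Longrightarrow> \<exists>T. cstar_algebra.iso_family (A\<lparr>carrier := cuntz\<rparr>) T n"
proof -
  assume n: "n \<ge> 1"
  interpret S: cstar_algebra "A\<lparr>carrier := cuntz\<rparr>" by (rule subalgebra_cstar[OF cuntz_subalgebra cuntz_one])
  have "x \<otimes> y \<in> cuntz" if "x \<in> cuntz" "y \<in> cuntz" for x y
    using that cuntz_subalgebra unfolding cstar_subalgebra_def by blast
  moreover have "s1 \<otimes> s1\<^sup>\<star> \<oplus> s \<otimes> s\<^sup>\<star> = \<one>" using range_sum by (simp add: a_comm)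
  ultimately show ?thesis
    using S.iso_family_exists[of cuntz s1 s n] n cuntz_gen cuntz_one s1_rel gen_rel(3) by auto
qed

lemma envelopes_isomorphic:
  fixes I1 I2 :: "'b cstar_alg"
  assumes e1: "injective_envelope (A\<lparr>carrier := cuntz\<rparr>) I1 j1" and e2: "injective_envelope A I2 j2"
  shows "star_isomorphic I1 I2"
proof -
  let ?S = "A\<lparr>carrier := cuntz\<rparr>"
  have inj1: "inj_on j1 cuntz" and I1: "injective_cstar I1" and
    rig1: "\<And>\<phi> x. \<lbrakk>ucp (carrier I1) I1 I1 \<phi>; \<And>a. a \<in> cuntz \<Longrightarrow> \<phi> (j1 a) = j1 a; x \<in> carrier I1\<rbrakk> \<Longrightarrow> \<phi> x = x"
    using e1 by (auto simp: injective_envelope_def)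
  have inj2: "inj_on j2 (carrier A)" and I2: "injective_cstar I2" and
    rig2: "\<And>\<phi> x. \<lbrakk>ucp (carrier I2) I2 I2 \<phi>; \<And>a. a \<in> carrier A \<Longrightarrow> \<phi> (j2 a) = j2 a; x \<in> carrier I2\<rbrakk> \<Longrightarrow> \<phi> x = x"
    using e2 by (auto simp: injective_envelope_def)
  have sub: "cuntz \<subseteq> carrier A" using cuntz_subalgebra by (simp add: cstar_subalgebra_def)
  interpret h1: cstar_hom ?S I1 j1
    using e1 by (auto simp: injective_envelope_def injective_cstar_def cstar_hom_def cstar_hom_axioms_def)
  interpret h2: cstar_hom A I2 j2
    using e2 by (auto simp: injective_envelope_def injective_cstar_def cstar_hom_def cstar_hom_axioms_def)
  have h2': "cstar_hom ?S I2 j2"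
  proof (unfold_locales)
    show "j2 \<in> star_hom ?S I2" using sub by (auto simp: star_hom_def ring_hom_def subset_iff)
  qed
  interpret h2': cstar_hom ?S I2 j2 by (rule h2')
  have inj2': "inj_on j2 cuntz" using inj2 sub by (rule inj_on_subset)
  have "ucp (j2 ` carrier ?S) I2 I1 (\<lambda>y. j1 (inv_into (carrier ?S) j2 y))"
    by (rule ucp_between_images[OF h2' h1.cstar_hom_axioms]) (use inj2' cuntz_iso_family in auto)
  then obtain \<theta> where \<theta>: "ucp (carrier I2) I2 I1 \<theta>" "\<And>y. y \<in> j2 ` carrier ?S \<Longrightarrow> \<theta> y = j1 (inv_into (carrier ?S) j2 y)"
    using injective_cstar_extend[OF I1 h2.B.cstar_algebra_axioms h2'.operator_system_image
      operator_system_carrier[OF h2.B.cstar_algebra_axioms]] h2'.hom_simps(1) by blast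
  have "ucp (j1 ` carrier ?S) I1 I2 (\<lambda>y. j2 (inv_into (carrier ?S) j1 y))"
    by (rule ucp_between_images[OF h1.cstar_hom_axioms h2']) (use inj1 cuntz_iso_family in auto)
  then obtain \<eta> where \<eta>: "ucp (carrier I1) I1 I2 \<eta>" "\<And>y. y \<in> j1 ` carrier ?S \<Longrightarrow> \<eta> y = j2 (inv_into (carrier ?S) j1 y)"
    using injective_cstar_extend[OF I2 h1.B.cstar_algebra_axioms h1.operator_system_image
      operator_system_carrier[OF h1.B.cstar_algebra_axioms]] h1.hom_simps(1) by blast
  have \<theta>j: "\<theta> (j2 a) = j1 a" if "a \<in> cuntz" for a using \<theta>(2)[of "j2 a"] inj2' that by simp
  have \<eta>j: "\<eta> (j1 a) = j2 a" if "a \<in> cuntz" for a using \<eta>(2)[of "j1 a"] inj1 that by simp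
  have inv1: "\<theta> (\<eta> x) = x" if "x \<in> carrier I1" for x
    using rig1[OF ucp_comp[OF \<eta>(1) \<theta>(1)]] \<theta>j \<eta>j that by simp
  let ?\<rho> = "\<lambda>x. \<eta> (\<theta> x)"
  have \<rho>: "ucp (carrier I2) I2 I2 ?\<rho>" by (rule ucp_comp[OF \<theta>(1) \<eta>(1)])
  interpret r: ucp_map I2 I2 ?\<rho> by unfold_locales (rule \<rho>)
  have fixed: "?\<rho> (j2 a) = j2 a" if "a \<in> cuntz" for a using \<theta>j \<eta>j that by simp
  define D where "D = j2 u \<ominus>\<^bsub>I2\<^esub> ?\<rho> (j2 u)"
  have Dc: "D \<in> carrier I2" unfolding D_def by (rule h2.B.minus_closed) auto
  have "D = j2 s \<otimes>\<^bsub>I2\<^esub> (D \<otimes>\<^bsub>I2\<^esub> star I2 (j2 s1))"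
    by (rule ucp_shift_equation[OF h2.cstar_hom_axioms r.ucp_map_axioms fixed D_def])
  then have "D = \<zero>\<^bsub>I2\<^esub>" using envelope_shift_eq_0[OF e2 Dc] by blast
  then have "?\<rho> (j2 u) = j2 u" using h2.B.diff_eq_0_iff[of "j2 u" "?\<rho> (j2 u)"] r.ucp_simps(1)[of "j2 u"] unfolding D_def by simp
  moreover have "s \<otimes> s\<^sup>\<star> \<in> cuntz" using cuntz_subalgebra cuntz_gen unfolding cstar_subalgebra_def by blast
  ultimately have "?\<rho> (j2 a) = j2 a" if "a \<in> carrier A" for a
    by (rule ucp_fixes_all[OF h2.cstar_hom_axioms r.ucp_map_axioms _ fixed[OF cuntz_gen(2)] fixed that])
  then have inv2: "\<eta> (\<theta> x) = x" if "x \<in> carrier I2" for x using rig2[OF \<rho>] that by simp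
  show ?thesis
    by (rule ucp_inverse_star_isomorphic[OF h1.B.cstar_algebra_axioms h2.B.cstar_algebra_axioms \<eta>(1) \<theta>(1)])
      (use inv1 inv2 in auto)
qed

end

section \<open>A model of the relations\<close>

definition sec :: "(nat \<Rightarrow> complex) \<Rightarrow> nat \<Rightarrow> real" where
  "sec x n = L2_set (\<lambda>i. norm (x i)) {..<n}"

text \<open>\<open>B\<close> bounds all finite sections of the matrix \<open>a\<close>, hence the norm of the operator
  on \<open>\<ell>\<^sup>2\<close> with matrix \<open>a\<close>.\<close>

definition mbound :: "(nat \<Rightarrow> nat \<Rightarrow> complex) \<Rightarrow> real \<Rightarrow> bool" where
  "mbound a B \<longleftrightarrow> B \<ge> 0 \<and> (\<forall>n m x. sec (\<lambda>i. \<Sum>j<m. a i j * x j) n \<le> B * sec x m)"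

definition mnorm :: "(nat \<Rightarrow> nat \<Rightarrow> complex) \<Rightarrow> real" where
  "mnorm a = Inf {B. mbound a B}"

text \<open>For bounded matrices the series converges, by Cauchy--Schwarz for a row and a column;
  see \<open>mmult_tends\<close>.\<close>

definition mmult :: "(nat \<Rightarrow> nat \<Rightarrow> complex) \<Rightarrow> (nat \<Rightarrow> nat \<Rightarrow> complex) \<Rightarrow> nat \<Rightarrow> nat \<Rightarrow> complex" where
  "mmult a b i j = (\<Sum>k. a i k * b k j)"

lemma sec_nonneg [simp]: "0 \<le> sec x n"
  by (simp add: sec_def L2_set_nonneg)

lemma sec_square: "(sec x n)\<^sup>2 = (\<Sum>i<n. (norm (x i))\<^sup>2)"
  by (simp add: sec_def L2_set_def sum_nonneg)

lemma norm_le_sec: "i < n \<Longrightarrow> norm (x i) \<le> sec x n"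
  unfolding sec_def by (rule member_le_L2_set) auto

lemma sec_mono: "n \<le> m \<Longrightarrow> sec x n \<le> sec x m"
  unfolding sec_def L2_set_def by (intro real_sqrt_le_mono sum_mono2) auto

lemma norm_sum_mult_le_sec: "norm (\<Sum>i<n. x i * y i) \<le> sec x n * sec y n"
proof -
  have "norm (\<Sum>i<n. x i * y i) \<le> (\<Sum>i<n. \<bar>norm (x i)\<bar> * \<bar>norm (y i)\<bar>)"
    by (rule order_trans[OF norm_sum]) (simp add: norm_mult)
  also have "\<dots> \<le> sec x n * sec y n" unfolding sec_def by (rule L2_set_mult_ineq)
  finally show ?thesis .
qed

lemma sec_cnj [simp]: "sec (\<lambda>i. cnj (x i)) n = sec x n"
  by (simp add: sec_def)

lemma sec_unit: "j < m \<Longrightarrow> sec (\<lambda>i. of_bool (i = j)) m = 1"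
proof -
  assume "j < m"
  have "(sec (\<lambda>i. of_bool (i = j)) m)\<^sup>2 = (\<Sum>i<m. if i = j then 1 else 0)"
    unfolding sec_square by (intro sum.cong) auto
  then show ?thesis using \<open>j < m\<close> sec_nonneg[of "\<lambda>i. of_bool (i = j)" m] by (simp add: power2_eq_1_iff)
qed

lemma sum_swap_form:
  fixes a :: "nat \<Rightarrow> nat \<Rightarrow> complex"
  shows "(\<Sum>i<n. y i * (\<Sum>j<m. a i j * x j)) = (\<Sum>j<m. (\<Sum>i<n. y i * a i j) * x j)"
  unfolding sum_distrib_left sum_distrib_right by (subst sum.swap) (simp add: mult.assoc)

lemma mbound_form:
  assumes "mbound a B" shows "norm (\<Sum>i<n. y i * (\<Sum>j<m. a i j * x j)) \<le> B * (sec y n * sec x m)"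
proof -
  have "norm (\<Sum>i<n. y i * (\<Sum>j<m. a i j * x j)) \<le> sec y n * sec (\<lambda>i. \<Sum>j<m. a i j * x j) n"
    by (rule norm_sum_mult_le_sec)
  also have "\<dots> \<le> sec y n * (B * sec x m)" using assms by (intro mult_left_mono) (auto simp: mbound_def)
  finally show ?thesis by (simp add: ac_simps)
qed

text \<open>Choosing \<open>y\<close> as the conjugate of the image vector turns a bound on the
  bilinear form into one on the operator.\<close>

lemma mboundI:
  assumes B: "B \<ge> 0" and f: "\<And>n m x y. norm (\<Sum>i<n. y i * (\<Sum>j<m. a i j * x j)) \<le> B * (sec y n * sec x m)"
  shows "mbound a B"
  unfolding mbound_def
proof (intro conjI allI B)
  fix n m x
  let ?v = "\<lambda>i. \<Sum>j<m. a i j * x j"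
  have "(\<Sum>i<n. cnj (?v i) * ?v i) = of_real ((sec ?v n)\<^sup>2)"
    unfolding sec_square of_real_sum by (intro sum.cong refl) (metis complex_norm_square mult.commute)
  then have "(sec ?v n)\<^sup>2 = norm (\<Sum>i<n. cnj (?v i) * ?v i)" by (simp only: norm_of_real) simp
  also have "\<dots> \<le> B * (sec (\<lambda>i. cnj (?v i)) n * sec x m)" by (rule f)
  finally have "sec ?v n * sec ?v n \<le> (B * sec x m) * sec ?v n"
    unfolding sec_cnj by (simp add: power2_eq_square ac_simps)
  then show "sec ?v n \<le> B * sec x m"
    using B by (cases "sec ?v n = 0") (auto dest: mult_right_le_imp_le simp: less_le)
qed

lemma mboundD: "mbound a B \<Longrightarrow> sec (\<lambda>i. \<Sum>j<m. a i j * x j) n \<le> B * sec x m"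
  by (simp add: mbound_def)

lemma mbound_nonneg: "mbound a B \<Longrightarrow> B \<ge> 0"
  by (simp add: mbound_def)

lemma mbound_mono: "mbound a B \<Longrightarrow> B \<le> C \<Longrightarrow> mbound a C"
  unfolding mbound_def by (meson mult_right_mono order_trans sec_nonneg)

lemma mbound_zero: "mbound (\<lambda>i j. 0) 0"
  by (rule mboundI) auto

lemma mbound_add:
  assumes "mbound a A" "mbound b B" shows "mbound (\<lambda>i j. a i j + b i j) (A + B)"
proof (rule mboundI)
  fix n m x y
  have "(\<Sum>i<n. y i * (\<Sum>j<m. (a i j + b i j) * x j))
      = (\<Sum>i<n. y i * (\<Sum>j<m. a i j * x j)) + (\<Sum>i<n. y i * (\<Sum>j<m. b i j * x j))"
    by (simp add: algebra_simps sum.distrib)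
  then show "norm (\<Sum>i<n. y i * (\<Sum>j<m. (a i j + b i j) * x j)) \<le> (A + B) * (sec y n * sec x m)"
    using norm_triangle_le[OF add_mono[OF mbound_form[OF assms(1), of y x m n] mbound_form[OF assms(2), of y x m n]]]
    by (simp add: algebra_simps)
qed (use assms mbound_nonneg in force)

lemma mbound_smult:
  assumes "mbound a A" shows "mbound (\<lambda>i j. c * a i j) (norm c * A)"
proof (rule mboundI)
  fix n m x y
  have "(\<Sum>i<n. y i * (\<Sum>j<m. c * a i j * x j)) = c * (\<Sum>i<n. y i * (\<Sum>j<m. a i j * x j))"
    by (simp add: sum_distrib_left ac_simps)
  then show "norm (\<Sum>i<n. y i * (\<Sum>j<m. c * a i j * x j)) \<le> norm c * A * (sec y n * sec x m)"
    using mult_left_mono[OF mbound_form[OF assms, of y x m n] norm_ge_zero[of c]] by (simp add: norm_mult mult.assoc)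
qed (use assms mbound_nonneg in simp)

lemma mbound_diff:
  assumes "mbound a A" "mbound b B" shows "mbound (\<lambda>i j. a i j - b i j) (A + B)"
  using mbound_add[OF assms(1) mbound_smult[OF assms(2), of "-1"]] by simp

lemma mbound_star:
  assumes "mbound a A" shows "mbound (\<lambda>i j. cnj (a j i)) A"
proof (rule mboundI)
  fix n m x y
  have "(\<Sum>i<n. y i * (\<Sum>j<m. cnj (a j i) * x j)) = cnj (\<Sum>j<m. cnj (x j) * (\<Sum>i<n. a j i * cnj (y i)))"
    unfolding cnj_sum complex_cnj_mult complex_cnj_cnj sum_distrib_left by (subst sum.swap) (simp add: ac_simps)
  then have "norm (\<Sum>i<n. y i * (\<Sum>j<m. cnj (a j i) * x j)) = norm (\<Sum>j<m. cnj (x j) * (\<Sum>i<n. a j i * cnj (y i)))"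
    by (simp only: complex_mod_cnj)
  then show "norm (\<Sum>i<n. y i * (\<Sum>j<m. cnj (a j i) * x j)) \<le> A * (sec y n * sec x m)"
    using mbound_form[OF assms, of "\<lambda>i. cnj (x i)" "\<lambda>i. cnj (y i)" n m] by (simp only: sec_cnj mult.commute[of "sec y n"])
qed (rule mbound_nonneg[OF assms])

text \<open>Only finite sections enter \<open>mbound\<close>, so bounds pass to entrywise limits.
  Bounds for products and for limits of Cauchy sequences are both obtained in this way.\<close>

lemma mbound_limit:
  assumes Y: "\<And>k. mbound (Y k) B" and lim: "\<And>i j. (\<lambda>k. Y k i j) \<longlonglongrightarrow> a i j"
  shows "mbound a B"
proof (rule mboundI[OF mbound_nonneg[OF Y]])
  fix n m x y
  have "(\<lambda>k. norm (\<Sum>i<n. y i * (\<Sum>j<m. Y k i j * x j))) \<longlonglongrightarrow> norm (\<Sum>i<n. y i * (\<Sum>j<m. a i j * x j))"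
    by (intro tendsto_intros lim)
  then show "norm (\<Sum>i<n. y i * (\<Sum>j<m. a i j * x j)) \<le> B * (sec y n * sec x m)"
    by (rule LIMSEQ_le_const2) (use mbound_form[OF Y] in auto)
qed

lemma mbound_column: assumes "mbound a B" shows "sec (\<lambda>i. a i j) n \<le> B"
proof -
  have eq: "(\<Sum>k<Suc j. a i k * of_bool (k = j)) = a i j" for i by simp
  have "sec (\<lambda>i. \<Sum>k<Suc j. a i k * of_bool (k = j)) n \<le> B * sec (\<lambda>k. of_bool (k = j)) (Suc j)"
    by (rule mboundD[OF assms])
  then show ?thesis unfolding eq sec_unit[OF lessI] by simp
qed

lemma mbound_row: assumes "mbound a B" shows "sec (\<lambda>j. a i j) n \<le> B"
  using mbound_column[OF mbound_star[OF assms], of i n] by simp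

lemma mbound_entry: assumes "mbound a B" shows "norm (a i j) \<le> B"
  using norm_le_sec[of i "Suc i" "\<lambda>i. a i j"] mbound_column[OF assms, of j "Suc i"] by simp

lemma sec_bounded_summable:
  assumes "\<And>n. sec x n \<le> B" shows "summable (\<lambda>i. (norm (x i))\<^sup>2)"
proof (rule summableI_nonneg_bounded)
  show "(\<Sum>i<n. (norm (x i))\<^sup>2) \<le> B\<^sup>2" for n
    unfolding sec_square[symmetric] using assms[of n] by (simp add: power_mono)
qed auto

lemma sec_bounded_summable_mult:
  assumes "\<And>n. sec x n \<le> B" "\<And>n. sec y n \<le> C" shows "summable (\<lambda>i. x i * y i)"
proof (rule summable_comparison_test')
  show "summable (\<lambda>i. (norm (x i))\<^sup>2 + (norm (y i))\<^sup>2)"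
    using assms by (intro summable_add sec_bounded_summable)
  show "norm (x i * y i) \<le> (norm (x i))\<^sup>2 + (norm (y i))\<^sup>2" for i
    using sum_squares_bound[of "norm (x i)" "norm (y i)"] mult_nonneg_nonneg[OF norm_ge_zero[of "x i"] norm_ge_zero[of "y i"]]
    unfolding norm_mult by linarith
qed

lemma mmult_tends:
  assumes "mbound a A" "mbound b B" shows "(\<lambda>K. \<Sum>k<K. a i k * b k j) \<longlonglongrightarrow> mmult a b i j"
  unfolding mmult_def
  by (rule summable_LIMSEQ, rule sec_bounded_summable_mult, rule mbound_row[OF assms(1)], rule mbound_column[OF assms(2)])

lemma mbound_mmult:
  assumes a: "mbound a A" and b: "mbound b B" shows "mbound (mmult a b) (A * B)"
proof (rule mbound_limit)
  fix K
  show "mbound (\<lambda>i j. \<Sum>k<K. a i k * b k j) (A * B)"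
    unfolding mbound_def
  proof (intro conjI allI)
    fix n m x
    let ?w = "\<lambda>k. \<Sum>j<m. b k j * x j"
    have "(\<Sum>j<m. (\<Sum>k<K. a i k * b k j) * x j) = (\<Sum>k<K. a i k * ?w k)" for i
      by (rule sum_swap_form[symmetric])
    then have "sec (\<lambda>i. \<Sum>j<m. (\<Sum>k<K. a i k * b k j) * x j) n = sec (\<lambda>i. \<Sum>k<K. a i k * ?w k) n" by simp
    also have "\<dots> \<le> A * sec ?w K" using a by (simp add: mbound_def)
    also have "\<dots> \<le> A * (B * sec x m)" using a b by (intro mult_left_mono) (auto simp: mbound_def)
    finally show "sec (\<lambda>i. \<Sum>j<m. (\<Sum>k<K. a i k * b k j) * x j) n \<le> A * B * sec x m" by (simp add: mult.assoc)
  qed (use a b mbound_nonneg in simp)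
qed (rule mmult_tends[OF a b])

text \<open>An interchange of two infinite sums. The part of column \<open>j\<close> of
  \<open>c\<close> from index \<open>K\<close> on has norm at most \<open>t K\<close>, which tends
  to 0; \<open>b\<close> maps it to a vector of norm at most \<open>B * t K\<close>, and pairing
  with row \<open>i\<close> of \<open>a\<close> leaves an error of at most
  \<open>A * (B * t K)\<close>.\<close>

lemma mmult_assoc:
  assumes a: "mbound a A" and b: "mbound b B" and c: "mbound c C"
  shows "mmult (mmult a b) c = mmult a (mmult b c)"
proof (intro ext)
  fix i j
  define q where "q k = (norm (c k j))\<^sup>2" for k
  have sq: "summable q" unfolding q_def using sec_bounded_summable mbound_column[OF c] by blast
  define t where "t K = sqrt (suminf q - sum q {..<K})" for K
  have t0: "t \<longlonglongrightarrow> 0"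
    unfolding t_def using tendsto_real_sqrt[OF tendsto_diff[OF tendsto_const summable_LIMSEQ[OF sq]], of "suminf q"] by simp
  note ab = mbound_mmult[OF a b] and bc = mbound_mmult[OF b c]
  have "norm (mmult a (mmult b c) i j - (\<Sum>k<K. mmult a b i k * c k j)) \<le> A * (B * t K)" for K
  proof -
    let ?d = "\<lambda>l. mmult b c l j - (\<Sum>k<K. b l k * c k j)"
    have sd: "sec ?d L \<le> B * t K" for L
    proof (rule LIMSEQ_le_const2)
      let ?e = "\<lambda>M l. (\<Sum>k<M. b l k * c k j) - (\<Sum>k<K. b l k * c k j)"
      show "(\<lambda>M. sec (?e M) L) \<longlonglongrightarrow> sec ?d L"
        unfolding sec_def L2_set_def by (intro tendsto_intros mmult_tends[OF b c])
      have "sec (?e M) L \<le> B * t K" if "M \<ge> K" for M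
      proof -
        let ?x = "\<lambda>k. if k < K then 0 else c k j"
        have "?e M l = (\<Sum>k<M. b l k * ?x k)" for l
        proof -
          have "(\<Sum>k<M. b l k * c k j) = (\<Sum>k<M. b l k * ?x k) + (\<Sum>k<M. if k < K then b l k * c k j else 0)"
            unfolding sum.distrib[symmetric] by (intro sum.cong) auto
          also have "(\<Sum>k<M. if k < K then b l k * c k j else 0) = (\<Sum>k<K. b l k * c k j)"
            using that by (subst sum.inter_filter[symmetric]) (auto intro!: sum.cong)
          finally show ?thesis by simp
        qed
        then have "sec (?e M) L \<le> B * sec ?x M" using b by (simp add: mbound_def)
        also have "sec ?x M \<le> t K" unfolding t_def
        proof (rule real_le_rsqrt)
          have "(sec ?x M)\<^sup>2 + sum q {..<K} = sum q {..<M}"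
          proof -
            have "sum q {..<K} = (\<Sum>k<M. if k < K then q k else 0)"
              using that by (subst sum.inter_filter[symmetric]) (auto intro!: sum.cong)
            then show ?thesis unfolding sec_square
              by (simp only: sum.distrib[symmetric]) (auto intro!: sum.cong simp: q_def)
          qed
          moreover have "sum q {..<M} \<le> suminf q" using sq by (intro sum_le_suminf) (auto simp: q_def)
          ultimately show "(sec ?x M)\<^sup>2 \<le> suminf q - sum q {..<K}" by simp
        qed
        finally show ?thesis using mbound_nonneg[OF b] by (simp add: mult_left_mono)
      qed
      then show "\<exists>N. \<forall>n\<ge>N. sec (?e n) L \<le> B * t K" by blast
    qed
    have "(\<lambda>L. norm (\<Sum>l<L. a i l * ?d l)) \<longlonglongrightarrow> norm (mmult a (mmult b c) i j - (\<Sum>k<K. mmult a b i k * c k j))"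
    proof (rule tendsto_norm)
      have "(\<Sum>l<L. a i l * ?d l) = (\<Sum>l<L. a i l * mmult b c l j) - (\<Sum>k<K. (\<Sum>l<L. a i l * b l k) * c k j)" for L
        unfolding sum_swap_form[symmetric] by (simp add: right_diff_distrib sum_subtractf)
      moreover have "(\<lambda>L. (\<Sum>l<L. a i l * mmult b c l j) - (\<Sum>k<K. (\<Sum>l<L. a i l * b l k) * c k j))
          \<longlonglongrightarrow> mmult a (mmult b c) i j - (\<Sum>k<K. mmult a b i k * c k j)"
        by (intro tendsto_intros mmult_tends[OF a bc] mmult_tends[OF a b])
      ultimately show "(\<lambda>L. \<Sum>l<L. a i l * ?d l) \<longlonglongrightarrow> mmult a (mmult b c) i j - (\<Sum>k<K. mmult a b i k * c k j)" by simp
    qed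
    moreover have "norm (\<Sum>l<L. a i l * ?d l) \<le> A * (B * t K)" for L
    proof -
      have "norm (\<Sum>l<L. a i l * ?d l) \<le> sec (\<lambda>l. a i l) L * sec ?d L" by (rule norm_sum_mult_le_sec)
      also have "\<dots> \<le> A * (B * t K)" using sd mbound_row[OF a] mbound_nonneg[OF a] by (intro mult_mono) auto
      finally show ?thesis .
    qed
    ultimately show ?thesis by (intro LIMSEQ_le_const2) auto
  qed
  then have ev: "\<forall>\<^sub>F K in sequentially.
      norm (mmult a (mmult b c) i j - (\<Sum>k<K. mmult a b i k * c k j)) \<le> A * (B * t K)"
    by (rule always_eventually[OF allI])
  have "(\<lambda>K. A * (B * t K)) \<longlonglongrightarrow> 0" using tendsto_mult_left[OF t0, of "A * B"] by (simp add: mult.assoc)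
  from tendsto_diff[OF tendsto_const Lim_null_comparison[OF ev this], of "mmult a (mmult b c) i j"]
  have "(\<lambda>K. \<Sum>k<K. mmult a b i k * c k j) \<longlonglongrightarrow> mmult a (mmult b c) i j" by simp
  then show "mmult (mmult a b) c i j = mmult a (mmult b c) i j"
    by (rule LIMSEQ_unique[OF mmult_tends[OF ab c]])
qed

lemma mnorm_le: "mbound a B \<Longrightarrow> mnorm a \<le> B"
  unfolding mnorm_def by (rule cInf_lower) (auto intro: bdd_belowI[of _ 0] simp: mbound_def)

text \<open>The infimum is attained, since each defining inequality is closed in the bound.\<close>

lemma mbound_mnorm: assumes "mbound a B" shows "mbound a (mnorm a)"
proof -
  have ge: "mnorm a \<ge> c" if "\<And>C. mbound a C \<Longrightarrow> c \<le> C" for c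
    unfolding mnorm_def using assms that by (intro cInf_greatest) auto
  show ?thesis unfolding mbound_def
  proof (intro conjI allI)
    show "0 \<le> mnorm a" using ge[of 0] mbound_nonneg by blast
    fix n m x
    let ?v = "sec (\<lambda>i. \<Sum>j<m. a i j * x j) n"
    have le: "?v \<le> C * sec x m" if "mbound a C" for C using that by (simp add: mbound_def)
    show "?v \<le> mnorm a * sec x m"
    proof (cases "sec x m = 0")
      case False
      then have pos: "sec x m > 0" using sec_nonneg[of x m] by linarith
      then have "?v / sec x m \<le> mnorm a" using le by (intro ge) (simp add: divide_le_eq)
      then show ?thesis using pos by (simp add: divide_le_eq)
    qed (use le[OF assms] in simp)
  qed
qed

lemma mnorm_nonneg: "mbound a B \<Longrightarrow> 0 \<le> mnorm a"
  using mbound_mnorm mbound_nonneg by blast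

lemma mnorm_smult: assumes a: "mbound a B" shows "mnorm (\<lambda>i j. c * a i j) = norm c * mnorm a"
proof (rule antisym)
  show le: "mnorm (\<lambda>i j. c * a i j) \<le> norm c * mnorm a"
    by (rule mnorm_le[OF mbound_smult[OF mbound_mnorm[OF a]]])
  show "norm c * mnorm a \<le> mnorm (\<lambda>i j. c * a i j)"
  proof (cases "c = 0")
    case False
    have "mbound (\<lambda>i j. inverse c * (c * a i j)) (norm (inverse c) * mnorm (\<lambda>i j. c * a i j))"
      by (rule mbound_smult[OF mbound_mnorm[OF mbound_smult[OF a]]])
    moreover have "(\<lambda>i j. inverse c * (c * a i j)) = a" using False by (simp add: mult.assoc[symmetric])
    ultimately have "mnorm a \<le> norm (inverse c) * mnorm (\<lambda>i j. c * a i j)" by (simp add: mnorm_le)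
    then show ?thesis using False by (simp add: norm_divide field_simps)
  qed (use mnorm_nonneg[OF mbound_smult[OF a, of c]] in simp)
qed

text \<open>For the bound on \<open>mnorm a\<close>, the form \<open>?p N\<close> is the squared
  norm of the first \<open>N\<close> coordinates of \<open>a x\<close>; it increases with
  \<open>N\<close> and tends to the quadratic form of the product at \<open>x\<close>.\<close>

lemma mnorm_cstar_identity:
  assumes a: "mbound a B" shows "mnorm (mmult (\<lambda>i j. cnj (a j i)) a) = (mnorm a)\<^sup>2"
proof (rule antisym)
  let ?s = "\<lambda>i j. cnj (a j i)"
  let ?c = "mmult ?s a"
  note n = mbound_mnorm[OF a]
  have c: "mbound ?c (mnorm a * mnorm a)" by (rule mbound_mmult[OF mbound_star[OF n] n])
  then show "mnorm ?c \<le> (mnorm a)\<^sup>2" unfolding power2_eq_square by (rule mnorm_le)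
  have "mbound a (sqrt (mnorm ?c))" unfolding mbound_def
  proof (intro conjI allI)
    show c0: "0 \<le> sqrt (mnorm ?c)" using mnorm_nonneg[OF c] by simp
    fix n m x
    let ?v = "\<lambda>i. \<Sum>j<m. a i j * x j"
    let ?p = "\<lambda>N. \<Sum>j<m. cnj (x j) * (\<Sum>j'<m. (\<Sum>i<N. ?s j i * a i j') * x j')"
    have eq: "of_real ((sec ?v N)\<^sup>2) = ?p N" for N
    proof -
      have "of_real ((sec ?v N)\<^sup>2) = (\<Sum>i<N. (\<Sum>j<m. cnj (x j) * ?s j i) * ?v i)"
        unfolding sec_square of_real_sum
        by (intro sum.cong refl) (simp add: complex_norm_square[unfolded of_real_power] mult.commute)
      also have "\<dots> = (\<Sum>j<m. cnj (x j) * (\<Sum>i<N. ?s j i * ?v i))" by (rule sum_swap_form[symmetric])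
      also have "\<dots> = ?p N" unfolding sum_swap_form ..
      finally show ?thesis .
    qed
    have "?p \<longlonglongrightarrow> (\<Sum>j<m. cnj (x j) * (\<Sum>j'<m. ?c j j' * x j'))"
      by (intro tendsto_intros mmult_tends[OF mbound_star[OF a] a])
    then have "(\<lambda>N. norm (?p N)) \<longlonglongrightarrow> norm (\<Sum>j<m. cnj (x j) * (\<Sum>j'<m. ?c j j' * x j'))" by (rule tendsto_norm)
    moreover have "(sec ?v n)\<^sup>2 \<le> norm (?p N)" if "N \<ge> n" for N
      unfolding eq[symmetric] using sec_mono[OF that, of ?v] by (simp add: power_mono norm_power)
    ultimately have "(sec ?v n)\<^sup>2 \<le> norm (\<Sum>j<m. cnj (x j) * (\<Sum>j'<m. ?c j j' * x j'))"
      by (intro LIMSEQ_le_const) auto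
    also have "\<dots> \<le> mnorm ?c * (sec x m * sec x m)" using mbound_form[OF mbound_mnorm[OF c], of "\<lambda>i. cnj (x i)"] by simp
    also have "\<dots> = (sqrt (mnorm ?c) * sec x m)\<^sup>2"
      using mnorm_nonneg[OF c] by (simp add: power_mult_distrib power2_eq_square)
    finally show "sec ?v n \<le> sqrt (mnorm ?c) * sec x m" using c0 by (auto intro: power2_le_imp_le)
  qed
  then have "(mnorm a)\<^sup>2 \<le> (sqrt (mnorm ?c))\<^sup>2" using mnorm_le mnorm_nonneg[OF a] by (intro power_mono) auto
  then show "(mnorm a)\<^sup>2 \<le> mnorm ?c" using mnorm_nonneg[OF c] by simp
qed

text \<open>Entries are Cauchy because they are bounded by the norm; \<open>mbound_limit\<close>,
  applied to the differences, turns their entrywise limits into convergence in norm.\<close>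

lemma mnorm_complete:
  assumes X: "\<And>n. mbound (X n) (B n)"
    and cau: "\<And>e. e > 0 \<Longrightarrow> \<exists>N. \<forall>m\<ge>N. \<forall>n\<ge>N. mnorm (\<lambda>i j. X m i j - X n i j) < e"
  shows "\<exists>x B. mbound x B \<and> (\<lambda>n. mnorm (\<lambda>i j. X n i j - x i j)) \<longlonglongrightarrow> 0"
proof -
  have bd: "mbound (\<lambda>i j. X m i j - X n i j) (mnorm (\<lambda>i j. X m i j - X n i j))" for m n
    by (rule mbound_mnorm[OF mbound_diff[OF X X]])
  have "\<exists>l. (\<lambda>n. X n i j) \<longlonglongrightarrow> l" for i j
  proof -
    have "Cauchy (\<lambda>n. X n i j)" unfolding Cauchy_def dist_norm
    proof (intro allI impI)
      fix e :: real assume "e > 0"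
      then obtain N where "\<forall>m\<ge>N. \<forall>n\<ge>N. mnorm (\<lambda>i j. X m i j - X n i j) < e" using cau by blast
      then show "\<exists>N. \<forall>m\<ge>N. \<forall>n\<ge>N. norm (X m i j - X n i j) < e"
        using le_less_trans[OF mbound_entry[OF bd]] by blast
    qed
    then show ?thesis by (simp add: Cauchy_convergent_iff convergent_def)
  qed
  then obtain x where x: "\<And>i j. (\<lambda>n. X n i j) \<longlonglongrightarrow> x i j" by metis
  have key: "\<exists>N. \<forall>m\<ge>N. mbound (\<lambda>i j. X m i j - x i j) e" if "e > 0" for e
  proof -
    obtain N where N: "\<And>m n. \<lbrakk>m \<ge> N; n \<ge> N\<rbrakk> \<Longrightarrow> mnorm (\<lambda>i j. X m i j - X n i j) < e" using cau[OF \<open>e > 0\<close>] by auto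
    have "mbound (\<lambda>i j. X m i j - x i j) e" if "m \<ge> N" for m
    proof (rule mbound_limit)
      show "mbound (\<lambda>i j. X m i j - X (N + k) i j) e" for k
        by (rule mbound_mono[OF bd]) (use N[of m "N + k"] that in simp)
      show "(\<lambda>k. X m i j - X (N + k) i j) \<longlonglongrightarrow> X m i j - x i j" for i j
        using LIMSEQ_ignore_initial_segment[OF x, of N i j] by (intro tendsto_intros) (simp add: add.commute)
    qed
    then show ?thesis by blast
  qed
  obtain N where "mbound (\<lambda>i j. X N i j - x i j) 1" using key[of 1] by auto
  from mbound_diff[OF X[of N] this] have "mbound x (B N + 1)" by simp
  moreover have "(\<lambda>n. mnorm (\<lambda>i j. X n i j - x i j)) \<longlonglongrightarrow> 0"
  proof (rule LIMSEQ_I)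
    fix r :: real assume "r > 0"
    then obtain M where "\<And>m. m \<ge> M \<Longrightarrow> mbound (\<lambda>i j. X m i j - x i j) (r/2)" using key[of "r/2"] by auto
    then have "norm (mnorm (\<lambda>i j. X n i j - x i j) - 0) < r" if "n \<ge> M" for n
      using mnorm_le[of "\<lambda>i j. X n i j - x i j" "r/2"] mnorm_nonneg[of "\<lambda>i j. X n i j - x i j"] that \<open>r > 0\<close>
      by fastforce
    then show "\<exists>no. \<forall>n\<ge>no. norm (mnorm (\<lambda>i j. X n i j - x i j) - 0) < r" by blast
  qed
  ultimately show ?thesis by blast
qed

text \<open>The operator sending the basis vector \<open>j\<close> to the basis vector
  \<open>f j\<close>; an isometry for injective \<open>f\<close>.\<close>

definition map_matrix :: "(nat \<Rightarrow> nat) \<Rightarrow> nat \<Rightarrow> nat \<Rightarrow> complex" where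
  "map_matrix f i j = of_bool (i = f j)"

text \<open>In the bilinear form \<open>y\<close> is replaced by its composition with
  \<open>f\<close>, which by injectivity rearranges a part of \<open>y\<close> without
  repetition.\<close>

lemma mbound_map_matrix: assumes f: "inj f" shows "mbound (map_matrix f) 1"
proof (rule mboundI)
  fix n m and x y :: "nat \<Rightarrow> complex"
  let ?y = "\<lambda>j. if f j < n then y (f j) else 0"
  have "(\<Sum>i<n. y i * map_matrix f i j) = ?y j" for j
    by (simp add: map_matrix_def of_bool_def if_distrib[of "(*) _"] cong: if_cong)
  then have "(\<Sum>i<n. y i * (\<Sum>j<m. map_matrix f i j * x j)) = (\<Sum>j<m. ?y j * x j)" unfolding sum_swap_form by simp
  also have "norm \<dots> \<le> sec ?y m * sec x m" by (rule norm_sum_mult_le_sec)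
  also have "sec ?y m \<le> sec y n"
  proof (rule power2_le_imp_le)
    have "(sec ?y m)\<^sup>2 = (\<Sum>j\<in>{j\<in>{..<m}. f j < n}. (norm (y (f j)))\<^sup>2)"
      unfolding sec_square by (subst sum.inter_filter) (auto intro!: sum.cong)
    also have "\<dots> = (\<Sum>i\<in>f ` {j\<in>{..<m}. f j < n}. (norm (y i))\<^sup>2)"
      using f by (subst sum.reindex) (auto simp: inj_on_def)
    also have "\<dots> \<le> (sec y n)\<^sup>2" unfolding sec_square by (intro sum_mono2) auto
    finally show "(sec ?y m)\<^sup>2 \<le> (sec y n)\<^sup>2" .
  qed simp
  finally show "norm (\<Sum>i<n. y i * (\<Sum>j<m. map_matrix f i j * x j)) \<le> 1 * (sec y n * sec x m)"
    by (simp add: mult_right_mono)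
qed simp

lemma suminf_of_bool: "(\<Sum>k. of_bool (k = l) * g k) = (g l :: complex)"
  using suminf_finite[of "{l}" "\<lambda>k. of_bool (k = l) * g k"] by simp

lemma mmult_map_matrix: "mmult a (map_matrix f) = (\<lambda>i j. a i (f j))"
  using suminf_of_bool by (intro ext) (simp add: mmult_def map_matrix_def mult.commute)

lemma cnj_of_bool [simp]: "cnj (of_bool p) = of_bool p"
  by simp

lemma mmult_star_map_matrix: "mmult (\<lambda>i j. cnj (map_matrix f j i)) a = (\<lambda>i j. a (f i) j)"
  using suminf_of_bool by (intro ext) (simp add: mmult_def map_matrix_def)

lemma mmult_map_matrix_star:
  assumes f: "inj f"
  shows "mmult (map_matrix f) (\<lambda>i j. cnj (map_matrix f j i)) = (\<lambda>i j. of_bool (i = j \<and> i \<in> range f))"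
proof (intro ext)
  fix i j
  show "mmult (map_matrix f) (\<lambda>i j. cnj (map_matrix f j i)) i j = of_bool (i = j \<and> i \<in> range f)"
  proof (cases "i \<in> range f")
    case True
    then obtain l where l: "i = f l" by blast
    then have "(i = f k) = (k = l)" for k using f by (auto dest: injD)
    then show ?thesis using suminf_of_bool[of l "\<lambda>k. of_bool (j = f k)"] l by (auto simp: mmult_def map_matrix_def)
  next
    case False
    then have "i \<noteq> f k" for k by blast
    then show ?thesis using False by (simp add: mmult_def map_matrix_def)
  qed
qed

text \<open>All bounded operators on \<open>\<ell>\<^sup>2(nat)\<close>, on the very type over which
  \<open>universal_diadic\<close> tests, so that universality yields a homomorphism into this
  algebra.\<close>

definition matrix_alg :: "(nat \<Rightarrow> nat \<Rightarrow> complex) cstar_alg" where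
  "matrix_alg = \<lparr>carrier = {a. \<exists>B. mbound a B}, monoid.mult = mmult, one = map_matrix id,
     zero = (\<lambda>i j. 0), add = (\<lambda>a b i j. a i j + b i j), smult = (\<lambda>c a i j. c * a i j),
     star = (\<lambda>a i j. cnj (a j i)), cnorm = mnorm\<rparr>"

lemma matrix_alg_simps:
  "a \<in> carrier matrix_alg \<longleftrightarrow> (\<exists>B. mbound a B)"
  "a \<otimes>\<^bsub>matrix_alg\<^esub> b = mmult a b" "\<one>\<^bsub>matrix_alg\<^esub> = map_matrix id"
  "\<zero>\<^bsub>matrix_alg\<^esub> = (\<lambda>i j. 0)" "a \<oplus>\<^bsub>matrix_alg\<^esub> b = (\<lambda>i j. a i j + b i j)"
  "c \<odot>\<^bsub>matrix_alg\<^esub> a = (\<lambda>i j. c * a i j)" "star matrix_alg a = (\<lambda>i j. cnj (a j i))"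
  "cnorm matrix_alg = mnorm"
  by (simp_all add: matrix_alg_def)

lemma mmult_add_left:
  assumes "mbound a A" "mbound b B" "mbound c C"
  shows "mmult (\<lambda>i j. a i j + b i j) c = (\<lambda>i j. mmult a c i j + mmult b c i j)"
proof (intro ext)
  fix i j
  have "(\<lambda>K. \<Sum>k<K. (a i k + b i k) * c k j) \<longlonglongrightarrow> mmult a c i j + mmult b c i j"
    using tendsto_add[OF mmult_tends[OF assms(1,3), of i j] mmult_tends[OF assms(2,3), of i j]]
    by (simp add: algebra_simps sum.distrib)
  then show "mmult (\<lambda>i j. a i j + b i j) c i j = mmult a c i j + mmult b c i j"
    by (rule LIMSEQ_unique[OF mmult_tends[OF mbound_add[OF assms(1,2)] assms(3)]])
qed

lemma mmult_smult_left:
  assumes "mbound a A" "mbound c C"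
  shows "mmult (\<lambda>i j. z * a i j) c = (\<lambda>i j. z * mmult a c i j)"
proof (intro ext)
  fix i j
  have "(\<lambda>K. \<Sum>k<K. (z * a i k) * c k j) \<longlonglongrightarrow> z * mmult a c i j"
    using tendsto_mult_left[OF mmult_tends[OF assms, of i j], of z]
    by (simp add: sum_distrib_left ac_simps)
  then show "mmult (\<lambda>i j. z * a i j) c i j = z * mmult a c i j"
    by (rule LIMSEQ_unique[OF mmult_tends[OF mbound_smult[OF assms(1)] assms(2)]])
qed

lemma mmult_star:
  assumes "mbound a A" "mbound b B"
  shows "mmult (\<lambda>i j. cnj (b j i)) (\<lambda>i j. cnj (a j i)) = (\<lambda>i j. cnj (mmult a b j i))"
proof (intro ext)
  fix i j
  have "(\<lambda>K. \<Sum>k<K. cnj (b k i) * cnj (a j k)) \<longlonglongrightarrow> cnj (mmult a b j i)"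
    using tendsto_cnj[OF mmult_tends[OF assms, of j i]] by (simp add: mult.commute)
  then show "mmult (\<lambda>i j. cnj (b j i)) (\<lambda>i j. cnj (a j i)) i j = cnj (mmult a b j i)"
    by (rule LIMSEQ_unique[OF mmult_tends[OF mbound_star[OF assms(2)] mbound_star[OF assms(1)]]])
qed

lemma mmult_add_right:
  assumes "mbound a A" "mbound b B" "mbound c C"
  shows "mmult c (\<lambda>i j. a i j + b i j) = (\<lambda>i j. mmult c a i j + mmult c b i j)"
proof (intro ext)
  fix i j
  have "(\<lambda>K. \<Sum>k<K. c i k * (a k j + b k j)) \<longlonglongrightarrow> mmult c a i j + mmult c b i j"
    using tendsto_add[OF mmult_tends[OF assms(3,1), of i j] mmult_tends[OF assms(3,2), of i j]]
    by (simp add: algebra_simps sum.distrib)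
  then show "mmult c (\<lambda>i j. a i j + b i j) i j = mmult c a i j + mmult c b i j"
    by (rule LIMSEQ_unique[OF mmult_tends[OF assms(3) mbound_add[OF assms(1,2)]]])
qed

lemma mmult_smult_right:
  assumes "mbound a A" "mbound c C"
  shows "mmult c (\<lambda>i j. z * a i j) = (\<lambda>i j. z * mmult c a i j)"
proof (intro ext)
  fix i j
  have "(\<lambda>K. \<Sum>k<K. c i k * (z * a k j)) \<longlonglongrightarrow> z * mmult c a i j"
    using tendsto_mult_left[OF mmult_tends[OF assms(2,1), of i j], of z]
    by (simp add: sum_distrib_left ac_simps)
  then show "mmult c (\<lambda>i j. z * a i j) i j = z * mmult c a i j"
    by (rule LIMSEQ_unique[OF mmult_tends[OF assms(2) mbound_smult[OF assms(1)]]])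
qed

lemma map_matrix_id_mmult: "mmult (map_matrix id) a = a"
  using suminf_of_bool by (intro ext) (simp add: mmult_def map_matrix_def eq_commute[of _ "_ :: nat"])

lemma matrix_alg_ring: "ring matrix_alg"
proof (rule ringI)
  show "abelian_group matrix_alg"
  proof (rule abelian_groupI)
    show "\<exists>y\<in>carrier matrix_alg. y \<oplus>\<^bsub>matrix_alg\<^esub> x = \<zero>\<^bsub>matrix_alg\<^esub>" if "x \<in> carrier matrix_alg" for x
    proof (rule bexI)
      show "(\<lambda>i j. (-1) * x i j) \<in> carrier matrix_alg" using that mbound_smult unfolding matrix_alg_simps by blast
    qed (simp add: matrix_alg_simps)
  qed (auto simp: matrix_alg_simps add.commute add.left_commute intro: mbound_add mbound_zero)
  show "monoid matrix_alg"
    by (rule monoidI)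
      (auto simp: matrix_alg_simps mmult_map_matrix map_matrix_id_mmult
        intro: mbound_mmult mbound_map_matrix[OF inj_on_id] mmult_assoc)
qed (auto simp: matrix_alg_simps intro: mmult_add_left mmult_add_right)

lemma matrix_alg_cstar: "cstar_algebra matrix_alg"
proof -
  interpret ring matrix_alg by (rule matrix_alg_ring)
  interpret pre_cstar_algebra matrix_alg
  proof unfold_locales
    fix a b assume "a \<in> carrier matrix_alg"
    then obtain A where a: "mbound a A" unfolding matrix_alg_simps ..
    have "a = (\<lambda>i j. 0)" if "mnorm a = 0"
      using mbound_entry[OF mbound_mnorm[OF a]] that by (intro ext) simp
    then show "cnorm matrix_alg a = 0 \<longleftrightarrow> a = \<zero>\<^bsub>matrix_alg\<^esub>"
      using mnorm_le[OF mbound_zero] mnorm_nonneg[OF mbound_zero] by (auto simp: matrix_alg_simps)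
    assume "b \<in> carrier matrix_alg"
    then obtain B where b: "mbound b B" unfolding matrix_alg_simps ..
    show "cnorm matrix_alg (a \<oplus>\<^bsub>matrix_alg\<^esub> b) \<le> cnorm matrix_alg a + cnorm matrix_alg b"
      unfolding matrix_alg_simps by (rule mnorm_le[OF mbound_add[OF mbound_mnorm[OF a] mbound_mnorm[OF b]]])
  qed (auto simp: matrix_alg_simps distrib_right mnorm_smult intro: mbound_smult mnorm_nonneg)
  have diff: "a \<ominus>\<^bsub>matrix_alg\<^esub> b = (\<lambda>i j. a i j - b i j)" if "b \<in> carrier matrix_alg" for a b
    using uminus_smult[OF that] by (simp add: minus_eq matrix_alg_simps)
  show "cstar_algebra matrix_alg"
  proof unfold_locales
    show "Metric_space.mcomplete (carrier matrix_alg) (cdist matrix_alg)"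
    proof (rule mcompleteI)
      fix X :: "nat \<Rightarrow> nat \<Rightarrow> nat \<Rightarrow> complex" assume X: "\<And>n. X n \<in> carrier matrix_alg"
        and cau: "\<And>e. e > 0 \<Longrightarrow> \<exists>N. \<forall>m\<ge>N. \<forall>n\<ge>N. cnorm matrix_alg (X m \<ominus>\<^bsub>matrix_alg\<^esub> X n) < e"
      have "\<forall>n. \<exists>B. mbound (X n) B" using X unfolding matrix_alg_simps by blast
      then obtain B where B: "\<And>n. mbound (X n) (B n)" by metis
      have "\<exists>x C. mbound x C \<and> (\<lambda>n. mnorm (\<lambda>i j. X n i j - x i j)) \<longlonglongrightarrow> 0"
        by (rule mnorm_complete[OF B]) (use cau in \<open>simp add: diff[OF X] matrix_alg_simps\<close>)
      then obtain x C where x: "mbound x C" "(\<lambda>n. mnorm (\<lambda>i j. X n i j - x i j)) \<longlonglongrightarrow> 0" by blast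
      then have xc: "x \<in> carrier matrix_alg" unfolding matrix_alg_simps by blast
      show "\<exists>x\<in>carrier matrix_alg. (\<lambda>n. cnorm matrix_alg (X n \<ominus>\<^bsub>matrix_alg\<^esub> x)) \<longlonglongrightarrow> 0"
        using x(2) xc by (intro bexI[of _ x]) (simp_all add: diff[OF xc] matrix_alg_simps(8))
    qed
    fix a b assume "a \<in> carrier matrix_alg" "b \<in> carrier matrix_alg"
    then obtain A B where ab: "mbound a A" "mbound b B" unfolding matrix_alg_simps by blast
    show "cnorm matrix_alg (a \<otimes>\<^bsub>matrix_alg\<^esub> b) \<le> cnorm matrix_alg a * cnorm matrix_alg b"
      unfolding matrix_alg_simps by (rule mnorm_le[OF mbound_mmult[OF mbound_mnorm[OF ab(1)] mbound_mnorm[OF ab(2)]]])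
  qed (use cnorm_nonneg cnorm_eq_0 cnorm_triangle in \<open>auto simp: matrix_alg_simps distrib_left distrib_right mult.assoc
      mmult_star mnorm_cstar_identity mmult_smult_left mmult_smult_right mnorm_smult intro: mbound_smult mbound_star\<close>)
qed

text \<open>The representation of \<open>Q\<^sub>2\<close> on \<open>\<ell>\<^sup>2(\<int>)\<close>: \<open>u\<close> shifts by one and \<open>s\<close> doubles.\<close>

lemma diadic_model: "\<exists>v t. diadic_relations matrix_alg v t"
proof (intro exI)
  interpret matrix_alg: cstar_algebra matrix_alg by (rule matrix_alg_cstar)
  \<comment> \<open>The basis of \<open>\<ell>\<^sup>2(\<int>)\<close> is numbered by
    \<open>int_encode\<close>; the ranges of \<open>?g\<close> and of its composition with
    \<open>?f\<close> are the codes of the even and of the odd integers.\<close>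
  let ?f = "\<lambda>n. int_encode (int_decode n + 1)" and ?g = "\<lambda>n. int_encode (2 * int_decode n)"
  have dec: "int_decode m = int_decode n \<longleftrightarrow> m = n" for m n by (metis int_decode_inverse)
  have enc: "int_encode x = int_encode y \<longleftrightarrow> x = y" for x y by (rule inj_eq[OF inj_int_encode])
  have f: "inj ?f" and g: "inj ?g" by (auto intro!: injI simp: dec enc)
  have fg: "inj (\<lambda>n. ?f (?g n))" by (auto intro!: injI simp: dec enc)
  have sf: "i \<in> range ?f" for i by (rule range_eqI[of _ _ "int_encode (int_decode i - 1)"]) simp
  have rg: "i \<in> range ?g \<longleftrightarrow> even (int_decode i)" for i
  proof
    assume "even (int_decode i)"
    then obtain k where "int_decode i = 2 * k" by blast
    then show "i \<in> range ?g" by (intro range_eqI[of _ _ "int_encode k"]) (metis int_decode_inverse int_encode_inverse)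
  qed auto
  have rfg: "i \<in> range (\<lambda>n. ?f (?g n)) \<longleftrightarrow> odd (int_decode i)" for i
  proof
    assume "odd (int_decode i)"
    then obtain k where "int_decode i = 2 * k + 1" by (rule oddE)
    then show "i \<in> range (\<lambda>n. ?f (?g n))"
      by (intro range_eqI[of _ _ "int_encode k"]) (metis int_decode_inverse int_encode_inverse)
  qed auto
  let ?u = "map_matrix ?f" and ?s = "map_matrix ?g"
  have c: "?u \<in> carrier matrix_alg" "?s \<in> carrier matrix_alg"
    using mbound_map_matrix f g unfolding matrix_alg_simps by blast+
  have us: "?u \<otimes>\<^bsub>matrix_alg\<^esub> ?s = map_matrix (\<lambda>n. ?f (?g n))"
    unfolding matrix_alg_simps mmult_map_matrix by (simp add: map_matrix_def fun_eq_iff)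
  have "?u \<otimes>\<^bsub>matrix_alg\<^esub> ?s \<otimes>\<^bsub>matrix_alg\<^esub> star matrix_alg ?s \<otimes>\<^bsub>matrix_alg\<^esub> star matrix_alg ?u
     = (?u \<otimes>\<^bsub>matrix_alg\<^esub> ?s) \<otimes>\<^bsub>matrix_alg\<^esub> star matrix_alg (?u \<otimes>\<^bsub>matrix_alg\<^esub> ?s)"
    using c by (simp add: matrix_alg.star_mult matrix_alg.m_assoc)
  also have "\<dots> = (\<lambda>i j. of_bool (i = j \<and> i \<in> range (\<lambda>n. ?f (?g n))))"
    unfolding us unfolding matrix_alg_simps by (rule mmult_map_matrix_star[OF fg])
  finally have r: "?u \<otimes>\<^bsub>matrix_alg\<^esub> ?s \<otimes>\<^bsub>matrix_alg\<^esub> star matrix_alg ?s \<otimes>\<^bsub>matrix_alg\<^esub> star matrix_alg ?u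
     = (\<lambda>i j. of_bool (i = j \<and> odd (int_decode i)))" unfolding rfg .
  have r': "?s \<otimes>\<^bsub>matrix_alg\<^esub> star matrix_alg ?s = (\<lambda>i j. of_bool (i = j \<and> even (int_decode i)))"
    unfolding matrix_alg_simps mmult_map_matrix_star[OF g] rg ..
  show "diadic_relations matrix_alg ?u ?s"
    unfolding diadic_relations_def
  proof (intro conjI c)
    show "?s \<otimes>\<^bsub>matrix_alg\<^esub> star matrix_alg ?s \<oplus>\<^bsub>matrix_alg\<^esub>
        ?u \<otimes>\<^bsub>matrix_alg\<^esub> ?s \<otimes>\<^bsub>matrix_alg\<^esub> star matrix_alg ?s \<otimes>\<^bsub>matrix_alg\<^esub> star matrix_alg ?u = \<one>\<^bsub>matrix_alg\<^esub>"
      unfolding r r' by (auto simp: matrix_alg_simps map_matrix_def fun_eq_iff)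
    show "star matrix_alg ?u \<otimes>\<^bsub>matrix_alg\<^esub> ?u = \<one>\<^bsub>matrix_alg\<^esub>" "star matrix_alg ?s \<otimes>\<^bsub>matrix_alg\<^esub> ?s = \<one>\<^bsub>matrix_alg\<^esub>"
      unfolding matrix_alg_simps mmult_star_map_matrix by (auto simp: map_matrix_def fun_eq_iff dec enc)
    show "?u \<otimes>\<^bsub>matrix_alg\<^esub> star matrix_alg ?u = \<one>\<^bsub>matrix_alg\<^esub>"
      unfolding matrix_alg_simps mmult_map_matrix_star[OF f] using sf by (simp add: map_matrix_def fun_eq_iff)
    show "?u \<otimes>\<^bsub>matrix_alg\<^esub> ?u \<otimes>\<^bsub>matrix_alg\<^esub> ?s = ?s \<otimes>\<^bsub>matrix_alg\<^esub> ?u"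
      unfolding matrix_alg_simps mmult_map_matrix by (simp add: map_matrix_def fun_eq_iff algebra_simps)
  qed
qed

text \<open>The zero algebra satisfies the relations, so nontriviality has to come from
  universality: a unital homomorphism into the nonzero \<open>matrix_alg\<close> separates
  \<open>\<one>\<close> from \<open>\<zero>\<close>.\<close>

lemma universal_diadic_cstar:
  assumes "universal_diadic Q u s" shows "diadic_cstar Q u s"
proof -
  have Q: "cstar_algebra Q" "diadic_relations Q u s" "cstar_generated Q {u, s} = carrier Q"
    using assms by (auto simp: universal_diadic_def)
  interpret cstar_algebra Q by (rule Q)
  obtain v t where "diadic_relations matrix_alg v t" using diadic_model by blast
  then obtain h where "h \<in> star_hom Q matrix_alg"
    using assms matrix_alg_cstar unfolding universal_diadic_def by blast
  then interpret h: cstar_hom Q matrix_alg h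
    using matrix_alg_cstar by (intro cstar_hom.intro cstar_hom_axioms.intro cstar_algebra_axioms)
  have "map_matrix id 0 0 \<noteq> 0" by (simp add: map_matrix_def)
  then have "\<one>\<^bsub>matrix_alg\<^esub> \<noteq> \<zero>\<^bsub>matrix_alg\<^esub>" by (auto simp: matrix_alg_simps)
  then have "\<one>\<^bsub>Q\<^esub> \<noteq> \<zero>\<^bsub>Q\<^esub>" using h.hom_simps(4) h.hom_zero by metis
  then show ?thesis using Q by unfold_locales
qed

theorem theorem2p7:
  fixes Q2 :: "'a cstar_alg" and U S1 S2 :: 'a and O2 :: "'a set"
  assumes "universal_diadic Q2 U S2"
    and "S1 = U \<otimes>\<^bsub>Q2\<^esub> S2"
    and "O2 = cstar_generated Q2 {S1, S2}"
  shows "cstar_irreducible O2 Q2 \<and> rigid O2 Q2 \<and>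
    (\<forall>(I1 :: 'b cstar_alg) (I2 :: 'b cstar_alg) j1 j2.
       injective_envelope (Q2\<lparr>carrier := O2\<rparr>) I1 j1 \<and> injective_envelope Q2 I2 j2
       \<longrightarrow> star_isomorphic I1 I2)"
proof -
  interpret diadic_cstar Q2 U S2 by (rule universal_diadic_cstar[OF assms(1)])
  show ?thesis unfolding assms(2,3) using cuntz_irreducible cuntz_rigid envelopes_isomorphic by blast
qed

end
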